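(* Let $r\ge1$, let $\mathfrak{g}=\mathfrak{sl}_{r+1}$, and let $\lambda$ be a dominant integral weight of $\mathfrak{g}$ with corresponding integer tuple $\underline{\lambda}:\lambda_1\ge\cdots\ge\lambda_r\ge\lambda_{r+1}=0$. The elements $v_{\mathfrak{P}}$, as $\mathfrak{P}$ varies over all POPs with bounding sequence $\underline{\lambda}$, form a basis for the local Weyl module $W(\lambda)$ of $\mathfrak{g}[t]$.
   Context: $\mathfrak{g}=\mathfrak{sl}_{r+1}$ is the Lie algebra of traceless complex $(r+1)\times(r+1)$ matrices; $\mathfrak{h}$ and $\mathfrak{n}^+$ are its diagonal and strictly upper triangular subalgebras. $\epsilon_i\in\mathfrak{h}^\star$ maps a diagonal matrix to its $(i,i)$ entry; the tuple $(a_1,\ldots,a_{r+1})$ corresponds to the weight $\sum a_i\epsilon_i$. Dominant integral weights correspond to integer tuples $\lambda_1\ge\cdots\ge\lambda_r\ge\lambda_{r+1}=0$. $\mathfrak{g}[t]=\mathfrak{g}\otimes\mathbb{C}[t]$ has bracket $[X\otimes f,Y\otimes g]=[X,Y]\otimes fg$. The local Weyl module $W(\lambda)$ is the cyclic $\mathfrak{g}[t]$-module generated by an element $w_\lambda$ subject to: $(\mathfrak{n}^+\otimes\mathbb{C}[t])w_\lambda=0$; $(\mathfrak{h}\otimes t\mathbb{C}[t])w_\lambda=0$; $Hw_\lambda=\langle\lambda,H\rangle w_\lambda$ for $H\in\mathfrak{h}$; and $\mathfrak{g}_{-\alpha}^{\langle\lambda,\alpha^\vee\rangle+1}w_\lambda=0$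 for every simple root $\alpha$ ($\alpha^\vee$ the coroot, $\mathfrak{g}_{-\alpha}$ the root space of $-\alpha$). A partition is a non-increasing, eventually zero sequence of non-negative integers; its non-zero terms are its parts. It fits into the rectangle $(a,b)$ ($a,b\ge0$ integers) if it has at most $a$ parts and every part is at most $b$. Non-increasing sequences $\lambda$ of length $m$ and $\mu$ of length $m-1$ interlace if $\lambda_i\ge\mu_i\ge\lambda_{i+1}$ for $1\le i\le m-1$. An integral GT pattern is a sequence $\lambda^1,\ldots,\lambda^n$ of non-increasing integer sequences, $\lambda^j$ of length $j$, with $\lambda^j,\lambda^{j+1}$ interlacing for $1\le j\le n-1$; $\lambda^n$ is its bounding sequence. A partition overlaid pattern (POP) consists of an integral GT pattern $\lambda^1,\ldots,\lambda^n$ and, for every pair $(j,i)$ with $1\le j<n$, $1\le i\le j$, a partition $\pi(j)^i$ that fits into the rectangle $(\lambda^{j+1}_i-\lambda^j_i,\ \lambda^j_i-\lambda^{j+1}_{i+1})$. Its bounding sequence is that of the underlying pattern. For $1\le i\le j\le r$ let $x_{ij}^-$ be the $(r+1)\times(r+1)$ matrix whose only non-zero entry is a $1$ in position $(j+1,i)$. For a partition $\pi$ fitting into $(a,b)$, let $m_k$ be the number of parts of $\pi$ equal to $k$ for $1\le k\le b$, let $m_0=a-\sum_{k=1}^b m_k$, and put $x_{ij}^-(a,b,\pi)=\prod_{k=0}^b (x_{ij}^-\otimes t^k)^{(m_k)}$, an element of the universal enveloping algebra $U(\mathfrak{g}[t])$ (the factors commute), where $T^{(m)}=T^m/m!$.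 For a POP $\mathfrak{P}$ with rows $\lambda^1,\ldots,\lambda^{r+1}=\underline{\lambda}$ and partitions $\pi(j)^i$, put $$\rho^j_{\mathfrak{P}}=\prod_{i=1}^j x_{ij}^-\left(\lambda_i^{j+1}-\lambda_i^j,\ \lambda_i^j-\lambda_{i+1}^{j+1},\ \pi(j)^i\right)\quad(1\le j\le r),$$ $\rho_{\mathfrak{P}}=\rho^1_{\mathfrak{P}}\rho^2_{\mathfrak{P}}\cdots\rho^r_{\mathfrak{P}}$ (in this order), and $v_{\mathfrak{P}}=\rho_{\mathfrak{P}}w_\lambda$. *)

theory Defs
  imports
    "Jordan_Normal_Form.VS_Connect"
    "HOL-Algebra.QuotRing"
    "HOL-Library.Poly_Mapping"
    "HOL-Library.FuncSet"
begin

section \<open>Lie algebras and universal enveloping algebras\<close>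

text \<open>The fields \<^term>\<open>mult\<close> and \<^term>\<open>one\<close> inherited from the record \<open>module\<close> play no
  role in a Lie algebra.\<close>

record ('k, 'a) lie_ring = "('k, 'a) module" +
  lie_bracket :: "'a \<Rightarrow> 'a \<Rightarrow> 'a"

locale lie_algebra = vectorspace K L
  for K :: "('k, 'm) ring_scheme" and L :: "('k, 'a, 'n) lie_ring_scheme" +
  assumes bracket_closed:
      "\<And>x y. \<lbrakk>x \<in> carrier L; y \<in> carrier L\<rbrakk> \<Longrightarrow> lie_bracket L x y \<in> carrier L"
    and bracket_add_left:
      "\<And>x y z. \<lbrakk>x \<in> carrier L; y \<in> carrier L; z \<in> carrier L\<rbrakk> \<Longrightarrow>
         lie_bracket L (x \<oplus>\<^bsub>L\<^esub> y) z = lie_bracket L x z \<oplus>\<^bsub>L\<^esub> lie_bracket L y z"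
    and bracket_add_right:
      "\<And>x y z. \<lbrakk>x \<in> carrier L; y \<in> carrier L; z \<in> carrier L\<rbrakk> \<Longrightarrow>
         lie_bracket L x (y \<oplus>\<^bsub>L\<^esub> z) = lie_bracket L x y \<oplus>\<^bsub>L\<^esub> lie_bracket L x z"
    and bracket_smult_left:
      "\<And>c x y. \<lbrakk>c \<in> carrier K; x \<in> carrier L; y \<in> carrier L\<rbrakk> \<Longrightarrow>
         lie_bracket L (c \<odot>\<^bsub>L\<^esub> x) y = c \<odot>\<^bsub>L\<^esub> lie_bracket L x y"
    and bracket_smult_right:
      "\<And>c x y. \<lbrakk>c \<in> carrier K; x \<in> carrier L; y \<in> carrier L\<rbrakk> \<Longrightarrow>
         lie_bracket L x (c \<odot>\<^bsub>L\<^esub> y) = c \<odot>\<^bsub>L\<^esub> lie_bracket L x y"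
    and bracket_alternating:
      "\<And>x. x \<in> carrier L \<Longrightarrow> lie_bracket L x x = \<zero>\<^bsub>L\<^esub>"
    and jacobi:
      "\<And>x y z. \<lbrakk>x \<in> carrier L; y \<in> carrier L; z \<in> carrier L\<rbrakk> \<Longrightarrow>
         lie_bracket L x (lie_bracket L y z) \<oplus>\<^bsub>L\<^esub> lie_bracket L y (lie_bracket L z x)
           \<oplus>\<^bsub>L\<^esub> lie_bracket L z (lie_bracket L x y) = \<zero>\<^bsub>L\<^esub>"

text \<open>The free monoid is written additively, so that multiplication in the type
  \<open>'a free_monoid \<Rightarrow>\<^sub>0 'k\<close> is the multiplication of the free associative algebra.\<close>

datatype 'a free_monoid = Word (letters: "'a list")

instantiation free_monoid :: (type) monoid_add
begin

definition zero_free_monoid :: "'a free_monoid" where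
  "0 = Word []"

definition plus_free_monoid :: "'a free_monoid \<Rightarrow> 'a free_monoid \<Rightarrow> 'a free_monoid" where
  "u + v = Word (letters u @ letters v)"

instance
  by standard (simp_all add: zero_free_monoid_def plus_free_monoid_def)

end

definition free_gen :: "'a \<Rightarrow> ('a free_monoid \<Rightarrow>\<^sub>0 'k::field)" where
  "free_gen x = Poly_Mapping.single (Word [x]) 1"

definition free_smult ::
  "'k::field \<Rightarrow> ('a free_monoid \<Rightarrow>\<^sub>0 'k) \<Rightarrow> ('a free_monoid \<Rightarrow>\<^sub>0 'k)" where
  "free_smult c p = Poly_Mapping.single 0 c * p"

definition free_algebra :: "'a set \<Rightarrow> ('k::field, 'a free_monoid \<Rightarrow>\<^sub>0 'k) module" where
  "free_algebra X =
     \<lparr>carrier = {p. \<forall>w \<in> Poly_Mapping.keys p. set (letters w) \<subseteq> X},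
      mult = (*), one = 1, zero = 0, add = (+), smult = free_smult\<rparr>"

text \<open>As for \<^const>\<open>rcoset_mult\<close>, scalar multiplication on a quotient is a union over all
  representatives. A quotient space has no product, so its fields \<^term>\<open>mult\<close> and
  \<^term>\<open>one\<close> are junk.\<close>

definition quot_space :: "('k, 'a, 'm) module_scheme \<Rightarrow> 'a set \<Rightarrow> ('k, 'a set) module" where
  "quot_space V N =
     \<lparr>carrier = a_rcosets\<^bsub>V\<^esub> N, mult = undefined, one = undefined,
      zero = N, add = set_add V,
      smult = (\<lambda>c X. \<Union>x\<in>X. N +>\<^bsub>V\<^esub> (c \<odot>\<^bsub>V\<^esub> x))\<rparr>"

definition quot_algebra :: "('k, 'a, 'm) module_scheme \<Rightarrow> 'a set \<Rightarrow> ('k, 'a set) module" where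
  "quot_algebra A I =
     (quot_space A I)\<lparr>mult := rcoset_mult A I, one := I +>\<^bsub>A\<^esub> \<one>\<^bsub>A\<^esub>\<rparr>"

definition uea_relations ::
  "('k::field, 'a, 'm) lie_ring_scheme \<Rightarrow> ('a free_monoid \<Rightarrow>\<^sub>0 'k) set" where
  "uea_relations L =
     {free_gen (x \<oplus>\<^bsub>L\<^esub> y) - free_gen x - free_gen y | x y. x \<in> carrier L \<and> y \<in> carrier L} \<union>
     {free_gen (c \<odot>\<^bsub>L\<^esub> x) - free_smult c (free_gen x) | c x. x \<in> carrier L} \<union>
     {free_gen x * free_gen y - free_gen y * free_gen x - free_gen (lie_bracket L x y)
        | x y. x \<in> carrier L \<and> y \<in> carrier L}"

definition uea_ideal ::
  "('k::field, 'a, 'm) lie_ring_scheme \<Rightarrow> ('a free_monoid \<Rightarrow>\<^sub>0 'k) set" where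
  "uea_ideal L = Idl\<^bsub>free_algebra (carrier L)\<^esub> (uea_relations L)"

definition uea ::
  "('k::field, 'a, 'm) lie_ring_scheme \<Rightarrow> ('k, ('a free_monoid \<Rightarrow>\<^sub>0 'k) set) module" where
  "uea L = quot_algebra (free_algebra (carrier L)) (uea_ideal L)"

definition uea_emb ::
  "('k::field, 'a, 'm) lie_ring_scheme \<Rightarrow> 'a \<Rightarrow> ('a free_monoid \<Rightarrow>\<^sub>0 'k) set" where
  "uea_emb L x = uea_ideal L +>\<^bsub>free_algebra (carrier L)\<^esub> free_gen x"

section \<open>Cyclic modules given by generators and relations\<close>

definition left_ideal :: "'a set \<Rightarrow> ('a, 'm) ring_scheme \<Rightarrow> bool" where
  "left_ideal J A \<longleftrightarrow>
     additive_subgroup J A \<and> (\<forall>a \<in> carrier A. \<forall>x \<in> J. a \<otimes>\<^bsub>A\<^esub> x \<in> J)"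

definition gen_left_ideal :: "('a, 'm) ring_scheme \<Rightarrow> 'a set \<Rightarrow> 'a set" where
  "gen_left_ideal A S = \<Inter>{J. left_ideal J A \<and> S \<subseteq> J}"

text \<open>The action of \<open>u\<close> on the quotient of \<open>A\<close> by the left ideal \<open>J\<close>, again as a union over
  representatives; see \<open>coset_act_coset\<close> below.\<close>

definition coset_act :: "('a, 'm) ring_scheme \<Rightarrow> 'a set \<Rightarrow> 'a \<Rightarrow> 'a set \<Rightarrow> 'a set" where
  "coset_act A J u X = (\<Union>x\<in>X. J +>\<^bsub>A\<^esub> (u \<otimes>\<^bsub>A\<^esub> x))"

section \<open>The special linear Lie algebra and its current algebra\<close>

text \<open>Matrices are indexed from 0, so the entry in position \<open>(i, j)\<close> of the usual
  convention is \<open>A $$ (i - 1, j - 1)\<close>. All other index ranges below start at 1.\<close>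

definition sl_carrier :: "nat \<Rightarrow> 'a::comm_ring_1 mat set" where
  "sl_carrier r = {A \<in> carrier_mat (Suc r) (Suc r). (\<Sum>i<Suc r. A $$ (i, i)) = 0}"

definition cartan :: "nat \<Rightarrow> complex mat set" where
  "cartan r = {H \<in> sl_carrier r. diagonal_mat H}"

definition n_plus :: "nat \<Rightarrow> complex mat set" where
  "n_plus r = {X \<in> sl_carrier r. \<forall>i<Suc r. \<forall>j\<le>i. X $$ (i, j) = 0}"

text \<open>The tensor product of the special linear Lie algebra with the polynomial ring is realised as
  the Lie algebra of traceless matrices with polynomial entries, where \<open>X \<otimes> f\<close> becomes the
  matrix with entries \<open>X $$ (i, j) * f\<close>; see \<open>tensor_poly_bracket\<close> below.\<close>

definition sl_current :: "nat \<Rightarrow> (complex, complex poly mat) lie_ring" where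
  "sl_current r =
     \<lparr>carrier = sl_carrier r, mult = undefined, one = undefined,
      zero = 0\<^sub>m (Suc r) (Suc r), add = (+),
      smult = (\<lambda>c A. [:c:] \<cdot>\<^sub>m A),
      lie_bracket = (\<lambda>A B. A * B - B * A)\<rparr>"

definition tensor_poly :: "complex mat \<Rightarrow> complex poly \<Rightarrow> complex poly mat" where
  "tensor_poly X f = map_mat (\<lambda>c. [:c:] * f) X"

abbreviation current_uea ::
  "nat \<Rightarrow> (complex, (complex poly mat free_monoid \<Rightarrow>\<^sub>0 complex) set) module" where
  "current_uea r \<equiv> uea (sl_current r)"

definition current_emb ::
  "nat \<Rightarrow> complex mat \<Rightarrow> complex poly \<Rightarrow> (complex poly mat free_monoid \<Rightarrow>\<^sub>0 complex) set" where
  "current_emb r X f = uea_emb (sl_current r) (tensor_poly X f)"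

definition eps :: "nat \<Rightarrow> complex mat \<Rightarrow> complex" where
  "eps i H = H $$ (i - 1, i - 1)"

definition weight :: "nat \<Rightarrow> (nat \<Rightarrow> int) \<Rightarrow> complex mat \<Rightarrow> complex" where
  "weight r a H = (\<Sum>i = 1..Suc r. of_int (a i) * eps i H)"

definition simple_root :: "nat \<Rightarrow> complex mat \<Rightarrow> complex" where
  "simple_root i H = eps i H - eps (Suc i) H"

definition simple_coroot :: "nat \<Rightarrow> nat \<Rightarrow> complex mat" where
  "simple_coroot r i = mat (Suc r) (Suc r)
     (\<lambda>(a, b). if a = b \<and> a = i - 1 then 1 else if a = b \<and> a = i then -1 else 0)"

definition root_space :: "nat \<Rightarrow> (complex mat \<Rightarrow> complex) \<Rightarrow> complex mat set" where
  "root_space r \<beta> = {X \<in> sl_carrier r. \<forall>H \<in> cartan r. H * X - X * H = \<beta> H \<cdot>\<^sub>m X}"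

section \<open>The local Weyl module\<close>

text \<open>The module with one generator subject to relations is the quotient of the enveloping algebra
  by the left ideal generated by the elements that annihilate the generator. The first two families
  consist of pure tensors, which span the spaces of all elements required to annihilate it. In the
  last family, \<open>m\<close> is the value of the weight on the \<open>i\<close>-th simple coroot.\<close>

definition weyl_relations ::
  "nat \<Rightarrow> (nat \<Rightarrow> int) \<Rightarrow> (complex poly mat free_monoid \<Rightarrow>\<^sub>0 complex) set set" where
  "weyl_relations r lam =
     {current_emb r X f | X f. X \<in> n_plus r} \<union>
     {current_emb r H (monom 1 1 * f) | H f. H \<in> cartan r} \<union>
     {current_emb r H 1
        \<ominus>\<^bsub>current_uea r\<^esub> (weight r lam H \<odot>\<^bsub>current_uea r\<^esub> \<one>\<^bsub>current_uea r\<^esub>) | H. H \<in> cartan r} \<union>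
     {current_emb r Y 1 [^]\<^bsub>current_uea r\<^esub> (m + 1 :: nat) | i Y m.
        i \<in> {1..r} \<and> Y \<in> root_space r (\<lambda>H. - simple_root i H) \<and>
        weight r lam (simple_coroot r i) = of_nat m}"

definition weyl_ideal ::
  "nat \<Rightarrow> (nat \<Rightarrow> int) \<Rightarrow> (complex poly mat free_monoid \<Rightarrow>\<^sub>0 complex) set set" where
  "weyl_ideal r lam = gen_left_ideal (current_uea r) (weyl_relations r lam)"

definition local_weyl ::
  "nat \<Rightarrow> (nat \<Rightarrow> int) \<Rightarrow> (complex, (complex poly mat free_monoid \<Rightarrow>\<^sub>0 complex) set set) module" where
  "local_weyl r lam = quot_space (current_uea r) (weyl_ideal r lam)"

definition weyl_gen ::
  "nat \<Rightarrow> (nat \<Rightarrow> int) \<Rightarrow> (complex poly mat free_monoid \<Rightarrow>\<^sub>0 complex) set set" where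
  "weyl_gen r lam = weyl_ideal r lam +>\<^bsub>current_uea r\<^esub> \<one>\<^bsub>current_uea r\<^esub>"

definition weyl_act ::
  "nat \<Rightarrow> (nat \<Rightarrow> int) \<Rightarrow> (complex poly mat free_monoid \<Rightarrow>\<^sub>0 complex) set \<Rightarrow>
   (complex poly mat free_monoid \<Rightarrow>\<^sub>0 complex) set set \<Rightarrow>
   (complex poly mat free_monoid \<Rightarrow>\<^sub>0 complex) set set" where
  "weyl_act r lam = coset_act (current_uea r) (weyl_ideal r lam)"

section \<open>Gelfand--Tsetlin patterns and partition overlaid patterns\<close>

text \<open>A finite sequence of length \<open>m\<close> is an extensional function on \<open>{1..m}\<close>; the terms of a
  partition are indexed from 0.\<close>

definition noninc_seqs :: "nat \<Rightarrow> (nat \<Rightarrow> int) set" where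
  "noninc_seqs m = {s \<in> {1..m} \<rightarrow>\<^sub>E UNIV. \<forall>i \<in> {1..<m}. s (Suc i) \<le> s i}"

definition interlace :: "nat \<Rightarrow> (nat \<Rightarrow> int) \<Rightarrow> (nat \<Rightarrow> int) \<Rightarrow> bool" where
  "interlace m s u \<longleftrightarrow> (\<forall>i \<in> {1..m - 1}. u i \<le> s i \<and> s (Suc i) \<le> u i)"

definition gt_patterns :: "nat \<Rightarrow> (nat \<Rightarrow> nat \<Rightarrow> int) set" where
  "gt_patterns n =
     {L \<in> (\<Pi>\<^sub>E j \<in> {1..n}. noninc_seqs j). \<forall>j \<in> {1..<n}. interlace (Suc j) (L (Suc j)) (L j)}"

definition is_partition :: "(nat \<Rightarrow> nat) \<Rightarrow> bool" where
  "is_partition p \<longleftrightarrow> antimono p \<and> eventually (\<lambda>k. p k = 0) sequentially"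

definition fits :: "nat \<Rightarrow> nat \<Rightarrow> (nat \<Rightarrow> nat) \<Rightarrow> bool" where
  "fits a b p \<longleftrightarrow> card {k. p k \<noteq> 0} \<le> a \<and> (\<forall>k. p k \<le> b)"

text \<open>The sides of the rectangle for the pair \<open>(j, i)\<close>; the differences are non-negative by
  interlacing.\<close>

definition rect_height :: "(nat \<Rightarrow> nat \<Rightarrow> int) \<Rightarrow> nat \<Rightarrow> nat \<Rightarrow> nat" where
  "rect_height L j i = nat (L (Suc j) i - L j i)"

definition rect_width :: "(nat \<Rightarrow> nat \<Rightarrow> int) \<Rightarrow> nat \<Rightarrow> nat \<Rightarrow> nat" where
  "rect_width L j i = nat (L j i - L (Suc j) (Suc i))"

definition pops :: "nat \<Rightarrow> ((nat \<Rightarrow> nat \<Rightarrow> int) \<times> (nat \<Rightarrow> nat \<Rightarrow> nat \<Rightarrow> nat)) set" where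
  "pops n = (SIGMA L : gt_patterns n.
     \<Pi>\<^sub>E j \<in> {1..<n}. \<Pi>\<^sub>E i \<in> {1..j}.
       {p. is_partition p \<and> fits (rect_height L j i) (rect_width L j i) p})"

definition pops_bounded ::
  "nat \<Rightarrow> (nat \<Rightarrow> int) \<Rightarrow> ((nat \<Rightarrow> nat \<Rightarrow> int) \<times> (nat \<Rightarrow> nat \<Rightarrow> nat \<Rightarrow> nat)) set" where
  "pops_bounded n lam = {P \<in> pops n. fst P n = lam}"

section \<open>The vectors attached to partition overlaid patterns\<close>

definition ordered_prod :: "('a, 'm) monoid_scheme \<Rightarrow> ('i \<Rightarrow> 'a) \<Rightarrow> 'i list \<Rightarrow> 'a" where
  "ordered_prod A f is = foldr (\<lambda>i y. f i \<otimes>\<^bsub>A\<^esub> y) is \<one>\<^bsub>A\<^esub>"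

definition divided_power :: "(complex, 'a, 'm) module_scheme \<Rightarrow> 'a \<Rightarrow> nat \<Rightarrow> 'a" where
  "divided_power A T m = (1 / fact m) \<odot>\<^bsub>A\<^esub> (T [^]\<^bsub>A\<^esub> m)"

definition x_minus :: "nat \<Rightarrow> nat \<Rightarrow> nat \<Rightarrow> complex mat" where
  "x_minus r i j = mat (Suc r) (Suc r) (\<lambda>(a, b). if a = j \<and> b = i - 1 then 1 else 0)"

definition part_mult :: "nat \<Rightarrow> nat \<Rightarrow> (nat \<Rightarrow> nat) \<Rightarrow> nat \<Rightarrow> nat" where
  "part_mult a b p k =
     (if k = 0 then a - (\<Sum>l = 1..b. card {s. p s = l}) else card {s. p s = k})"

definition x_minus_partition ::
  "nat \<Rightarrow> nat \<Rightarrow> nat \<Rightarrow> nat \<Rightarrow> nat \<Rightarrow> (nat \<Rightarrow> nat) \<Rightarrow> (complex poly mat free_monoid \<Rightarrow>\<^sub>0 complex) set"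
  where
  "x_minus_partition r i j a b p =
     ordered_prod (current_uea r)
       (\<lambda>k. divided_power (current_uea r) (current_emb r (x_minus r i j) (monom 1 k))
              (part_mult a b p k)) [0..<Suc b]"

definition pop_row ::
  "nat \<Rightarrow> (nat \<Rightarrow> nat \<Rightarrow> int) \<times> (nat \<Rightarrow> nat \<Rightarrow> nat \<Rightarrow> nat) \<Rightarrow> nat \<Rightarrow>
   (complex poly mat free_monoid \<Rightarrow>\<^sub>0 complex) set" where
  "pop_row r P j =
     ordered_prod (current_uea r)
       (\<lambda>i. x_minus_partition r i j (rect_height (fst P) j i) (rect_width (fst P) j i) (snd P j i))
       [1..<Suc j]"

definition pop_monomial ::
  "nat \<Rightarrow> (nat \<Rightarrow> nat \<Rightarrow> int) \<times> (nat \<Rightarrow> nat \<Rightarrow> nat \<Rightarrow> nat) \<Rightarrow>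
   (complex poly mat free_monoid \<Rightarrow>\<^sub>0 complex) set" where
  "pop_monomial r P = ordered_prod (current_uea r) (pop_row r P) [1..<Suc r]"

definition pop_vector ::
  "nat \<Rightarrow> (nat \<Rightarrow> int) \<Rightarrow> (nat \<Rightarrow> nat \<Rightarrow> int) \<times> (nat \<Rightarrow> nat \<Rightarrow> nat \<Rightarrow> nat) \<Rightarrow>
   (complex poly mat free_monoid \<Rightarrow>\<^sub>0 complex) set set" where
  "pop_vector r lam P = weyl_act r lam (pop_monomial r P) (weyl_gen r lam)"

section \<open>Well-definedness\<close>

lemma quot_space_smult:
  assumes "Module.module K V" "Module.submodule N K V" "c \<in> carrier K" "x \<in> carrier V"
  shows "c \<odot>\<^bsub>quot_space V N\<^esub> (N +>\<^bsub>V\<^esub> x) = N +>\<^bsub>V\<^esub> (c \<odot>\<^bsub>V\<^esub> x)"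
proof -
  interpret Module.module K V by fact
  interpret N: Module.submodule N K V by fact
  interpret A: abelian_subgroup N V
    by (rule abelian_subgroupI3)
      (auto intro: additive_subgroup.intro N.subgroup_axioms M.abelian_group_axioms)
  have "N +>\<^bsub>V\<^esub> (c \<odot>\<^bsub>V\<^esub> y) = N +>\<^bsub>V\<^esub> (c \<odot>\<^bsub>V\<^esub> x)" if y: "y \<in> N +>\<^bsub>V\<^esub> x" for y
  proof -
    from y obtain n where n: "n \<in> N" "y = n \<oplus>\<^bsub>V\<^esub> x"
      by (auto simp: a_r_coset_def r_coset_def)
    have nV: "n \<in> carrier V" using n(1) A.a_subset by auto
    have "c \<odot>\<^bsub>V\<^esub> y = c \<odot>\<^bsub>V\<^esub> n \<oplus>\<^bsub>V\<^esub> c \<odot>\<^bsub>V\<^esub> x"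
      using n nV assms by (simp add: smult_r_distr)
    moreover have "c \<odot>\<^bsub>V\<^esub> n \<in> N" using n assms N.smult_closed by blast
    ultimately have "c \<odot>\<^bsub>V\<^esub> y \<in> N +>\<^bsub>V\<^esub> (c \<odot>\<^bsub>V\<^esub> x)"
      by (auto simp: a_r_coset_def r_coset_def)
    from A.a_repr_independence'[OF this smult_closed[OF assms(3,4)]]
    show ?thesis by (rule sym)
  qed
  moreover have "x \<in> N +>\<^bsub>V\<^esub> x"
    by (rule A.a_rcos_self[OF assms(4)])
  ultimately have "(\<Union>y\<in>N +>\<^bsub>V\<^esub> x. N +>\<^bsub>V\<^esub> (c \<odot>\<^bsub>V\<^esub> y)) = N +>\<^bsub>V\<^esub> (c \<odot>\<^bsub>V\<^esub> x)"
    by blast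
  then show ?thesis
    by (simp add: quot_space_def)
qed

lemma quot_space_vectorspace:
  assumes "vectorspace K V" "Module.submodule N K V"
  shows "vectorspace K (quot_space V N)"
proof -
  interpret vectorspace K V by fact
  interpret N: Module.submodule N K V by fact
  interpret A: abelian_subgroup N V
    by (rule abelian_subgroupI3)
      (auto intro: additive_subgroup.intro N.subgroup_axioms M.abelian_group_axioms)
  have car: "X \<in> carrier (quot_space V N) \<longleftrightarrow> (\<exists>x\<in>carrier V. X = N +>\<^bsub>V\<^esub> x)" for X
    by (auto simp: quot_space_def A_RCOSETS_def RCOSETS_def a_r_coset_def)
  note sm = quot_space_smult[OF module_axioms assms(2)]
  have ad: "(N +>\<^bsub>V\<^esub> x) \<oplus>\<^bsub>quot_space V N\<^esub> (N +>\<^bsub>V\<^esub> y) = N +>\<^bsub>V\<^esub> (x \<oplus>\<^bsub>V\<^esub> y)"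
    if "x \<in> carrier V" "y \<in> carrier V" for x y
    using A.a_rcos_sum[OF that] by (simp add: quot_space_def)
  have ze: "\<zero>\<^bsub>quot_space V N\<^esub> = N +>\<^bsub>V\<^esub> \<zero>\<^bsub>V\<^esub>"
    by (simp add: quot_space_def A.a_subset)
  let ?Q = "quot_space V N"
  have ag: "abelian_group ?Q"
  proof (rule abelian_groupI)
    fix X assume "X \<in> carrier ?Q"
    then obtain x where x: "x \<in> carrier V" "X = N +>\<^bsub>V\<^esub> x" unfolding car by blast
    then show "\<zero>\<^bsub>?Q\<^esub> \<oplus>\<^bsub>?Q\<^esub> X = X" by (simp add: ze ad)
    have "N +>\<^bsub>V\<^esub> (\<ominus>\<^bsub>V\<^esub> x) \<in> carrier ?Q" unfolding car using x by blast
    moreover have "(N +>\<^bsub>V\<^esub> (\<ominus>\<^bsub>V\<^esub> x)) \<oplus>\<^bsub>?Q\<^esub> X = \<zero>\<^bsub>?Q\<^esub>"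
      using x by (simp add: ze ad M.l_neg)
    ultimately show "\<exists>Y\<in>carrier ?Q. Y \<oplus>\<^bsub>?Q\<^esub> X = \<zero>\<^bsub>?Q\<^esub>" by blast
  next
    fix X Y assume "X \<in> carrier ?Q" "Y \<in> carrier ?Q"
    then obtain x y where xy: "x \<in> carrier V" "X = N +>\<^bsub>V\<^esub> x" "y \<in> carrier V" "Y = N +>\<^bsub>V\<^esub> y"
      unfolding car by blast
    then have "X \<oplus>\<^bsub>?Q\<^esub> Y = N +>\<^bsub>V\<^esub> (x \<oplus>\<^bsub>V\<^esub> y)" by (simp add: ad)
    then show "X \<oplus>\<^bsub>?Q\<^esub> Y \<in> carrier ?Q" unfolding car using xy by blast
    show "X \<oplus>\<^bsub>?Q\<^esub> Y = Y \<oplus>\<^bsub>?Q\<^esub> X" using xy by (simp add: ad M.a_comm)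
    fix Z assume "Z \<in> carrier ?Q"
    then obtain z where z: "z \<in> carrier V" "Z = N +>\<^bsub>V\<^esub> z" unfolding car by blast
    show "X \<oplus>\<^bsub>?Q\<^esub> Y \<oplus>\<^bsub>?Q\<^esub> Z = X \<oplus>\<^bsub>?Q\<^esub> (Y \<oplus>\<^bsub>?Q\<^esub> Z)"
      using xy z by (simp add: ad M.a_assoc)
  next
    show "\<zero>\<^bsub>?Q\<^esub> \<in> carrier ?Q" unfolding car ze by blast
  qed
  have "Module.module K ?Q"
  proof (rule moduleI[OF is_cring ag])
    fix c X assume c: "c \<in> carrier K" and "X \<in> carrier ?Q"
    then obtain x where x: "x \<in> carrier V" "X = N +>\<^bsub>V\<^esub> x" unfolding car by blast
    show "c \<odot>\<^bsub>?Q\<^esub> X \<in> carrier ?Q"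
      unfolding car using c x sm[OF c x(1)] smult_closed[OF c x(1)] by blast
    fix d assume d: "d \<in> carrier K"
    show "(c \<oplus>\<^bsub>K\<^esub> d) \<odot>\<^bsub>?Q\<^esub> X = c \<odot>\<^bsub>?Q\<^esub> X \<oplus>\<^bsub>?Q\<^esub> d \<odot>\<^bsub>?Q\<^esub> X"
      using c d x by (simp add: sm ad smult_l_distr)
    show "(c \<otimes>\<^bsub>K\<^esub> d) \<odot>\<^bsub>?Q\<^esub> X = c \<odot>\<^bsub>?Q\<^esub> (d \<odot>\<^bsub>?Q\<^esub> X)"
      using c d x by (simp add: sm smult_assoc1)
  next
    fix X assume "X \<in> carrier ?Q"
    then obtain x where x: "x \<in> carrier V" "X = N +>\<^bsub>V\<^esub> x" unfolding car by blast
    then show "\<one>\<^bsub>K\<^esub> \<odot>\<^bsub>?Q\<^esub> X = X" by (simp add: sm)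
  next
    fix c X Y assume c: "c \<in> carrier K" and "X \<in> carrier ?Q" "Y \<in> carrier ?Q"
    then obtain x y where xy: "x \<in> carrier V" "X = N +>\<^bsub>V\<^esub> x" "y \<in> carrier V" "Y = N +>\<^bsub>V\<^esub> y"
      unfolding car by blast
    then show "c \<odot>\<^bsub>?Q\<^esub> (X \<oplus>\<^bsub>?Q\<^esub> Y) = c \<odot>\<^bsub>?Q\<^esub> X \<oplus>\<^bsub>?Q\<^esub> c \<odot>\<^bsub>?Q\<^esub> Y"
      using c by (simp add: sm ad smult_r_distr)
  qed
  then show ?thesis
    by (rule vectorspace.intro) (rule field_axioms)
qed

lemma free_algebra_ring: "ring (free_algebra X :: ('k::field, _) module)"
proof -
  have cl: "p * q \<in> carrier (free_algebra X)"
    if pq: "p \<in> carrier (free_algebra X)" "q \<in> carrier (free_algebra X)"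
    for p q :: "_ \<Rightarrow>\<^sub>0 'k"
  proof -
    have "set (letters w) \<subseteq> X" if w: "w \<in> Poly_Mapping.keys (p * q)" for w
    proof -
      obtain u v where uv: "u \<in> Poly_Mapping.keys p" "v \<in> Poly_Mapping.keys q" "w = u + v"
        using keys_mult[of p q] w by blast
      have "set (letters u) \<subseteq> X" "set (letters v) \<subseteq> X"
        using pq uv(1,2) by (simp_all add: free_algebra_def)
      then show ?thesis
        by (simp add: uv(3) plus_free_monoid_def)
    qed
    then show ?thesis by (simp add: free_algebra_def)
  qed
  have mi: "- p \<in> carrier (free_algebra X)" if "p \<in> carrier (free_algebra X)" for p :: "_ \<Rightarrow>\<^sub>0 'k"
    using that by (simp add: free_algebra_def in_keys_iff)
  have pl: "p + q \<in> carrier (free_algebra X)"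
    if "p \<in> carrier (free_algebra X)" "q \<in> carrier (free_algebra X)" for p q :: "_ \<Rightarrow>\<^sub>0 'k"
    using that Poly_Mapping.keys_add[of p q] by (auto simp: free_algebra_def)
  have 1: "1 \<in> carrier (free_algebra X :: ('k, _) module)"
    "0 \<in> carrier (free_algebra X :: ('k, _) module)"
    by (auto simp: free_algebra_def zero_free_monoid_def)
  let ?F = "free_algebra X :: ('k, _) module"
  have ops: "mult ?F = (*)" "add ?F = (+)" "zero ?F = 0" "one ?F = 1"
    by (simp_all add: free_algebra_def)
  show ?thesis
  proof (rule ringI)
    show "abelian_group ?F"
    proof (rule abelian_groupI)
      fix p assume "p \<in> carrier ?F"
      then show "\<exists>q\<in>carrier ?F. q \<oplus>\<^bsub>?F\<^esub> p = \<zero>\<^bsub>?F\<^esub>"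
        by (intro bexI[of _ "- p"] mi) (simp_all add: ops)
    qed (simp_all add: ops pl 1 ac_simps)
    show "Group.monoid ?F"
      by (rule Group.monoidI) (simp_all add: ops cl 1 mult.assoc)
  qed (simp_all add: ops distrib_left distrib_right)
qed

lemma free_smult_closed:
  assumes "p \<in> carrier (free_algebra X)"
  shows "free_smult c p \<in> carrier (free_algebra X)"
proof -
  have "Poly_Mapping.keys (free_smult c p) \<subseteq> Poly_Mapping.keys p"
  proof
    fix w assume "w \<in> Poly_Mapping.keys (free_smult c p)"
    then obtain u v where "u \<in> Poly_Mapping.keys (Poly_Mapping.single (0::'a free_monoid) c)"
      "v \<in> Poly_Mapping.keys p" "w = u + v"
      using keys_mult[of "Poly_Mapping.single 0 c" p] by (auto simp: free_smult_def)
    then show "w \<in> Poly_Mapping.keys p" by (auto split: if_splits)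
  qed
  then show ?thesis using assms by (auto simp: free_algebra_def)
qed

lemma free_smult_mult: "free_smult c (p * q) = free_smult c p * q"
  by (simp add: free_smult_def mult.assoc)

lemma free_algebra_vectorspace: "vectorspace class_ring (free_algebra X :: ('k::field, _) module)"
proof -
  let ?F = "free_algebra X :: ('k, _) module"
  have ops: "smult ?F = free_smult" "add ?F = (+)"
    by (simp_all add: free_algebra_def)
  have "Module.module class_ring ?F"
    by (rule moduleI[OF class_cring.is_cring ring.is_abelian_group[OF free_algebra_ring]])
      (simp_all add: ops free_smult_closed, simp_all add: free_smult_def distrib_left distrib_right
        single_add mult_single mult.assoc[symmetric])
  then show ?thesis
    by (rule vectorspace.intro) (rule class_field.field_axioms)
qed


lemma uea_relations_subset:
  assumes "lie_algebra class_ring L"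
  shows "uea_relations L \<subseteq> carrier (free_algebra (carrier L))"
proof -
  interpret lie_algebra class_ring L by fact
  interpret F: ring "free_algebra (carrier L) :: ('a, _) module" by (rule free_algebra_ring)
  let ?C = "carrier (free_algebra (carrier L) :: ('a, _) module)"
  have gen: "free_gen x \<in> ?C" if "x \<in> carrier L" for x
    using that by (simp add: free_algebra_def free_gen_def)
  have mul: "p * q \<in> ?C" if "p \<in> ?C" "q \<in> ?C" for p q
    using F.m_closed[OF that] by (simp add: free_algebra_def)
  have sub: "p - q \<in> ?C" if "p \<in> ?C" "q \<in> ?C" for p q
    using that keys_diff[of p q] unfolding free_algebra_def by fastforce
  show ?thesis
    unfolding uea_relations_def
    by (auto intro!: gen mul sub free_smult_closed bracket_closed smult_closed)
qed

lemma uea_ideal: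
  assumes "lie_algebra class_ring L"
  shows "ideal (uea_ideal L) (free_algebra (carrier L))"
  unfolding uea_ideal_def
  by (rule ring.genideal_ideal[OF free_algebra_ring uea_relations_subset[OF assms]])

lemma ideal_submodule:
  fixes I :: "('a free_monoid \<Rightarrow>\<^sub>0 'k::field) set"
  assumes "ideal I (free_algebra X :: ('k, _) module)"
  shows "Module.submodule I class_ring (free_algebra X)"
proof -
  interpret ideal I "free_algebra X :: ('k, _) module" by fact
  show ?thesis
  proof (intro Module.submodule.intro a_subgroup Module.submodule_axioms.intro)
    fix c :: 'k and p assume p: "p \<in> I"
    have "Poly_Mapping.single 0 c \<in> carrier (free_algebra X :: ('k, _) module)"
      by (simp add: free_algebra_def zero_free_monoid_def)
    from I_l_closed[OF p this]
    show "c \<odot>\<^bsub>free_algebra X\<^esub> p \<in> I"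
      by (simp add: free_algebra_def free_smult_def)
  qed
qed

lemma
  assumes "vectorspace K A" "ideal I A" "Module.submodule I K A"
  shows quot_algebra_ring: "ring (quot_algebra A I)"
    and quot_algebra_vectorspace: "vectorspace K (quot_algebra A I)"
proof -
  interpret I: ideal I A by fact
  interpret Q: vectorspace K "quot_space A I"
    by (rule quot_space_vectorspace[OF assms(1,3)])
  have eq: "carrier (quot_algebra A I) = carrier (A Quot I)"
    "add (quot_algebra A I) = add (A Quot I)" "zero (quot_algebra A I) = zero (A Quot I)"
    "mult (quot_algebra A I) = mult (A Quot I)" "one (quot_algebra A I) = one (A Quot I)"
    by (simp_all add: quot_algebra_def quot_space_def FactRing_def)
  have am: "add_monoid (quot_algebra A I) = add_monoid (quot_space A I)"
    by (simp add: quot_algebra_def)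
  have ag: "abelian_group (quot_algebra A I)"
    using Q.abelian_group_axioms
    unfolding abelian_group_def abelian_monoid_def abelian_group_axioms_def am .
  interpret Q': ring "A Quot I" by (rule I.quotient_is_ring)
  show "ring (quot_algebra A I)"
    by (rule ringI[OF ag], rule Group.monoidI)
      (simp_all add: eq Q'.m_assoc Q'.l_distr Q'.r_distr)
  have "module_axioms K (quot_algebra A I)"
    using Q.module_axioms unfolding Module.module_def module_axioms_def
    by (simp add: quot_algebra_def)
  then show "vectorspace K (quot_algebra A I)"
    by (intro vectorspace.intro Module.module.intro Q.is_cring ag Q.field_axioms)
qed

lemma
  assumes "lie_algebra class_ring L"
  shows uea_ring: "ring (uea L)"
    and uea_vectorspace: "vectorspace class_ring (uea L)"
  unfolding uea_def
  by (rule quot_algebra_ring quot_algebra_vectorspace;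
      rule free_algebra_vectorspace uea_ideal[OF assms] ideal_submodule[OF uea_ideal[OF assms]])+

lemma uea_emb_closed:
  assumes "lie_algebra class_ring L" "x \<in> carrier L"
  shows "uea_emb L x \<in> carrier (uea L)"
proof -
  have "free_gen x \<in> carrier (free_algebra (carrier L))"
    using assms by (simp add: free_algebra_def free_gen_def)
  then show ?thesis
    by (auto simp: uea_def uea_emb_def quot_algebra_def quot_space_def A_RCOSETS_def RCOSETS_def
        a_r_coset_def)
qed

lemma uea_smult_mult:
  assumes "lie_algebra class_ring L" "a \<in> carrier (uea L)"
  shows "c \<odot>\<^bsub>uea L\<^esub> a = (c \<odot>\<^bsub>uea L\<^esub> \<one>\<^bsub>uea L\<^esub>) \<otimes>\<^bsub>uea L\<^esub> a"
proof -
  let ?F = "free_algebra (carrier L) :: ('a, _) module" and ?I = "uea_ideal L"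
  interpret I: ideal ?I ?F by (rule uea_ideal[OF assms(1)])
  interpret F: vectorspace class_ring ?F by (rule free_algebra_vectorspace)
  have sm: "c \<odot>\<^bsub>uea L\<^esub> (?I +>\<^bsub>?F\<^esub> p) = ?I +>\<^bsub>?F\<^esub> (free_smult c p)" if "p \<in> carrier ?F" for p
    using quot_space_smult[OF F.module_axioms ideal_submodule[OF I.ideal_axioms] _ that, of c]
    by (simp add: uea_def quot_algebra_def free_algebra_def)
  have mu: "(?I +>\<^bsub>?F\<^esub> p) \<otimes>\<^bsub>uea L\<^esub> (?I +>\<^bsub>?F\<^esub> q) = ?I +>\<^bsub>?F\<^esub> (p * q)"
    if "p \<in> carrier ?F" "q \<in> carrier ?F" for p q
    using I.rcoset_mult_add[OF that] by (simp add: uea_def quot_algebra_def free_algebra_def)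
  obtain p where p: "p \<in> carrier ?F" "a = ?I +>\<^bsub>?F\<^esub> p"
    using assms(2)
    by (auto simp: uea_def quot_algebra_def quot_space_def A_RCOSETS_def RCOSETS_def a_r_coset_def)
  have one: "\<one>\<^bsub>uea L\<^esub> = ?I +>\<^bsub>?F\<^esub> 1" "1 \<in> carrier ?F"
    by (auto simp: uea_def quot_algebra_def free_algebra_def zero_free_monoid_def)
  show ?thesis
    by (simp only: p(2) one(1) sm[OF p(1)] sm[OF one(2)] mu[OF free_smult_closed[OF one(2)] p(1)]
        free_smult_mult[symmetric] mult_1_left)
qed

lemma gen_left_ideal_left_ideal:
  assumes "ring A" "S \<subseteq> carrier A"
  shows "left_ideal (gen_left_ideal A S) A"
proof -
  interpret ring A by fact
  have car: "left_ideal (carrier A) A"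
    by (auto simp: left_ideal_def additive_subgroup_def intro: add.subgroup_self)
  let ?J = "{J. left_ideal J A \<and> S \<subseteq> J}"
  have "subgroup (\<Inter>?J) (add_monoid A)"
    by (rule add.subgroups_Inter) (use car assms(2) in \<open>auto simp: left_ideal_def additive_subgroup_def\<close>)
  then show ?thesis
    by (auto simp: gen_left_ideal_def left_ideal_def additive_subgroup_def)
qed

lemma coset_act_coset:
  assumes "ring A" "left_ideal J A" "u \<in> carrier A" "x \<in> carrier A"
  shows "coset_act A J u (J +>\<^bsub>A\<^esub> x) = J +>\<^bsub>A\<^esub> (u \<otimes>\<^bsub>A\<^esub> x)"
proof -
  interpret ring A by fact
  interpret J: abelian_subgroup J A
    by (rule abelian_subgroupI3) (use assms in \<open>auto simp: left_ideal_def intro: abelian_group_axioms\<close>)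
  have "J +>\<^bsub>A\<^esub> (u \<otimes>\<^bsub>A\<^esub> y) = J +>\<^bsub>A\<^esub> (u \<otimes>\<^bsub>A\<^esub> x)" if "y \<in> J +>\<^bsub>A\<^esub> x" for y
  proof -
    from that obtain n where n: "n \<in> J" "y = n \<oplus>\<^bsub>A\<^esub> x"
      by (auto simp: a_r_coset_def r_coset_def)
    have nA: "n \<in> carrier A" using n(1) J.a_subset by auto
    have "u \<otimes>\<^bsub>A\<^esub> y = u \<otimes>\<^bsub>A\<^esub> n \<oplus>\<^bsub>A\<^esub> u \<otimes>\<^bsub>A\<^esub> x"
      using n nA assms by (simp add: r_distr)
    moreover have "u \<otimes>\<^bsub>A\<^esub> n \<in> J" using n assms by (simp add: left_ideal_def)
    ultimately have "u \<otimes>\<^bsub>A\<^esub> y \<in> J +>\<^bsub>A\<^esub> (u \<otimes>\<^bsub>A\<^esub> x)"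
      by (auto simp: a_r_coset_def r_coset_def)
    from J.a_repr_independence'[OF this m_closed[OF assms(3,4)]]
    show ?thesis by (rule sym)
  qed
  moreover have "x \<in> J +>\<^bsub>A\<^esub> x"
    by (rule J.a_rcos_self[OF assms(4)])
  ultimately show ?thesis
    unfolding coset_act_def by blast
qed

lemma uea_left_ideal_submodule:
  assumes "lie_algebra class_ring L" "left_ideal J (uea L)"
  shows "Module.submodule J class_ring (uea L)"
proof -
  interpret U: ring "uea L" by (rule uea_ring[OF assms(1)])
  interpret V: vectorspace class_ring "uea L" by (rule uea_vectorspace[OF assms(1)])
  have J: "subgroup J (add_monoid (uea L))"
    using assms(2) by (simp add: left_ideal_def additive_subgroup_def)
  show ?thesis
  proof (intro Module.submodule.intro J Module.submodule_axioms.intro)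
    fix c x assume x: "x \<in> J"
    then have xU: "x \<in> carrier (uea L)" using subgroup.subset[OF J] by auto
    have "c \<odot>\<^bsub>uea L\<^esub> \<one>\<^bsub>uea L\<^esub> \<in> carrier (uea L)"
      by (rule V.smult_closed) simp_all
    then show "c \<odot>\<^bsub>uea L\<^esub> x \<in> J"
      using assms(2) x by (simp add: uea_smult_mult[OF assms(1) xU] left_ideal_def)
  qed
qed

lemma trace_mult_comm:
  fixes A B :: "'a::comm_ring_1 mat"
  assumes "A \<in> carrier_mat n n" "B \<in> carrier_mat n n"
  shows "(\<Sum>i<n. (A * B) $$ (i, i)) = (\<Sum>i<n. (B * A) $$ (i, i))"
proof -
  have e: "(\<Sum>i<n. (C * D) $$ (i, i)) = (\<Sum>i<n. \<Sum>k<n. C $$ (i, k) * D $$ (k, i))"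
    if "C \<in> carrier_mat n n" "D \<in> carrier_mat n n" for C D :: "'a mat"
    using that by (intro sum.cong refl) (simp add: scalar_prod_def atLeast0LessThan)
  show ?thesis
    unfolding e[OF assms] e[OF assms(2,1)] by (subst sum.swap) (simp add: mult.commute)
qed

lemma sl_current_lie_algebra: "lie_algebra class_ring (sl_current r)"
proof -
  let ?L = "sl_current r" and ?M = "carrier_mat (Suc r) (Suc r) :: complex poly mat set"
  have ops: "carrier ?L = sl_carrier r" "add ?L = (+)" "zero ?L = 0\<^sub>m (Suc r) (Suc r)"
    "smult ?L = (\<lambda>c A. [:c:] \<cdot>\<^sub>m A)" "lie_bracket ?L = (\<lambda>A B. A * B - B * A)"
    by (simp_all add: sl_current_def)
  have D: "A \<in> ?M" if "A \<in> sl_carrier r" for A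
    using that by (simp add: sl_carrier_def)
  have cl: "A + B \<in> sl_carrier r" "[:c:] \<cdot>\<^sub>m A \<in> sl_carrier r" "- A \<in> sl_carrier r"
    "A * B - B * A \<in> sl_carrier r"
    if A: "A \<in> sl_carrier r" and B: "B \<in> sl_carrier r" for A B :: "complex poly mat" and c
  proof -
    have M: "A \<in> ?M" "B \<in> ?M" using A B D by auto
    have t: "(\<Sum>i<Suc r. A $$ (i, i)) = 0" "(\<Sum>i<Suc r. B $$ (i, i)) = 0"
      using A B by (simp_all add: sl_carrier_def)
    have "(\<Sum>i<Suc r. (A + B) $$ (i, i)) = (\<Sum>i<Suc r. A $$ (i, i)) + (\<Sum>i<Suc r. B $$ (i, i))"
      using M by (subst sum.distrib[symmetric], intro sum.cong) auto
    then show "A + B \<in> sl_carrier r" using M t by (simp add: sl_carrier_def del: sum.lessThan_Suc)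
    have "(\<Sum>i<Suc r. ([:c:] \<cdot>\<^sub>m A) $$ (i, i)) = [:c:] * (\<Sum>i<Suc r. A $$ (i, i))"
      using M by (subst sum_distrib_left, intro sum.cong) auto
    then show "[:c:] \<cdot>\<^sub>m A \<in> sl_carrier r" using M t by (simp add: sl_carrier_def del: sum.lessThan_Suc)
    have "(\<Sum>i<Suc r. (- A) $$ (i, i)) = - (\<Sum>i<Suc r. A $$ (i, i))"
      using M by (subst sum_negf[symmetric], intro sum.cong) auto
    then show "- A \<in> sl_carrier r" using M t by (simp add: sl_carrier_def del: sum.lessThan_Suc)
    have "(\<Sum>i<Suc r. (A * B - B * A) $$ (i, i))
        = (\<Sum>i<Suc r. (A * B) $$ (i, i)) - (\<Sum>i<Suc r. (B * A) $$ (i, i))"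
      using M by (subst sum_subtractf[symmetric], intro sum.cong) auto
    moreover have "A * B - B * A \<in> ?M" using M by (intro minus_carrier_mat mult_carrier_mat)
    ultimately show "A * B - B * A \<in> sl_carrier r"
      using M trace_mult_comm[OF M] by (simp add: sl_carrier_def del: sum.lessThan_Suc)
  qed
  have z: "0\<^sub>m (Suc r) (Suc r) \<in> sl_carrier r"
    by (simp add: sl_carrier_def)
  have ag: "abelian_group ?L"
  proof (rule abelian_groupI)
    fix A assume A: "A \<in> carrier ?L"
    then show "\<exists>B\<in>carrier ?L. B \<oplus>\<^bsub>?L\<^esub> A = \<zero>\<^bsub>?L\<^esub>"
      by (intro bexI[of _ "- A"]) (auto simp: ops cl dest!: D)
  next
    fix A B assume "A \<in> carrier ?L" "B \<in> carrier ?L"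
    then show "A \<oplus>\<^bsub>?L\<^esub> B = B \<oplus>\<^bsub>?L\<^esub> A"
      by (auto simp: ops intro!: comm_add_mat[of _ "Suc r" "Suc r"] dest!: D)
    fix C assume "C \<in> carrier ?L"
    then show "A \<oplus>\<^bsub>?L\<^esub> B \<oplus>\<^bsub>?L\<^esub> C = A \<oplus>\<^bsub>?L\<^esub> (B \<oplus>\<^bsub>?L\<^esub> C)"
      using \<open>A \<in> carrier ?L\<close> \<open>B \<in> carrier ?L\<close>
      by (auto simp: ops intro!: assoc_add_mat[of _ "Suc r" "Suc r"] dest!: D)
  qed (auto simp: ops cl z dest!: D)
  have "Module.module class_ring ?L"
    by (rule moduleI[OF class_cring.is_cring ag])
      (auto simp: ops cl dest!: D intro!: eq_matI simp: distrib_left distrib_right algebra_simps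
        smult_add_left smult_add_right)
  then have vs: "vectorspace class_ring ?L"
    by (rule vectorspace.intro) (rule class_field.field_axioms)
  have sa: "A + (B - C) = A + B - C" if "A \<in> ?M" "B \<in> ?M" "C \<in> ?M" for A B C
    using that by (intro eq_matI) auto
  show ?thesis
  proof (intro lie_algebra.intro vs lie_algebra_axioms.intro)
    fix x y z assume xyz: "x \<in> carrier ?L" "y \<in> carrier ?L" "z \<in> carrier ?L"
    have M: "x \<in> ?M" "y \<in> ?M" "z \<in> ?M" using xyz by (auto simp: ops D)
    show "lie_bracket ?L (x \<oplus>\<^bsub>?L\<^esub> y) z = lie_bracket ?L x z \<oplus>\<^bsub>?L\<^esub> lie_bracket ?L y z"
      using M by (simp add: ops add_mult_distrib_mat[OF M(1,2,3)] mult_add_distrib_mat[OF M(3,1,2)])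
        (intro eq_matI, auto)
    show "lie_bracket ?L x (y \<oplus>\<^bsub>?L\<^esub> z) = lie_bracket ?L x y \<oplus>\<^bsub>?L\<^esub> lie_bracket ?L x z"
      using M by (simp add: ops add_mult_distrib_mat[OF M(2,3,1)] mult_add_distrib_mat[OF M(1,2,3)])
        (intro eq_matI, auto)
    have br: "A * (B * C - C * B) - (B * C - C * B) * A
        = (A * (B * C) - A * (C * B)) - (B * (C * A) - C * (B * A))"
      if "A \<in> ?M" "B \<in> ?M" "C \<in> ?M" for A B C
      using that by (simp add: mult_minus_distrib_mat[of _ "Suc r" "Suc r" _ "Suc r"]
          minus_mult_distrib_mat[of _ "Suc r" "Suc r" _ _ "Suc r"]
          assoc_mult_mat[of _ "Suc r" "Suc r" _ "Suc r" _ "Suc r"])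
    show "lie_bracket ?L x (lie_bracket ?L y z) \<oplus>\<^bsub>?L\<^esub> lie_bracket ?L y (lie_bracket ?L z x)
           \<oplus>\<^bsub>?L\<^esub> lie_bracket ?L z (lie_bracket ?L x y) = \<zero>\<^bsub>?L\<^esub>"
      unfolding ops br[OF M(1,2,3)] br[OF M(2,3,1)] br[OF M(3,1,2)]
      by (rule eq_matI) (use M in auto)
  next
    fix x assume "x \<in> carrier ?L"
    then have "x \<in> ?M" by (simp add: ops D)
    then show "lie_bracket ?L x x = \<zero>\<^bsub>?L\<^esub>" by (simp add: ops)
  next
    fix x y and c :: complex assume xy: "x \<in> carrier ?L" "y \<in> carrier ?L"
    have M: "x \<in> ?M" "y \<in> ?M" using xy by (auto simp: ops D)
    show "lie_bracket ?L (c \<odot>\<^bsub>?L\<^esub> x) y = c \<odot>\<^bsub>?L\<^esub> lie_bracket ?L x y"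
      "lie_bracket ?L x (c \<odot>\<^bsub>?L\<^esub> y) = c \<odot>\<^bsub>?L\<^esub> lie_bracket ?L x y"
      using M by (simp_all add: ops mult_smult_assoc_mat[OF M] mult_smult_distrib[OF M(2,1)]
          mult_smult_assoc_mat[OF M(2,1)] mult_smult_distrib[OF M])
        (auto intro!: eq_matI simp: algebra_simps smult_diff_right)
    show "lie_bracket ?L x y \<in> carrier ?L" using xy by (simp add: ops cl)
  qed
qed

lemma tensor_poly_closed:
  assumes "X \<in> sl_carrier r"
  shows "tensor_poly X f \<in> sl_carrier r"
proof -
  have s: "(\<Sum>i<n. [:g i:] * f) = [:\<Sum>i<n. g i:] * f" for n and g :: "nat \<Rightarrow> complex"
    by (induction n) (simp_all add: algebra_simps smult_add_left)
  have X: "X \<in> carrier_mat (Suc r) (Suc r)" "(\<Sum>i<Suc r. X $$ (i, i)) = 0"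
    using assms by (auto simp: sl_carrier_def)
  have "(\<Sum>i<Suc r. tensor_poly X f $$ (i, i)) = (\<Sum>i<Suc r. [:X $$ (i, i):] * f)"
    using X by (intro sum.cong) (auto simp: tensor_poly_def)
  also have "\<dots> = 0" unfolding s X(2) by simp
  finally show ?thesis using X by (simp add: sl_carrier_def tensor_poly_def)
qed

lemma tensor_poly_bracket:
  assumes "X \<in> sl_carrier r" "Y \<in> sl_carrier r"
  shows "lie_bracket (sl_current r) (tensor_poly X f) (tensor_poly Y g)
    = tensor_poly (X * Y - Y * X) (f * g)"
proof -
  have M: "X \<in> carrier_mat (Suc r) (Suc r)" "Y \<in> carrier_mat (Suc r) (Suc r)"
    using assms by (auto simp: sl_carrier_def)
  have p: "tensor_poly X f * tensor_poly Y g = tensor_poly (X * Y) (f * g)"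
    if "X \<in> carrier_mat (Suc r) (Suc r)" "Y \<in> carrier_mat (Suc r) (Suc r)" for X Y f g
    using that by (intro eq_matI) (auto simp: tensor_poly_def scalar_prod_def smult_sum ac_simps simp del: sum.op_ivl_Suc)
  show ?thesis
    using M by (simp add: sl_current_def p mult.commute[of g f])
      (auto intro!: eq_matI simp: tensor_poly_def algebra_simps smult_diff_left)
qed

lemma weyl_relations_subset: "weyl_relations r lam \<subseteq> carrier (current_uea r)"
proof -
  interpret U: ring "current_uea r" by (rule uea_ring[OF sl_current_lie_algebra])
  interpret V: vectorspace class_ring "current_uea r"
    by (rule uea_vectorspace[OF sl_current_lie_algebra])
  have e: "current_emb r X f \<in> carrier (current_uea r)" if "X \<in> sl_carrier r" for X f
    unfolding current_emb_def
    by (rule uea_emb_closed[OF sl_current_lie_algebra])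
      (use tensor_poly_closed[OF that, of f] in \<open>simp add: sl_current_def\<close>)
  have "c \<odot>\<^bsub>current_uea r\<^esub> \<one>\<^bsub>current_uea r\<^esub> \<in> carrier (current_uea r)" for c
    by (rule V.smult_closed) simp_all
  then show ?thesis
    by (auto simp: weyl_relations_def n_plus_def cartan_def root_space_def
        intro!: e U.minus_closed U.m_closed)
qed

lemma weyl_left_ideal: "left_ideal (weyl_ideal r lam) (current_uea r)"
  unfolding weyl_ideal_def
  by (rule gen_left_ideal_left_ideal[OF uea_ring[OF sl_current_lie_algebra] weyl_relations_subset])

lemma local_weyl_vectorspace: "vectorspace class_ring (local_weyl r lam)"
  unfolding local_weyl_def
  by (rule quot_space_vectorspace[OF uea_vectorspace uea_left_ideal_submodule])
    (rule sl_current_lie_algebra weyl_left_ideal)+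

lemma weyl_act_coset:
  assumes "u \<in> carrier (current_uea r)" "x \<in> carrier (current_uea r)"
  shows "weyl_act r lam u (weyl_ideal r lam +>\<^bsub>current_uea r\<^esub> x)
    = weyl_ideal r lam +>\<^bsub>current_uea r\<^esub> (u \<otimes>\<^bsub>current_uea r\<^esub> x)"
  unfolding weyl_act_def
  by (rule coset_act_coset[OF uea_ring[OF sl_current_lie_algebra] weyl_left_ideal assms])

end

theory Submission
  imports Defs "HOL-Library.Function_Algebras" "HOL-Library.Nat_Bijection"
    "HOL-Combinatorics.Permutations" "Jordan_Normal_Form.Determinant"
begin

text \<open>
  The proof compares two bounds. For the upper bound, \<open>g[t]\<close> is enlarged to the currents of
  \<open>gl_(r+1)\<close>, and one inducts on the rank: a highest weight vector generates, under the currents of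
  \<open>gl_r\<close> and monomials in the bottom row \<open>x_(i,r)^- \<otimes> t^s\<close>, the whole module, and identities of
  Garland type (through Newton's identities for a shift operator) cut these monomials down to those whose
  exponents fit into a box, up to terms that are of higher order in a filtration by weight. Each such
  monomial is again a highest weight vector modulo that filtration, and boxed monomials are the same as
  partition overlays of an interlacing row. For the lower bound, the relations of the local Weyl module
  hold, modulo a variable \<open>s\<close>, in the submodule generated by the highest weight vector of a tensor product
  over \<open>C[s]\<close> of exterior powers of the natural module, on whose factors \<open>t\<close> acts by pairwise distinct
  multiples of \<open>s\<close>. Over \<open>C(s)\<close> this is a tensor product of evaluation modules at distinct points, so the
  submodule has rank \<open>\<Prod>i. (r+1 choose i) ^ (\<lambda>_i - \<lambda>_(i+1))\<close>, and it cannot be spanned modulo \<open>s\<close> by fewer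
  vectors. The number of POPs is the same product.
\<close>

section \<open>Reduction of monomials to a box\<close>

text \<open>Factors with the same index i commute, so a relation among their exponents is a
  symmetric polynomial in N variables, N being their number. Cartan currents make these relations an
  ideal, and Garland's identities put into it the complete symmetric polynomials h_a with a + N > m,
  where m = \<lambda>_i - \<lambda>_(i+1). The quotient by these h_a is the cohomology ring of a
  Grassmannian, which explains why exponents bounded by m - N suffice. The obstacle is that, except
  for the last index, Garland's identities concern the simple lowering operator from i to i + 1 and
  not the bottom row. Bracketing with a power of the bottom row element of index i + 1 moves them
  there, and the errors have a larger sum of indices; this sum is the weight that orders the
  filtration. In the lower bound, distinct points violate the relation that h \<otimes> t C[t] kills
  the generator, while at equal points the highest weight vector in general generates too little.
  The variable s reconciles the two: the relation holds modulo s inside the cyclic submodule, and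
  the dimension is a rank after inverting s.\<close>

fun elem_shift :: "nat \<Rightarrow> (nat list \<Rightarrow> complex) \<Rightarrow> nat list \<Rightarrow> complex" where
  "elem_shift k g [] = (if k = 0 then g [] else 0)"
| "elem_shift k g (s # t) = elem_shift k (\<lambda>l. g (s # l)) t +
     (if 0 < k \<and> 0 < s then elem_shift (k - 1) (\<lambda>l. g ((s - 1) # l)) t else 0)"

text \<open>A function \<open>g\<close> on lists is read as the polynomial whose coefficient at the
  monomial with exponent list \<open>l\<close> is \<open>g l\<close>. Then
  \<open>elem_shift k\<close> is multiplication by the k-th elementary symmetric polynomial e_k and
  \<open>power_shift a\<close> is multiplication by the power sum p_a, in as many variables as the
  list has entries.\<close>

fun power_shift :: "nat \<Rightarrow> (nat list \<Rightarrow> complex) \<Rightarrow> nat list \<Rightarrow> complex" where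
  "power_shift a g [] = 0"
| "power_shift a g (s # t) = power_shift a (\<lambda>l. g (s # l)) t + (if a \<le> s then g ((s - a) # t) else 0)"

lemma elem_shift_cong:
  "(\<And>l. length l = length t \<Longrightarrow> g l = g' l) \<Longrightarrow> elem_shift k g t = elem_shift k g' t"
proof (induction t arbitrary: k g g')
  case (Cons s t)
  have "elem_shift k (\<lambda>l. g (u # l)) t = elem_shift k (\<lambda>l. g' (u # l)) t" for k u
    by (rule Cons.IH) (simp add: Cons.prems)
  then show ?case by simp
qed simp

lemma elem_shift_zero: "elem_shift k (\<lambda>l. 0) t = 0"
  by (induction t arbitrary: k) auto

lemma elem_shift_0: "elem_shift 0 g t = g t"
  by (induction t arbitrary: g) auto

lemma power_shift_add: "power_shift k (\<lambda>l. g l + g' l) t = power_shift k g t + power_shift k g' t"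
  by (induction t arbitrary: g g') (auto simp: algebra_simps)

lemma power_shift_zero: "power_shift k (\<lambda>l. 0) t = 0"
  by (induction t) auto

lemma sum_alternating_telescope:
  fixes T :: "nat \<Rightarrow> 'a::comm_ring_1"
  shows "(\<Sum>i\<le>m. (-1)^i * (T i + T (Suc i))) = T 0 + (-1)^m * T (Suc m)"
  by (induction m) (auto simp: algebra_simps)

text \<open>Newton's identity between power sums and elementary symmetric polynomials, as
  multiplication operators. Induction on the number of variables: the identity for the tail accounts
  for the products in which the power sum acts on the tail, and the powers of the first variable
  cancel in pairs, which is the telescoping of \<open>T\<close>.\<close>

lemma newton_shift:
  "of_nat (Suc m) * elem_shift (Suc m) g t =
     (\<Sum>i\<le>m. (-1)^i * power_shift (Suc i) (elem_shift (m - i) g) t)"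
proof (induction t arbitrary: g m)
  case (Cons s t)
  define G where "G u = (\<lambda>l. g (u # l))" for u
  define T where "T i = (if i < s \<and> i \<le> m then elem_shift (m - i) (G (s - Suc i)) t else 0)" for i
  have e: "elem_shift j g (u # l) = elem_shift j (G u) l +
      (if 0 < j \<and> 0 < u then elem_shift (j - 1) (G (u - 1)) l else 0)" for j u l
    by (simp add: G_def)
  have "power_shift (Suc i) (elem_shift (m - i) g) (s # t) =
      power_shift (Suc i) (elem_shift (m - i) (G s)) t
      + (if i < m \<and> 0 < s then power_shift (Suc i) (elem_shift (m - i - 1) (G (s - 1))) t else 0)
      + (T i + T (Suc i))" if i: "i \<le> m" for i
  proof -
    have "power_shift (Suc i) (\<lambda>l. elem_shift (m - i) g (s # l)) t =
        power_shift (Suc i) (elem_shift (m - i) (G s)) t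
        + (if i < m \<and> 0 < s then power_shift (Suc i) (elem_shift (m - i - 1) (G (s - 1))) t else 0)"
      unfolding e power_shift_add using i by (auto simp: power_shift_zero)
    moreover have "(if Suc i \<le> s then elem_shift (m - i) g ((s - Suc i) # t) else 0) = T i + T (Suc i)"
      unfolding e using i by (auto simp: T_def Suc_le_eq)
    ultimately show ?thesis unfolding power_shift.simps by (simp only:)
  qed
  then have "(\<Sum>i\<le>m. (-1)^i * power_shift (Suc i) (elem_shift (m - i) g) (s # t)) =
     (\<Sum>i\<le>m. (-1)^i * power_shift (Suc i) (elem_shift (m - i) (G s)) t)
     + (\<Sum>i\<le>m. (-1)^i * (if i < m \<and> 0 < s then power_shift (Suc i) (elem_shift (m - i - 1) (G (s - 1))) t else 0))
     + (\<Sum>i\<le>m. (-1)^i * (T i + T (Suc i)))"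
    unfolding sum.distrib[symmetric] distrib_left[symmetric] by (intro sum.cong refl) simp
  moreover have "(\<Sum>i\<le>m. (-1)^i * (T i + T (Suc i))) = (if 0 < s then elem_shift m (G (s - 1)) t else 0)"
    unfolding sum_alternating_telescope by (simp add: T_def)
  moreover have "(\<Sum>i\<le>m. (-1)^i * (if i < m \<and> 0 < s then power_shift (Suc i) (elem_shift (m - i - 1) (G (s - 1))) t else 0))
      = (if 0 < s then of_nat m * elem_shift m (G (s - 1)) t else 0)"
  proof (cases m)
    case (Suc m')
    have "(\<Sum>i\<le>m. (-1)^i * (if i < m \<and> 0 < s then power_shift (Suc i) (elem_shift (m - i - 1) (G (s - 1))) t else 0))
       = (\<Sum>i\<le>m'. (-1)^i * (if 0 < s then power_shift (Suc i) (elem_shift (m' - i) (G (s - 1))) t else 0))"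
      by (auto simp: Suc Suc_diff_le intro!: sum.cong)
    then show ?thesis using Cons.IH[of m' "G (s - 1)"] by (simp add: Suc)
  qed simp
  ultimately show ?case
    unfolding e Cons.IH[of m "G s", symmetric] by (cases "0 < s") (simp_all add: distrib_right distrib_left)
qed simp

section \<open>Symmetric coefficient functions\<close>

definition symmetric_fun :: "('a list \<Rightarrow> 'b) \<Rightarrow> bool" where
  "symmetric_fun g \<longleftrightarrow> (\<forall>l l'. mset l = mset l' \<longrightarrow> g l = g l')"

lemma symmetric_funD: "symmetric_fun g \<Longrightarrow> mset l = mset l' \<Longrightarrow> g l = g l'"
  unfolding symmetric_fun_def by blast

lemma symmetric_fun_Cons: "symmetric_fun g \<Longrightarrow> symmetric_fun (\<lambda>l. g (s # l))"
  unfolding symmetric_fun_def by (metis mset.simps(2))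

text \<open>Two rearranged lists with different heads \<open>a\<close> and \<open>b\<close> are
  compared with \<open>a # b # t''\<close> and \<open>b # a # t''\<close> over a common tail. This
  leaves the exchange of the first two entries, which is visible after unfolding the recursion
  twice.\<close>

lemma symmetric_elem_shift:
  assumes "symmetric_fun g"
  shows "symmetric_fun (elem_shift k g)"
proof -
  have "elem_shift k g l = elem_shift k g l'" if "mset l = mset l'" "symmetric_fun g" for l l' g k
    using that
  proof (induction l arbitrary: l' g k rule: length_induct)
    case (1 l)
    have tl: "elem_shift k g t = elem_shift k g t'" if "mset t = mset t'" "length t < length l"
      "symmetric_fun g" for t t' g k
      using 1(1) that by blast
    show ?case
    proof (cases l)
      case Nil
      then show ?thesis using 1 by auto
    next
      case (Cons a t)
      then obtain b t' where l': "l' = b # t'" using 1(2) Cons by (cases l') auto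
      show ?thesis
      proof (cases "a = b")
        case True
        then have "mset t = mset t'" using 1(2) by (simp add: Cons l')
        then show ?thesis using True tl[of t t'] symmetric_fun_Cons[OF 1(3)] by (simp add: Cons l')
      next
        case False
        have "add_mset a (mset t) = add_mset b (mset t')" using 1(2) by (simp add: Cons l')
        then obtain M where M: "mset t = add_mset b M" "mset t' = add_mset a M"
          using False by (auto simp: add_eq_conv_ex)
        obtain t'' where t'': "mset t'' = M" using ex_mset by blast
        have len: "length t = length t'"
          using arg_cong[OF 1(2), of size] by (simp add: Cons l')
        have "elem_shift k g (a # t) = elem_shift k g (a # b # t'')"
          using tl[of t "b # t''"] symmetric_fun_Cons[OF 1(3)] M t'' by (simp add: Cons)
        moreover have "elem_shift k g (b # t') = elem_shift k g (b # a # t'')"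
          using tl[of t' "a # t''"] symmetric_fun_Cons[OF 1(3)] M t'' len by (simp add: Cons)
        moreover have "(\<lambda>l. g (x # y # l)) = (\<lambda>l. g (y # x # l))" for x y
          by (rule ext) (rule symmetric_funD[OF 1(3)], simp)
        ultimately show ?thesis by (simp add: Cons l')
      qed
    qed
  qed
  then show ?thesis using assms unfolding symmetric_fun_def[of "elem_shift k g"] by blast
qed

text \<open>If \<open>g\<close> only involves entries at most \<open>n\<close>, the lists in the support of the \<open>k\<close>-th
  elementary shift with exactly \<open>k\<close> entries \<open>Suc n\<close> come from lowering these \<open>k\<close> entries.\<close>

lemma elem_shift_top_aux:
  assumes "\<And>l. \<exists>x\<in>set l. n < x \<Longrightarrow> g l = 0"
  shows "((\<exists>x\<in>set t. Suc n < x) \<or> k < count (mset t) (Suc n) \<longrightarrow> elem_shift k g t = 0) \<and>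
    ((\<forall>x\<in>set t. x \<le> Suc n) \<and> count (mset t) (Suc n) = k \<longrightarrow>
      elem_shift k g t = g (map (\<lambda>x. if x = Suc n then n else x) t))"
  using assms
proof (induction t arbitrary: g k)
  case (Cons s t)
  define G where "G u = (\<lambda>l. g (u # l))" for u
  have e: "elem_shift k g (s # t) = elem_shift k (G s) t +
      (if 0 < k \<and> 0 < s then elem_shift (k - 1) (G (s - 1)) t else 0)"
    by (simp add: G_def)
  have G: "\<exists>x\<in>set l. n < x \<Longrightarrow> G u l = 0" for u l
    by (auto simp: G_def intro!: Cons.prems)
  have Z: "G u = (\<lambda>l. 0)" if "n < u" for u
    using that by (auto simp: G_def intro!: Cons.prems ext)
  have IH1: "elem_shift j (G u) t = 0" if "(\<exists>x\<in>set t. Suc n < x) \<or> j < count (mset t) (Suc n)" for j u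
    using Cons.IH[of "G u" j] that G by blast
  have IH3: "elem_shift j (G u) t = g (u # map (\<lambda>x. if x = Suc n then n else x) t)"
    if "\<forall>x\<in>set t. x \<le> Suc n" "count (mset t) (Suc n) = j" for j u
    using Cons.IH[of "G u" j] that G unfolding G_def by blast
  have 1: "elem_shift k g (s # t) = 0"
    if "(\<exists>x\<in>set (s # t). Suc n < x) \<or> k < count (mset (s # t)) (Suc n)"
  proof (cases "Suc n < s")
    case True
    then show ?thesis unfolding e by (simp add: Z elem_shift_zero)
  next
    case False
    show ?thesis
    proof (cases "Suc n = s")
      case True
      then show ?thesis using that unfolding e by (auto simp: Z elem_shift_zero intro!: IH1)
    next
      case neq: False
      have "(\<exists>x\<in>set t. Suc n < x) \<or> k < count (mset t) (Suc n)"
        "(\<exists>x\<in>set t. Suc n < x) \<or> k - 1 < count (mset t) (Suc n)"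
        using that False neq by auto
      from IH1[OF this(1)] IH1[OF this(2)] show ?thesis unfolding e by simp
    qed
  qed
  have 2: "elem_shift k g (s # t) = g (map (\<lambda>x. if x = Suc n then n else x) (s # t))"
    if "\<forall>x\<in>set (s # t). x \<le> Suc n" "count (mset (s # t)) (Suc n) = k"
  proof (cases "Suc n = s")
    case True
    then show ?thesis unfolding e using that IH3[of "k - 1" "s - 1"]
      by (auto simp: Z elem_shift_zero)
  next
    case False
    then show ?thesis unfolding e using that IH3[of k s] IH1[of "k - 1" "s - 1"]
      by auto
  qed
  from 1 2 show ?case by blast
qed auto

lemma elem_shift_top:
  assumes "\<forall>l. (\<exists>x\<in>set l. n < x) \<longrightarrow> g l = 0"
  shows "\<exists>x\<in>set t. Suc n < x \<Longrightarrow> elem_shift k g t = 0"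
    and "k < count (mset t) (Suc n) \<Longrightarrow> elem_shift k g t = 0"
    and "\<forall>x\<in>set t. x \<le> Suc n \<Longrightarrow> count (mset t) (Suc n) = k \<Longrightarrow>
      elem_shift k g t = g (map (\<lambda>x. if x = Suc n then n else x) t)"
  using elem_shift_top_aux[of n g t k] assms by blast+

text \<open>The exponent lists of the monomials of degree \<open>d\<close> in \<open>N\<close>
  variables; zero entries are allowed.\<close>

definition compositions :: "nat \<Rightarrow> nat \<Rightarrow> nat list set" where
  "compositions N d = {l. length l = N \<and> sum_list l = d}"

lemma finite_compositions: "finite (compositions N d)"
proof (rule finite_subset)
  show "compositions N d \<subseteq> {l. set l \<subseteq> {..d} \<and> length l = N}"
    by (auto simp: compositions_def member_le_sum_list)
  show "finite {l. set l \<subseteq> {..d} \<and> length l = N}" by (rule finite_lists_length_eq) simp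
qed

locale complex_space = vector_space scale
  for scale :: "complex \<Rightarrow> 'v::ab_group_add \<Rightarrow> 'v" (infixr "*s" 75)
begin

section \<open>Symmetric polynomials modulo complete symmetric polynomials of high degree\<close>

context
  fixes Psi :: "nat list \<Rightarrow> 'v" and G :: "'v set" and N N' m :: nat
  assumes sG: "subspace G" and N: "N = Suc N'"
    and symP: "symmetric_fun Psi"
    and D: "\<And>g a. a \<ge> 1 \<Longrightarrow> (\<And>d. (\<Sum>l\<in>compositions N d. g l *s Psi l) \<in> G) \<Longrightarrow>
      (\<And>d. (\<Sum>l\<in>compositions N d. power_shift a g l *s Psi l) \<in> G)"
    and X: "\<And>a. m < a + N \<Longrightarrow> (\<Sum>l\<in>compositions N a. Psi l) \<in> G"
begin

text \<open>The polynomials whose pairing with \<open>Psi\<close> lies in \<open>G\<close> in every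
  degree. By \<open>D\<close> they are closed under multiplication by power sums, and by
  \<open>X\<close> they include the complete symmetric polynomial of degree \<open>a\<close>
  whenever \<open>m < a + N\<close>.\<close>

private definition "II g \<longleftrightarrow> (\<forall>d. (\<Sum>l\<in>compositions N d. g l *s Psi l) \<in> G)" for g

private lemma II_zero: "II (\<lambda>l. 0)"
  by (simp add: II_def subspace_0[OF sG])

private lemma II_add: "II g \<Longrightarrow> II h \<Longrightarrow> II (\<lambda>l. g l + h l)"
  by (simp add: II_def scale_left_distrib sum.distrib subspace_add[OF sG])

private lemma II_scale: "II g \<Longrightarrow> II (\<lambda>l. c * g l)"
  by (simp add: II_def subspace_scale[OF sG] scale_sum_right[symmetric] flip: scale_scale)

private lemma II_sum: "finite A \<Longrightarrow> (\<And>i. i \<in> A \<Longrightarrow> II (g i)) \<Longrightarrow> II (\<lambda>l. \<Sum>i\<in>A. g i l)"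
proof (induction A rule: finite_induct)
  case (insert x F)
  then show ?case using II_add[of "g x" "\<lambda>l. \<Sum>i\<in>F. g i l"] by simp
qed (simp add: II_zero)

text \<open>Newton's identity expresses elementary symmetric polynomials through power sums. The
  division by k is where characteristic zero enters.\<close>

private lemma II_elem: "II g \<Longrightarrow> II (elem_shift k g)"
proof (induction k rule: less_induct)
  case (less k)
  show ?case
  proof (cases k)
    case 0
    then have "elem_shift k g = g" by (auto simp: elem_shift_0)
    then show ?thesis using less.prems by simp
  next
    case (Suc k')
    have e: "elem_shift k g = (\<lambda>l. inverse (of_nat k) *
       (\<Sum>i\<le>k'. (-1)^i * power_shift (Suc i) (elem_shift (k' - i) g) l))"
      unfolding Suc newton_shift[symmetric] by (auto simp del: of_nat_Suc)
    have "II (power_shift (Suc i) (elem_shift (k' - i) g))" if "i \<le> k'" for i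
      using less.IH[of "k' - i"] less.prems D[of "Suc i" "elem_shift (k' - i) g"] that Suc
      unfolding II_def by auto
    then show ?thesis unfolding e by (intro II_scale II_sum) auto
  qed
qed

text \<open>\<open>gs n\<close> plays the role of the divided difference of \<open>x\<^sub>1^(n + N - 1) * q(x\<^sub>2, \<dots>, x\<^sub>N)\<close>:
  for \<open>d \<ge> b\<close>, where \<open>b\<close> bounds the degree of \<open>q\<close> in each variable, its coefficient at
  \<open>x\<^sub>1^d\<close> is the product of \<open>q\<close> with a complete symmetric polynomial of degree \<open>n - d\<close>.\<close>

private definition "Fam b q \<longleftrightarrow> (\<exists>gs qs. (\<forall>n. m < n + N \<longrightarrow> II (gs n)) \<and> (\<forall>n. symmetric_fun (gs n)) \<and>
    (\<forall>t. length t = N' \<longrightarrow> qs 0 t = q t) \<and>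
    (\<forall>n d t. m < n + N \<longrightarrow> b \<le> d \<longrightarrow> length t = N' \<longrightarrow>
       gs n (d # t) = (if d \<le> n then qs (n - d) t else 0)))" for b :: nat and q :: "nat list \<Rightarrow> complex"

text \<open>For q = 1 the divided difference is the complete symmetric polynomial h_n, whose
  coefficient at x_1^d is h_(n-d) in the remaining variables.\<close>

private lemma Fam_base: "Fam 0 (\<lambda>t. if sum_list t = 0 then 1 else 0)"
proof -
  have "(\<Sum>l\<in>compositions N d. (if sum_list l = n then 1 else 0) *s Psi l) \<in> G"
    if "m < n + N" for n d
  proof -
    have "(\<Sum>l\<in>compositions N d. (if sum_list l = n then 1 else 0) *s Psi l)
      = (\<Sum>l\<in>compositions N d. if d = n then Psi l else 0)"
      by (intro sum.cong) (auto simp: compositions_def)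
    also have "\<dots> \<in> G" using X[OF that] subspace_0[OF sG] by (cases "d = n") auto
    finally show ?thesis .
  qed
  then have "II (\<lambda>l. if sum_list l = n then 1 else 0)" if "m < n + N" for n
    using that by (simp add: II_def)
  then show ?thesis unfolding Fam_def
    by (intro exI[of _ "\<lambda>n l. if sum_list l = n then 1 else 0"] conjI)
      (auto simp: symmetric_fun_def simp flip: sum_mset_sum_list)
qed

private lemma Fam_mono: "Fam b q \<Longrightarrow> b \<le> b' \<Longrightarrow> Fam b' q"
  unfolding Fam_def by (elim exE, rule_tac x=gs in exI, rule_tac x=qs in exI) auto

private lemma Fam_cong: "Fam b q \<Longrightarrow> (\<And>t. length t = N' \<Longrightarrow> q t = q' t) \<Longrightarrow> Fam b q'"
  unfolding Fam_def by simp

private lemma Fam_lin: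
  assumes "Fam b q" "Fam b q'"
  shows "Fam b (\<lambda>t. q t + c * q' t)"
proof -
  obtain gs qs where 1: "\<And>n. m < n + N \<Longrightarrow> II (gs n)" "\<And>n. symmetric_fun (gs n)"
    "\<And>t. length t = N' \<Longrightarrow> qs 0 t = q t"
    "\<And>n d t. m < n + N \<Longrightarrow> b \<le> d \<Longrightarrow> length t = N' \<Longrightarrow>
       gs n (d # t) = (if d \<le> n then qs (n - d) t else 0)"
    using assms(1) unfolding Fam_def by blast
  obtain gs' qs' where 2: "\<And>n. m < n + N \<Longrightarrow> II (gs' n)" "\<And>n. symmetric_fun (gs' n)"
    "\<And>t. length t = N' \<Longrightarrow> qs' 0 t = q' t"
    "\<And>n d t. m < n + N \<Longrightarrow> b \<le> d \<Longrightarrow> length t = N' \<Longrightarrow>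
       gs' n (d # t) = (if d \<le> n then qs' (n - d) t else 0)"
    using assms(2) unfolding Fam_def by blast
  have "symmetric_fun (\<lambda>l. gs n l + c * gs' n l)" for n
    using 1(2)[of n] 2(2)[of n] unfolding symmetric_fun_def by metis
  then show ?thesis unfolding Fam_def
    by (intro exI[of _ "\<lambda>n l. gs n l + c * gs' n l"] exI[of _ "\<lambda>n l. qs n l + c * qs' n l"] conjI)
      (auto simp: 1 2 intro!: II_add II_scale)
qed

text \<open>Divided differences are linear over the symmetric polynomials in all variables, and
  e_k(x_2, ..., x_N) is the alternating sum of the products x_1^j e_(k-j)(x_1, ..., x_N). The factor
  x_1^j only shifts \<open>n\<close> to \<open>n + j\<close>, hence the formula for
  \<open>gs'\<close>. The bound increases by one because the coefficient of \<open>gs'\<close> at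
  \<open>d\<close> also involves those of \<open>gs\<close> at \<open>d - 1\<close>.\<close>

private lemma Fam_elem:
  assumes "Fam b q"
  shows "Fam (Suc b) (elem_shift k q)"
proof -
  obtain gs qs where 1: "\<And>n. m < n + N \<Longrightarrow> II (gs n)" "\<And>n. symmetric_fun (gs n)"
    "\<And>t. length t = N' \<Longrightarrow> qs 0 t = q t"
    "\<And>n d t. m < n + N \<Longrightarrow> b \<le> d \<Longrightarrow> length t = N' \<Longrightarrow>
       gs n (d # t) = (if d \<le> n then qs (n - d) t else 0)"
    using assms unfolding Fam_def by blast
  define gs' where "gs' n = (\<lambda>l. \<Sum>j\<le>k. (-1)^j * elem_shift (k - j) (gs (n + j)) l)" for n
  have "II (gs' n)" if "m < n + N" for n
    unfolding gs'_def using that by (intro II_sum II_scale II_elem 1(1)) auto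
  moreover have "symmetric_fun (gs' n)" for n
    unfolding gs'_def symmetric_fun_def
  proof (intro allI impI sum.cong refl)
    fix l l' :: "nat list" and j assume "mset l = mset l'"
    from symmetric_funD[OF symmetric_elem_shift[OF 1(2)] this]
    show "(-1)^j * elem_shift (k - j) (gs (n + j)) l = (-1)^j * elem_shift (k - j) (gs (n + j)) l'"
      by simp
  qed
  moreover have "elem_shift k (qs 0) t = elem_shift k q t" if "length t = N'" for t
    by (rule elem_shift_cong) (simp add: 1(3) that)
  moreover have "gs' n (d # t) = (if d \<le> n then elem_shift k (qs (n - d)) t else 0)"
    if n: "m < n + N" and d: "Suc b \<le> d" and t: "length t = N'" for n d t
  proof -
    define T where "T j = (if j \<le> k \<and> d \<le> n + j then elem_shift (k - j) (qs (n + j - d)) t else 0)" for j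
    have g: "elem_shift i (\<lambda>l. gs (n + j) (u # l)) t =
      (if u \<le> n + j then elem_shift i (qs (n + j - u)) t else 0)" if "b \<le> u" for i j u
    proof -
      have "elem_shift i (\<lambda>l. gs (n + j) (u # l)) t =
        elem_shift i (\<lambda>l. if u \<le> n + j then qs (n + j - u) l else 0) t"
        by (rule elem_shift_cong) (use n that t in \<open>simp add: 1(4)\<close>)
      then show ?thesis by (auto simp: elem_shift_zero)
    qed
    have "elem_shift (k - j) (gs (n + j)) (d # t) = T j + T (Suc j)" if "j \<le> k" for j
      unfolding elem_shift.simps using that d by (auto simp: g T_def Suc_diff_le le_Suc_eq)
    then have "gs' n (d # t) = (\<Sum>j\<le>k. (-1)^j * (T j + T (Suc j)))"
      unfolding gs'_def by (intro sum.cong) auto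
    also have "\<dots> = T 0" unfolding sum_alternating_telescope by (simp add: T_def)
    finally show ?thesis by (simp add: T_def)
  qed
  ultimately show ?thesis unfolding Fam_def
    by (intro exI[of _ gs'] exI[of _ "\<lambda>j. elem_shift k (qs j)"] conjI allI impI)
qed

text \<open>Symmetric polynomials with exponents at most \<open>b\<close> arise from constants by
  \<open>b\<close> rounds of multiplication by elementary symmetric polynomials and linear
  combination. Within a round, \<open>c\<close> bounds the number of exponents equal to
  \<open>Suc b\<close>: the terms with exactly \<open>Suc c\<close> of them are the top part of
  e_(c+1) times \<open>q'\<close>, where \<open>q'\<close> is obtained by lowering these exponents
  to \<open>b\<close>.\<close>

private lemma Fam_all:
  assumes "symmetric_fun q" "\<And>t. length t = N' \<Longrightarrow> \<exists>x\<in>set t. b < x \<Longrightarrow> q t = 0"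
  shows "Fam b q"
  using assms
proof (induction b arbitrary: q)
  case 0
  have "q t = 0 + q (replicate N' 0) * (if sum_list t = 0 then 1 else 0)" if t: "length t = N'" for t
  proof (cases "sum_list t = 0")
    case True
    then have "t = replicate N' 0" using t by (intro replicate_eqI) auto
    then show ?thesis using True by simp
  next
    case False
    then obtain x where "x \<in> set t" "x \<noteq> 0" by auto
    then show ?thesis using 0(2)[OF t] False by auto
  qed
  moreover have "Fam 0 (\<lambda>t. 0)"
    using Fam_lin[OF Fam_base Fam_base, of "-1"] by simp
  ultimately show ?case
    by (rule_tac Fam_cong[OF Fam_lin[OF _ Fam_base, of "\<lambda>t. 0" "q (replicate N' 0)"]]) (assumption, metis)
next
  case (Suc b)
  note IHb = Suc.IH and premsb = Suc.prems
  have "Fam (Suc b) q" if "symmetric_fun q" "\<And>t. length t = N' \<Longrightarrow> \<exists>x\<in>set t. Suc b < x \<Longrightarrow> q t = 0"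
    "\<And>t. length t = N' \<Longrightarrow> c < count (mset t) (Suc b) \<Longrightarrow> q t = 0" for q c
    using that
  proof (induction c arbitrary: q)
    case 0
    have "Fam b q"
    proof (rule IHb[OF 0(1)])
      fix t assume t: "length t = N'" "\<exists>x\<in>set t. b < x"
      then obtain x where "x \<in> set t" "b < x" by auto
      then show "q t = 0" using 0(2)[OF t(1)] 0(3)[OF t(1)]
        by (metis Suc_lessI count_greater_zero_iff set_mset_mset)
    qed
    then show ?case by (rule Fam_mono) simp
  next
    case (Suc c)
    \<comment> \<open>\<open>R\<close> undoes the lowering: it turns \<open>Suc c\<close> of the
      exponents \<open>b\<close> back into \<open>Suc b\<close>.\<close>
    define R where "R M = M - replicate_mset (Suc c) b + replicate_mset (Suc c) (Suc b)" for M
    define q' where "q' t = (if (\<forall>x\<in>set t. x \<le> b) \<and> Suc c \<le> count (mset t) b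
      then q (sorted_list_of_multiset (R (mset t))) else 0)" for t
    define r where "r t = q t + (-1) * elem_shift (Suc c) q' t" for t
    have sym': "symmetric_fun q'"
      unfolding symmetric_fun_def q'_def by (metis set_mset_mset)
    have F': "Fam (Suc b) (elem_shift (Suc c) q')"
      by (rule Fam_elem, rule IHb[OF sym']) (auto simp: q'_def)
    have "\<forall>l. (\<exists>x\<in>set l. b < x) \<longrightarrow> q' l = 0" by (auto simp: q'_def)
    note top = elem_shift_top[OF this]
    have "Fam (Suc b) r"
    proof (rule Suc.IH)
      show "symmetric_fun r"
        using symmetric_elem_shift[OF sym', of "Suc c"] Suc.prems(1) unfolding r_def symmetric_fun_def by metis
      fix t :: "nat list" assume t: "length t = N'"
      show e: "r t = 0" if "\<exists>x\<in>set t. Suc b < x"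
        using Suc.prems(2)[OF t that] top(1)[OF that] by (simp add: r_def)
      assume c: "c < count (mset t) (Suc b)"
      show "r t = 0"
      proof (cases "\<exists>x\<in>set t. Suc b < x")
        case True
        then show ?thesis by (rule e)
      next
        case False
        then have le: "\<forall>x\<in>set t. x \<le> Suc b" by (auto simp: not_less)
        show ?thesis
        proof (cases "count (mset t) (Suc b) = Suc c")
          case True
          let ?t = "map (\<lambda>x. if x = Suc b then b else x) t"
          have "mset (map (\<lambda>x. if x = Suc b then b else x) u) + replicate_mset (count (mset u) (Suc b)) (Suc b)
              = mset u + replicate_mset (count (mset u) (Suc b)) b" for u
            by (induction u) auto
          from arg_cong[OF this[of t], of count]
          have ct: "count (mset ?t) x + count (replicate_mset (Suc c) (Suc b)) x =
              count (mset t) x + count (replicate_mset (Suc c) b) x" for x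
            unfolding True by (metis count_union)
          have "R (mset ?t) = mset t"
          proof (rule multiset_eqI)
            fix x
            show "count (R (mset ?t)) x = count (mset t) x"
              using ct[of x] True unfolding R_def by (cases "x = b"; cases "x = Suc b") auto
          qed
          moreover have "Suc c \<le> count (mset ?t) b" using ct[of b] by simp
          moreover have "\<forall>x\<in>set ?t. x \<le> b" using le by (auto simp: le_Suc_eq)
          ultimately have "q' ?t = q (sorted_list_of_multiset (mset t))"
            by (simp add: q'_def)
          also have "\<dots> = q t" by (rule symmetric_funD[OF Suc.prems(1)]) simp
          finally show ?thesis using top(3)[OF le True] by (simp add: r_def)
        next
          case False
          then have "Suc c < count (mset t) (Suc b)" using c by simp
          then show ?thesis using Suc.prems(3)[OF t] top(2)[of "Suc c" t] by (simp add: r_def)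
        qed
      qed
    qed
    from Fam_lin[OF this F', of 1] show ?case by (rule Fam_cong) (simp add: r_def)
  qed
  note * = this
  have "q t = 0" if "length t = N'" "N' < count (mset t) (Suc b)" for t
    using that count_le_length[of t "Suc b"] by (simp add: count_mset)
  then show ?case using *[OF premsb, of N'] by blast
qed

text \<open>The largest exponent is pushed down step by step. If it is \<open>b\<close> and lies
  outside the box, some polynomial in the ideal is, among the exponent lists with an entry at least
  \<open>b\<close>, the indicator of the rearrangements of \<open>t\<close>. Pairing it with
  \<open>Psi\<close> expresses \<open>Psi t\<close> through lists with all entries below
  \<open>b\<close>.\<close>

lemma box_reduction:
  assumes "length l = N"
  shows "Psi l \<in> span ({Psi l' | l'. length l' = N \<and> sum_list l' = sum_list l \<and>
    (\<forall>s\<in>set l'. s + N \<le> m)} \<union> G)"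
proof -
  define S where "S = span ({Psi l' | l'. length l' = N \<and> sum_list l' = sum_list l \<and>
    (\<forall>s\<in>set l'. s + N \<le> m)} \<union> G)"
  have sS: "subspace S" by (simp add: S_def)
  have "Psi t \<in> S" if "length t = N" "sum_list t = sum_list l" "\<forall>x\<in>set t. x < b" for t b
    using that
  proof (induction b arbitrary: t)
    case 0
    then show ?case by (cases t) (auto simp: N)
  next
    case (Suc b)
    consider "Suc b + N \<le> Suc m" | "b \<notin> set t" | "m < b + N" "b \<in> set t" by linarith
    then show ?case
    proof cases
      case 1
      then have "\<forall>s\<in>set t. s + N \<le> m" using Suc.prems(3) by auto
      then show ?thesis unfolding S_def using Suc.prems by (intro span_base) auto
    next
      case 2
      then show ?thesis using Suc.prems by (intro Suc.IH) (auto simp: less_Suc_eq)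
    next
      case 3
      then obtain t1 t2 where t12: "t = t1 @ b # t2" by (auto simp: in_set_conv_decomp)
      define t' where "t' = t1 @ t2"
      have mt: "mset t = mset (b # t')" and lt: "length t' = N'"
        using Suc.prems(1) by (auto simp: t12 t'_def N)
      \<comment> \<open>The monomial symmetric polynomial of the exponents that remain after one
        \<open>b\<close> has been split off.\<close>
      define q where "q u = (if mset u = mset t' then 1 else 0 :: complex)" for u
      have "Fam b q"
      proof (rule Fam_all)
        show "symmetric_fun q" by (auto simp: symmetric_fun_def q_def)
        fix u assume "\<exists>x\<in>set u. b < x"
        moreover have "\<forall>x\<in>set t'. x \<le> b"
          using Suc.prems(3) unfolding t12 t'_def less_Suc_eq_le by simp
        ultimately have "set u \<noteq> set t'" by (metis leD)
        then show "q u = 0" unfolding q_def by (metis set_mset_mset)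
      qed
      then obtain gs qs where 1: "II (gs b)" "symmetric_fun (gs b)"
        "\<And>u. length u = N' \<Longrightarrow> qs 0 u = q u"
        "\<And>d u. b \<le> d \<Longrightarrow> length u = N' \<Longrightarrow> gs b (d # u) = (if d \<le> b then qs (b - d) u else 0)"
        unfolding Fam_def using 3(1) by blast
      have g: "gs b u = (if mset u = mset t then 1 else 0)"
        if u: "length u = N" "\<exists>x\<in>set u. b \<le> x" for u
      proof -
        from u(2) obtain x u1 u2 where x: "b \<le> x" "u = u1 @ x # u2" by (auto simp: in_set_conv_decomp)
        have "gs b u = gs b (x # u1 @ u2)" by (rule symmetric_funD[OF 1(2)]) (simp add: x)
        also have "\<dots> = (if x \<le> b then qs (b - x) (u1 @ u2) else 0)"
          using u(1) x N by (intro 1(4)) auto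
        also have "\<dots> = (if x = b \<and> mset (u1 @ u2) = mset t' then 1 else 0)"
          using x(1) u(1) N x by (auto simp: 1(3) q_def)
        also have "\<dots> = (if mset u = mset t then 1 else 0)"
        proof -
          have "x \<le> b" if "mset u = mset t"
          proof -
            have "x \<in> set t" using x(2) arg_cong[OF that, of set_mset] by auto
            with Suc.prems(3) have "x < Suc b" by (rule bspec)
            then show ?thesis by simp
          qed
          then show ?thesis using x(1) mt by (auto simp: x(2))
        qed
        finally show ?thesis .
      qed
      let ?d = "sum_list l"
      have t: "t \<in> compositions N ?d" using Suc.prems by (simp add: compositions_def)
      have "(\<Sum>u\<in>compositions N ?d. gs b u *s Psi u) =
         (\<Sum>u\<in>compositions N ?d. (if mset u = mset t then 1 else 0) *s Psi t)
         + (\<Sum>u\<in>compositions N ?d. if \<exists>x\<in>set u. b \<le> x then 0 else gs b u *s Psi u)"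
        unfolding sum.distrib[symmetric]
      proof (rule sum.cong[OF refl])
        fix u assume u: "u \<in> compositions N ?d"
        show "gs b u *s Psi u = (if mset u = mset t then 1 else 0) *s Psi t +
           (if \<exists>x\<in>set u. b \<le> x then 0 else gs b u *s Psi u)"
        proof (cases "\<exists>x\<in>set u. b \<le> x")
          case True
          then show ?thesis using g[of u] u symmetric_funD[OF symP, of u t] by (auto simp: compositions_def)
        next
          case False
          then have "set u \<noteq> set t" using 3(2) by auto
          then have "mset u \<noteq> mset t" by (metis set_mset_mset)
          then show ?thesis using False by simp
        qed
      qed
      moreover have "(\<Sum>u\<in>compositions N ?d. gs b u *s Psi u) \<in> S"
        using 1(1) unfolding II_def S_def by (meson span_superset subsetD UnI2)
      moreover have "(\<Sum>u\<in>compositions N ?d. if \<exists>x\<in>set u. b \<le> x then 0 else gs b u *s Psi u) \<in> S"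
      proof (rule subspace_sum[OF sS])
        fix u assume "u \<in> compositions N ?d"
        then show "(if \<exists>x\<in>set u. b \<le> x then 0 else gs b u *s Psi u) \<in> S"
          using Suc.IH[of u] subspace_0[OF sS] subspace_scale[OF sS]
          by (auto simp: compositions_def not_le)
      qed
      ultimately have *: "(\<Sum>u\<in>compositions N ?d. (if mset u = mset t then 1 else 0) *s Psi t) \<in> S"
        using subspace_diff[OF sS] by (metis (no_types, lifting) add_diff_cancel_right')
      \<comment> \<open>The rearrangements of \<open>t\<close> all have the same value under
        \<open>Psi\<close>, so their number appears as a factor and has to be inverted.\<close>
      define c where "c = card {u \<in> compositions N ?d. mset u = mset t}"
      have "(\<Sum>u\<in>compositions N ?d. (if mset u = mset t then 1 else 0) *s Psi t) = of_nat c *s Psi t"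
        unfolding scale_sum_left[symmetric] c_def
        by (simp add: finite_compositions sum.If_cases Int_def)
      moreover have "c \<noteq> 0" unfolding c_def using t finite_compositions[of N ?d] by auto
      ultimately have "Psi t = inverse (of_nat c) *s (\<Sum>u\<in>compositions N ?d. (if mset u = mset t then 1 else 0) *s Psi t)"
        by simp
      also have "\<dots> \<in> S" using * by (rule subspace_scale[OF sS])
      finally show ?thesis .
    qed
  qed
  from this[OF assms refl, of "Suc (sum_list l)"] member_le_sum_list[of _ l]
  show ?thesis unfolding S_def by (auto simp: le_imp_less_Suc)
qed

end

end

section \<open>Representations of the current algebra of the general linear algebra\<close>

lemma sum_triangle_swap:
  fixes F :: "nat \<Rightarrow> nat \<Rightarrow> 'a::comm_monoid_add"
  shows "(\<Sum>s\<le>b. \<Sum>u\<le>b - s. F s u) = (\<Sum>u\<le>b. \<Sum>s\<le>b - u. F s u)"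
proof -
  have "(\<Sum>s\<le>b. \<Sum>u\<le>b - s. F s u) = (\<Sum>s\<in>{..b}. \<Sum>u\<in>{u \<in> {..b}. s + u \<le> b}. F s u)"
    by (intro sum.cong refl) auto
  also have "\<dots> = (\<Sum>u\<in>{..b}. \<Sum>s\<in>{s \<in> {..b}. s + u \<le> b}. F s u)"
    by (rule sum.swap_restrict) auto
  also have "\<dots> = (\<Sum>u\<le>b. \<Sum>s\<le>b - u. F s u)"
    by (intro sum.cong refl) auto
  finally show ?thesis .
qed

lemma sum_compositions_Suc:
  fixes F :: "nat list \<Rightarrow> 'a::comm_monoid_add"
  shows "sum F (compositions (Suc N) d) = (\<Sum>s\<le>d. \<Sum>t\<in>compositions N (d - s). F (s # t))"
proof -
  have "compositions (Suc N) d = (\<Union>s\<in>{..d}. (#) s ` compositions N (d - s))"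
  proof (rule subset_antisym; rule subsetI)
    fix l assume "l \<in> compositions (Suc N) d"
    then obtain s t where "l = s # t" "length t = N" "s + sum_list t = d"
      by (auto simp: compositions_def length_Suc_conv)
    then have "s \<in> {..d}" "l \<in> (#) s ` compositions N (d - s)" by (auto simp: compositions_def)
    then show "l \<in> (\<Union>s\<in>{..d}. (#) s ` compositions N (d - s))" by blast
  qed (auto simp: compositions_def)
  then have "sum F (compositions (Suc N) d) = sum F (\<Union>s\<in>{..d}. (#) s ` compositions N (d - s))"
    by (rule arg_cong)
  also have "\<dots> = (\<Sum>s\<in>{..d}. sum F ((#) s ` compositions N (d - s)))"
  proof (rule sum.UNION_disjoint)
    show "\<forall>s\<in>{..d}. finite ((#) s ` compositions N (d - s))" by (simp add: finite_compositions)
  qed auto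
  finally show ?thesis by (simp add: sum.reindex)
qed

lemma compositions_0: "compositions 0 d = (if d = 0 then {[]} else {})"
  by (auto simp: compositions_def)

section \<open>Powers of a generating series of operators\<close>

context complex_space
begin

definition lin :: "('v \<Rightarrow> 'v) \<Rightarrow> bool" where
  "lin f \<longleftrightarrow> (\<forall>x y. f (x + y) = f x + f y) \<and> (\<forall>c x. f (c *s x) = c *s f x)"

lemma linD: assumes "lin f"
  shows lin_add: "f (x + y) = f x + f y" and lin_scale: "f (c *s x) = c *s f x"
    and lin_0: "f 0 = 0" and lin_neg: "f (- x) = - f x" and lin_diff: "f (x - y) = f x - f y"
    and lin_sum: "f (sum g A) = (\<Sum>i\<in>A. f (g i))"
proof -
  show *: "f (x + y) = f x + f y" "f (c *s x) = c *s f x" for x y c using assms by (auto simp: lin_def)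
  show z: "f 0 = 0" using *(2)[of 0 0] by simp
  show n: "f (- x) = - f x" for x using *(2)[of "-1" x] by simp
  show "f (x - y) = f x - f y" using *(1)[of x "- y"] n by simp
  show "f (sum g A) = (\<Sum>i\<in>A. f (g i))"
    by (induction A rule: infinite_finite_induct) (auto simp: z *)
qed

lemma lin_foldr: "(\<And>x. lin (F x)) \<Longrightarrow> lin (foldr F xs)"
  by (induction xs) (auto simp: lin_def)

lemma lin_funpow: "lin f \<Longrightarrow> lin (f ^^ k)"
  by (induction k) (auto simp: lin_def)

lemma subspace_scale_cancel:
  assumes "subspace S" "c *s x \<in> S" "c \<noteq> 0"
  shows "x \<in> S"
  using subspace_scale[OF assms(1,2), of "inverse c"] assms(3) by simp

text \<open>The coefficient at u^a in the N-th power of the operator series with coefficients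
  \<open>f s\<close>. On a product of pairwise commuting operators this is the complete symmetric
  polynomial of degree \<open>a\<close>.\<close>

fun complete_op :: "(nat \<Rightarrow> 'v \<Rightarrow> 'v) \<Rightarrow> nat \<Rightarrow> nat \<Rightarrow> 'v \<Rightarrow> 'v" where
  "complete_op f 0 a v = (if a = 0 then v else 0)"
| "complete_op f (Suc N) a v = (\<Sum>s\<le>a. f s (complete_op f N (a - s) v))"

lemma complete_op_compositions:
  assumes "\<And>s. lin (f s)"
  shows "complete_op f N a v = (\<Sum>l\<in>compositions N a. foldr f l v)"
  by (induction N arbitrary: a) (auto simp: compositions_0 sum_compositions_Suc lin_sum[OF assms])

lemma lin_complete_op:
  assumes "\<And>s. lin (f s)"
  shows "lin (complete_op f N a)"
  unfolding lin_def
  by (auto simp: complete_op_compositions[OF assms] linD[OF lin_foldr[OF assms]] sum.distrib scale_sum_right)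

lemma complete_op_commute:
  assumes "lin g" "\<And>s v. g (f s v) = f s (g v)"
  shows "g (complete_op f N a v) = complete_op f N a (g v)"
  by (induction N arbitrary: a) (auto simp: linD[OF assms(1)] assms(2))

lemma complete_op_0: "lin (f 0) \<Longrightarrow> complete_op f N 0 v = (f 0 ^^ N) v"
  by (induction N) auto

lemma complete_op_mem:
  assumes "subspace K" "\<And>s v. v \<in> K \<Longrightarrow> f s v \<in> K" "v \<in> K"
  shows "complete_op f N a v \<in> K"
  by (induction N arbitrary: a) (auto intro!: subspace_sum[OF assms(1)] assms simp: subspace_0[OF assms(1)])

text \<open>Euler's identity for complete symmetric polynomials.\<close>

lemma complete_op_euler:
  assumes lin: "\<And>s. lin (f s)" and comm: "\<And>s u v. f s (f u v) = f u (f s v)"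
  shows "of_nat (Suc N) *s (\<Sum>s\<le>a. of_nat s *s f s (complete_op f N (a - s) v))
    = of_nat a *s complete_op f (Suc N) a v"
proof (induction N arbitrary: a)
  case 0
  have "(\<Sum>s\<le>a. of_nat s *s f s (complete_op f 0 (a - s) v)) = (\<Sum>s\<le>a. if s = a then of_nat a *s f a v else 0)"
    by (intro sum.cong) (auto simp: linD[OF lin])
  moreover have "complete_op f (Suc 0) a v = (\<Sum>s\<le>a. if s = a then f a v else 0)"
    unfolding complete_op.simps by (intro sum.cong) (auto simp: linD[OF lin])
  ultimately show ?case by (simp del: complete_op.simps)
next
  case (Suc N)
  define E where "E = (\<Sum>s\<le>a. of_nat s *s f s (complete_op f (Suc N) (a - s) v))"
  have "E = (\<Sum>s\<le>a. \<Sum>u\<le>a - s. of_nat s *s f s (f u (complete_op f N (a - s - u) v)))"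
    unfolding E_def complete_op.simps by (simp add: linD[OF lin] scale_sum_right)
  also have "\<dots> = (\<Sum>u\<le>a. \<Sum>s\<le>a - u. of_nat s *s f s (f u (complete_op f N (a - s - u) v)))"
    by (rule sum_triangle_swap)
  also have "\<dots> = (\<Sum>u\<le>a. f u (\<Sum>s\<le>a - u. of_nat s *s f s (complete_op f N (a - u - s) v)))"
    by (simp add: linD[OF lin] comm[of _ u for u] add.commute)
  finally have "E = (\<Sum>u\<le>a. f u (\<Sum>s\<le>a - u. of_nat s *s f s (complete_op f N (a - u - s) v)))" .
  then have "of_nat (Suc N) *s E = (\<Sum>u\<le>a. f u (of_nat (Suc N) *s (\<Sum>s\<le>a - u. of_nat s *s f s (complete_op f N (a - u - s) v))))"
    by (simp only: linD(2)[OF lin] scale_sum_right[of _ _ "{..a}"])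
  also have "\<dots> = (\<Sum>u\<le>a. of_nat (a - u) *s f u (complete_op f (Suc N) (a - u) v))"
    unfolding Suc by (simp only: linD(2)[OF lin])
  also have "\<dots> = (\<Sum>u\<le>a. of_nat a *s f u (complete_op f (Suc N) (a - u) v) - of_nat u *s f u (complete_op f (Suc N) (a - u) v))"
    by (intro sum.cong refl) (simp add: of_nat_diff scale_left_diff_distrib del: complete_op.simps)
  also have "\<dots> = of_nat a *s complete_op f (Suc (Suc N)) a v - E"
    unfolding complete_op.simps(2)[of f "Suc N"] E_def scale_sum_right by (rule sum_subtractf)
  finally have "of_nat (Suc N) *s E + E = of_nat a *s complete_op f (Suc (Suc N)) a v" by simp
  moreover have "of_nat (Suc (Suc N)) *s E = of_nat (Suc N) *s E + E"
    by (simp only: of_nat_Suc[of "Suc N"] scale_left_distrib scale_one add.commute)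
  ultimately show ?case unfolding E_def by simp
qed

end

text \<open>\<open>e a b s\<close> stands for the matrix unit E_ab times t^s. With gl in place of sl
  the diagonal entries have separate weights and the passage to smaller rank is a restriction of
  indices; the price is the scalar \<open>c\<close> in \<open>highest\<close>.\<close>

locale gl_current_rep = complex_space scale
  for scale :: "complex \<Rightarrow> 'v::ab_group_add \<Rightarrow> 'v" (infixr "*s" 75) +
  fixes n0 :: nat and e :: "nat \<Rightarrow> nat \<Rightarrow> nat \<Rightarrow> 'v \<Rightarrow> 'v"
  assumes lin_e: "lin (e a b s)"
    and e_bracket: "\<lbrakk>a \<in> {1..n0}; b \<in> {1..n0}; c \<in> {1..n0}; d \<in> {1..n0}\<rbrakk> \<Longrightarrow>
      e a b s (e c d u x) = e c d u (e a b s x) + (if b = c then e a d (s + u) x else 0)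
        - (if a = d then e c b (s + u) x else 0)"
begin

lemmas e_lin = linD[OF lin_e]

definition stable :: "nat \<Rightarrow> 'v set \<Rightarrow> bool" where
  "stable n S \<longleftrightarrow> subspace S \<and> (\<forall>a\<in>{1..n}. \<forall>b\<in>{1..n}. \<forall>s. \<forall>v\<in>S. e a b s v \<in> S)"

definition gen :: "nat \<Rightarrow> 'v set \<Rightarrow> 'v set" where
  "gen n A = stable n hull A"

lemma stable_gen: "stable n (gen n A)"
  unfolding gen_def by (rule hull_in) (auto simp: stable_def intro: subspace_Inter)

lemma gen_superset: "A \<subseteq> gen n A"
  unfolding gen_def by (rule hull_subset)

lemma gen_minimal: "A \<subseteq> T \<Longrightarrow> stable n T \<Longrightarrow> gen n A \<subseteq> T"
  unfolding gen_def by (rule hull_minimal)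

lemma stable_subspace: "stable n S \<Longrightarrow> subspace S"
  by (simp add: stable_def)

lemma stable_e: "stable n S \<Longrightarrow> a \<in> {1..n} \<Longrightarrow> b \<in> {1..n} \<Longrightarrow> v \<in> S \<Longrightarrow> e a b s v \<in> S"
  by (simp add: stable_def)

lemma stable_mono: "stable n S \<Longrightarrow> m \<le> n \<Longrightarrow> stable m S"
  by (auto simp: stable_def)

lemma stable_span:
  assumes "\<And>v a b s. v \<in> A \<Longrightarrow> a \<in> {1..n} \<Longrightarrow> b \<in> {1..n} \<Longrightarrow> e a b s v \<in> span A"
  shows "stable n (span A)"
proof -
  have "e a b s v \<in> span A" if v: "v \<in> span A" and ab: "a \<in> {1..n}" "b \<in> {1..n}" for a b s v
    using v
  proof (induction rule: span_induct_alt)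
    case base
    then show ?case by (simp add: e_lin span_zero)
  next
    case (step c x y)
    then show ?case using assms ab by (simp add: e_lin span_add span_scale)
  qed
  then show ?thesis by (simp add: stable_def)
qed

lemma stable_span_Union:
  assumes "\<And>A. A \<in> F \<Longrightarrow> stable n A"
  shows "stable n (span (\<Union>F))"
proof (rule stable_span)
  fix v a b s assume "v \<in> \<Union>F" "a \<in> {1..n}" "b \<in> {1..n}"
  then show "e a b s v \<in> span (\<Union>F)"
    using assms stable_e by (blast intro: span_base)
qed

text \<open>The relations of a local Weyl module, modulo a submodule \<open>K\<close>. The common
  shift \<open>c\<close> cancels in the differences of weights; it is there because gl will act
  through its quotient by scalar matrices. Only some vanishing power of each simple lowering
  operator is asked for, which is easy to pass on to other vectors; the exact exponent is recovered
  from sl_2 theory.\<close>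

definition highest :: "nat \<Rightarrow> (nat \<Rightarrow> int) \<Rightarrow> complex \<Rightarrow> 'v set \<Rightarrow> 'v \<Rightarrow> bool" where
  "highest n lam c K z \<longleftrightarrow>
     (\<forall>a b s. 1 \<le> a \<longrightarrow> a < b \<longrightarrow> b \<le> n \<longrightarrow> e a b s z \<in> K) \<and>
     (\<forall>a s. 1 \<le> a \<longrightarrow> a \<le> n \<longrightarrow> 0 < s \<longrightarrow> e a a s z \<in> K) \<and>
     (\<forall>a. 1 \<le> a \<longrightarrow> a \<le> n \<longrightarrow> e a a 0 z - (of_int (lam a) + c) *s z \<in> K) \<and>
     (\<forall>i. 1 \<le> i \<longrightarrow> i < n \<longrightarrow> (\<exists>N. (e (Suc i) i 0 ^^ N) z \<in> K))"

section \<open>Garland's identities for a simple lowering operator\<close>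

context
  fixes i n :: nat and lam :: "nat \<Rightarrow> int" and c :: complex and K :: "'v set" and z :: 'v and m :: nat
  assumes i: "1 \<le> i" "i < n" "n \<le> n0" and K: "stable n K" and z: "highest n lam c K z"
    and m: "lam i - lam (Suc i) = int m"
begin

private abbreviation f where "f \<equiv> e (Suc i) i"
private abbreviation h where "h s v \<equiv> e i i s v - e (Suc i) (Suc i) s v"

private lemma f_comm: "f s (f u v) = f u (f s v)"
  using i by (subst e_bracket) auto

private lemma ef: "e i (Suc i) s (f u v) = f u (e i (Suc i) s v) + h (s + u) v"
  using i by (subst e_bracket) auto

private lemma hf: "h s (f u v) = f u (h s v) - 2 *s f (s + u) v"
proof -
  have "h s (f u v) = f u (h s v) - f (s + u) v - f (s + u) v"
  proof -
    have "e i i s (f u v) = f u (e i i s v) - f (s + u) v"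
      using i by (subst e_bracket) auto
    moreover have "e (Suc i) (Suc i) s (f u v) = f u (e (Suc i) (Suc i) s v) + f (s + u) v"
      using i by (subst e_bracket) auto
    ultimately show ?thesis by (simp add: e_lin)
  qed
  moreover have "2 *s f (s + u) v = f (s + u) v + f (s + u) v"
    using scale_left_distrib[of 1 1] by simp
  ultimately show ?thesis by simp
qed

private lemmas sK = stable_subspace[OF K]

private lemma f_K: "v \<in> K \<Longrightarrow> f s v \<in> K"
  using i by (intro stable_e[OF K]) auto

private lemma hz: "0 < s \<Longrightarrow> h s z \<in> K"
  using z i by (intro subspace_diff[OF sK]) (auto simp: highest_def)

private lemma ez: "e i (Suc i) s z \<in> K"
  using z i by (auto simp: highest_def)

private lemma h0z: "h 0 z - of_nat m *s z \<in> K"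
proof -
  have "e i i 0 z - (of_int (lam i) + c) *s z \<in> K"
    "e (Suc i) (Suc i) 0 z - (of_int (lam (Suc i)) + c) *s z \<in> K"
    using z i by (auto simp: highest_def)
  from subspace_diff[OF sK this]
  have "h 0 z - ((of_int (lam i) + c) - (of_int (lam (Suc i)) + c)) *s z \<in> K"
    by (simp add: scale_left_diff_distrib algebra_simps)
  moreover have "(of_int (lam i) + c) - (of_int (lam (Suc i)) + c) = of_int (lam i - lam (Suc i))"
    by simp
  ultimately show ?thesis unfolding m by simp
qed

private lemma h0f: "h 0 ((f 0 ^^ k) z) - (of_nat m - 2 * of_nat k) *s (f 0 ^^ k) z \<in> K"
proof (induction k)
  case 0
  then show ?case using h0z by simp
next
  case (Suc k)
  have "h 0 ((f 0 ^^ Suc k) z) - (of_nat m - 2 * of_nat (Suc k)) *s (f 0 ^^ Suc k) z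
    = f 0 (h 0 ((f 0 ^^ k) z) - (of_nat m - 2 * of_nat k) *s (f 0 ^^ k) z)"
    by (simp add: hf e_lin scale_left_diff_distrib scale_left_distrib algebra_simps)
  then show ?case using f_K[OF Suc] by simp
qed

private lemma e0f: "e i (Suc i) 0 ((f 0 ^^ Suc k) z) - (of_nat (Suc k) * (of_nat m - of_nat k)) *s (f 0 ^^ k) z \<in> K"
proof (induction k)
  case 0
  have "e i (Suc i) 0 ((f 0 ^^ Suc 0) z) - (of_nat (Suc 0) * (of_nat m - of_nat 0)) *s (f 0 ^^ 0) z
    = f 0 (e i (Suc i) 0 z) + (h 0 z - of_nat m *s z)"
    by (simp add: ef)
  then show ?case using subspace_add[OF sK f_K[OF ez] h0z] by (simp add: add_diff_eq)
next
  case (Suc k)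
  define y where "y = (f 0 ^^ Suc k) z"
  have c: "of_nat (Suc (Suc k)) * (of_nat m - of_nat (Suc k))
    = of_nat (Suc k) * (of_nat m - of_nat k) + (of_nat m - 2 * of_nat (Suc k) :: complex)"
    by (simp add: algebra_simps)
  have "e i (Suc i) 0 ((f 0 ^^ Suc (Suc k)) z) - (of_nat (Suc (Suc k)) * (of_nat m - of_nat (Suc k))) *s y
    = f 0 (e i (Suc i) 0 y - (of_nat (Suc k) * (of_nat m - of_nat k)) *s (f 0 ^^ k) z)
     + (h 0 y - (of_nat m - 2 * of_nat (Suc k)) *s y)"
  proof -
    have "e i (Suc i) 0 ((f 0 ^^ Suc (Suc k)) z) = f 0 (e i (Suc i) 0 y) + h 0 y"
      unfolding y_def using ef[of 0 0 "(f 0 ^^ Suc k) z"] by simp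
    moreover have "f 0 (C *s (f 0 ^^ k) z) = C *s y" for C by (simp add: y_def e_lin)
    ultimately show ?thesis unfolding c e_lin(5) scale_left_distrib by (simp only:) simp
  qed
  then show ?case using subspace_add[OF sK f_K[OF Suc] h0f[of "Suc k"]] unfolding y_def by simp
qed

text \<open>If f^(k+1) z is the first power in \<open>K\<close>, then applying the raising operator
  puts (k + 1)(m - k) f^k z into \<open>K\<close> as well. The factor must vanish, so k = m;
  \<open>f_power\<close> needs only that k is not larger than m.\<close>

private lemma f_power:
  assumes "m < N"
  shows "(f 0 ^^ N) z \<in> K"
proof -
  have ex: "\<exists>N. (f 0 ^^ N) z \<in> K" using z i by (auto simp: highest_def)
  define N0 where "N0 = (LEAST N. (f 0 ^^ N) z \<in> K)"
  have N0: "(f 0 ^^ N0) z \<in> K" unfolding N0_def by (rule LeastI_ex[OF ex])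
  have min: "(f 0 ^^ k) z \<notin> K" if "k < N0" for k
    using that not_less_Least unfolding N0_def by blast
  have "N0 \<le> Suc m"
  proof (rule ccontr)
    assume "\<not> N0 \<le> Suc m"
    then obtain k where k: "N0 = Suc k" "m < k" by (cases N0) auto
    have "e i (Suc i) 0 ((f 0 ^^ Suc k) z) \<in> K"
      using N0 i unfolding k by (intro stable_e[OF K]) auto
    from subspace_diff[OF sK this e0f[of k]]
    have *: "(of_nat (Suc k) * (of_nat m - of_nat k)) *s (f 0 ^^ k) z \<in> K" by simp
    have "of_nat (Suc k) * (of_nat m - of_nat k) \<noteq> (0::complex)" using k(2)
      by (simp del: of_nat_Suc)
    with * have "(f 0 ^^ k) z \<in> K" by (rule subspace_scale_cancel[OF sK])
    then show False using min[of k] k by simp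
  qed
  have "(f 0 ^^ (N0 + j)) z \<in> K" for j
    by (induction j) (use N0 in \<open>auto intro: f_K\<close>)
  from this[of "N - N0"] show ?thesis using \<open>N0 \<le> Suc m\<close> assms by simp
qed

text \<open>Each of the N factors of the series contributes a bracket [h_t, f_s] = -2 f_(s+t), and
  the factors commute, so the N contributions coincide.\<close>

private lemma hX: "0 < t \<Longrightarrow> h t (complete_op f N b z) +
   (2 * of_nat N) *s (\<Sum>s\<le>b. f (s + t) (complete_op f (N - 1) (b - s) z)) \<in> K"
proof (induction N arbitrary: b)
  case 0
  then show ?case using hz by (auto simp: e_lin subspace_0[OF sK])
next
  case (Suc N)
  define Y where "Y b = (\<Sum>s\<le>b. f (s + t) (complete_op f (N - 1) (b - s) z))" for b
  have sw: "of_nat N *s (\<Sum>s\<le>b. f s (Y (b - s))) = of_nat N *s (\<Sum>u\<le>b. f (u + t) (complete_op f N (b - u) z))"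
  proof (cases N)
    case (Suc N')
    have "(\<Sum>s\<le>b. f s (Y (b - s))) = (\<Sum>s\<le>b. \<Sum>u\<le>b - s. f s (f (u + t) (complete_op f N' (b - s - u) z)))"
      unfolding Y_def Suc by (simp add: e_lin)
    also have "\<dots> = (\<Sum>u\<le>b. \<Sum>s\<le>b - u. f s (f (u + t) (complete_op f N' (b - s - u) z)))"
      by (rule sum_triangle_swap)
    also have "\<dots> = (\<Sum>u\<le>b. f (u + t) (complete_op f N (b - u) z))"
      unfolding Suc complete_op.simps(2) e_lin(6)
      by (intro sum.cong refl) (subst f_comm, simp add: add.commute)
    finally show ?thesis by simp
  qed simp
  have "(\<Sum>s\<le>b. f s (h t (complete_op f N (b - s) z) + (2 * of_nat N) *s Y (b - s))) \<in> K"
    unfolding Y_def by (intro subspace_sum[OF sK] f_K Suc.IH Suc.prems)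
  also have "(\<Sum>s\<le>b. f s (h t (complete_op f N (b - s) z) + (2 * of_nat N) *s Y (b - s)))
    = (\<Sum>s\<le>b. f s (h t (complete_op f N (b - s) z))) + 2 *s (of_nat N *s (\<Sum>s\<le>b. f s (Y (b - s))))"
    by (simp add: e_lin sum.distrib scale_sum_right sum_subtractf)
  also have "\<dots> = (\<Sum>s\<le>b. f s (h t (complete_op f N (b - s) z)) - 2 *s f (s + t) (complete_op f N (b - s) z))
    + (2 * of_nat (Suc N)) *s (\<Sum>s\<le>b. f (s + t) (complete_op f (Suc N - 1) (b - s) z))"
    unfolding sw by (simp add: sum_subtractf scale_sum_right[symmetric] scale_left_distrib ring_distribs)
  also have "(\<Sum>s\<le>b. f s (h t (complete_op f N (b - s) z)) - 2 *s f (s + t) (complete_op f N (b - s) z))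
    = h t (complete_op f (Suc N) b z)"
    unfolding complete_op.simps e_lin(6) sum_subtractf[symmetric] hf by (simp add: add.commute)
  finally show ?case .
qed

text \<open>Modulo \<open>K\<close> and up to a nonzero factor, the current e \<otimes> t carries
  the coefficient of f(u)^(N+1) at u^a to that of f(u)^N at u^(a+1). Moving it past one factor f_s
  leaves f_s times the induction hypothesis and an h-current of degree s + 1, to which
  \<open>hX\<close> applies.\<close>

private lemma e1X: "e i (Suc i) 1 (complete_op f (Suc N) a z) +
  (of_nat (Suc N) * of_nat (Suc a)) *s complete_op f N (Suc a) z \<in> K"
proof (induction N arbitrary: a)
  case 0
  have "e i (Suc i) 1 (complete_op f (Suc 0) a z) = e i (Suc i) 1 (f a z)"
  proof -
    have "complete_op f (Suc 0) a z = (\<Sum>s\<le>a. if s = a then f a z else 0)"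
      unfolding complete_op.simps by (intro sum.cong) (auto simp: e_lin)
    then show ?thesis by simp
  qed
  also have "\<dots> = f a (e i (Suc i) 1 z) + h (1 + a) z" by (rule ef)
  also have "\<dots> \<in> K" by (intro subspace_add[OF sK] f_K ez hz) simp
  finally show ?case by simp
next
  case (Suc N)
  let ?M = "Suc N" and ?A = "Suc a"
  define X where "X N a = complete_op f N a z" for N a
  \<comment> \<open>Both contributions produce this weighted sum. Euler's identity turns
    \<open>of_nat ?M *s E\<close> into \<open>of_nat ?A *s X ?M ?A\<close>, and then the factors add
    up to (N + 2)(a + 1).\<close>
  define E where "E = (\<Sum>s\<le>?A. of_nat s *s f s (X N (?A - s)))"
  have euler: "of_nat ?M *s E = of_nat ?A *s X ?M ?A"
    unfolding E_def X_def by (rule complete_op_euler[OF lin_e f_comm])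
  have XM: "X ?M ?A = (\<Sum>s\<le>?A. f s (X N (?A - s)))" unfolding X_def by simp
  have 1: "(\<Sum>s\<le>a. f s (e i (Suc i) 1 (X ?M (a - s)) + (of_nat ?M * of_nat (Suc (a - s))) *s X N (Suc (a - s)))) \<in> K"
    unfolding X_def by (intro subspace_sum[OF sK] f_K Suc)
  have 2: "(\<Sum>s\<le>a. h (Suc s) (X ?M (a - s)) + (2 * of_nat ?M) *s (\<Sum>u\<le>a - s. f (u + Suc s) (X N (a - s - u)))) \<in> K"
  proof (intro subspace_sum[OF sK])
    fix s
    show "h (Suc s) (X ?M (a - s)) + (2 * of_nat ?M) *s (\<Sum>u\<le>a - s. f (u + Suc s) (X N (a - s - u))) \<in> K"
      using hX[of "Suc s" ?M "a - s"] unfolding X_def by (simp only: diff_Suc_1 zero_less_Suc simp_thms)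
  qed
  have e1: "e i (Suc i) 1 (X (Suc ?M) a) = (\<Sum>s\<le>a. f s (e i (Suc i) 1 (X ?M (a - s)))) + (\<Sum>s\<le>a. h (Suc s) (X ?M (a - s)))"
    unfolding X_def complete_op.simps(2)[of f ?M] e_lin(6) ef sum.distrib[symmetric] by simp
  have A: "(\<Sum>s\<le>a. f s ((of_nat ?M * of_nat (Suc (a - s))) *s X N (Suc (a - s))))
      = of_nat ?M *s (of_nat ?A *s X ?M ?A - E)"
  proof -
    have "(\<Sum>s\<le>a. f s ((of_nat ?M * of_nat (Suc (a - s))) *s X N (Suc (a - s))))
      = (\<Sum>s\<le>a. of_nat ?M *s (of_nat (?A - s) *s f s (X N (?A - s))))"
      by (intro sum.cong refl) (simp add: e_lin Suc_diff_le del: of_nat_Suc)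
    also have "\<dots> = (\<Sum>s\<le>?A. of_nat ?M *s (of_nat (?A - s) *s f s (X N (?A - s))))" by simp
    also have "\<dots> = of_nat ?M *s (\<Sum>s\<le>?A. of_nat ?A *s f s (X N (?A - s)) - of_nat s *s f s (X N (?A - s)))"
      unfolding scale_sum_right
      by (intro sum.cong refl) (simp add: of_nat_diff scale_left_diff_distrib del: of_nat_Suc)
    also have "\<dots> = of_nat ?M *s (of_nat ?A *s X ?M ?A - E)"
      unfolding XM E_def by (simp only: sum_subtractf scale_sum_right)
    finally show ?thesis .
  qed
  have B: "(\<Sum>s\<le>a. \<Sum>u\<le>a - s. f (u + Suc s) (X N (a - s - u))) = E"
  proof -
    have "(\<Sum>s\<le>a. \<Sum>u\<le>a - s. f (u + Suc s) (X N (a - s - u)))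
      = (\<Sum>s\<le>a. \<Sum>y\<in>{y \<in> {..a}. s \<le> y}. f (Suc y) (X N (a - y)))"
    proof (rule sum.cong[OF refl])
      fix s assume "s \<in> {..a}"
      then show "(\<Sum>u\<le>a - s. f (u + Suc s) (X N (a - s - u))) = (\<Sum>y\<in>{y \<in> {..a}. s \<le> y}. f (Suc y) (X N (a - y)))"
        by (intro sum.reindex_bij_witness[of _ "\<lambda>y. y - s" "\<lambda>u. u + s"]) (auto simp: algebra_simps)
    qed
    also have "\<dots> = (\<Sum>y\<le>a. \<Sum>s\<in>{s \<in> {..a}. s \<le> y}. f (Suc y) (X N (a - y)))"
      by (rule sum.swap_restrict) auto
    also have "\<dots> = (\<Sum>y\<le>a. of_nat (Suc y) *s f (Suc y) (X N (a - y)))"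
    proof (rule sum.cong[OF refl])
      fix y assume "y \<in> {..a}"
      then have "{s \<in> {..a}. s \<le> y} = {..y}" by auto
      then show "(\<Sum>s\<in>{s \<in> {..a}. s \<le> y}. f (Suc y) (X N (a - y))) = of_nat (Suc y) *s f (Suc y) (X N (a - y))"
        using scale_sum_left[of "\<lambda>_. 1" "{..y}" "f (Suc y) (X N (a - y))"] by simp
    qed
    also have "\<dots> = E" unfolding E_def by (subst sum.atMost_Suc_shift) simp
    finally show ?thesis .
  qed
  define P1 where "P1 = (\<Sum>s\<le>a. f s (e i (Suc i) 1 (X ?M (a - s))))"
  define P2 where "P2 = (\<Sum>s\<le>a. h (Suc s) (X ?M (a - s)))"
  have 3: "P1 + of_nat ?M *s (of_nat ?A *s X ?M ?A - E) \<in> K"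
    using 1 by (simp only: e_lin(1) sum.distrib A P1_def)
  have 4: "P2 + (2 * of_nat ?M) *s E \<in> K"
    using 2 by (simp only: sum.distrib scale_sum_right[symmetric] B P2_def)
  have "of_nat ?M *s (of_nat ?A *s X ?M ?A - E) + (2 * of_nat ?M) *s E
    = of_nat ?M *s (of_nat ?A *s X ?M ?A) + of_nat ?M *s E"
    by (simp only: scale_right_diff_distrib mult_2 scale_left_distrib) simp
  also have "\<dots> = (of_nat (Suc ?M) * of_nat ?A) *s X ?M ?A"
    unfolding euler of_nat_Suc[of ?M] by (simp only: scale_left_distrib distrib_right scale_scale mult_1 add.commute)
  finally have 5: "of_nat ?M *s (of_nat ?A *s X ?M ?A - E) + (2 * of_nat ?M) *s E
    = (of_nat (Suc ?M) * of_nat ?A) *s X ?M ?A" .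
  have "P1 + P2 + (of_nat (Suc ?M) * of_nat ?A) *s X ?M ?A \<in> K"
    unfolding 5[symmetric] using subspace_add[OF sK 3 4] by (simp only: ac_simps)
  then show ?case using e1 by (simp only: P1_def P2_def X_def)
qed

text \<open>For a = 0 this is the nilpotency of the lowering operator. Applying e \<otimes> t trades
  one factor of the series for one power of t, so N + a stays the same while a grows.\<close>

lemma complete_op_highest:
  assumes "m < N + a"
  shows "complete_op (e (Suc i) i) N a z \<in> K"
  using assms
proof (induction a arbitrary: N)
  case 0
  then show ?case using f_power[of N] by (simp add: complete_op_0 lin_e)
next
  case (Suc a)
  have "complete_op f (Suc N) a z \<in> K"
    using Suc.IH[of "Suc N"] Suc.prems by (simp del: complete_op.simps)
  then have "e i (Suc i) 1 (complete_op f (Suc N) a z) \<in> K" using i by (intro stable_e[OF K]) auto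
  from subspace_diff[OF sK e1X[of N a] this]
  have *: "(of_nat (Suc N) * of_nat (Suc a)) *s complete_op f N (Suc a) z \<in> K" by simp
  have "of_nat (Suc N) * of_nat (Suc a) \<noteq> (0::complex)" by (simp del: of_nat_Suc)
  with * show ?case by (rule subspace_scale_cancel[OF sK])
qed

end

end

section \<open>Spanning by induction on the rank\<close>

fun raise_entry :: "nat \<Rightarrow> nat list \<Rightarrow> nat list list" where
  "raise_entry a [] = []"
| "raise_entry a (s # t) = ((s + a) # t) # map ((#) s) (raise_entry a t)"

lemma power_shift_small: "sum_list t < a \<Longrightarrow> power_shift a g t = 0"
  by (induction t arbitrary: g) auto

context complex_space
begin

text \<open>A Cartan current of degree \<open>a\<close> acts on a monomial by raising one exponent
  by \<open>a\<close>. Moved over to the coefficients this is multiplication by p_a, so that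
  stability under the current becomes closure of the relations under power sums.\<close>

lemma power_shift_dual:
  "(\<Sum>l\<in>compositions N d. g l *s (\<Sum>l'\<leftarrow>raise_entry a l. P l'))
    = (\<Sum>l\<in>compositions N (d + a). power_shift a g l *s P l)"
proof (induction N arbitrary: d g P)
  case 0
  then show ?case by (auto simp: compositions_0)
next
  case (Suc N)
  define h where "h s t = (if a \<le> s then g ((s - a) # t) *s P (s # t) else 0)" for s t
  have "(\<Sum>l\<in>compositions (Suc N) d. g l *s (\<Sum>l'\<leftarrow>raise_entry a l. P l'))
    = (\<Sum>s\<le>d. \<Sum>t\<in>compositions N (d - s). g (s # t) *s P ((s + a) # t))
     + (\<Sum>s\<le>d. \<Sum>t\<in>compositions N (d - s). g (s # t) *s (\<Sum>t'\<leftarrow>raise_entry a t. P (s # t')))"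
    unfolding sum_compositions_Suc raise_entry.simps list.map sum_list.Cons
    by (simp add: scale_right_distrib sum.distrib o_def)
  also have "(\<Sum>s\<le>d. \<Sum>t\<in>compositions N (d - s). g (s # t) *s (\<Sum>t'\<leftarrow>raise_entry a t. P (s # t')))
    = (\<Sum>s\<le>d. \<Sum>t\<in>compositions N (d - s + a). power_shift a (\<lambda>l. g (s # l)) t *s P (s # t))"
    by (intro sum.cong refl Suc.IH)
  also have "\<dots> = (\<Sum>s\<le>d. \<Sum>t\<in>compositions N (d + a - s). power_shift a (\<lambda>l. g (s # l)) t *s P (s # t))"
    by (intro sum.cong refl) auto
  also have "\<dots> = (\<Sum>s\<le>d + a. \<Sum>t\<in>compositions N (d + a - s). power_shift a (\<lambda>l. g (s # l)) t *s P (s # t))"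
  proof (rule sum.mono_neutral_left)
    show "\<forall>s\<in>{..d + a} - {..d}. (\<Sum>t\<in>compositions N (d + a - s). power_shift a (\<lambda>l. g (s # l)) t *s P (s # t)) = 0"
      by (auto intro!: sum.neutral simp: compositions_def power_shift_small)
  qed auto
  also have "(\<Sum>s\<le>d. \<Sum>t\<in>compositions N (d - s). g (s # t) *s P ((s + a) # t))
    = (\<Sum>s\<le>d + a. \<Sum>t\<in>compositions N (d + a - s). h s t)"
  proof -
    have "(\<Sum>s\<le>d. \<Sum>t\<in>compositions N (d - s). g (s # t) *s P ((s + a) # t))
      = (\<Sum>s\<in>{a..d + a}. \<Sum>t\<in>compositions N (d + a - s). h s t)"
      by (rule sum.reindex_bij_witness[of _ "\<lambda>s. s - a" "\<lambda>s. s + a"]) (auto simp: h_def)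
    also have "\<dots> = (\<Sum>s\<le>d + a. \<Sum>t\<in>compositions N (d + a - s). h s t)"
      by (rule sum.mono_neutral_left) (auto simp: h_def intro!: sum.neutral)
    finally show ?thesis .
  qed
  also have "(\<Sum>s\<le>d + a. \<Sum>t\<in>compositions N (d + a - s). h s t) +
     (\<Sum>s\<le>d + a. \<Sum>t\<in>compositions N (d + a - s). power_shift a (\<lambda>l. g (s # l)) t *s P (s # t))
    = (\<Sum>l\<in>compositions (Suc N) (d + a). power_shift a g l *s P l)"
    unfolding sum_compositions_Suc sum.distrib[symmetric] power_shift.simps
    by (intro sum.cong refl) (auto simp: h_def scale_left_distrib)
  finally show ?case .
qed

text \<open>The multiplicity of \<open>T\<close> is a natural number and not just a scalar: together
  with one further copy of \<open>T\<close> the factor cannot vanish.\<close>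

lemma sum_list_dichotomy:
  assumes "subspace S" "\<forall>q\<in>set L. F q = T \<or> F q \<in> S"
  shows "\<exists>k. sum_list (map F L) - of_nat k *s T \<in> S"
  using assms(2)
proof (induction L)
  case Nil
  then show ?case using subspace_0[OF assms(1)] by (intro exI[of _ 0]) simp
next
  case (Cons q L)
  then obtain k where k: "sum_list (map F L) - of_nat k *s T \<in> S" by auto
  from Cons.prems consider "F q = T" | "F q \<in> S" by auto
  then show ?case
  proof cases
    case 1
    then show ?thesis using k by (intro exI[of _ "Suc k"]) (simp add: scale_left_distrib algebra_simps)
  next
    case 2
    then show ?thesis using subspace_add[OF assms(1) 2 k] by (intro exI[of _ k]) (simp add: algebra_simps)
  qed
qed

lemma sum_list_mem:
  assumes "subspace S" "\<forall>q\<in>set L. F q \<in> S"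
  shows "sum_list (map F L) \<in> S"
  using assms(2) by (induction L) (auto simp: subspace_0[OF assms(1)] subspace_add[OF assms(1)])

end

section \<open>Statistics of monomials in the bottom row\<close>

definition index_sum :: "(nat \<times> nat) list \<Rightarrow> nat" where
  "index_sum ps = sum_list (map fst ps)"

definition t_degree :: "(nat \<times> nat) list \<Rightarrow> nat" where
  "t_degree ps = sum_list (map snd ps)"

definition index_count :: "nat \<Rightarrow> (nat \<times> nat) list \<Rightarrow> nat" where
  "index_count i ps = length (filter (\<lambda>p. fst p = i) ps)"

definition indices_le :: "nat \<Rightarrow> (nat \<times> nat) list \<Rightarrow> bool" where
  "indices_le r ps \<longleftrightarrow> (\<forall>p\<in>set ps. fst p \<in> {1..r})"

text \<open>The exponents at index \<open>i\<close> form a partition with at most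
  \<open>index_count i ps\<close> parts, each at most \<open>m i - index_count i ps\<close>. For
  \<open>m i\<close> = lam i - lam (i + 1) this is the rectangle of a POP whose next row has the
  entry lam i - \<open>index_count i ps\<close>.\<close>

definition boxed :: "(nat \<Rightarrow> nat) \<Rightarrow> nat \<Rightarrow> (nat \<times> nat) list \<Rightarrow> bool" where
  "boxed m i ps \<longleftrightarrow> (\<forall>s. (i, s) \<in> set ps \<longrightarrow> s + index_count i ps \<le> m i)"

lemma stats_simps [simp]:
  "index_sum [] = 0" "index_sum (p # ps) = fst p + index_sum ps" "index_sum (ps @ qs) = index_sum ps + index_sum qs"
  "t_degree [] = 0" "t_degree (p # ps) = snd p + t_degree ps" "t_degree (ps @ qs) = t_degree ps + t_degree qs"
  "index_count i [] = 0" "index_count i (p # ps) = (if fst p = i then 1 else 0) + index_count i ps"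
  "index_count i (ps @ qs) = index_count i ps + index_count i qs"
  "indices_le r []" "indices_le r (p # ps) \<longleftrightarrow> fst p \<in> {1..r} \<and> indices_le r ps"
  "indices_le r (ps @ qs) \<longleftrightarrow> indices_le r ps \<and> indices_le r qs"
  by (auto simp: index_sum_def t_degree_def index_count_def indices_le_def)

lemma stats_perm:
  assumes "mset ps = mset qs"
  shows "index_sum ps = index_sum qs" "t_degree ps = t_degree qs" "index_count i ps = index_count i qs"
    "indices_le r ps = indices_le r qs" "length ps = length qs"
proof -
  show "index_sum ps = index_sum qs" "t_degree ps = t_degree qs"
    unfolding index_sum_def t_degree_def sum_mset_sum_list[symmetric] mset_map assms by auto
  show "index_count i ps = index_count i qs"
    unfolding index_count_def size_mset[symmetric] mset_filter assms ..
  show "indices_le r ps = indices_le r qs"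
    unfolding indices_le_def using mset_eq_setD[OF assms] by simp
  show "length ps = length qs" by (rule mset_eq_length[OF assms])
qed

text \<open>The terms in the bracket of E_ij \<otimes> t^s with a monomial, up to sign: one factor
  E_(n,i) \<otimes> t^u becomes E_(n,j) \<otimes> t^(u+s).\<close>

fun replace_index :: "nat \<Rightarrow> nat \<Rightarrow> nat \<Rightarrow> (nat \<times> nat) list \<Rightarrow> (nat \<times> nat) list list" where
  "replace_index i j s [] = []"
| "replace_index i j s (p # ps) = (if fst p = i then [(j, snd p + s) # ps] else [])
     @ map ((#) p) (replace_index i j s ps)"

lemma replace_index_cases:
  assumes "qs \<in> set (replace_index i j s ps)"
  obtains p1 u p2 where "ps = p1 @ (i, u) # p2" "qs = p1 @ (j, u + s) # p2"
proof -
  have "\<exists>p1 u p2. ps = p1 @ (i, u) # p2 \<and> qs = p1 @ (j, u + s) # p2"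
    using assms
  proof (induction ps arbitrary: qs)
    case (Cons p ps)
    then consider "fst p = i" "qs = (j, snd p + s) # ps" | qs' where "qs' \<in> set (replace_index i j s ps)" "qs = p # qs'"
      by (auto split: if_splits)
    then show ?case
    proof cases
      case 1
      then have "p # ps = [] @ (i, snd p) # ps" "qs = [] @ (j, snd p + s) # ps" by (auto simp: prod_eq_iff)
      then show ?thesis by blast
    next
      case 2
      from Cons.IH[OF 2(1)] obtain p1 u p2 where "ps = p1 @ (i, u) # p2" "qs' = p1 @ (j, u + s) # p2" by blast
      then have "p # ps = (p # p1) @ (i, u) # p2" "qs = (p # p1) @ (j, u + s) # p2" using 2 by auto
      then show ?thesis by blast
    qed
  qed simp
  then show ?thesis using that by blast
qed

lemma replace_index_stats:
  assumes "qs \<in> set (replace_index i j s ps)"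
  shows "length qs = length ps" "index_sum qs + i = index_sum ps + j" "t_degree qs = t_degree ps + s"
    "indices_le r ps \<Longrightarrow> j \<in> {1..r} \<Longrightarrow> indices_le r qs"
  by (rule replace_index_cases[OF assms]; simp)+

lemma replace_index_same: "replace_index i i 0 ps = replicate (index_count i ps) ps"
proof (induction ps)
  case (Cons p ps)
  then show ?case by (cases p) (auto simp: map_replicate_const[symmetric] simp del: map_replicate_const)
qed simp

lemma index_sum_le: "indices_le r ps \<Longrightarrow> index_sum ps \<le> r * length ps"
  by (induction ps) auto

lemma t_degree_le: "\<forall>p\<in>set ps. snd p \<le> M \<Longrightarrow> t_degree ps \<le> length ps * M"
  by (induction ps) auto

lemma boxed_index_count: "boxed m i ps \<Longrightarrow> index_count i ps \<le> m i"
proof (cases "index_count i ps = 0")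
  case False
  then obtain p where "p \<in> set ps" "fst p = i" by (auto simp: index_count_def filter_empty_conv)
  then have "(i, snd p) \<in> set ps" by (metis prod.collapse)
  moreover assume "boxed m i ps"
  ultimately show ?thesis by (auto simp: boxed_def)
qed simp

lemma replace_index_map_Pair:
  assumes "\<forall>p\<in>set rest. fst p \<noteq> i"
  shows "replace_index i i a (map (Pair i) l @ rest) = map (\<lambda>l'. map (Pair i) l' @ rest) (raise_entry a l)"
proof -
  have "replace_index i i a rest = []" using assms by (induction rest) auto
  then show ?thesis by (induction l) auto
qed

section \<open>Bottom row monomials under the currents of smaller rank\<close>

context gl_current_rep
begin

definition umono :: "nat \<Rightarrow> (nat \<times> nat) list \<Rightarrow> 'v \<Rightarrow> 'v" where
  "umono n ps = foldr (\<lambda>p. e n (fst p) (snd p)) ps"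

lemma mono_simps [simp]: "umono n [] v = v" "umono n (p # ps) v = e n (fst p) (snd p) (umono n ps v)"
  "umono n (ps @ qs) v = umono n ps (umono n qs v)"
  by (simp_all add: umono_def)

lemma lin_mono: "lin (umono n ps)"
  unfolding umono_def by (rule lin_foldr) (rule lin_e)

lemma mono_mem: "stable n K \<Longrightarrow> indices_le n ps \<Longrightarrow> 1 \<le> n \<Longrightarrow> v \<in> K \<Longrightarrow> umono n ps v \<in> K"
  by (induction ps) (auto intro!: stable_e)

text \<open>A boxed list encodes one step of a POP: its index counts give the next row of the
  pattern and its exponents give the partitions overlaid on it.\<close>

fun pop_vectors :: "nat \<Rightarrow> (nat \<Rightarrow> int) \<Rightarrow> 'v \<Rightarrow> 'v set" where
  "pop_vectors 0 lam z = {z}"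
| "pop_vectors (Suc r) lam z =
     (\<Union>ps\<in>{ps. indices_le (Suc r) ps \<and> (\<forall>i\<in>{1..Suc r}. boxed (\<lambda>i. nat (lam i - lam (Suc i))) i ps)}.
       pop_vectors r (\<lambda>i. lam i - int (index_count i ps)) (umono (Suc (Suc r)) ps z))"

lemma gen_induct: "v \<in> gen n A \<Longrightarrow> (\<And>x. x \<in> A \<Longrightarrow> P x) \<Longrightarrow> stable n {x. P x} \<Longrightarrow> P v"
  unfolding gen_def by (rule hull_induct)

lemma subspace_preimage:
  assumes "subspace T"
  shows "subspace {v. v \<in> T \<and> (\<forall>j\<in>J. \<forall>s. e (p j) (q j) s v \<in> T)}"
  by (rule subspaceI) (auto simp: e_lin subspace_0[OF assms] subspace_add[OF assms] subspace_scale[OF assms])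

context
  fixes r :: nat
  assumes r: "1 \<le> r" "Suc r \<le> n0"
begin

private abbreviation "n \<equiv> Suc r"

lemma u_commute: "i \<in> {1..r} \<Longrightarrow> j \<in> {1..r} \<Longrightarrow> e n i s (e n j u v) = e n j u (e n i s v)"
  using r by (subst e_bracket) auto

lemma levi_u: "i \<in> {1..r} \<Longrightarrow> j \<in> {1..r} \<Longrightarrow> k \<in> {1..r} \<Longrightarrow>
   e i j s (e n k u v) = e n k u (e i j s v) - (if i = k then e n j (s + u) v else 0)"
  using r by (subst e_bracket) auto

lemma mono_perm:
  assumes "mset ps = mset qs" "indices_le r ps"
  shows "umono n ps v = umono n qs v"
proof -
  have "fold (\<lambda>p. e n (fst p) (snd p)) (rev ps) = fold (\<lambda>p. e n (fst p) (snd p)) (rev qs)"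
    by (rule fold_multiset_equiv) (use assms in \<open>auto simp: indices_le_def o_def u_commute\<close>)
  then show ?thesis by (simp add: umono_def foldr_conv_fold)
qed

lemma levi_mono: "i \<in> {1..r} \<Longrightarrow> j \<in> {1..r} \<Longrightarrow> indices_le r ps \<Longrightarrow>
   e i j s (umono n ps v) = umono n ps (e i j s v) - sum_list (map (\<lambda>qs. umono n qs v) (replace_index i j s ps))"
proof (induction ps)
  case (Cons p ps)
  have L: "e n k u (sum_list (map F L)) = sum_list (map (\<lambda>x. e n k u (F x)) L)" for k u and F :: "(nat \<times> nat) list \<Rightarrow> 'v" and L
    by (induction L) (auto simp: e_lin)
  have IH: "e i j s (umono n ps v) = umono n ps (e i j s v) - sum_list (map (\<lambda>qs. umono n qs v) (replace_index i j s ps))"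
    using Cons by auto
  have "e i j s (umono n (p # ps) v) = e n (fst p) (snd p) (e i j s (umono n ps v))
     - (if i = fst p then e n j (s + snd p) (umono n ps v) else 0)"
    using Cons.prems by (simp add: levi_u)
  then show ?case unfolding IH e_lin L by (auto simp: o_def add.commute[of s])
qed simp

lemma mono_commute: "indices_le r ps \<Longrightarrow> (\<And>i s v. i \<in> {1..r} \<Longrightarrow> (\<exists>u. (i, u) \<in> set ps) \<Longrightarrow> g (e n i s v) = e n i s (g v)) \<Longrightarrow>
   g (umono n ps v) = umono n ps (g v)"
proof (induction ps)
  case (Cons p ps)
  have "g (umono n ps v) = umono n ps (g v)"
    using Cons.prems by (intro Cons.IH) auto
  moreover have "\<exists>u. (fst p, u) \<in> set (p # ps)" by (intro exI[of _ "snd p"]) simp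
  ultimately show ?case using Cons.prems by simp
qed simp

context
  fixes lam :: "nat \<Rightarrow> int" and c :: complex and K :: "'v set" and z :: 'v and m :: "nat \<Rightarrow> nat"
  assumes K: "stable n K" and z: "highest n lam c K z"
    and m: "\<And>i. i \<in> {1..r} \<Longrightarrow> lam i - lam (Suc i) = int (m i)"
begin

text \<open>The currents of gl_r preserve the number \<open>d\<close> of factors, and its raising
  operators E_ab with a < b replace an index a by the larger b. The index sum therefore increases,
  which makes monomials highest weight vectors modulo a later step.\<close>

definition filtration :: "nat \<Rightarrow> nat \<Rightarrow> 'v set" where
  "filtration d q = gen r (K \<union> {umono n ps z | ps. indices_le r ps \<and> length ps = d \<and> q \<le> index_sum ps})"

lemma filtration_stable: "stable r (filtration d q)" unfolding filtration_def by (rule stable_gen)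

lemmas filtration_sub = stable_subspace[OF filtration_stable]

lemma K_filtration: "v \<in> K \<Longrightarrow> v \<in> filtration d q"
  unfolding filtration_def by (intro subsetD[OF gen_superset] UnI1)

lemma mono_filtration: "indices_le r ps \<Longrightarrow> length ps = d \<Longrightarrow> q \<le> index_sum ps \<Longrightarrow> umono n ps z \<in> filtration d q"
  unfolding filtration_def by (intro subsetD[OF gen_superset] UnI2 CollectI exI[of _ ps] conjI refl)

lemma mono_K: "indices_le r ps \<Longrightarrow> v \<in> K \<Longrightarrow> umono n ps v \<in> K"
  by (rule mono_mem[OF K]) (auto simp: indices_le_def)

section \<open>Transfer of Garland's identities to the bottom row\<close>

context
  fixes i :: nat
  assumes i: "1 \<le> i" "i < r"
begin

private abbreviation "a0 \<equiv> e n (Suc i) 0"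
private abbreviation "fl \<equiv> e (Suc i) i"
private abbreviation "b \<equiv> e n i"

private lemma a0_f: "a0 (fl s x) = fl s (a0 x) + b s x"
  using r i by (subst e_bracket) auto

private lemma b_a0: "a0 (b s x) = b s (a0 x)"
  using i by (intro u_commute) auto

private lemma f_b: "fl s (b u x) = b u (fl s x)"
  using i by (subst levi_u) auto

private lemma b_a0_pow: "(a0 ^^ k) (b s x) = b s ((a0 ^^ k) x)"
  by (induction k) (simp_all add: b_a0)

private lemma a0_pow_f: "(a0 ^^ k) (fl s x) = fl s ((a0 ^^ k) x) + of_nat k *s b s ((a0 ^^ (k - 1)) x)"
proof (induction k)
  case (Suc k)
  have "(a0 ^^ Suc k) (fl s x) = fl s ((a0 ^^ Suc k) x) + b s ((a0 ^^ k) x) + of_nat k *s b s (a0 ((a0 ^^ (k - 1)) x))"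
    by (simp add: Suc e_lin a0_f b_a0)
  also have "of_nat k *s b s (a0 ((a0 ^^ (k - 1)) x)) = of_nat k *s b s ((a0 ^^ k) x)"
    by (cases k) simp_all
  finally show ?case by (simp add: scale_left_distrib)
qed simp

private lemma foldr_f_b: "foldr fl l (b s x) = b s (foldr fl l x)"
  by (induction l) (simp_all add: f_b)

private lemma a0_pow_mono: "(a0 ^^ k) (umono n ps v) = umono n (replicate k (Suc i, 0) @ ps) v"
  by (induction k) simp_all

private lemma index_sum_replicate: "index_sum (replicate k (j, u)) = k * j" "indices_le r (replicate k (j, u)) \<longleftrightarrow> k = 0 \<or> j \<in> {1..r}"
  by (induction k) auto

text \<open>Moving one \<open>fl\<close> out to the left past the powers of \<open>a0\<close> either
  leaves it in front, where the stability of the filtration absorbs it, or turns one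
  \<open>a0\<close> into \<open>b\<close>, which lowers the index sum by one. At most
  \<open>length l\<close> is lost in total.\<close>

private lemma straighten1:
  "indices_le r ps \<Longrightarrow> q + length l \<le> index_sum ps + k * Suc i \<Longrightarrow>
     (a0 ^^ k) (foldr fl l (umono n ps z)) \<in> filtration (k + length ps) q"
proof (induction l arbitrary: k ps)
  case Nil
  then show ?case using i unfolding foldr.simps id_apply a0_pow_mono
    by (intro mono_filtration) (auto simp: index_sum_replicate)
next
  case (Cons s l)
  have 1: "fl s ((a0 ^^ k) (foldr fl l (umono n ps z))) \<in> filtration (k + length ps) q"
    using Cons.prems i by (intro stable_e[OF filtration_stable] Cons.IH) auto
  have 2: "of_nat k *s b s ((a0 ^^ (k - 1)) (foldr fl l (umono n ps z))) \<in> filtration (k + length ps) q"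
  proof (cases k)
    case (Suc k')
    have "(a0 ^^ k') (foldr fl l (umono n ((i, s) # ps) z)) \<in> filtration (k' + length ((i, s) # ps)) q"
      using Cons.prems i by (intro Cons.IH) (auto simp: Suc)
    then have "b s ((a0 ^^ k') (foldr fl l (umono n ps z))) \<in> filtration (k + length ps) q"
      by (simp add: Suc foldr_f_b b_a0_pow)
    then show ?thesis by (simp add: Suc subspace_scale[OF filtration_sub])
  qed (simp add: subspace_0[OF filtration_sub])
  show ?case using subspace_add[OF filtration_sub 1 2] by (simp add: a0_pow_f)
qed

text \<open>Now the bound is one too high for \<open>straighten1\<close>, so a single kind of term
  can fail to lie in the filtration: every \<open>fl\<close> has turned an \<open>a0\<close> into a
  \<open>b\<close>. The factor counts the injective ways of choosing these
  \<open>a0\<close>.\<close>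

private lemma straighten2:
  "indices_le r ps \<Longrightarrow> length l \<le> k \<Longrightarrow> q + length l = Suc (index_sum ps + k * Suc i) \<Longrightarrow>
     (a0 ^^ k) (foldr fl l (umono n ps z)) -
       (fact k / fact (k - length l)) *s foldr b l ((a0 ^^ (k - length l)) (umono n ps z)) \<in> filtration (k + length ps) q"
proof (induction l arbitrary: k ps)
  case Nil
  then show ?case by (simp add: subspace_0[OF filtration_sub])
next
  case (Cons s l)
  then obtain k' where k: "k = Suc k'" by (cases k) auto
  have 1: "fl s ((a0 ^^ k) (foldr fl l (umono n ps z))) \<in> filtration (k + length ps) q"
    using Cons.prems i by (intro stable_e[OF filtration_stable] straighten1) auto
  have "(a0 ^^ k') (foldr fl l (umono n ((i, s) # ps) z)) -
       (fact k' / fact (k' - length l)) *s foldr b l ((a0 ^^ (k' - length l)) (umono n ((i, s) # ps) z)) \<in> filtration (k' + length ((i, s) # ps)) q"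
    using Cons.prems i by (intro Cons.IH) (auto simp: k)
  moreover have "foldr b l (b s x) = b s (foldr b l x)" for x
    using i by (induction l) (auto simp: u_commute)
  ultimately have "b s ((a0 ^^ k') (foldr fl l (umono n ps z))) -
       (fact k' / fact (k' - length l)) *s foldr b (s # l) ((a0 ^^ (k' - length l)) (umono n ps z)) \<in> filtration (k + length ps) q"
    by (simp add: foldr_f_b b_a0_pow k)
  from subspace_scale[OF filtration_sub this, of "of_nat k"]
  have 2: "of_nat k *s b s ((a0 ^^ k') (foldr fl l (umono n ps z))) -
       (fact k / fact (k' - length l)) *s foldr b (s # l) ((a0 ^^ (k' - length l)) (umono n ps z)) \<in> filtration (k + length ps) q"
    by (simp add: scale_right_diff_distrib k)
  have e: "(a0 ^^ k) (foldr fl (s # l) (umono n ps z)) = fl s ((a0 ^^ k) (foldr fl l (umono n ps z)))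
     + of_nat k *s b s ((a0 ^^ k') (foldr fl l (umono n ps z)))"
    using a0_pow_f[of k s] by (simp only: foldr.simps o_apply k diff_Suc_1)
  have kl: "k - length (s # l) = k' - length l" by (simp add: k)
  show ?case unfolding e kl using subspace_add[OF filtration_sub 1 2] by (simp only: add_diff_eq)
qed

text \<open>No factor of \<open>ps\<close> has index \<open>Suc i\<close>, so \<open>fl\<close>
  commutes with the monomial and its Garland relation is available there. Multiplying by the power N
  + k of \<open>a0\<close> converts it into the relation for \<open>b\<close>, with k copies of
  \<open>a0\<close> left over and the nonzero factor \<open>C\<close>.\<close>

private lemma box_relation_zero:
  assumes "m i < N + a" "indices_le r ps" "\<forall>p\<in>set ps. fst p \<noteq> Suc i"
  shows "complete_op b N a ((a0 ^^ k) (umono n ps z)) \<in> filtration (N + k + length ps) (Suc (N * i + k * Suc i + index_sum ps))"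
proof -
  define q where "q = Suc (N * i + k * Suc i + index_sum ps)"
  define C where "C = (fact (N + k) / fact k :: complex)"
  have "complete_op fl N a z \<in> K"
    by (rule complete_op_highest[OF _ _ _ K z m assms(1)]) (use i r in auto)
  then have "umono n ps (complete_op fl N a z) \<in> K" by (rule mono_K[OF assms(2)])
  moreover have "complete_op fl N a (umono n ps z) = umono n ps (complete_op fl N a z)"
  proof (rule mono_commute[OF assms(2)])
    fix j s v assume j: "j \<in> {1..r}" "\<exists>u. (j, u) \<in> set ps"
    then have "j \<noteq> Suc i" using assms(3) by auto
    then have "e n j s (fl u x) = fl u (e n j s x)" for u x using levi_u[of "Suc i" i j u s x] i j by auto
    from complete_op_commute[of "e n j s" fl, OF lin_e this]
    show "complete_op fl N a (e n j s v) = e n j s (complete_op fl N a v)" by simp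
  qed
  ultimately have "complete_op fl N a (umono n ps z) \<in> K" by simp
  then have 1: "(a0 ^^ (N + k)) (complete_op fl N a (umono n ps z)) \<in> filtration (N + k + length ps) q"
  proof (intro K_filtration)
    have "(a0 ^^ j) v \<in> K" if "v \<in> K" for j v
      using that i r by (induction j) (auto intro!: stable_e[OF K])
    then show "complete_op fl N a (umono n ps z) \<in> K \<Longrightarrow> (a0 ^^ (N + k)) (complete_op fl N a (umono n ps z)) \<in> K" .
  qed
  have "(\<Sum>l\<in>compositions N a. (a0 ^^ (N + k)) (foldr fl l (umono n ps z)) - C *s foldr b l ((a0 ^^ k) (umono n ps z)))
    \<in> filtration (N + k + length ps) q"
  proof (rule subspace_sum[OF filtration_sub])
    fix l assume "l \<in> compositions N a"
    then have l: "length l = N" by (simp add: compositions_def)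
    show "(a0 ^^ (N + k)) (foldr fl l (umono n ps z)) - C *s foldr b l ((a0 ^^ k) (umono n ps z)) \<in> filtration (N + k + length ps) q"
      using straighten2[OF assms(2), of l "N + k" q] l by (simp add: q_def C_def algebra_simps)
  qed
  also have "(\<Sum>l\<in>compositions N a. (a0 ^^ (N + k)) (foldr fl l (umono n ps z)) - C *s foldr b l ((a0 ^^ k) (umono n ps z)))
    = (a0 ^^ (N + k)) (complete_op fl N a (umono n ps z)) - C *s complete_op b N a ((a0 ^^ k) (umono n ps z))"
    by (simp add: complete_op_compositions[OF lin_e] lin_sum[OF lin_funpow[OF lin_e]] sum_subtractf scale_sum_right)
  finally have "C *s complete_op b N a ((a0 ^^ k) (umono n ps z)) \<in> filtration (N + k + length ps) q"
    using subspace_diff[OF filtration_sub 1] by fastforce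
  then have "complete_op b N a ((a0 ^^ k) (umono n ps z)) \<in> filtration (N + k + length ps) q"
    by (rule subspace_scale_cancel[OF filtration_sub]) (simp add: C_def)
  then show ?thesis unfolding q_def .
qed

text \<open>The currents \<open>e (Suc i) (Suc i) s\<close> preserve \<open>filtration d q\<close> and generate all monomials in the
  \<open>e n (Suc i) s\<close> of a given length from the power of \<open>e n (Suc i) 0\<close>.\<close>

private lemma box_relation_higher_index:
  assumes "m i < N + a" "indices_le r ps" "\<forall>p\<in>set ps. fst p \<noteq> i"
  shows "complete_op b N a (umono n ps z) \<in> filtration (N + length ps) (Suc (N * i + index_sum ps))"
  using assms(2,3)
proof (induction "length (filter (\<lambda>p. fst p = Suc i \<and> snd p \<noteq> 0) ps)" arbitrary: ps rule: less_induct)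
  case less
  let ?nz = "\<lambda>ps. length (filter (\<lambda>p. fst p = Suc i \<and> snd p \<noteq> 0) ps)"
  let ?F = "\<lambda>ps. complete_op b N a (umono n ps z)"
  show ?case
  proof (cases "?nz ps = 0")
    case True
    define P where "P = (\<lambda>p :: nat \<times> nat. fst p = Suc i)"
    define k where "k = length (filter P ps)"
    define rest where "rest = filter (\<lambda>p. \<not> P p) ps"
    have "filter P ps = replicate k (Suc i, 0)"
      unfolding k_def using True by (intro replicate_eqI) (auto simp: P_def filter_empty_conv prod_eq_iff)
    moreover have "mset ps = mset (filter P ps @ rest)"
      unfolding rest_def by (simp add: multiset_partition)
    ultimately have ms: "mset ps = mset (replicate k (Suc i, 0) @ rest)" by simp
    have rest: "indices_le r rest" "\<forall>p\<in>set rest. fst p \<noteq> Suc i"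
      using less.prems(1) by (auto simp: rest_def P_def indices_le_def)
    have "?F ps = complete_op b N a ((a0 ^^ k) (umono n rest z))"
      unfolding a0_pow_mono using mono_perm[OF ms less.prems(1)] by simp
    also have "\<dots> \<in> filtration (N + k + length rest) (Suc (N * i + k * Suc i + index_sum rest))"
      by (rule box_relation_zero[OF assms(1) rest])
    finally show ?thesis
      using stats_perm(1,5)[OF ms] by (simp add: index_sum_replicate algebra_simps)
  next
    case False
    then obtain p where "p \<in> set ps" "fst p = Suc i" "snd p \<noteq> 0" by (auto simp: filter_empty_conv)
    then obtain s where s: "(Suc i, s) \<in> set ps" "s \<noteq> 0" by (metis prod.collapse)
    then obtain p1 p2 where "ps = p1 @ (Suc i, s) # p2" by (auto simp: in_set_conv_decomp)
    then have ms: "mset ps = mset ((Suc i, s) # (p1 @ p2))" by simp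
    define rest where "rest = p1 @ p2"
    have ms: "mset ps = mset ((Suc i, s) # rest)" using ms by (simp add: rest_def)
    have rest: "indices_le r rest" "\<forall>p\<in>set rest. fst p \<noteq> i"
      using less.prems mset_eq_setD[OF ms] by (auto simp: indices_le_def)
    have nz: "?nz ps = Suc (?nz rest)"
    proof -
      have "?nz ps = ?nz ((Suc i, s) # rest)"
        unfolding size_mset[symmetric] mset_filter ms ..
      then show ?thesis using s(2) by simp
    qed
    let ?d = "N + length ps" and ?q = "Suc (N * i + index_sum ps)"
    have dq: "?d = N + Suc (length rest)" "?q = Suc (N * i + (Suc i + index_sum rest))"
      using stats_perm(1,5)[OF ms] by auto
    have F: "?F qs \<in> filtration ?d ?q" if "?nz qs < ?nz ps" "indices_le r qs" "\<forall>p\<in>set qs. fst p \<noteq> i"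
      "length qs = length ps" "index_sum qs = index_sum ps" for qs
      using less.hyps[OF that(1-3)] that(4,5) by simp
    define T where "T = ?F ps"
    \<comment> \<open>Replacing the exponent \<open>s\<close> by 0 lowers the measure. The diagonal
      current of degree \<open>s\<close>, applied afterwards, gives back \<open>T\<close> and
      further terms in which another factor is raised.\<close>
    define ps1 where "ps1 = (Suc i, 0) # rest"
    have ps1: "?F ps1 \<in> filtration ?d ?q"
      using rest i nz less.prems dq by (intro F) (auto simp: ps1_def)
    have T1: "?F ((Suc i, s) # rest) = T"
      unfolding T_def using mono_perm[OF ms less.prems(1)] by simp
    \<comment> \<open>Raising another factor with exponent 0 gives a rearrangement of
      \<open>ps\<close>, hence \<open>T\<close> again. Raising a factor with nonzero exponent
      creates no new nonzero exponent, so the measure is still smaller than for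
      \<open>ps\<close>.\<close>
    have dich: "\<forall>qs\<in>set (replace_index (Suc i) (Suc i) s rest). ?F ((Suc i, 0) # qs) = T \<or> ?F ((Suc i, 0) # qs) \<in> filtration ?d ?q"
    proof
      fix qs assume qs: "qs \<in> set (replace_index (Suc i) (Suc i) s rest)"
      then obtain p1 u p2 where p: "rest = p1 @ (Suc i, u) # p2" "qs = p1 @ (Suc i, u + s) # p2"
        by (rule replace_index_cases)
      show "?F ((Suc i, 0) # qs) = T \<or> ?F ((Suc i, 0) # qs) \<in> filtration ?d ?q"
      proof (cases "u = 0")
        case True
        have "mset ps = mset ((Suc i, 0) # qs)" unfolding ms by (simp add: p True)
        from mono_perm[OF this less.prems(1)] show ?thesis by (simp add: T_def)
      next
        case False
        have "?F ((Suc i, 0) # qs) \<in> filtration ?d ?q"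
        proof (rule F)
          show "?nz ((Suc i, 0) # qs) < ?nz ps" unfolding nz using False by (simp add: p)
          show "indices_le r ((Suc i, 0) # qs)" using rest i by (auto simp: p)
          show "\<forall>x\<in>set ((Suc i, 0) # qs). fst x \<noteq> i" using rest(2) by (auto simp: p)
          show "length ((Suc i, 0) # qs) = length ps" "index_sum ((Suc i, 0) # qs) = index_sum ps"
            using stats_perm(1,5)[OF ms] by (auto simp: p)
        qed
        then show ?thesis ..
      qed
    qed
    obtain k where k: "sum_list (map (\<lambda>qs. ?F ((Suc i, 0) # qs)) (replace_index (Suc i) (Suc i) s rest)) - of_nat k *s T \<in> filtration ?d ?q"
      using sum_list_dichotomy[OF filtration_sub dich] by blast
    let ?h = "e (Suc i) (Suc i) s"
    have hb: "?h (b u x) = b u (?h x)" for u x using levi_u[of "Suc i" "Suc i" i s u x] i by auto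
    have L: "complete_op b N a (sum_list (map F L)) = sum_list (map (\<lambda>x. complete_op b N a (F x)) L)"
      for F :: "(nat \<times> nat) list \<Rightarrow> 'v" and L
      by (induction L) (auto simp: linD[OF lin_complete_op[OF lin_e]])
    have ps1_ok: "indices_le r ps1" using rest i by (auto simp: ps1_def)
    have "?h z \<in> K" using z s(2) i r by (auto simp: highest_def)
    then have "umono n ps1 (?h z) \<in> K" by (rule mono_K[OF ps1_ok])
    then have hK: "complete_op b N a (umono n ps1 (?h z)) \<in> K"
      by (rule complete_op_mem[OF stable_subspace[OF K], rotated]) (use i r in \<open>auto intro: stable_e[OF K]\<close>)
    have "?h (?F ps1) = complete_op b N a (?h (umono n ps1 z))"
      by (rule complete_op_commute[of ?h b, OF lin_e hb])
    also have "?h (umono n ps1 z) = umono n ps1 (?h z) - sum_list (map (\<lambda>qs. umono n qs z) (replace_index (Suc i) (Suc i) s ps1))"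
      using i by (intro levi_mono ps1_ok) auto
    also have "complete_op b N a \<dots> = complete_op b N a (umono n ps1 (?h z))
       - (T + sum_list (map (\<lambda>qs. ?F ((Suc i, 0) # qs)) (replace_index (Suc i) (Suc i) s rest)))"
      unfolding linD(5)[OF lin_complete_op[OF lin_e]] L T1[symmetric] by (simp add: ps1_def o_def)
    finally have eq: "?h (?F ps1) = complete_op b N a (umono n ps1 (?h z))
       - (T + sum_list (map (\<lambda>qs. ?F ((Suc i, 0) # qs)) (replace_index (Suc i) (Suc i) s rest)))" .
    have "?h (?F ps1) \<in> filtration ?d ?q" using ps1 i by (intro stable_e[OF filtration_stable]) auto
    from subspace_diff[OF filtration_sub K_filtration[OF hK] this]
    have "T + sum_list (map (\<lambda>qs. ?F ((Suc i, 0) # qs)) (replace_index (Suc i) (Suc i) s rest)) \<in> filtration ?d ?q"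
      unfolding eq by (simp add: add.commute)
    moreover have "x + y - (y - of_nat k *s x) = of_nat (Suc k) *s x" for x y
      by (simp add: scale_left_distrib)
    ultimately have "of_nat (Suc k) *s T \<in> filtration ?d ?q"
      using subspace_diff[OF filtration_sub _ k] by metis
    then have "T \<in> filtration ?d ?q" by (rule subspace_scale_cancel[OF filtration_sub]) (simp del: of_nat_Suc)
    then show ?thesis unfolding T_def .
  qed
qed

lemmas box_relation_lt = box_relation_higher_index

end

text \<open>For the last index i = r, the element \<open>e n r\<close> is itself a simple lowering
  operator of gl_n and commutes with all bottom row factors, so Garland's identity applies without
  errors.\<close>

lemma box_relation:
  assumes "i \<in> {1..r}" "m i < N + a" "indices_le r ps" "\<forall>p\<in>set ps. fst p \<noteq> i"
  shows "complete_op (e n i) N a (umono n ps z) \<in> filtration (N + length ps) (Suc (N * i + index_sum ps))"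
proof (cases "i < r")
  case True
  then show ?thesis using assms by (intro box_relation_lt) auto
next
  case False
  then have i: "i = r" using assms(1) by auto
  have "complete_op (e n i) N a z \<in> K"
    unfolding i by (rule complete_op_highest[OF _ _ _ K z m]) (use assms r i in auto)
  then have "umono n ps (complete_op (e n i) N a z) \<in> K" by (rule mono_K[OF assms(3)])
  moreover have "complete_op (e n i) N a (umono n ps z) = umono n ps (complete_op (e n i) N a z)"
    by (rule mono_commute[OF assms(3)], rule complete_op_commute[OF lin_e, symmetric])
      (use assms(1) in \<open>auto simp: u_commute\<close>)
  ultimately show ?thesis by (intro K_filtration) simp
qed

text \<open>An instance of \<open>box_reduction\<close> for the exponents at index \<open>i\<close>,
  with all other factors fixed. The diagonal currents \<open>e i i a\<close> supply closure under
  power sums, and \<open>box_relation\<close> supplies the complete sums. Boxes already attained at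
  other indices survive because their exponents and counts are untouched.\<close>

lemma box_step:
  assumes i: "i \<in> {1..r}" and ps: "indices_le r ps"
  shows "umono n ps z \<in> span ({umono n qs z | qs. indices_le r qs \<and> length qs = length ps \<and>
    index_sum qs = index_sum ps \<and> t_degree qs = t_degree ps \<and> boxed m i qs \<and>
    (\<forall>k. k \<noteq> i \<longrightarrow> boxed m k ps \<longrightarrow> boxed m k qs)} \<union> filtration (length ps) (Suc (index_sum ps)))"
proof -
  define l where "l = map snd (filter (\<lambda>p. fst p = i) ps)"
  define rest where "rest = filter (\<lambda>p. fst p \<noteq> i) ps"
  have "map (Pair i) l = filter (\<lambda>p. fst p = i) ps"
    unfolding l_def map_map o_def by (rule map_idI) (auto simp: prod_eq_iff)
  then have ms: "mset ps = mset (map (Pair i) l @ rest)" by (simp add: rest_def multiset_partition)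
  have rest: "indices_le r rest" "\<forall>p\<in>set rest. fst p \<noteq> i" using ps by (auto simp: rest_def indices_le_def)
  define N where "N = length l"
  define Psi where "Psi u = umono n (map (Pair i) u @ rest) z" for u
  have ok: "indices_le r (map (Pair i) u @ rest)" for u using rest i by (auto simp: indices_le_def)
  have mp: "index_sum (map (Pair i) u) = length u * i" "t_degree (map (Pair i) u) = sum_list u"
    "index_count k (map (Pair i) u) = (if k = i then length u else 0)" for u k
    by (induction u) auto
  have icount_i: "index_count i rest = 0" using rest(2) by (induction rest) auto
  define GG where "GG = filtration (length ps) (Suc (index_sum ps))"
  have GG: "GG = filtration (N + length rest) (Suc (N * i + index_sum rest))"
    unfolding GG_def N_def using stats_perm(1,5)[OF ms] mp by simp
  have psi: "umono n ps z = Psi l" unfolding Psi_def by (rule mono_perm[OF ms ps])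
  let ?A = "{umono n qs z | qs. indices_le r qs \<and> length qs = length ps \<and>
    index_sum qs = index_sum ps \<and> t_degree qs = t_degree ps \<and> boxed m i qs \<and>
    (\<forall>k. k \<noteq> i \<longrightarrow> boxed m k ps \<longrightarrow> boxed m k qs)}"
  have A: "Psi u \<in> ?A" if u: "length u = N" "sum_list u = sum_list l" "\<forall>s\<in>set u. s + N \<le> m i" for u
  proof -
    have "boxed m k (map (Pair i) u @ rest)" if "k \<noteq> i" "boxed m k ps" for k
    proof -
      have "index_count k ps = index_count k rest" using stats_perm(3)[OF ms, of k] mp that by simp
      moreover have "set rest \<subseteq> set ps" by (auto simp: rest_def)
      ultimately show ?thesis using that by (auto simp: boxed_def mp)
    qed
    moreover have "boxed m i (map (Pair i) u @ rest)"
      using u rest(2) by (auto simp: boxed_def mp icount_i)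
    ultimately show ?thesis unfolding Psi_def
      using ok[of u] stats_perm(1,2,5)[OF ms] u
      by (intro CollectI exI[of _ "map (Pair i) u @ rest"]) (auto simp: N_def mp)
  qed
  show ?thesis
  proof (cases N)
    case 0
    then have "Psi l \<in> ?A" by (intro A) (auto simp: N_def)
    then show ?thesis unfolding psi by (intro span_base) blast
  next
    case (Suc N')
    have "Psi l \<in> span ({Psi l' | l'. length l' = N \<and> sum_list l' = sum_list l \<and> (\<forall>s\<in>set l'. s + N \<le> m i)} \<union> GG)"
    proof (rule box_reduction[of GG N N' Psi "m i"])
      show "subspace GG" unfolding GG_def by (rule filtration_sub)
      show "N = Suc N'" by (rule Suc)
      show "symmetric_fun Psi" unfolding symmetric_fun_def Psi_def
        by (intro allI impI mono_perm ok) simp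
      show "length l = N" by (simp add: N_def)
    next
      fix a assume a: "m i < a + N"
      have "complete_op (e n i) N a (umono n rest z) \<in> GG"
        unfolding GG using a by (intro box_relation i rest) simp
      moreover have "foldr (e n i) u v = umono n (map (Pair i) u) v" for u v
        by (induction u) auto
      ultimately show "(\<Sum>l\<in>compositions N a. Psi l) \<in> GG"
        unfolding complete_op_compositions[OF lin_e] by (simp add: Psi_def)
    next
      fix g and a d :: nat assume a: "1 \<le> a" and g: "\<And>d. (\<Sum>l\<in>compositions N d. g l *s Psi l) \<in> GG"
      show "(\<Sum>l\<in>compositions N d. power_shift a g l *s Psi l) \<in> GG"
      proof (cases "a \<le> d")
        case False
        then have "(\<Sum>l\<in>compositions N d. power_shift a g l *s Psi l) = 0"
          by (intro sum.neutral) (auto simp: compositions_def power_shift_small)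
        then show ?thesis using subspace_0[OF filtration_sub] by (simp add: GG_def)
      next
        case True
        then obtain d' where d: "d = d' + a" by (metis add.commute le_Suc_ex)
        let ?h = "e i i a"
        have h: "?h (Psi u) + (\<Sum>l'\<leftarrow>raise_entry a u. Psi l') \<in> GG" for u
        proof -
          have "?h (Psi u) = umono n (map (Pair i) u @ rest) (?h z)
            - sum_list (map (\<lambda>qs. umono n qs z) (replace_index i i a (map (Pair i) u @ rest)))"
            unfolding Psi_def by (intro levi_mono i ok)
          also have "sum_list (map (\<lambda>qs. umono n qs z) (replace_index i i a (map (Pair i) u @ rest)))
            = (\<Sum>l'\<leftarrow>raise_entry a u. Psi l')"
            unfolding replace_index_map_Pair[OF rest(2)] Psi_def by (simp add: o_def)
          finally have "?h (Psi u) + (\<Sum>l'\<leftarrow>raise_entry a u. Psi l') = umono n (map (Pair i) u @ rest) (?h z)"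
            by simp
          moreover have "?h z \<in> K" using z a i r by (auto simp: highest_def)
          ultimately show ?thesis unfolding GG_def using K_filtration mono_K[OF ok] by metis
        qed
        have "(\<Sum>l\<in>compositions N d'. g l *s (?h (Psi l) + (\<Sum>l'\<leftarrow>raise_entry a l. Psi l'))) \<in> GG"
          unfolding GG_def by (intro subspace_sum[OF filtration_sub] subspace_scale[OF filtration_sub] h[unfolded GG_def])
        also have "(\<Sum>l\<in>compositions N d'. g l *s (?h (Psi l) + (\<Sum>l'\<leftarrow>raise_entry a l. Psi l')))
          = ?h (\<Sum>l\<in>compositions N d'. g l *s Psi l) + (\<Sum>l\<in>compositions N d. power_shift a g l *s Psi l)"
          unfolding d power_shift_dual[symmetric] by (simp add: scale_right_distrib sum.distrib e_lin)
        finally have *: "?h (\<Sum>l\<in>compositions N d'. g l *s Psi l) + (\<Sum>l\<in>compositions N d. power_shift a g l *s Psi l) \<in> GG" .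
        have "?h (\<Sum>l\<in>compositions N d'. g l *s Psi l) \<in> GG"
          using g[of d'] i unfolding GG_def by (intro stable_e[OF filtration_stable]) auto
        from subspace_diff[OF filtration_sub *[unfolded GG_def] this[unfolded GG_def]]
        show ?thesis unfolding GG_def by simp
      qed
    qed
    moreover have "{Psi l' | l'. length l' = N \<and> sum_list l' = sum_list l \<and> (\<forall>s\<in>set l'. s + N \<le> m i)} \<subseteq> ?A"
      using A by blast
    ultimately show ?thesis unfolding psi GG_def
      by (meson Un_mono order_refl span_mono subsetD)
  qed
qed

text \<open>The indices are treated one after another. Length and index sum do not change, so every
  error falls into the same step of the filtration.\<close>

lemma box_all:
  assumes "indices_le r ps"
  shows "umono n ps z \<in> span ({umono n qs z | qs. indices_le r qs \<and> length qs = length ps \<and>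
    index_sum qs = index_sum ps \<and> t_degree qs = t_degree ps \<and> (\<forall>k\<in>{1..r}. boxed m k qs)}
    \<union> filtration (length ps) (Suc (index_sum ps)))"
proof -
  define B where "B j = {umono n qs z | qs. indices_le r qs \<and> length qs = length ps \<and>
    index_sum qs = index_sum ps \<and> t_degree qs = t_degree ps \<and> (\<forall>k\<in>{1..j}. boxed m k qs)}" for j
  define GG where "GG = filtration (length ps) (Suc (index_sum ps))"
  have "umono n ps z \<in> span (B j \<union> GG)" if "j \<le> r" for j
    using that
  proof (induction j)
    case 0
    show ?case using assms by (intro span_base) (auto simp: B_def)
  next
    case (Suc j)
    have "B j \<union> GG \<subseteq> span (B (Suc j) \<union> GG)"
    proof
      fix v assume "v \<in> B j \<union> GG"
      then consider "v \<in> GG" | qs where "v = umono n qs z" "indices_le r qs" "length qs = length ps"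
        "index_sum qs = index_sum ps" "t_degree qs = t_degree ps" "\<forall>k\<in>{1..j}. boxed m k qs"
        by (auto simp: B_def)
      then show "v \<in> span (B (Suc j) \<union> GG)"
      proof cases
        case 1
        then show ?thesis by (intro span_base) simp
      next
        case 2
        have sj: "Suc j \<in> {1..r}" using Suc.prems by auto
        have "{umono n qs' z | qs'. indices_le r qs' \<and> length qs' = length qs \<and>
          index_sum qs' = index_sum qs \<and> t_degree qs' = t_degree qs \<and> boxed m (Suc j) qs' \<and>
          (\<forall>k. k \<noteq> Suc j \<longrightarrow> boxed m k qs \<longrightarrow> boxed m k qs')} \<subseteq> B (Suc j)"
        proof
          fix w assume "w \<in> {umono n qs' z | qs'. indices_le r qs' \<and> length qs' = length qs \<and>
          index_sum qs' = index_sum qs \<and> t_degree qs' = t_degree qs \<and> boxed m (Suc j) qs' \<and>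
          (\<forall>k. k \<noteq> Suc j \<longrightarrow> boxed m k qs \<longrightarrow> boxed m k qs')}"
          then obtain qs' where q: "w = umono n qs' z" "indices_le r qs'" "length qs' = length qs"
          "index_sum qs' = index_sum qs" "t_degree qs' = t_degree qs" "boxed m (Suc j) qs'"
          "\<forall>k. k \<noteq> Suc j \<longrightarrow> boxed m k qs \<longrightarrow> boxed m k qs'" by blast
          have "\<forall>k\<in>{1..Suc j}. boxed m k qs'"
          proof
            fix k assume "k \<in> {1..Suc j}"
            then show "boxed m k qs'" using q(6,7) 2(6) by (cases "k = Suc j") auto
          qed
          then show "w \<in> B (Suc j)" using q 2 unfolding B_def by auto
        qed
        with box_step[OF sj 2(2)] show ?thesis
          unfolding 2(1) GG_def 2(3,4) by (meson Un_mono order_refl span_mono subsetD)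
      qed
    qed
    then have "span (B j \<union> GG) \<subseteq> span (B (Suc j) \<union> GG)"
      by (rule span_minimal) simp
    then show ?case using Suc by auto
  qed
  from this[of r] show ?thesis by (simp add: B_def GG_def)
qed

text \<open>The right side is shown to be stable under all of gl_n[t]. The order of the three checks
  matters: for the corner \<open>e n n\<close> the brackets with bottom row factors return to the
  bottom row, and for the last column \<open>e i n\<close> they lead to gl_r and the corner.\<close>

lemma gen_levi: "gen n (insert z K) \<subseteq> gen r (K \<union> {umono n ps z | ps. indices_le r ps})"
proof -
  define T where "T = gen r (K \<union> {umono n ps z | ps. indices_le r ps})"
  have sT: "stable r T" unfolding T_def by (rule stable_gen)
  note subT = stable_subspace[OF sT]
  have KT: "v \<in> T" if "v \<in> K" for v using that unfolding T_def by (intro subsetD[OF gen_superset] UnI1)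
  have uT: "umono n ps z \<in> T" if "indices_le r ps" for ps
    using that unfolding T_def by (intro subsetD[OF gen_superset] UnI2 CollectI exI[of _ ps] conjI refl)
  have KT': "e a b s x \<in> T" if "x \<in> K" "a \<in> {1..n}" "b \<in> {1..n}" for a b s x
    by (intro KT stable_e[OF K] that)
  note gi = gen_induct[of _ r "K \<union> {umono n ps z | ps. indices_le r ps}", folded T_def]
  have one: "v \<in> T \<and> (\<forall>j\<in>{1..r}. \<forall>s. e n j s v \<in> T)" if "v \<in> T" for v
    using that
  proof (rule gi)
    fix x assume "x \<in> K \<union> {umono n ps z | ps. indices_le r ps}"
    then consider "x \<in> K" | ps where "x = umono n ps z" "indices_le r ps" by blast
    then show "x \<in> T \<and> (\<forall>j\<in>{1..r}. \<forall>s. e n j s x \<in> T)"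
    proof cases
      case 1
      then show ?thesis using r by (auto intro: KT KT')
    next
      case 2
      have "e n j s x \<in> T" if "j \<in> {1..r}" for j s using uT[of "(j, s) # ps"] 2 that by simp
      then show ?thesis using 2 uT by blast
    qed
  next
    show "stable r {v. v \<in> T \<and> (\<forall>j\<in>{1..r}. \<forall>s. e n j s v \<in> T)}"
      unfolding stable_def
    proof (intro conjI ballI allI)
      show "subspace {v. v \<in> T \<and> (\<forall>j\<in>{1..r}. \<forall>s. e n j s v \<in> T)}"
        by (rule subspace_preimage[OF subT, of _ "\<lambda>_. n" "\<lambda>j. j"])
      fix a b u v assume ab: "a \<in> {1..r}" "b \<in> {1..r}" and v: "v \<in> {v. v \<in> T \<and> (\<forall>j\<in>{1..r}. \<forall>s. e n j s v \<in> T)}"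
      have "e n j s (e a b u v) \<in> T" if j: "j \<in> {1..r}" for j s
      proof -
        have "e n j s (e a b u v) = e a b u (e n j s v) + (if a = j then e n b (u + s) v else 0)"
          using levi_u[OF ab j, of u s v] by simp
        moreover have "e a b u (e n j s v) \<in> T" by (rule stable_e[OF sT ab]) (use v j in blast)
        moreover have "(if a = j then e n b (u + s) v else 0) \<in> T" using v ab(2) subspace_0[OF subT] by simp
        ultimately show ?thesis using subspace_add[OF subT] by simp
      qed
      then show "e a b u v \<in> {v. v \<in> T \<and> (\<forall>j\<in>{1..r}. \<forall>s. e n j s v \<in> T)}"
        using v ab stable_e[OF sT] by auto
    qed
  qed
  have 2: "v \<in> T \<and> (\<forall>j\<in>{n}. \<forall>s. e n n s v \<in> T)" if "v \<in> T" for v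
    using that
  proof (rule gi)
    fix x assume "x \<in> K \<union> {umono n ps z | ps. indices_le r ps}"
    then consider "x \<in> K" | ps where "x = umono n ps z" "indices_le r ps" by blast
    then show "x \<in> T \<and> (\<forall>j\<in>{n}. \<forall>s. e n n s x \<in> T)"
    proof cases
      case 1
      then show ?thesis using r by (auto intro: KT KT')
    next
      case 2
      have "e n n s (umono n ps z) \<in> T" for s
        using 2(2)
      proof (induction ps)
        case Nil
        show ?case
        proof (cases "s = 0")
          case True
          have "e n n 0 z - (of_int (lam n) + c) *s z \<in> T" using z by (intro KT) (auto simp: highest_def)
          moreover have "(of_int (lam n) + c) *s z \<in> T" using uT[of "[]"] by (intro subspace_scale[OF subT]) simp
          ultimately show ?thesis using subspace_add[OF subT] True by fastforce
        next
          case False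
          then show ?thesis using z by (auto simp: highest_def intro!: KT)
        qed
      next
        case (Cons p ps)
        have "e n n s (umono n (p # ps) z) = e n (fst p) (snd p) (e n n s (umono n ps z)) + umono n ((fst p, s + snd p) # ps) z"
          using Cons.prems r e_bracket[of n n n "fst p" s "snd p" "umono n ps z"] by simp
        moreover have "e n (fst p) (snd p) (e n n s (umono n ps z)) \<in> T" using one[OF Cons.IH] Cons.prems by simp
        moreover have "umono n ((fst p, s + snd p) # ps) z \<in> T" using Cons.prems by (intro uT) simp
        ultimately show ?case using subspace_add[OF subT] by simp
      qed
      then show ?thesis using 2 uT by blast
    qed
  next
    show "stable r {v. v \<in> T \<and> (\<forall>j\<in>{n}. \<forall>s. e n n s v \<in> T)}"
      unfolding stable_def
    proof (intro conjI ballI allI)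
      show "subspace {v. v \<in> T \<and> (\<forall>j\<in>{n}. \<forall>s. e n n s v \<in> T)}"
        by (rule subspace_preimage[OF subT, of _ "\<lambda>_. n" "\<lambda>j. n"])
      fix a b u v assume ab: "a \<in> {1..r}" "b \<in> {1..r}" and v: "v \<in> {v. v \<in> T \<and> (\<forall>j\<in>{n}. \<forall>s. e n n s v \<in> T)}"
      have "e n n s (e a b u v) = e a b u (e n n s v)" for s
        using ab r e_bracket[of n n a b s u v] by simp
      then show "e a b u v \<in> {v. v \<in> T \<and> (\<forall>j\<in>{n}. \<forall>s. e n n s v \<in> T)}"
        using v ab stable_e[OF sT] by auto
    qed
  qed
  note two = 2
  have 3: "v \<in> T \<and> (\<forall>i\<in>{1..r}. \<forall>s. e i n s v \<in> T)" if "v \<in> T" for v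
    using that
  proof (rule gi)
    fix x assume "x \<in> K \<union> {umono n ps z | ps. indices_le r ps}"
    then consider "x \<in> K" | ps where "x = umono n ps z" "indices_le r ps" by blast
    then show "x \<in> T \<and> (\<forall>i\<in>{1..r}. \<forall>s. e i n s x \<in> T)"
    proof cases
      case 1
      then show ?thesis using r by (auto intro: KT KT')
    next
      case 2
      have "e i n s (umono n ps z) \<in> T" if i: "i \<in> {1..r}" for i s
        using 2(2)
      proof (induction ps)
        case Nil
        show ?case using z i by (auto simp: highest_def intro!: KT)
      next
        case (Cons p ps)
        have "e i n s (umono n (p # ps) z) = e n (fst p) (snd p) (e i n s (umono n ps z))
          + e i (fst p) (s + snd p) (umono n ps z) - (if i = fst p then e n n (s + snd p) (umono n ps z) else 0)"
          using Cons.prems r i e_bracket[of i n n "fst p" s "snd p" "umono n ps z"] by simp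
        moreover have "e n (fst p) (snd p) (e i n s (umono n ps z)) \<in> T" using one[OF Cons.IH] Cons.prems by simp
        moreover have u: "umono n ps z \<in> T" using Cons.prems by (intro uT) simp
        moreover have "e i (fst p) (s + snd p) (umono n ps z) \<in> T"
          by (rule stable_e[OF sT i _ u]) (use Cons.prems in simp)
        moreover have "(if i = fst p then e n n (s + snd p) (umono n ps z) else 0) \<in> T"
          using two[OF u] subspace_0[OF subT] by simp
        ultimately show ?case using subspace_add[OF subT] subspace_diff[OF subT] by simp
      qed
      then show ?thesis using 2 uT by blast
    qed
  next
    show "stable r {v. v \<in> T \<and> (\<forall>i\<in>{1..r}. \<forall>s. e i n s v \<in> T)}"
      unfolding stable_def
    proof (intro conjI ballI allI)
      show "subspace {v. v \<in> T \<and> (\<forall>i\<in>{1..r}. \<forall>s. e i n s v \<in> T)}"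
        by (rule subspace_preimage[OF subT, of _ "\<lambda>i. i" "\<lambda>_. n"])
      fix a b u v assume ab: "a \<in> {1..r}" "b \<in> {1..r}" and v: "v \<in> {v. v \<in> T \<and> (\<forall>i\<in>{1..r}. \<forall>s. e i n s v \<in> T)}"
      have "e i n s (e a b u v) \<in> T" if i: "i \<in> {1..r}" for i s
      proof -
        have "e i n s (e a b u v) = e a b u (e i n s v) - (if i = b then e a n (s + u) v else 0)"
          using ab r i e_bracket[of i n a b s u v] by simp
        moreover have "e a b u (e i n s v) \<in> T" by (rule stable_e[OF sT ab]) (use v i in blast)
        moreover have "(if i = b then e a n (s + u) v else 0) \<in> T" using v ab(1) subspace_0[OF subT] by simp
        ultimately show ?thesis using subspace_diff[OF subT] by simp
      qed
      then show "e a b u v \<in> {v. v \<in> T \<and> (\<forall>i\<in>{1..r}. \<forall>s. e i n s v \<in> T)}"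
        using v ab stable_e[OF sT] by auto
    qed
  qed
  have "stable n T"
    unfolding stable_def
  proof (intro conjI ballI allI)
    fix a b s v assume ab: "a \<in> {1..n}" "b \<in> {1..n}" and v: "v \<in> T"
    consider "a \<in> {1..r}" "b \<in> {1..r}" | "a = n" "b \<in> {1..r}" | "a = n" "b = n" | "a \<in> {1..r}" "b = n"
      using ab by fastforce
    then show "e a b s v \<in> T"
      by cases (use one[OF v] two[OF v] 3[OF v] stable_e[OF sT _ _ v] in auto)
  qed (rule subT)
  then show ?thesis unfolding T_def[symmetric] using KT uT[of "[]"]
    by (intro gen_minimal) auto
qed

text \<open>The bracket \<open>D\<close> of the lowering operator with a bottom row factor commutes
  with the lowering operator again, so each factor raises the nilpotency exponent by at most
  one.\<close>

lemma nilpotent_umono: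
  assumes "1 \<le> i" "i < r" "indices_le r ps"
  shows "\<exists>N. (e (Suc i) i 0 ^^ N) (umono n ps z) \<in> K"
  using assms(3)
proof (induction ps)
  case Nil
  then show ?case using z assms by (auto simp: highest_def)
next
  case (Cons p ps)
  let ?f = "e (Suc i) i 0" and ?j = "fst p" and ?s = "snd p"
  define D where "D v = (if Suc i = ?j then e n i ?s v else 0)" for v
  have fX: "?f (e n ?j ?s y) = e n ?j ?s (?f y) - D y" for y
    using assms Cons.prems levi_u[of "Suc i" i ?j 0 ?s y] by (simp add: D_def)
  have fD: "?f (D y) = D (?f y)" for y
  proof -
    have "?f (e n i ?s y) = e n i ?s (?f y)" using assms levi_u[of "Suc i" i i 0 ?s y] by simp
    then show ?thesis unfolding D_def by (cases "Suc i = ?j") (simp_all only: if_True if_False e_lin simp_thms)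
  qed
  have "(?f ^^ N) (e n ?j ?s x) = e n ?j ?s ((?f ^^ N) x) - of_nat N *s D ((?f ^^ (N - 1)) x)" for N x
  proof (induction N)
    case (Suc N)
    have "of_nat N *s D (?f ((?f ^^ (N - 1)) x)) = of_nat N *s D ((?f ^^ N) x)" by (cases N) auto
    then show ?case unfolding funpow.simps o_apply Suc e_lin fX fD
      by (simp add: scale_left_distrib diff_diff_eq2 diff_add_eq)
  qed simp
  note pow = this
  obtain N where N: "(?f ^^ N) (umono n ps z) \<in> K" using Cons by auto
  note sK = stable_subspace[OF K]
  have "?f v \<in> K" if "v \<in> K" for v using that assms r by (intro stable_e[OF K]) auto
  then have N1: "(?f ^^ Suc N) (umono n ps z) \<in> K" using N by simp
  have u: "e n j s v \<in> K" if "v \<in> K" "j \<in> {1..r}" for j s v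
    using that by (intro stable_e[OF K]) auto
  have 1: "e n ?j ?s ((?f ^^ Suc N) (umono n ps z)) \<in> K" using Cons.prems by (intro u N1) auto
  have 2: "D ((?f ^^ N) (umono n ps z)) \<in> K"
  proof -
    have "e n i ?s ((?f ^^ N) (umono n ps z)) \<in> K" using assms(1,2) by (intro u N) auto
    then show ?thesis unfolding D_def using subspace_0[OF sK] by (simp only: simp_thms split: if_split)
  qed
  have "(?f ^^ Suc N) (umono n (p # ps) z)
    = e n ?j ?s ((?f ^^ Suc N) (umono n ps z)) - of_nat (Suc N) *s D ((?f ^^ N) (umono n ps z))"
  proof -
    have "umono n (p # ps) z = e n ?j ?s (umono n ps z)" by simp
    moreover have "Suc N - 1 = N" by simp
    ultimately show ?thesis using pow[of "Suc N" "umono n ps z"] by metis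
  qed
  then have "(?f ^^ Suc N) (umono n (p # ps) z) \<in> K"
    using subspace_diff[OF sK 1 subspace_scale[OF sK 2]] by (simp only:)
  then show ?case by blast
qed

text \<open>Raising operators increase the index sum and diagonal currents of positive degree
  increase the t-degree; \<open>K'\<close> contains the monomials reached in both ways. The diagonal
  elements of degree zero reproduce the monomial once for each factor of their index, with a minus
  sign, which shifts the weight.\<close>

lemma highest_umono:
  assumes ps: "indices_le r ps" and K': "stable r K'" "filtration (length ps) (Suc (index_sum ps)) \<subseteq> K'"
    and deg: "\<And>qs. indices_le r qs \<Longrightarrow> length qs = length ps \<Longrightarrow> index_sum qs = index_sum ps \<Longrightarrow>
      t_degree ps < t_degree qs \<Longrightarrow> umono n qs z \<in> K'"
  shows "highest r (\<lambda>i. lam i - int (index_count i ps)) c K' (umono n ps z)"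
proof -
  note sK' = stable_subspace[OF K'(1)]
  have KK: "v \<in> K'" if "v \<in> K" for v using K'(2) K_filtration[OF that] by blast
  have "e a b s (umono n ps z) \<in> K'" if ab: "1 \<le> a" "a < b" "b \<le> r" for a b s
  proof -
    have abr: "a \<in> {1..r}" "b \<in> {1..r}" using ab by auto
    have "e a b s z \<in> K" using z ab by (auto simp: highest_def)
    then have "umono n ps (e a b s z) \<in> K'" by (intro KK mono_K[OF ps])
    moreover have "umono n qs z \<in> K'" if "qs \<in> set (replace_index a b s ps)" for qs
    proof -
      note st = replace_index_stats[OF that]
      have "umono n qs z \<in> filtration (length ps) (Suc (index_sum ps))"
        using st(1,2) st(4)[OF ps abr(2)] ab by (intro mono_filtration) auto
      then show ?thesis using K'(2) by blast
    qed
    ultimately show ?thesis unfolding levi_mono[OF abr ps]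
      by (intro subspace_diff[OF sK'] sum_list_mem[OF sK']) auto
  qed
  moreover have "e a a s (umono n ps z) \<in> K'" if a: "1 \<le> a" "a \<le> r" "0 < s" for a s
  proof -
    have ar: "a \<in> {1..r}" using a by auto
    have "e a a s z \<in> K" using z a by (auto simp: highest_def)
    then have "umono n ps (e a a s z) \<in> K'" by (intro KK mono_K[OF ps])
    moreover have "umono n qs z \<in> K'" if "qs \<in> set (replace_index a a s ps)" for qs
      using replace_index_stats[OF that] a ps ar by (intro deg) auto
    ultimately show ?thesis unfolding levi_mono[OF ar ar ps]
      by (intro subspace_diff[OF sK'] sum_list_mem[OF sK']) auto
  qed
  moreover have "e a a 0 (umono n ps z) - (of_int (lam a - int (index_count a ps)) + c) *s umono n ps z \<in> K'"
    if a: "1 \<le> a" "a \<le> r" for a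
  proof -
    have ar: "a \<in> {1..r}" using a by auto
    have "e a a 0 z - (of_int (lam a) + c) *s z \<in> K" using z a by (auto simp: highest_def)
    then have "umono n ps (e a a 0 z - (of_int (lam a) + c) *s z) \<in> K'" by (intro KK mono_K[OF ps])
    moreover have "sum_list (replicate k v) = of_nat k *s v" for k v
      by (induction k) (auto simp: scale_left_distrib)
    ultimately show ?thesis unfolding levi_mono[OF ar ar ps] replace_index_same
      by (simp add: linD[OF lin_mono] scale_left_distrib scale_left_diff_distrib algebra_simps)
  qed
  moreover have "\<exists>N. (e (Suc i) i 0 ^^ N) (umono n ps z) \<in> K'" if "1 \<le> i" "i < r" for i
    using nilpotent_umono[OF that ps] KK by blast
  ultimately show ?thesis unfolding highest_def by blast
qed

text \<open>Each step of the filtration is refined by the t-degree. Modulo the next refined piece a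
  boxed monomial is a highest weight vector for gl_r, and \<open>IH\<close> spans what it generates.
  Both descending inductions terminate: index sums are at most r * d, and boxed exponents are
  bounded.\<close>

lemma filtration_span:
  assumes IH: "\<And>lam' K' z'. stable r K' \<Longrightarrow> highest r lam' c K' z' \<Longrightarrow> (\<forall>i\<in>{1..<r}. lam' (Suc i) \<le> lam' i) \<Longrightarrow>
    gen r (insert z' K') \<subseteq> span (pop_vectors (r - 1) lam' z' \<union> K')"
  shows "gen n (insert z K) \<subseteq> span ((\<Union>ps\<in>{ps. indices_le r ps \<and> (\<forall>i\<in>{1..r}. boxed m i ps)}.
    pop_vectors (r - 1) (\<lambda>i. lam i - int (index_count i ps)) (umono n ps z)) \<union> K)"
proof -
  define A where "A = (\<Union>ps\<in>{ps. indices_le r ps \<and> (\<forall>i\<in>{1..r}. boxed m i ps)}.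
    pop_vectors (r - 1) (\<lambda>i. lam i - int (index_count i ps)) (umono n ps z))"
  define W where "W = span (A \<union> K)"
  have sW: "subspace W" by (simp add: W_def)
  have KW: "K \<subseteq> W" unfolding W_def using span_superset by blast
  define M where "M = (\<Sum>i\<in>{1..r}. m i)"
  have mM: "m i \<le> M" if "i \<in> {1..r}" for i unfolding M_def using that by (intro member_le_sum) auto
  have GW: "filtration d q \<subseteq> W" for d q
  proof (induction "Suc (r * d) - q" arbitrary: q)
    case 0
    have "{umono n ps z | ps. indices_le r ps \<and> length ps = d \<and> q \<le> index_sum ps} = {}"
      using 0 index_sum_le[of r] by fastforce
    then have "filtration d q \<subseteq> K" unfolding filtration_def using K by (intro gen_minimal) (auto intro: stable_mono)
    then show ?case using KW by blast
  next
    case (Suc x)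
    have G1: "filtration d (Suc q) \<subseteq> W" using Suc by (intro Suc(1)) auto
    \<comment> \<open>The pieces between \<open>filtration d (Suc q)\<close> and
      \<open>filtration d q\<close>. As gl_r-submodules generated by monomials they can serve as
      \<open>K'\<close> in \<open>highest_umono\<close>.\<close>
    define H where "H t = gen r (filtration d (Suc q) \<union> {umono n ps z | ps. indices_le r ps \<and> length ps = d \<and>
      index_sum ps = q \<and> t \<le> t_degree ps})" for t
    have sH: "stable r (H t)" for t unfolding H_def by (rule stable_gen)
    have GH: "filtration d (Suc q) \<subseteq> H t" for t unfolding H_def using gen_superset by blast
    have uH: "umono n ps z \<in> H t" if "indices_le r ps" "length ps = d" "index_sum ps = q" "t \<le> t_degree ps" for ps t
      unfolding H_def using that by (intro subsetD[OF gen_superset] UnI2 CollectI exI[of _ ps] conjI refl)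
    have HW: "H t \<subseteq> W" for t
    proof (induction "Suc (d * M) - t" arbitrary: t)
      \<comment> \<open>Above t-degree \<open>d * M\<close> there is no boxed monomial with
        \<open>d\<close> factors, so \<open>box_all\<close> sends every monomial to the next step of
        the filtration.\<close>
      case 0
      have "umono n ps z \<in> filtration d (Suc q)" if ps: "indices_le r ps" "length ps = d" "index_sum ps = q" "t \<le> t_degree ps" for ps
      proof -
        have "{umono n qs z | qs. indices_le r qs \<and> length qs = length ps \<and>
          index_sum qs = index_sum ps \<and> t_degree qs = t_degree ps \<and> (\<forall>k\<in>{1..r}. boxed m k qs)} = {}"
        proof -
          have False if qs: "indices_le r qs" "length qs = length ps" "t_degree qs = t_degree ps" "\<forall>k\<in>{1..r}. boxed m k qs" for qs
          proof -
            have "\<forall>p\<in>set qs. snd p \<le> M"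
            proof
              fix p assume p: "p \<in> set qs"
              then have k: "fst p \<in> {1..r}" using qs(1) by (auto simp: indices_le_def)
              then have "snd p \<le> m (fst p)" using qs(4) p unfolding boxed_def by (metis add_leD1 prod.collapse)
              then show "snd p \<le> M" using mM[OF k] by simp
            qed
            from t_degree_le[OF this] show False using qs ps 0 by simp
          qed
          then show ?thesis by blast
        qed
        then have "umono n ps z \<in> span (filtration d (Suc q))" using box_all[OF ps(1)] ps by (simp only: Un_empty_left)
        moreover have "span (filtration d (Suc q)) = filtration d (Suc q)" using filtration_sub by (rule span_eq_iff[THEN iffD2])
        ultimately show ?thesis by (simp only:)
      qed
      then have "H t \<subseteq> filtration d (Suc q)" unfolding H_def by (intro gen_minimal filtration_stable) blast
      then show ?case using G1 by blast
    next
      case (Suc x)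
      have H1: "H (Suc t) \<subseteq> W" using Suc by (intro Suc(1)) auto
      define BB where "BB = {ps. indices_le r ps \<and> length ps = d \<and> index_sum ps = q \<and> t_degree ps = t \<and> (\<forall>k\<in>{1..r}. boxed m k ps)}"
      define F where "F = insert (H (Suc t)) ((\<lambda>ps. gen r (insert (umono n ps z) (H (Suc t)))) ` BB)"
      have sF: "stable r (span (\<Union>F))"
        by (rule stable_span_Union) (auto simp: F_def sH stable_gen)
      have "gen r (insert (umono n ps z) (H (Suc t))) \<subseteq> W" if "ps \<in> BB" for ps
      proof -
        have ps: "indices_le r ps" "length ps = d" "index_sum ps = q" "t_degree ps = t" "\<forall>k\<in>{1..r}. boxed m k ps"
          using that by (auto simp: BB_def)
        have "gen r (insert (umono n ps z) (H (Suc t))) \<subseteq>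
          span (pop_vectors (r - 1) (\<lambda>i. lam i - int (index_count i ps)) (umono n ps z) \<union> H (Suc t))"
        proof (rule IH[OF sH])
          show "highest r (\<lambda>i. lam i - int (index_count i ps)) c (H (Suc t)) (umono n ps z)"
            by (rule highest_umono[OF ps(1) sH]) (use GH[of "Suc t"] ps in \<open>auto intro: uH\<close>)
          show "\<forall>i\<in>{1..<r}. lam (Suc i) - int (index_count (Suc i) ps) \<le> lam i - int (index_count i ps)"
          proof
            fix i assume i: "i \<in> {1..<r}"
            then have "index_count i ps \<le> m i" using ps(5) by (intro boxed_index_count) auto
            then show "lam (Suc i) - int (index_count (Suc i) ps) \<le> lam i - int (index_count i ps)"
              using m[of i] i by auto
          qed
        qed
        also have "\<dots> \<subseteq> W"
        proof (rule span_minimal[OF _ sW])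
          have "pop_vectors (r - 1) (\<lambda>i. lam i - int (index_count i ps)) (umono n ps z) \<subseteq> A"
            unfolding A_def using ps by blast
          then show "pop_vectors (r - 1) (\<lambda>i. lam i - int (index_count i ps)) (umono n ps z) \<union> H (Suc t) \<subseteq> W"
            using H1 span_superset[of "A \<union> K"] unfolding W_def by blast
        qed
        finally show ?thesis .
      qed
      then have FW: "span (\<Union>F) \<subseteq> W" using H1 by (intro span_minimal sW) (auto simp: F_def)
      have G1F: "filtration d (Suc q) \<subseteq> span (\<Union>F)"
        using GH[of "Suc t"] span_superset[of "\<Union>F"] unfolding F_def by blast
      have "umono n ps z \<in> span (\<Union>F)" if ps: "indices_le r ps" "length ps = d" "index_sum ps = q" "t \<le> t_degree ps" for ps
      proof (cases "t_degree ps = t")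
        case True
        have "{umono n qs z | qs. indices_le r qs \<and> length qs = length ps \<and>
          index_sum qs = index_sum ps \<and> t_degree qs = t_degree ps \<and> (\<forall>k\<in>{1..r}. boxed m k qs)} \<subseteq> span (\<Union>F)"
        proof
          fix w assume "w \<in> {umono n qs z | qs. indices_le r qs \<and> length qs = length ps \<and>
            index_sum qs = index_sum ps \<and> t_degree qs = t_degree ps \<and> (\<forall>k\<in>{1..r}. boxed m k qs)}"
          then obtain qs where qs: "w = umono n qs z" "qs \<in> BB" using ps True by (auto simp: BB_def)
          then have "w \<in> gen r (insert (umono n qs z) (H (Suc t)))" using gen_superset by blast
          then show "w \<in> span (\<Union>F)" using qs by (intro span_base) (auto simp: F_def)
        qed
        then have "span ({umono n qs z | qs. indices_le r qs \<and> length qs = length ps \<and>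
          index_sum qs = index_sum ps \<and> t_degree qs = t_degree ps \<and> (\<forall>k\<in>{1..r}. boxed m k qs)}
          \<union> filtration (length ps) (Suc (index_sum ps))) \<subseteq> span (\<Union>F)"
          using G1F ps by (intro span_minimal) auto
        then show ?thesis using box_all[OF ps(1)] by blast
      next
        case False
        then have "umono n ps z \<in> H (Suc t)" using ps by (intro uH) auto
        then show ?thesis by (intro span_base) (auto simp: F_def)
      qed
      then have "H t \<subseteq> span (\<Union>F)" unfolding H_def using G1F by (intro gen_minimal sF) blast
      then show ?case using FW by blast
    qed
    have "filtration d q \<subseteq> H 0"
      unfolding filtration_def
    proof (rule gen_minimal[OF _ sH])
      have "umono n ps z \<in> H 0" if ps: "indices_le r ps" "length ps = d" "q \<le> index_sum ps" for ps
      proof (cases "index_sum ps = q")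
        case True
        then show ?thesis using ps by (intro uH) auto
      next
        case False
        then have "umono n ps z \<in> filtration d (Suc q)" using ps by (intro mono_filtration) auto
        then show ?thesis using GH by blast
      qed
      moreover have "K \<subseteq> H 0" using GH[of 0] K_filtration by blast
      ultimately show "K \<union> {umono n ps z | ps. indices_le r ps \<and> length ps = d \<and> q \<le> index_sum ps} \<subseteq> H 0"
        by blast
    qed
    then show ?case using HW by blast
  qed
  define F where "F = range (\<lambda>d. filtration d 0)"
  have "gen r (K \<union> {umono n ps z | ps. indices_le r ps}) \<subseteq> span (\<Union>F)"
  proof (rule gen_minimal)
    show "stable r (span (\<Union>F))" by (rule stable_span_Union) (auto simp: F_def filtration_stable)
    have "umono n ps z \<in> span (\<Union>F)" if "indices_le r ps" for ps
      using mono_filtration[OF that refl, of 0] by (intro span_base) (auto simp: F_def)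
    moreover have "v \<in> span (\<Union>F)" if "v \<in> K" for v
      using K_filtration[OF that, of 0 0] by (intro span_base) (auto simp: F_def)
    ultimately show "K \<union> {umono n ps z | ps. indices_le r ps} \<subseteq> span (\<Union>F)" by blast
  qed
  moreover have "span (\<Union>F) \<subseteq> W" using GW by (intro span_minimal sW) (auto simp: F_def)
  ultimately show ?thesis using gen_levi unfolding W_def A_def by blast
qed

end

end

text \<open>Induction on the rank, with \<open>K\<close>, \<open>lam\<close> and \<open>z\<close>
  arbitrary since the step uses them for submodules of the filtration. At the bottom, gl_1[t] acts
  on \<open>z\<close> by a scalar modulo \<open>K\<close>.\<close>

theorem gen_subset_span_pop_vectors:
  assumes "Suc r \<le> n0" "stable (Suc r) K" "highest (Suc r) lam c K z" "\<forall>i\<in>{1..r}. lam (Suc i) \<le> lam i"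
  shows "gen (Suc r) (insert z K) \<subseteq> span (pop_vectors r lam z \<union> K)"
  using assms
proof (induction r arbitrary: lam K z)
  case 0
  show ?case
  proof (rule gen_minimal)
    show "insert z K \<subseteq> span (pop_vectors 0 lam z \<union> K)" using span_superset by fastforce
    show "stable (Suc 0) (span (pop_vectors 0 lam z \<union> K))"
    proof (rule stable_span)
      fix v a b s assume v: "v \<in> pop_vectors 0 lam z \<union> K" and ab: "a \<in> {1..Suc 0}" "b \<in> {1..Suc 0}"
      then have ab': "a = 1" "b = 1" by auto
      have "e 1 1 s z \<in> span ({z} \<union> K)"
      proof (cases "s = 0")
        case True
        have "e 1 1 0 z - (of_int (lam 1) + c) *s z \<in> span ({z} \<union> K)"
          using 0(3) by (intro span_base) (auto simp: highest_def)
        moreover have "(of_int (lam 1) + c) *s z \<in> span ({z} \<union> K)"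
          by (intro span_scale span_base) simp
        ultimately show ?thesis using span_add True by fastforce
      next
        case False
        then show ?thesis using 0(3) by (intro span_base) (auto simp: highest_def)
      qed
      moreover have "e 1 1 s x \<in> span ({z} \<union> K)" if "x \<in> K" for x
        using that 0(2) by (intro span_base) (auto intro: stable_e)
      ultimately show "e a b s v \<in> span (pop_vectors 0 lam z \<union> K)" using v ab' by auto
    qed
  qed
next
  case (Suc r)
  have m: "lam i - lam (Suc i) = int (nat (lam i - lam (Suc i)))" if "i \<in> {1..Suc r}" for i
    using Suc.prems(4) that by auto
  have "gen (Suc r) (insert z' K') \<subseteq> span (pop_vectors (Suc r - 1) lam' z' \<union> K')"
    if "stable (Suc r) K'" "highest (Suc r) lam' c K' z'" "\<forall>i\<in>{1..<Suc r}. lam' (Suc i) \<le> lam' i" for lam' K' z'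
    using Suc.IH[OF _ that(1,2)] that(3) Suc.prems(1) by (simp add: atLeastLessThanSuc_atLeastAtMost)
  from filtration_span[OF _ Suc.prems(1-3) m this]
  show ?case by simp
qed

end

section \<open>A module over the polynomial ring\<close>

type_synonym position = "nat \<times> nat \<times> nat"

definition column :: "position \<Rightarrow> nat \<times> nat" where
  "column p = (fst p, fst (snd p))"

text \<open>The pair \<open>(i, j)\<close> is the j-th column of height \<open>i\<close> in the
  diagram of the weight with \<open>m i\<close> columns of height \<open>i\<close>, and it carries
  one exterior power of degree \<open>i\<close>. A position adds the row \<open>q\<close> inside the
  column, counted from 0.\<close>

definition columns :: "nat \<Rightarrow> (nat \<Rightarrow> nat) \<Rightarrow> (nat \<times> nat) set" where
  "columns r m = (SIGMA i:{1..r}. {..<m i})"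

definition positions :: "nat \<Rightarrow> (nat \<Rightarrow> nat) \<Rightarrow> position set" where
  "positions r m = {(i, j, q). (i, j) \<in> columns r m \<and> q < i}"

lemma finite_columns: "finite (columns r m)" by (simp add: columns_def)

lemma finite_positions: "finite (positions r m)"
proof -
  have "positions r m \<subseteq> (\<Union>(i, j)\<in>columns r m. {i} \<times> {j} \<times> {..<i})"
    by (auto simp: positions_def)
  then show ?thesis by (rule finite_subset) (auto intro!: finite_UN_I finite_columns)
qed

text \<open>Evaluation at \<open>code * s\<close>, where \<open>s\<close> is the variable of the coefficient polynomials and the
  codes of different columns are different.\<close>

definition eval_at :: "position \<Rightarrow> complex poly \<Rightarrow> complex poly" where
  "eval_at p f = pcompose f [:0, of_nat (prod_encode (column p)):]"

lemma eval_at_simps: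
  "eval_at p (f + g) = eval_at p f + eval_at p g" "eval_at p (f * g) = eval_at p f * eval_at p g"
  "eval_at p 0 = 0" "eval_at p 1 = 1" "eval_at p [:c:] = [:c:]" "eval_at p (- f) = - eval_at p f"
  "eval_at p (f - g) = eval_at p f - eval_at p g"
  by (simp_all add: eval_at_def pcompose_add pcompose_mult pcompose_uminus pcompose_diff pcompose_1)

lemma eval_at_sum: "eval_at p (sum f A) = (\<Sum>i\<in>A. eval_at p (f i))"
  by (simp add: eval_at_def pcompose_sum)

lemma eval_at_column: "column p = column q \<Longrightarrow> eval_at p f = eval_at q f"
  by (simp add: eval_at_def)

lemma sum_delta_pair:
  assumes "finite A" "a \<in> A"
  shows "(\<Sum>x\<in>A. if x = a \<and> P then F x else (0::'b::comm_monoid_add)) = (if P then F a else 0)"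
  using assms by (cases P) (auto simp: sum.delta)

context
  fixes r :: nat and m :: "nat \<Rightarrow> nat"
begin

private abbreviation "n \<equiv> Suc r"
private abbreviation "Pos \<equiv> positions r m"

declare sum.lessThan_Suc [simp del] split_paired_All [simp del]

text \<open>An element of the tensor power is given by its coordinates at the basis tensors
  \<open>g\<close>. The matrix acts as a derivation, its polynomial entries being evaluated on each
  tensor factor at the point of the column. Tuples \<open>g\<close> that do not index a basis tensor
  receive 0.\<close>

definition tensor_act :: "complex poly mat \<Rightarrow> ((position \<Rightarrow> nat) \<Rightarrow> complex poly) \<Rightarrow> (position \<Rightarrow> nat) \<Rightarrow> complex poly" where
  "tensor_act A \<phi> g = (if \<forall>p\<in>Pos. g p < n
     then \<Sum>p\<in>Pos. \<Sum>b<n. eval_at p (A $$ (g p, b)) * \<phi> (g(p := b)) else 0)"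

lemma tensor_act_add: "tensor_act A (\<phi> + \<psi>) = tensor_act A \<phi> + tensor_act A \<psi>"
  by (auto simp: tensor_act_def fun_eq_iff distrib_left sum.distrib)

lemma tensor_act_scale: "tensor_act A (\<lambda>g. c * \<phi> g) = (\<lambda>g. c * tensor_act A \<phi> g)"
  by (auto simp: tensor_act_def fun_eq_iff sum_distrib_left mult_ac)

lemma tensor_act_mat_add:
  assumes "A \<in> carrier_mat n n" "B \<in> carrier_mat n n"
  shows "tensor_act (A + B) \<phi> = tensor_act A \<phi> + tensor_act B \<phi>"
proof
  fix g
  show "tensor_act (A + B) \<phi> g = (tensor_act A \<phi> + tensor_act B \<phi>) g"
  proof (cases "\<forall>p\<in>Pos. g p < n")
    case g: True
    have e: "(A + B) $$ (g p, b) = A $$ (g p, b) + B $$ (g p, b)" if "p \<in> Pos" "b < n" for p b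
      using assms g that by simp
    show ?thesis
      unfolding tensor_act_def plus_fun_def if_P[OF g] sum.distrib[symmetric]
      by (intro sum.cong refl) (simp add: e eval_at_simps distrib_right)
  qed (auto simp: tensor_act_def)
qed

lemma tensor_act_mat_scale:
  assumes "A \<in> carrier_mat n n"
  shows "tensor_act ([:c:] \<cdot>\<^sub>m A) \<phi> = (\<lambda>g. [:c:] * tensor_act A \<phi> g)"
proof
  fix g
  show "tensor_act ([:c:] \<cdot>\<^sub>m A) \<phi> g = [:c:] * tensor_act A \<phi> g"
    unfolding tensor_act_def sum_distrib_left if_distrib[of "\<lambda>x. [:c:] * x"] mult_zero_right
    using assms by (intro if_cong refl sum.cong) (auto simp: eval_at_simps(2,5) mult.assoc simp del: mult_pCons_left)
qed

text \<open>Two actions at the same position compose to \<open>A * B\<close>. The double sum over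
  distinct positions is symmetric in the two matrices, so it will cancel in the bracket.\<close>

lemma tensor_act_twice:
  assumes A: "A \<in> carrier_mat n n" and B: "B \<in> carrier_mat n n" and g: "\<forall>p\<in>Pos. g p < n"
  shows "tensor_act A (tensor_act B \<phi>) g = tensor_act (A * B) \<phi> g +
    (\<Sum>p\<in>Pos. \<Sum>p'\<in>Pos - {p}. \<Sum>b<n. \<Sum>b'<n. eval_at p (A $$ (g p, b)) * eval_at p' (B $$ (g p', b')) * \<phi> (g(p := b, p' := b')))"
proof -
  have "tensor_act A (tensor_act B \<phi>) g = (\<Sum>p\<in>Pos. \<Sum>b<n. eval_at p (A $$ (g p, b)) *
    (\<Sum>p'\<in>Pos. \<Sum>b'<n. eval_at p' (B $$ ((g(p := b)) p', b')) * \<phi> (g(p := b, p' := b'))))"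
  proof -
    have tB: "tensor_act B \<phi> (g(p := b)) = (\<Sum>p'\<in>Pos. \<Sum>b'<n. eval_at p' (B $$ ((g(p := b)) p', b')) * \<phi> (g(p := b, p' := b')))"
      if "b < n" for p b
      unfolding tensor_act_def using g that by simp
    show ?thesis
      unfolding tensor_act_def[of A] if_P[OF g] by (intro sum.cong refl) (simp only: tB lessThan_iff)
  qed
  also have "\<dots> = (\<Sum>p\<in>Pos. (\<Sum>b'<n. eval_at p ((A * B) $$ (g p, b')) * \<phi> (g(p := b'))) +
     (\<Sum>p'\<in>Pos - {p}. \<Sum>b<n. \<Sum>b'<n. eval_at p (A $$ (g p, b)) * eval_at p' (B $$ (g p', b')) * \<phi> (g(p := b, p' := b'))))"
  proof (rule sum.cong[OF refl])
    fix p assume p: "p \<in> Pos"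
    have "(\<Sum>b<n. eval_at p (A $$ (g p, b)) * (\<Sum>p'\<in>Pos. \<Sum>b'<n. eval_at p' (B $$ ((g(p := b)) p', b')) * \<phi> (g(p := b, p' := b'))))
      = (\<Sum>b<n. eval_at p (A $$ (g p, b)) * (\<Sum>b'<n. eval_at p (B $$ (b, b')) * \<phi> (g(p := b'))))
       + (\<Sum>b<n. eval_at p (A $$ (g p, b)) * (\<Sum>p'\<in>Pos - {p}. \<Sum>b'<n. eval_at p' (B $$ (g p', b')) * \<phi> (g(p := b, p' := b'))))"
      unfolding sum.distrib[symmetric] distrib_left[symmetric]
      by (intro sum.cong refl arg_cong2[of _ _ _ _ "(*)"]) (subst sum.remove[OF finite_positions p], simp)
    moreover have "(\<Sum>b<n. eval_at p (A $$ (g p, b)) * (\<Sum>b'<n. eval_at p (B $$ (b, b')) * \<phi> (g(p := b'))))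
      = (\<Sum>b'<n. eval_at p ((A * B) $$ (g p, b')) * \<phi> (g(p := b')))"
    proof -
      have "(A * B) $$ (g p, b') = (\<Sum>b<n. A $$ (g p, b) * B $$ (b, b'))" if "b' < n" for b'
        using A B g p that by (simp add: scalar_prod_def atLeast0LessThan)
      then have "(\<Sum>b'<n. eval_at p ((A * B) $$ (g p, b')) * \<phi> (g(p := b')))
        = (\<Sum>b'<n. \<Sum>b<n. eval_at p (A $$ (g p, b)) * (eval_at p (B $$ (b, b')) * \<phi> (g(p := b'))))"
        by (intro sum.cong refl) (simp add: eval_at_sum eval_at_simps(2) sum_distrib_right mult.assoc del: sum.lessThan_Suc)
      then show ?thesis by (subst (asm) sum.swap) (simp add: sum_distrib_left del: sum.lessThan_Suc)
    qed
    moreover have "(\<Sum>b<n. eval_at p (A $$ (g p, b)) * (\<Sum>p'\<in>Pos - {p}. \<Sum>b'<n. eval_at p' (B $$ (g p', b')) * \<phi> (g(p := b, p' := b'))))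
      = (\<Sum>p'\<in>Pos - {p}. \<Sum>b<n. \<Sum>b'<n. eval_at p (A $$ (g p, b)) * eval_at p' (B $$ (g p', b')) * \<phi> (g(p := b, p' := b')))"
      by (subst sum.swap) (simp add: sum_distrib_left mult.assoc del: sum.lessThan_Suc)
    ultimately show "(\<Sum>b<n. eval_at p (A $$ (g p, b)) * (\<Sum>p'\<in>Pos. \<Sum>b'<n. eval_at p' (B $$ ((g(p := b)) p', b')) * \<phi> (g(p := b, p' := b'))))
      = (\<Sum>b'<n. eval_at p ((A * B) $$ (g p, b')) * \<phi> (g(p := b'))) +
     (\<Sum>p'\<in>Pos - {p}. \<Sum>b<n. \<Sum>b'<n. eval_at p (A $$ (g p, b)) * eval_at p' (B $$ (g p', b')) * \<phi> (g(p := b, p' := b')))"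
      by simp
  qed
  also have "\<dots> = tensor_act (A * B) \<phi> g + (\<Sum>p\<in>Pos. \<Sum>p'\<in>Pos - {p}. \<Sum>b<n. \<Sum>b'<n. eval_at p (A $$ (g p, b)) * eval_at p' (B $$ (g p', b')) * \<phi> (g(p := b, p' := b')))"
    unfolding tensor_act_def[of "A * B"] using g by (simp add: sum.distrib del: sum.lessThan_Suc)
  finally show ?thesis .
qed

lemma tensor_act_bracket:
  assumes A: "A \<in> carrier_mat n n" and B: "B \<in> carrier_mat n n"
  shows "tensor_act (A * B - B * A) \<phi> = tensor_act A (tensor_act B \<phi>) - tensor_act B (tensor_act A \<phi>)"
proof
  fix g
  show "tensor_act (A * B - B * A) \<phi> g = (tensor_act A (tensor_act B \<phi>) - tensor_act B (tensor_act A \<phi>)) g"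
  proof (cases "\<forall>p\<in>Pos. g p < n")
    case g: True
    let ?S = "\<lambda>A B. \<Sum>p\<in>Pos. \<Sum>p'\<in>Pos - {p}. \<Sum>b<n. \<Sum>b'<n. eval_at p (A $$ (g p, b)) * eval_at p' (B $$ (g p', b')) * \<phi> (g(p := b, p' := b'))"
    have "?S A B = (\<Sum>p\<in>Pos. \<Sum>p'\<in>{p'\<in>Pos. p \<noteq> p'}. \<Sum>b<n. \<Sum>b'<n. eval_at p (A $$ (g p, b)) * eval_at p' (B $$ (g p', b')) * \<phi> (g(p := b, p' := b')))"
      by (intro sum.cong refl) auto
    also have "\<dots> = (\<Sum>p'\<in>Pos. \<Sum>p\<in>{p\<in>Pos. p \<noteq> p'}. \<Sum>b<n. \<Sum>b'<n. eval_at p (A $$ (g p, b)) * eval_at p' (B $$ (g p', b')) * \<phi> (g(p := b, p' := b')))"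
      by (rule sum.swap_restrict) (auto simp: finite_positions)
    also have "\<dots> = (\<Sum>p'\<in>Pos. \<Sum>p\<in>Pos - {p'}. \<Sum>b'<n. \<Sum>b<n. eval_at p' (B $$ (g p', b')) * eval_at p (A $$ (g p, b)) * \<phi> (g(p' := b', p := b)))"
    proof (rule sum.cong[OF refl])
      fix p' assume "p' \<in> Pos"
      show "(\<Sum>p\<in>{p\<in>Pos. p \<noteq> p'}. \<Sum>b<n. \<Sum>b'<n. eval_at p (A $$ (g p, b)) * eval_at p' (B $$ (g p', b')) * \<phi> (g(p := b, p' := b')))
        = (\<Sum>p\<in>Pos - {p'}. \<Sum>b'<n. \<Sum>b<n. eval_at p' (B $$ (g p', b')) * eval_at p (A $$ (g p, b)) * \<phi> (g(p' := b', p := b)))"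
      proof (rule sum.cong)
        fix p assume "p \<in> Pos - {p'}"
        then have "g(p := b, p' := b') = g(p' := b', p := b)" for b b' by (auto simp: fun_upd_twist)
        then show "(\<Sum>b<n. \<Sum>b'<n. eval_at p (A $$ (g p, b)) * eval_at p' (B $$ (g p', b')) * \<phi> (g(p := b, p' := b')))
          = (\<Sum>b'<n. \<Sum>b<n. eval_at p' (B $$ (g p', b')) * eval_at p (A $$ (g p, b)) * \<phi> (g(p' := b', p := b)))"
          by (subst sum.swap) (simp add: mult.commute del: sum.lessThan_Suc)
      qed auto
    qed
    finally have S: "?S A B = ?S B A" .
    have "tensor_act (A * B - B * A) \<phi> g = tensor_act (A * B) \<phi> g - tensor_act (B * A) \<phi> g"
    proof -
      have e: "(A * B - B * A) $$ (g p, b) = (A * B) $$ (g p, b) - (B * A) $$ (g p, b)" if "p \<in> Pos" "b < n" for p b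
        using A B g that by simp
      show ?thesis unfolding tensor_act_def if_P[OF g] sum_subtractf[symmetric]
        by (intro sum.cong refl) (simp only: e lessThan_iff eval_at_simps left_diff_distrib)
    qed
    then show ?thesis
      using tensor_act_twice[OF A B g, of \<phi>] tensor_act_twice[OF B A g, of \<phi>] S by (simp del: sum.lessThan_Suc)
  qed (auto simp: tensor_act_def)
qed

section \<open>Exterior powers inside the tensor power\<close>

definition column_perms :: "(position \<Rightarrow> position) set" where
  "column_perms = {\<sigma>. \<sigma> permutes Pos \<and> (\<forall>p. column (\<sigma> p) = column p)}"

definition fillings :: "(position \<Rightarrow> nat) set" where
  "fillings = {s. (\<forall>p\<in>Pos. s p < n) \<and> (\<forall>p. p \<notin> Pos \<longrightarrow> s p = 0)}"

text \<open>The antisymmetrisation along each column of the basis tensor \<open>s\<close>: a tensor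
  product of wedge products of basis vectors.\<close>

definition alt :: "(position \<Rightarrow> nat) \<Rightarrow> (position \<Rightarrow> nat) \<Rightarrow> complex poly" where
  "alt s g = (\<Sum>\<sigma>\<in>column_perms. of_int (sign \<sigma>) * (if g = s \<circ> \<sigma> then 1 else 0))"

lemma finite_column_perms: "finite column_perms"
  unfolding column_perms_def by (rule finite_subset[OF _ finite_permutations[OF finite_positions]]) auto

lemma column_permsD: "\<sigma> \<in> column_perms \<Longrightarrow> \<sigma> permutes Pos" "\<sigma> \<in> column_perms \<Longrightarrow> column (\<sigma> p) = column p"
  by (auto simp: column_perms_def)

lemma fillings_upd: "s \<in> fillings \<Longrightarrow> q \<in> Pos \<Longrightarrow> a < n \<Longrightarrow> s(q := a) \<in> fillings"
  by (auto simp: fillings_def)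

text \<open>The derivation rule for wedge products. For each column permutation the positions are
  reindexed by it, which is harmless because the evaluation point depends on the column
  only.\<close>

lemma tensor_act_alt:
  assumes s: "s \<in> fillings"
  shows "tensor_act A (alt s) = (\<lambda>g. \<Sum>q\<in>Pos. \<Sum>a<n. eval_at q (A $$ (a, s q)) * alt (s(q := a)) g)"
proof
  fix g
  show "tensor_act A (alt s) g = (\<Sum>q\<in>Pos. \<Sum>a<n. eval_at q (A $$ (a, s q)) * alt (s(q := a)) g)"
  proof (cases "\<forall>p\<in>Pos. g p < n")
    case g: True
    have 1: "tensor_act A (alt s) g = (\<Sum>\<sigma>\<in>column_perms. \<Sum>p\<in>Pos. of_int (sign \<sigma>) *
        (\<Sum>b<n. eval_at p (A $$ (g p, b)) * (if g(p := b) = s \<circ> \<sigma> then 1 else 0)))"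
    proof -
      have "tensor_act A (alt s) g = (\<Sum>p\<in>Pos. \<Sum>b<n. \<Sum>\<sigma>\<in>column_perms. of_int (sign \<sigma>) * (eval_at p (A $$ (g p, b)) * (if g(p := b) = s \<circ> \<sigma> then 1 else 0)))"
        unfolding tensor_act_def alt_def using g by (simp add: sum_distrib_left mult_ac del: sum.lessThan_Suc)
      also have "\<dots> = (\<Sum>p\<in>Pos. \<Sum>\<sigma>\<in>column_perms. \<Sum>b<n. of_int (sign \<sigma>) * (eval_at p (A $$ (g p, b)) * (if g(p := b) = s \<circ> \<sigma> then 1 else 0)))"
        by (rule sum.cong[OF refl], rule sum.swap)
      also have "\<dots> = (\<Sum>\<sigma>\<in>column_perms. \<Sum>p\<in>Pos. \<Sum>b<n. of_int (sign \<sigma>) * (eval_at p (A $$ (g p, b)) * (if g(p := b) = s \<circ> \<sigma> then 1 else 0)))"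
        by (rule sum.swap)
      finally show ?thesis by (simp only: sum_distrib_left)
    qed
    have 2: "(\<Sum>q\<in>Pos. \<Sum>a<n. eval_at q (A $$ (a, s q)) * alt (s(q := a)) g) = (\<Sum>\<sigma>\<in>column_perms. \<Sum>q\<in>Pos. of_int (sign \<sigma>) *
        (\<Sum>a<n. eval_at q (A $$ (a, s q)) * (if g = s(q := a) \<circ> \<sigma> then 1 else 0)))"
    proof -
      have "(\<Sum>q\<in>Pos. \<Sum>a<n. eval_at q (A $$ (a, s q)) * alt (s(q := a)) g) = (\<Sum>q\<in>Pos. \<Sum>a<n. \<Sum>\<sigma>\<in>column_perms. of_int (sign \<sigma>) * (eval_at q (A $$ (a, s q)) * (if g = s(q := a) \<circ> \<sigma> then 1 else 0)))"
        unfolding alt_def by (simp add: sum_distrib_left mult_ac del: sum.lessThan_Suc)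
      also have "\<dots> = (\<Sum>q\<in>Pos. \<Sum>\<sigma>\<in>column_perms. \<Sum>a<n. of_int (sign \<sigma>) * (eval_at q (A $$ (a, s q)) * (if g = s(q := a) \<circ> \<sigma> then 1 else 0)))"
        by (rule sum.cong[OF refl], rule sum.swap)
      also have "\<dots> = (\<Sum>\<sigma>\<in>column_perms. \<Sum>q\<in>Pos. \<Sum>a<n. of_int (sign \<sigma>) * (eval_at q (A $$ (a, s q)) * (if g = s(q := a) \<circ> \<sigma> then 1 else 0)))"
        by (rule sum.swap)
      finally show ?thesis by (simp only: sum_distrib_left)
    qed
    show ?thesis unfolding 1 2
    proof (rule sum.cong[OF refl])
      fix \<sigma> assume \<sigma>: "\<sigma> \<in> column_perms"
      note P = column_permsD(1)[OF \<sigma>]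
      have inj: "\<sigma> x = \<sigma> y \<longleftrightarrow> x = y" for x y by (rule inj_eq[OF permutes_inj[OF P]])
      have "(\<Sum>p\<in>Pos. of_int (sign \<sigma>) * (\<Sum>a<n. eval_at (\<sigma> p) (A $$ (a, s (\<sigma> p))) * (if g = s(\<sigma> p := a) \<circ> \<sigma> then 1 else 0)))
        = (\<Sum>q\<in>Pos. of_int (sign \<sigma>) * (\<Sum>a<n. eval_at q (A $$ (a, s q)) * (if g = s(q := a) \<circ> \<sigma> then 1 else 0)))"
        by (rule sum.permute[OF P, unfolded o_def, symmetric])
      moreover have "(\<Sum>a<n. eval_at (\<sigma> p) (A $$ (a, s (\<sigma> p))) * (if g = s(\<sigma> p := a) \<circ> \<sigma> then 1 else 0))
        = (\<Sum>b<n. eval_at p (A $$ (g p, b)) * (if g(p := b) = s \<circ> \<sigma> then 1 else 0))" if p: "p \<in> Pos" for p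
      proof -
        define Q where "Q \<longleftrightarrow> (\<forall>x. x \<noteq> p \<longrightarrow> g x = s (\<sigma> x))"
        have e1: "g = s(\<sigma> p := a) \<circ> \<sigma> \<longleftrightarrow> a = g p \<and> Q" for a
        proof
          assume h: "g = s(\<sigma> p := a) \<circ> \<sigma>"
          show "a = g p \<and> Q" unfolding Q_def
          proof (intro conjI allI impI)
            show "a = g p" using fun_cong[OF h, of p] by simp
            fix x assume "x \<noteq> p"
            then show "g x = s (\<sigma> x)" using fun_cong[OF h, of x] by (simp add: inj)
          qed
        next
          assume h: "a = g p \<and> Q"
          show "g = s(\<sigma> p := a) \<circ> \<sigma>"
          proof
            fix x show "g x = (s(\<sigma> p := a) \<circ> \<sigma>) x" using h unfolding Q_def by (simp add: inj)
          qed
        qed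
        have e2: "g(p := b) = s \<circ> \<sigma> \<longleftrightarrow> b = s (\<sigma> p) \<and> Q" for b
          unfolding fun_eq_iff Q_def by (metis comp_apply fun_upd_apply)
        have "\<sigma> p \<in> Pos" using permutes_in_image[OF P] p by simp
        then have "s (\<sigma> p) < n" "g p < n" using s g p by (auto simp: fillings_def)
        moreover have "(\<Sum>a<n. eval_at (\<sigma> p) (A $$ (a, s (\<sigma> p))) * (if g = s(\<sigma> p := a) \<circ> \<sigma> then 1 else 0))
          = (\<Sum>a<n. if a = g p \<and> Q then eval_at (\<sigma> p) (A $$ (a, s (\<sigma> p))) else 0)"
          by (intro sum.cong refl) (simp add: e1)
        moreover have "(\<Sum>b<n. eval_at p (A $$ (g p, b)) * (if g(p := b) = s \<circ> \<sigma> then 1 else 0))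
          = (\<Sum>b<n. if b = s (\<sigma> p) \<and> Q then eval_at p (A $$ (g p, b)) else 0)"
          by (intro sum.cong refl) (simp add: e2)
        ultimately show ?thesis
          using eval_at_column[OF column_permsD(2)[OF \<sigma>, of p]] by (simp add: sum_delta_pair del: sum.lessThan_Suc)
      qed
      ultimately show "(\<Sum>p\<in>Pos. of_int (sign \<sigma>) * (\<Sum>b<n. eval_at p (A $$ (g p, b)) * (if g(p := b) = s \<circ> \<sigma> then 1 else 0)))
        = (\<Sum>q\<in>Pos. of_int (sign \<sigma>) * (\<Sum>a<n. eval_at q (A $$ (a, s q)) * (if g = s(q := a) \<circ> \<sigma> then 1 else 0)))"
        by (simp cong: sum.cong del: sum.lessThan_Suc)
    qed
  next
    case False
    then obtain p where p: "p \<in> Pos" "\<not> g p < n" by blast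
    have "alt (s(q := a)) g = 0" if "q \<in> Pos" "a < n" for q a
    proof -
      have "g \<noteq> s(q := a) \<circ> \<sigma>" if \<sigma>: "\<sigma> \<in> column_perms" for \<sigma>
      proof
        assume "g = s(q := a) \<circ> \<sigma>"
        then have "g p = (s(q := a)) (\<sigma> p)" by simp
        moreover have "\<sigma> p \<in> Pos" using permutes_in_image[OF column_permsD(1)[OF \<sigma>]] p by simp
        ultimately show False using p fillings_upd[OF s \<open>q \<in> Pos\<close> \<open>a < n\<close>] by (auto simp: fillings_def)
      qed
      then show ?thesis by (simp add: alt_def)
    qed
    then have "(\<Sum>q\<in>Pos. \<Sum>a<n. eval_at q (A $$ (a, s q)) * alt (s(q := a)) g) = 0"
      by (intro sum.neutral ballI) simp
    then show ?thesis unfolding tensor_act_def if_not_P[OF False] by simp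
  qed
qed

lemma alt_repeated:
  assumes "p \<in> Pos" "q \<in> Pos" "p \<noteq> q" "column p = column q" "s p = s q"
  shows "alt s = 0"
proof
  fix g
  let ?t = "transpose p q"
  have t: "?t permutes Pos" using assms by (simp add: permutes_swap_id)
  have st: "s \<circ> ?t = s" using assms by (auto simp: fun_eq_iff transpose_def)
  have tt: "?t \<circ> (?t \<circ> \<sigma>) = \<sigma>" for \<sigma> by (simp add: fun_eq_iff)
  have mem: "?t \<circ> \<sigma> \<in> column_perms" if "\<sigma> \<in> column_perms" for \<sigma>
    using that t assms by (auto simp: column_perms_def permutes_compose transpose_def)
  have sg: "sign (?t \<circ> \<sigma>) = - sign \<sigma>" if "\<sigma> \<in> column_perms" for \<sigma>
  proof -
    have "permutation \<sigma>" using column_permsD(1)[OF that] finite_positions permutation_permutes by blast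
    then show ?thesis using assms(3) by (simp add: sign_compose permutation_swap_id sign_swap_id)
  qed
  have "alt s g = (\<Sum>\<sigma>\<in>column_perms. of_int (sign (?t \<circ> \<sigma>)) * (if g = s \<circ> (?t \<circ> \<sigma>) then 1 else 0))"
    unfolding alt_def
    by (rule sum.reindex_bij_witness[of _ "\<lambda>\<sigma>. ?t \<circ> \<sigma>" "\<lambda>\<sigma>. ?t \<circ> \<sigma>"]) (simp_all add: tt mem)
  also have "\<dots> = - alt s g"
    unfolding alt_def sum_negf[symmetric] comp_assoc[symmetric] st
    by (intro sum.cong refl) (simp add: sg)
  finally show "alt s g = 0 g" by simp
qed

end

section \<open>Independence modulo the variable\<close>

lemma det_zero_row:
  fixes A :: "'a::comm_ring_1 mat"
  assumes "A \<in> carrier_mat n n" "k < n" "\<And>j. j < n \<Longrightarrow> A $$ (k, j) = 0"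
  shows "det A = 0"
proof -
  have "multrow k 0 A = A" using assms by (intro eq_matI) auto
  then show ?thesis using det_multrow[OF assms(2,1), of 0] by simp
qed

text \<open>Iterating \<open>span\<close> to precision E + 1 and reading off values at the points
  \<open>g l\<close> gives s^E (1 - s \<Psi>) = P V with matrices over C[s], where V has fewer than
  N nonzero rows. The right side has determinant 0. On the left, the determinant is a power of s
  times a polynomial with value 1 at s = 0.\<close>

lemma no_small_span_mod_variable:
  fixes M V :: "('g \<Rightarrow> complex poly) set" and y :: "nat \<Rightarrow> 'g \<Rightarrow> complex poly" and g :: "nat \<Rightarrow> 'g"
  assumes M_scale: "\<And>c \<phi>. \<phi> \<in> M \<Longrightarrow> (\<lambda>x. c * \<phi> x) \<in> M"
    and fin: "finite V" and card: "card V < N"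
    and span: "\<And>\<phi>. \<phi> \<in> M \<Longrightarrow> \<exists>a. \<exists>\<psi>\<in>M. \<forall>x. \<phi> x = (\<Sum>v\<in>V. [:a v:] * v x) + [:0, 1:] * \<psi> x"
    and y: "\<And>k. k < N \<Longrightarrow> y k \<in> M"
      "\<And>k l. k < N \<Longrightarrow> l < N \<Longrightarrow> y k (g l) = (if k = l then [:0, 1:] ^ E else 0)"
  shows False
proof -
  let ?s = "[:0, 1:] :: complex poly"
  have it: "\<exists>p. \<exists>\<psi>\<in>M. \<forall>x. \<phi> x = (\<Sum>v\<in>V. p v * v x) + ?s ^ e * \<psi> x" if "\<phi> \<in> M" for \<phi> e
    using that
  proof (induction e arbitrary: \<phi>)
    case 0
    then show ?case by (intro exI[of _ "\<lambda>_. 0"] bexI[of _ \<phi>]) auto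
  next
    case (Suc e)
    then obtain p \<psi> where 1: "\<psi> \<in> M" "\<And>x. \<phi> x = (\<Sum>v\<in>V. p v * v x) + ?s ^ e * \<psi> x" by blast
    from span[OF 1(1)] obtain a \<psi>' where 2: "\<psi>' \<in> M" "\<And>x. \<psi> x = (\<Sum>v\<in>V. [:a v:] * v x) + ?s * \<psi>' x" by blast
    have *: "\<phi> x = (\<Sum>v\<in>V. (p v + ?s ^ e * [:a v:]) * v x) + ?s ^ Suc e * \<psi>' x" for x
    proof -
      have "(\<Sum>v\<in>V. (p v + ?s ^ e * [:a v:]) * v x) = (\<Sum>v\<in>V. p v * v x) + ?s ^ e * (\<Sum>v\<in>V. [:a v:] * v x)"
        by (simp only: distrib_right sum.distrib sum_distrib_left mult.assoc)
      then show ?thesis unfolding 1(2) 2(2) by (simp only: distrib_left power_Suc2 mult.assoc add.assoc)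
    qed
    show ?case
      by (rule exI[of _ "\<lambda>v. p v + ?s ^ e * [:a v:]"], rule bexI[OF _ 2(1)], rule allI, rule *)
  qed
  have "\<exists>p. \<exists>\<psi>\<in>M. k < N \<longrightarrow> (\<forall>x. y k x = (\<Sum>v\<in>V. p v * v x) + ?s ^ Suc E * \<psi> x)" for k
  proof (cases "k < N")
    case True
    then show ?thesis using it[OF y(1)[OF True], of "Suc E"] by blast
  next
    case False
    have "y 0 \<in> M" using card by (intro y(1)) simp
    then show ?thesis using False by blast
  qed
  then have ex: "\<forall>k. \<exists>p. \<exists>\<psi>\<in>M. k < N \<longrightarrow> (\<forall>x. y k x = (\<Sum>v\<in>V. p v * v x) + ?s ^ Suc E * \<psi> x)"
    by (rule allI)
  obtain P where P1: "\<forall>k. \<exists>\<psi>\<in>M. k < N \<longrightarrow> (\<forall>x. y k x = (\<Sum>v\<in>V. P k v * v x) + ?s ^ Suc E * \<psi> x)"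
    using choice[OF ex] by blast
  then have "\<forall>k. \<exists>\<psi>. k < N \<longrightarrow> (\<forall>x. y k x = (\<Sum>v\<in>V. P k v * v x) + ?s ^ Suc E * \<psi> x)" by blast
  from choice[OF this] obtain \<Psi> where
    P: "\<And>k x. k < N \<Longrightarrow> y k x = (\<Sum>v\<in>V. P k v * v x) + ?s ^ Suc E * \<Psi> k x" by blast
  obtain vs where vs: "set vs = V" "distinct vs" using finite_distinct_list[OF fin] by blast
  have len: "length vs < N" using card vs distinct_card by fastforce
  define B where "B = mat N N (\<lambda>(k, l). (if k = l then 1 else 0) - ?s * \<Psi> k (g l))"
  \<comment> \<open>Padding with zeros makes both factors square, so that the determinant is
    multiplicative. As \<open>length vs < N\<close>, the last row of \<open>VM\<close> is
    zero.\<close>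
  define PM where "PM = mat N N (\<lambda>(k, j). if j < length vs then P k (vs ! j) else 0)"
  define VM where "VM = mat N N (\<lambda>(j, l). if j < length vs then (vs ! j) (g l) else 0)"
  have "?s ^ E \<cdot>\<^sub>m B = PM * VM"
  proof (rule eq_matI)
    fix k l assume "k < dim_row (PM * VM)" "l < dim_col (PM * VM)"
    then have kl: "k < N" "l < N" by (auto simp: PM_def VM_def)
    have "(PM * VM) $$ (k, l) = (\<Sum>j<N. (if j < length vs then P k (vs ! j) * (vs ! j) (g l) else 0))"
      using kl by (auto simp: PM_def VM_def scalar_prod_def atLeast0LessThan intro!: sum.cong)
    also have "\<dots> = (\<Sum>j<length vs. P k (vs ! j) * (vs ! j) (g l))"
      using len by (intro sum.mono_neutral_cong_right) auto
    also have "\<dots> = (\<Sum>v\<in>V. P k v * v (g l))"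
      unfolding vs(1)[symmetric] by (simp add: sum.distinct_set_conv_list[OF vs(2)] sum_list_sum_nth atLeast0LessThan)
    also have "\<dots> = y k (g l) - ?s ^ Suc E * \<Psi> k (g l)" using P[OF kl(1), of "g l"] by simp
    also have "\<dots> = (?s ^ E \<cdot>\<^sub>m B) $$ (k, l)"
      using kl y(2)[OF kl] by (simp only: B_def index_smult_mat dim_row_mat dim_col_mat index_mat split power_Suc2 mult.assoc right_diff_distrib) simp
    finally show "(?s ^ E \<cdot>\<^sub>m B) $$ (k, l) = (PM * VM) $$ (k, l)" by simp
  qed (auto simp: PM_def VM_def B_def)
  moreover have "det (PM * VM) = det PM * det VM"
    by (rule det_mult[of _ N]) (auto simp: PM_def VM_def)
  moreover have "det VM = 0"
    by (rule det_zero_row[of _ N "N - 1"]) (use len in \<open>auto simp: VM_def\<close>)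
  moreover have "det (?s ^ E \<cdot>\<^sub>m B) = (?s ^ E) ^ N * det B"
    using det_smult[of "?s ^ E" B] by (simp add: B_def)
  ultimately have "det B = 0" by simp
  moreover have "poly (det B) 0 = 1"
  proof -
    interpret h: comm_ring_hom "\<lambda>p :: complex poly. poly p 0" by unfold_locales auto
    have "map_mat (\<lambda>p. poly p 0) B = 1\<^sub>m N" by (intro eq_matI) (auto simp: B_def)
    then show ?thesis using h.hom_det[of B] by (simp add: det_one)
  qed
  ultimately show False by simp
qed

section \<open>The cyclic submodule and the relations of its generator\<close>

context
  fixes r :: nat and m :: "nat \<Rightarrow> nat"
begin

private abbreviation "sz \<equiv> Suc r"
private abbreviation "Posn \<equiv> positions r m"

declare sum.lessThan_Suc [simp del] split_paired_All [simp del]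

text \<open>Row \<open>q\<close> of every column contains \<open>q\<close>, so each column is the
  wedge of the first basis vectors, the highest weight vector of its exterior power.\<close>

definition std_filling :: "position \<Rightarrow> nat" where
  "std_filling p = (if p \<in> Posn then snd (snd p) else 0)"

lemma std_filling_mem: "std_filling \<in> fillings r m"
  by (auto simp: fillings_def std_filling_def positions_def columns_def)

definition tensor_gen :: "(position \<Rightarrow> nat) \<Rightarrow> complex poly" where
  "tensor_gen = alt r m std_filling"

inductive_set cyclic_sub :: "((position \<Rightarrow> nat) \<Rightarrow> complex poly) set" where
  gen: "tensor_gen \<in> cyclic_sub"
| add: "\<phi> \<in> cyclic_sub \<Longrightarrow> \<psi> \<in> cyclic_sub \<Longrightarrow> \<phi> + \<psi> \<in> cyclic_sub"
| scale: "\<phi> \<in> cyclic_sub \<Longrightarrow> (\<lambda>g. c * \<phi> g) \<in> cyclic_sub"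
| act: "\<phi> \<in> cyclic_sub \<Longrightarrow> A \<in> sl_carrier r \<Longrightarrow> tensor_act r m A \<phi> \<in> cyclic_sub"

lemma cyclic_sub_sum:
  assumes "\<And>i. i \<in> I \<Longrightarrow> f i \<in> cyclic_sub"
  shows "(\<lambda>g. \<Sum>i\<in>I. f i g) \<in> cyclic_sub"
  using assms
proof (induction I rule: infinite_finite_induct)
  case (insert i I)
  have "f i + (\<lambda>g. \<Sum>i\<in>I. f i g) \<in> cyclic_sub" using insert by (intro add) auto
  then show ?case using insert by (simp add: plus_fun_def)
qed (use scale[OF gen, of 0] in auto)

text \<open>A strictly upper triangular matrix replaces an entry by a smaller one, which the same
  column already contains.\<close>

lemma tensor_act_upper:
  assumes "\<And>a b. b \<le> a \<Longrightarrow> a < sz \<Longrightarrow> A $$ (a, b) = 0"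
  shows "tensor_act r m A tensor_gen = 0"
proof
  fix g
  have "eval_at q (A $$ (a, std_filling q)) * alt r m (std_filling(q := a)) g = 0" if q: "q \<in> Posn" and a: "a < sz" for q a
  proof (cases "std_filling q \<le> a")
    case True
    then show ?thesis using assms[OF _ a] by (simp add: eval_at_simps)
  next
    case False
    obtain i j k where ijk: "q = (i, j, k)" by (cases q)
    have "std_filling q = k" using q by (simp add: std_filling_def ijk)
    then have ak: "a < k" using False by simp
    have "(i, j, a) \<in> Posn" using q ak by (auto simp: positions_def ijk)
    then have "alt r m (std_filling(q := a)) = 0"
      using q ak by (intro alt_repeated[of "(i, j, a)" _ _ q]) (auto simp: ijk column_def std_filling_def)
    then show ?thesis by simp
  qed
  then show "tensor_act r m A tensor_gen g = 0 g"
    unfolding tensor_gen_def tensor_act_alt[OF std_filling_mem] by (auto intro!: sum.neutral)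
qed

lemma tensor_act_diag:
  assumes "\<And>a b. a < sz \<Longrightarrow> b < sz \<Longrightarrow> a \<noteq> b \<Longrightarrow> A $$ (a, b) = 0"
  shows "tensor_act r m A tensor_gen = (\<lambda>g. (\<Sum>q\<in>Posn. eval_at q (A $$ (std_filling q, std_filling q))) * tensor_gen g)"
proof
  fix g
  have "(\<Sum>a<sz. eval_at q (A $$ (a, std_filling q)) * alt r m (std_filling(q := a)) g)
    = eval_at q (A $$ (std_filling q, std_filling q)) * tensor_gen g" if q: "q \<in> Posn" for q
  proof -
    have "(\<Sum>a<sz. eval_at q (A $$ (a, std_filling q)) * alt r m (std_filling(q := a)) g)
      = (\<Sum>a<sz. if a = std_filling q then eval_at q (A $$ (std_filling q, std_filling q)) * tensor_gen g else 0)"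
    proof (rule sum.cong[OF refl])
      fix a assume a: "a \<in> {..<sz}"
      have "std_filling q < sz" using std_filling_mem q by (auto simp: fillings_def)
      then show "eval_at q (A $$ (a, std_filling q)) * alt r m (std_filling(q := a)) g
        = (if a = std_filling q then eval_at q (A $$ (std_filling q, std_filling q)) * tensor_gen g else 0)"
        using assms[of a "std_filling q"] a by (cases "a = std_filling q") (simp_all add: eval_at_simps tensor_gen_def)
    qed
    then show ?thesis using std_filling_mem q by (auto simp: fillings_def)
  qed
  then show "tensor_act r m A tensor_gen g = (\<Sum>q\<in>Posn. eval_at q (A $$ (std_filling q, std_filling q))) * tensor_gen g"
    unfolding tensor_gen_def[symmetric] tensor_act_alt[OF std_filling_mem, folded tensor_gen_def] sum_distrib_right
    by (intro sum.cong refl)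
qed

lemma sum_positions: "(\<Sum>q\<in>Posn. F (snd (snd q))) = (\<Sum>i=1..r. of_nat (m i) * (\<Sum>q<i. F q :: complex))"
proof -
  have "Posn = (SIGMA i:{1..r}. {..<m i} \<times> {..<i})"
    by (auto simp: positions_def columns_def)
  then have "(\<Sum>q\<in>Posn. F (snd (snd q))) = (\<Sum>i=1..r. \<Sum>jq\<in>{..<m i} \<times> {..<i}. F (snd jq))"
    by (simp add: sum.Sigma split_def)
  also have "\<dots> = (\<Sum>i=1..r. of_nat (m i) * (\<Sum>q<i. F q))"
  proof (rule sum.cong[OF refl])
    fix i
    have "(\<Sum>jq\<in>{..<m i} \<times> {..<i}. F (snd jq)) = (\<Sum>j<m i. \<Sum>q<i. F q)"
      unfolding sum.cartesian_product by (simp add: split_def)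
    then show "(\<Sum>jq\<in>{..<m i} \<times> {..<i}. F (snd jq)) = of_nat (m i) * (\<Sum>q<i. F q)" by simp
  qed
  finally show ?thesis .
qed

context
  fixes i :: nat and Y :: "complex poly mat" and c :: complex
  assumes i: "1 \<le> i" "i \<le> r"
    and Y: "\<And>a b. a < sz \<Longrightarrow> b < sz \<Longrightarrow> Y $$ (a, b) = (if a = i \<and> b = i - 1 then [:c:] else 0)"
begin

private definition "free_pos s = {q\<in>Posn. s q = i - 1 \<and> (\<forall>q'\<in>Posn. column q' = column q \<longrightarrow> s q' \<noteq> i)}"

text \<open>\<open>Y\<close> turns an entry \<open>i - 1\<close> into \<open>i\<close>. The result
  vanishes if the column already contains \<open>i\<close>, so only the positions in
  \<open>free_pos\<close> contribute, and each change strictly decreases their number.\<close>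

lemma tensor_act_lower_power:
  assumes "s \<in> fillings r m" "card (free_pos s) < k"
  shows "(tensor_act r m Y ^^ k) (alt r m s) = 0"
  using assms
proof (induction k arbitrary: s)
  case (Suc k)
  let ?T = "tensor_act r m Y"
  have fin: "finite (free_pos s)" for s by (simp add: free_pos_def finite_positions)
  have "?T (\<lambda>g. 0) = (\<lambda>g. 0)" by (auto simp: tensor_act_def fun_eq_iff)
  then have T0: "(?T ^^ k) (\<lambda>g. 0) = (\<lambda>g. 0)" by (induction k) simp_all
  have T00: "(?T ^^ k) 0 g = 0" for g using fun_cong[OF T0, of g] by (simp add: zero_fun_def)
  have "?T (\<lambda>g. \<phi> g + \<psi> g) = (\<lambda>g. ?T \<phi> g + ?T \<psi> g)" for \<phi> \<psi>
    using tensor_act_add[of r m Y \<phi> \<psi>] by (simp add: plus_fun_def)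
  then have Tadd: "(?T ^^ k) (\<lambda>g. \<phi> g + \<psi> g) = (\<lambda>g. (?T ^^ k) \<phi> g + (?T ^^ k) \<psi> g)" for \<phi> \<psi> and k
    by (induction k arbitrary: \<phi> \<psi>) simp_all
  have Tscale: "(?T ^^ k) (\<lambda>g. d * \<phi> g) = (\<lambda>g. d * (?T ^^ k) \<phi> g)" for \<phi> d and k
    by (induction k arbitrary: \<phi>) (simp_all add: tensor_act_scale)
  have Tsum: "(?T ^^ k) (\<lambda>g. \<Sum>q\<in>I. f q g) = (\<lambda>g. \<Sum>q\<in>I. (?T ^^ k) (f q) g)" if "finite I" for I :: "position set" and f
    using that
  proof (induction I rule: finite_induct)
    case empty
    then show ?case using T0 by simp
  next
    case (insert q I)
    then show ?case by (simp add: Tadd)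
  qed
  have "?T (alt r m s) = (\<lambda>g. \<Sum>q\<in>Posn. (if s q = i - 1 then [:c:] else 0) * alt r m (s(q := i)) g)"
  proof
    fix g
    have "(\<Sum>a<sz. eval_at q (Y $$ (a, s q)) * alt r m (s(q := a)) g) = (if s q = i - 1 then [:c:] else 0) * alt r m (s(q := i)) g"
      if q: "q \<in> Posn" for q
    proof -
      have sq: "s q < sz" using Suc.prems(1) q by (auto simp: fillings_def)
      have "(\<Sum>a<sz. eval_at q (Y $$ (a, s q)) * alt r m (s(q := a)) g)
        = (\<Sum>a<sz. if a = i then (if s q = i - 1 then [:c:] else 0) * alt r m (s(q := i)) g else 0)"
        by (intro sum.cong refl) (use sq in \<open>auto simp: Y eval_at_simps\<close>)
      then show ?thesis using i by simp
    qed
    then show "?T (alt r m s) g = (\<Sum>q\<in>Posn. (if s q = i - 1 then [:c:] else 0) * alt r m (s(q := i)) g)"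
      unfolding tensor_act_alt[OF Suc.prems(1)] by (intro sum.cong refl)
  qed
  then have "(?T ^^ Suc k) (alt r m s) = (\<lambda>g. \<Sum>q\<in>Posn. (if s q = i - 1 then [:c:] else 0) * (?T ^^ k) (alt r m (s(q := i))) g)"
    unfolding funpow_Suc_right o_apply by (simp only: Tsum[OF finite_positions] Tscale)
  moreover have "(if s q = i - 1 then [:c:] else 0) * (?T ^^ k) (alt r m (s(q := i))) g = 0" if q: "q \<in> Posn" for q g
  proof (cases "s q = i - 1")
    case True
    show ?thesis
    proof (cases "\<exists>q'\<in>Posn. column q' = column q \<and> s q' = i")
      case blocked: True
      then obtain q' where q': "q' \<in> Posn" "column q' = column q" "s q' = i" by blast
      then have "alt r m (s(q := i)) = 0" using True i q
        by (intro alt_repeated[of q' _ _ q]) auto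
      then show ?thesis by (simp add: T00)
    next
      case False
      then have qf: "q \<in> free_pos s" using True q by (auto simp: free_pos_def)
      have "free_pos (s(q := i)) \<subseteq> free_pos s - {q}"
      proof
        fix x assume x: "x \<in> free_pos (s(q := i))"
        have "x \<noteq> q" using x i by (auto simp: free_pos_def)
        moreover have "s q' \<noteq> i" if "q' \<in> Posn" "column q' = column x" for q'
        proof (cases "q' = q")
          case True
          then show ?thesis using \<open>s q = i - 1\<close> i by auto
        next
          case False
          then show ?thesis using x that by (auto simp: free_pos_def)
        qed
        ultimately show "x \<in> free_pos s - {q}" using x by (auto simp: free_pos_def)
      qed
      then have "card (free_pos (s(q := i))) < card (free_pos s)"
        using qf fin by (intro psubset_card_mono) auto
      then have lt: "card (free_pos (s(q := i))) < k" using Suc.prems(2) by simp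
      have "s(q := i) \<in> fillings r m" by (rule fillings_upd[OF Suc.prems(1) q]) (use i in simp)
      from fun_cong[OF Suc.IH[OF this lt], of g]
      have "(?T ^^ k) (alt r m (s(q := i))) g = 0" by (simp only: zero_fun_apply)
      then show ?thesis by (simp only: mult_zero_right)
    qed
  qed simp
  ultimately show ?case by (simp add: zero_fun_def)
qed simp

text \<open>In the standard filling the columns higher than \<open>i\<close> already contain
  \<open>i\<close>, and the lower ones do not contain \<open>i - 1\<close>. The free positions are
  thus the last rows of the \<open>m i\<close> columns of height \<open>i\<close>.\<close>

lemma tensor_act_lower:
  "(tensor_act r m Y ^^ Suc (m i)) tensor_gen = 0"
proof -
  have "free_pos std_filling \<subseteq> (\<lambda>j. (i, j, i - 1)) ` {..<m i}"
  proof
    fix q assume q: "q \<in> free_pos std_filling"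
    obtain i' j k where ijk: "q = (i', j, k)" by (cases q)
    have 1: "(i', j) \<in> columns r m" "k < i'" "k = i - 1"
      using q by (auto simp: free_pos_def std_filling_def positions_def ijk)
    have "\<not> i < i'"
    proof
      assume "i < i'"
      then have "(i', j, i) \<in> Posn" "column (i', j, i) = column q" "std_filling (i', j, i) = i"
        using 1 by (auto simp: positions_def ijk column_def std_filling_def)
      then show False using q by (auto simp: free_pos_def)
    qed
    then have "i' = i" using 1 i by auto
    then show "q \<in> (\<lambda>j. (i, j, i - 1)) ` {..<m i}" using 1 by (auto simp: ijk columns_def)
  qed
  then have "card (free_pos std_filling) \<le> card ((\<lambda>j. (i, j, i - 1)) ` {..<m i})"
    by (intro card_mono) auto
  also have "\<dots> \<le> m i" using card_image_le[of "{..<m i}"] by simp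
  finally show ?thesis unfolding tensor_gen_def
    by (intro tensor_act_lower_power std_filling_mem) simp
qed

end

section \<open>Full rank after inverting the variable\<close>

definition unit_mat :: "nat \<Rightarrow> nat \<Rightarrow> complex poly \<Rightarrow> complex poly mat" where
  "unit_mat a b f = mat sz sz (\<lambda>(x, y). if x = a \<and> y = b then f else 0)"

lemma unit_mat_sl: "a \<noteq> b \<Longrightarrow> unit_mat a b f \<in> sl_carrier r"
  by (auto simp: sl_carrier_def unit_mat_def intro!: sum.neutral)

lemma tensor_act_unit:
  assumes "s \<in> fillings r m" "a < sz"
  shows "tensor_act r m (unit_mat a b f) (alt r m s) = (\<lambda>g. \<Sum>q\<in>{q\<in>Posn. s q = b}. eval_at q f * alt r m (s(q := a)) g)"
proof
  fix g
  have "(\<Sum>x<sz. eval_at q (unit_mat a b f $$ (x, s q)) * alt r m (s(q := x)) g) = (if s q = b then eval_at q f * alt r m (s(q := a)) g else 0)"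
    if q: "q \<in> Posn" for q
  proof -
    have sq: "s q < sz" using assms(1) q by (auto simp: fillings_def)
    have "(\<Sum>x<sz. eval_at q (unit_mat a b f $$ (x, s q)) * alt r m (s(q := x)) g)
      = (\<Sum>x<sz. if x = a then (if s q = b then eval_at q f * alt r m (s(q := a)) g else 0) else 0)"
      by (intro sum.cong refl) (use sq in \<open>auto simp: unit_mat_def eval_at_simps\<close>)
    then show ?thesis using assms(2) by simp
  qed
  then have "tensor_act r m (unit_mat a b f) (alt r m s) g = (\<Sum>q\<in>Posn. if s q = b then eval_at q f * alt r m (s(q := a)) g else 0)"
    unfolding tensor_act_alt[OF assms(1)] by (intro sum.cong refl)
  also have "\<dots> = (\<Sum>q\<in>{q\<in>Posn. s q = b}. eval_at q f * alt r m (s(q := a)) g)"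
    by (rule sum.inter_filter[symmetric]) (rule finite_positions)
  finally show "tensor_act r m (unit_mat a b f) (alt r m s) g = (\<Sum>q\<in>{q\<in>Posn. s q = b}. eval_at q f * alt r m (s(q := a)) g)" .
qed

text \<open>Membership in the cyclic submodule once the variable is inverted.\<close>

definition reachable :: "(position \<Rightarrow> nat) \<Rightarrow> bool" where
  "reachable s \<longleftrightarrow> (\<exists>e. (\<lambda>g. [:0, 1:] ^ e * alt r m s g) \<in> cyclic_sub)"

definition column_inj :: "(position \<Rightarrow> nat) \<Rightarrow> bool" where
  "column_inj s \<longleftrightarrow> (\<forall>p\<in>Posn. \<forall>q\<in>Posn. column p = column q \<longrightarrow> s p = s q \<longrightarrow> p = q)"

text \<open>A Lagrange interpolation polynomial separates the evaluation points, so that a single column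
  can be changed without affecting the others.\<close>

lemma reachable_upd:
  assumes s: "s \<in> fillings r m" "column_inj s" "reachable s" and q: "q \<in> Posn" and a: "a < sz" "a \<noteq> s q"
  shows "reachable (s(q := a))"
proof -
  let ?s = "[:0, 1:] :: complex poly"
  define \<kappa> where "\<kappa> p = (of_nat (prod_encode p) :: complex)" for p
  define C where "C = columns r m - {column q}"
  \<comment> \<open>A polynomial in t with coefficients in C[s], which act on the cyclic submodule.
    It vanishes at the points of all columns other than that of \<open>q\<close>, and at the latter
    it is s^(card C) times the constant \<open>D\<close>, nonzero because the codes are
    distinct.\<close>
  define L where "L = (\<Prod>c\<in>C. [:- [:0, \<kappa> c:], 1:])"
  have finC: "finite C" by (simp add: C_def finite_columns)
  obtain e where e: "(\<lambda>g. ?s ^ e * alt r m s g) \<in> cyclic_sub" using s(3) by (auto simp: reachable_def)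
  define \<phi> where "\<phi> g = (\<Sum>k\<le>degree L. coeff L k * tensor_act r m (unit_mat a (s q) (monom 1 k)) (\<lambda>g. ?s ^ e * alt r m s g) g)" for g
  have \<phi>: "\<phi> \<in> cyclic_sub" unfolding \<phi>_def
    by (intro cyclic_sub_sum scale act e unit_mat_sl) (use a in auto)
  have ev: "eval_at p (monom 1 k) = [:0, \<kappa> (column p):] ^ k" for p k
  proof (induction k)
    case (Suc k)
    have "monom 1 (Suc k) = [:0, 1:] * (monom 1 k :: complex poly)" by (simp add: monom_Suc)
    moreover have "eval_at p [:0, 1:] = [:0, \<kappa> (column p):]" by (simp add: eval_at_def \<kappa>_def pcompose_pCons)
    ultimately show ?case using Suc by (simp only: eval_at_simps(2) power_Suc)
  qed (simp add: eval_at_simps one_pCons[symmetric] monom_0)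
  have Lev: "(\<Sum>k\<le>degree L. coeff L k * [:0, \<kappa> (column p):] ^ k) = (\<Prod>c\<in>C. [:0, \<kappa> (column p) - \<kappa> c:])" for p
  proof -
    have "(\<Sum>k\<le>degree L. coeff L k * [:0, \<kappa> (column p):] ^ k) = poly L [:0, \<kappa> (column p):]"
      by (rule poly_altdef[symmetric])
    also have "\<dots> = (\<Prod>c\<in>C. [:0, \<kappa> (column p) - \<kappa> c:])" by (simp add: L_def poly_prod)
    finally show ?thesis .
  qed
  have "\<phi> g = ?s ^ e * (\<Sum>p\<in>{p\<in>Posn. s p = s q}. (\<Prod>c\<in>C. [:0, \<kappa> (column p) - \<kappa> c:]) * alt r m (s(p := a)) g)" for g
  proof -
    have "\<phi> g = (\<Sum>k\<le>degree L. \<Sum>p\<in>{p\<in>Posn. s p = s q}. ?s ^ e * ((coeff L k * [:0, \<kappa> (column p):] ^ k) * alt r m (s(p := a)) g))"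
      unfolding \<phi>_def tensor_act_scale tensor_act_unit[OF s(1) a(1)] ev by (simp add: sum_distrib_left mult_ac del: mult_pCons_left)
    also have "\<dots> = (\<Sum>p\<in>{p\<in>Posn. s p = s q}. \<Sum>k\<le>degree L. ?s ^ e * ((coeff L k * [:0, \<kappa> (column p):] ^ k) * alt r m (s(p := a)) g))"
      by (rule sum.swap)
    also have "\<dots> = (\<Sum>p\<in>{p\<in>Posn. s p = s q}. ?s ^ e * ((\<Sum>k\<le>degree L. coeff L k * [:0, \<kappa> (column p):] ^ k) * alt r m (s(p := a)) g))"
      by (simp only: sum_distrib_left sum_distrib_right)
    finally show ?thesis unfolding Lev by (simp only: sum_distrib_left)
  qed
  moreover have "(\<Sum>p\<in>{p\<in>Posn. s p = s q}. (\<Prod>c\<in>C. [:0, \<kappa> (column p) - \<kappa> c:]) * alt r m (s(p := a)) g)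
    = (\<Sum>p\<in>{q}. (\<Prod>c\<in>C. [:0, \<kappa> (column p) - \<kappa> c:]) * alt r m (s(p := a)) g)" for g
  proof (rule sum.mono_neutral_right)
    show "\<forall>p\<in>{p\<in>Posn. s p = s q} - {q}. (\<Prod>c\<in>C. [:0, \<kappa> (column p) - \<kappa> c:]) * alt r m (s(p := a)) g = 0"
    proof
      fix p assume p: "p \<in> {p\<in>Posn. s p = s q} - {q}"
      then have "column p \<noteq> column q" using s(2) q by (auto simp: column_inj_def)
      moreover have "column p \<in> columns r m" using p by (auto simp: positions_def column_def)
      ultimately have "column p \<in> C" by (simp add: C_def)
      then have "(\<Prod>c\<in>C. [:0, \<kappa> (column p) - \<kappa> c:]) = 0" using finC by (intro prod_zero) auto
      then show "(\<Prod>c\<in>C. [:0, \<kappa> (column p) - \<kappa> c:]) * alt r m (s(p := a)) g = 0" by simp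
    qed
  qed (use q in \<open>auto simp: finite_positions\<close>)
  moreover define D where "D = (\<Prod>c\<in>C. \<kappa> (column q) - \<kappa> c)"
  have "(\<Prod>c\<in>C. [:0, \<kappa> (column q) - \<kappa> c:]) = [:D:] * ?s ^ card C"
  proof -
    have "(\<Prod>c\<in>C. [:0, \<kappa> (column q) - \<kappa> c:]) = (\<Prod>c\<in>C. [:\<kappa> (column q) - \<kappa> c:] * ?s)" by simp
    also have "\<dots> = (\<Prod>c\<in>C. [:\<kappa> (column q) - \<kappa> c:]) * ?s ^ card C" by (simp only: prod.distrib prod_constant)
    also have "(\<Prod>c\<in>C. [:\<kappa> (column q) - \<kappa> c:]) = [:D:]" unfolding D_def
      by (induction C rule: infinite_finite_induct) (auto simp: one_pCons)
    finally show ?thesis .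
  qed
  ultimately have \<phi>_eq: "\<phi> g = [:D:] * (?s ^ (e + card C) * alt r m (s(q := a)) g)" for g
    by (simp add: power_add mult_ac del: mult_pCons_left)
  have "D \<noteq> 0" unfolding D_def using finC by (auto simp: C_def \<kappa>_def)
  then have "?s ^ (e + card C) * alt r m (s(q := a)) g = [:inverse D:] * \<phi> g" for g
    unfolding \<phi>_eq mult.assoc[symmetric] by (simp add: one_pCons[symmetric])
  then have "(\<lambda>g. ?s ^ (e + card C) * alt r m (s(q := a)) g) = (\<lambda>g. [:inverse D:] * \<phi> g)" by blast
  then show ?thesis unfolding reachable_def using scale[OF \<phi>, of "[:inverse D:]"] by (intro exI[of _ "e + card C"]) simp
qed

text \<open>One subset per column, the index set of the wedge basis of the tensor product of
  exterior powers.\<close>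

definition column_sets :: "(nat \<times> nat \<Rightarrow> nat set) set" where
  "column_sets = (PiE (columns r m) (\<lambda>c. {S. S \<subseteq> {..<sz} \<and> card S = fst c}))"

definition sorted_filling :: "(nat \<times> nat \<Rightarrow> nat set) \<Rightarrow> position \<Rightarrow> nat" where
  "sorted_filling S p = (if p \<in> Posn then sorted_list_of_set (S (column p)) ! snd (snd p) else 0)"

lemma card_column_sets: "card column_sets = (\<Prod>i=1..r. (sz choose i) ^ m i)"
proof -
  have "card {S. S \<subseteq> {..<sz} \<and> card S = k} = sz choose k" for k
    using n_subsets[of "{..<sz}" k] by simp
  then have "card column_sets = (\<Prod>c\<in>columns r m. sz choose fst c)"
    unfolding column_sets_def by (simp add: card_PiE finite_columns)
  also have "\<dots> = (\<Prod>i=1..r. \<Prod>j<m i. sz choose i)"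
    unfolding columns_def by (subst prod.Sigma) (auto simp: split_def)
  finally show ?thesis by simp
qed

lemma finite_column_sets: "finite column_sets"
  unfolding column_sets_def by (intro finite_PiE finite_columns) auto

context
  fixes S assumes S: "S \<in> column_sets"
begin

private lemma S_props: assumes "c \<in> columns r m"
  shows "S c \<subseteq> {..<sz}" "finite (S c)" "card (S c) = fst c" "length (sorted_list_of_set (S c)) = fst c"
    "set (sorted_list_of_set (S c)) = S c" "sorted_wrt (<) (sorted_list_of_set (S c))"
proof -
  have "S c \<in> {S. S \<subseteq> {..<sz} \<and> card S = fst c}" using S assms unfolding column_sets_def by (rule PiE_mem)
  then show *: "S c \<subseteq> {..<sz}" "finite (S c)" "card (S c) = fst c" by (auto intro: finite_subset)
  then show "length (sorted_list_of_set (S c)) = fst c" "set (sorted_list_of_set (S c)) = S c" by auto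
  show "sorted_wrt (<) (sorted_list_of_set (S c))" by simp
qed

private lemma pos_col: "p \<in> Posn \<Longrightarrow> column p \<in> columns r m" "p \<in> Posn \<Longrightarrow> snd (snd p) < fst (column p)"
  by (auto simp: positions_def column_def)

lemma sorted_filling_less:
  assumes "p \<in> Posn" "q \<in> Posn" "column p = column q" "snd (snd p) < snd (snd q)"
  shows "sorted_filling S p < sorted_filling S q"
proof -
  have "sorted_list_of_set (S (column q)) ! snd (snd p) < sorted_list_of_set (S (column q)) ! snd (snd q)"
    by (rule sorted_wrt_nth_less[OF S_props(6)[OF pos_col(1)[OF assms(2)]] assms(4)])
      (use S_props(4)[OF pos_col(1)[OF assms(2)]] pos_col(2)[OF assms(2)] in simp)
  then show ?thesis using assms by (simp add: sorted_filling_def)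
qed

lemma position_eqI: "column p = column q \<Longrightarrow> snd (snd p) = snd (snd q) \<Longrightarrow> p = q"
  by (auto simp: column_def prod_eq_iff)

text \<open>A strictly increasing column dominates the standard one entry by entry. This prevents
  collisions when the columns are changed one entry at a time.\<close>

lemma sorted_filling_ge: "p \<in> Posn \<Longrightarrow> snd (snd p) \<le> sorted_filling S p"
proof (induction "snd (snd p)" arbitrary: p)
  case (Suc k)
  obtain i j where p: "p = (i, j, Suc k)" using Suc(2) by (cases p) auto
  have p': "(i, j, k) \<in> Posn" using Suc.prems by (auto simp: positions_def p)
  then have "k \<le> sorted_filling S (i, j, k)" using Suc(1)[of "(i, j, k)"] by simp
  also have "\<dots> < sorted_filling S p"
    by (rule sorted_filling_less[OF p' Suc.prems]) (auto simp: p column_def)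
  finally show ?case by (simp add: p)
qed simp

lemma sorted_filling_mem: "sorted_filling S \<in> fillings r m"
proof -
  have "sorted_filling S p < sz" if p: "p \<in> Posn" for p
  proof -
    note P = S_props[OF pos_col(1)[OF p]]
    have "sorted_list_of_set (S (column p)) ! snd (snd p) \<in> S (column p)"
      using P(4,5) pos_col(2)[OF p] nth_mem by metis
    then show ?thesis using P(1) p by (auto simp: sorted_filling_def)
  qed
  then show ?thesis by (auto simp: fillings_def sorted_filling_def)
qed

lemma sorted_filling_inj: "column_inj (sorted_filling S)"
  unfolding column_inj_def
proof (intro ballI impI)
  fix p q assume pq: "p \<in> Posn" "q \<in> Posn" "column p = column q" "sorted_filling S p = sorted_filling S q"
  have "\<not> snd (snd p) < snd (snd q)" using sorted_filling_less[OF pq(1-3)] pq(4) by auto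
  moreover have "\<not> snd (snd q) < snd (snd p)" using sorted_filling_less[OF pq(2,1) pq(3)[symmetric]] pq(4) by auto
  ultimately show "p = q" using position_eqI[OF pq(3)] by simp
qed

lemma sorted_filling_image:
  assumes "c \<in> columns r m"
  shows "sorted_filling S ` {p\<in>Posn. column p = c} = S c"
proof -
  have "{p\<in>Posn. column p = c} = (\<lambda>k. (fst c, snd c, k)) ` {..<fst c}"
    using assms by (auto simp: positions_def column_def image_iff)
  then have "sorted_filling S ` {p\<in>Posn. column p = c} = (\<lambda>k. sorted_filling S (fst c, snd c, k)) ` {..<fst c}"
    by (simp only: image_image)
  also have "\<dots> = (\<lambda>k. sorted_list_of_set (S c) ! k) ` {..<fst c}"
  proof (rule image_cong[OF refl])
    fix k assume "k \<in> {..<fst c}"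
    then have "(fst c, snd c, k) \<in> Posn" using assms by (auto simp: positions_def)
    then show "sorted_filling S (fst c, snd c, k) = sorted_list_of_set (S c) ! k"
      by (simp add: sorted_filling_def column_def)
  qed
  also have "\<dots> = set (sorted_list_of_set (S c))"
    using S_props(4)[OF assms] by (auto simp: set_conv_nth)
  finally show ?thesis using S_props(5)[OF assms] by simp
qed

text \<open>The entries are changed from the largest row number to the smallest: \<open>U\<close> is
  the set of changed positions, closed under passing to larger rows of a column, and its member
  \<open>q\<close> with the least row number is the one changed last. A changed entry is at least
  its own row number and so differs from the standard entries in smaller rows; this keeps
  \<open>reachable_upd\<close> applicable.\<close>

lemma reachable_sorted_filling: "reachable (sorted_filling S)"
proof -
  define t where "t U = (\<lambda>p. if p \<in> U then sorted_filling S p else std_filling p)" for U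
  have "reachable (t U)" if "finite U" "U \<subseteq> Posn"
    "\<forall>p\<in>U. \<forall>q\<in>Posn. column q = column p \<longrightarrow> snd (snd p) < snd (snd q) \<longrightarrow> q \<in> U" for U
    using that
  proof (induction "card U" arbitrary: U)
    case 0
    then have "t U = std_filling" by (auto simp: t_def)
    then show ?case using gen unfolding reachable_def tensor_gen_def by (intro exI[of _ 0]) simp
  next
    case (Suc k)
    then have "U \<noteq> {}" by auto
    define q where "q = arg_min_on (\<lambda>p. snd (snd p)) U"
    have q: "q \<in> U" "\<And>p. p \<in> U \<Longrightarrow> snd (snd q) \<le> snd (snd p)"
      unfolding q_def using arg_min_if_finite[OF Suc.prems(1) \<open>U \<noteq> {}\<close>, of "\<lambda>p. snd (snd p)"]
      by (auto simp: not_less)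
    define U' where "U' = U - {q}"
    have U': "finite U'" "U' \<subseteq> Posn" "card U' = k" using Suc.prems Suc(2) q by (auto simp: U'_def)
    have up: "\<forall>p\<in>U'. \<forall>q\<in>Posn. column q = column p \<longrightarrow> snd (snd p) < snd (snd q) \<longrightarrow> q \<in> U'"
    proof (intro ballI impI)
      fix p x assume px: "p \<in> U'" "x \<in> Posn" "column x = column p" "snd (snd p) < snd (snd x)"
      then have "x \<in> U" using Suc.prems(3) by (auto simp: U'_def)
      moreover have "x \<noteq> q" using q(2)[of p] px by (auto simp: U'_def)
      ultimately show "x \<in> U'" by (simp add: U'_def)
    qed
    have R: "reachable (t U')" using Suc(1)[OF U'(3)[symmetric] U'(1,2) up] .
    have qP: "q \<in> Posn" using q(1) Suc.prems(2) by blast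
    have tU: "t U = (t U')(q := sorted_filling S q)" using q(1) by (auto simp: t_def U'_def)
    have tU'q: "t U' q = snd (snd q)" using qP by (simp add: t_def U'_def std_filling_def)
    show ?case
    proof (cases "sorted_filling S q = t U' q")
      case True
      then show ?thesis using R tU by (metis fun_upd_triv)
    next
      case False
      have fil: "t U' \<in> fillings r m"
        using sorted_filling_mem std_filling_mem by (auto simp: fillings_def t_def)
      have inj: "column_inj (t U')"
      proof -
        have cross: False if "p \<in> U'" "x \<in> Posn" "x \<notin> U'" "column p = column x" "t U' p = t U' x" for p x
        proof -
          have p: "p \<in> Posn" using that U' by blast
          have "\<not> snd (snd p) < snd (snd x)" using up that by metis
          moreover have "snd (snd p) \<noteq> snd (snd x)" using position_eqI[OF that(4)] that by metis
          ultimately have "snd (snd x) < snd (snd p)" by simp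
          also have "\<dots> \<le> sorted_filling S p" by (rule sorted_filling_ge[OF p])
          finally show False using that by (simp add: t_def std_filling_def)
        qed
        show ?thesis unfolding column_inj_def
        proof (intro ballI impI)
          fix p x assume px: "p \<in> Posn" "x \<in> Posn" "column p = column x" "t U' p = t U' x"
          consider "p \<in> U'" "x \<in> U'" | "p \<notin> U'" "x \<notin> U'" | "p \<in> U'" "x \<notin> U'" | "p \<notin> U'" "x \<in> U'" by blast
          then show "p = x"
          proof cases
            case 1
            then show ?thesis using px sorted_filling_inj by (auto simp: column_inj_def t_def)
          next
            case 2
            then show ?thesis using px position_eqI by (simp add: t_def std_filling_def)
          qed (use cross px in metis)+
        qed
      qed
      have "sorted_filling S q < sz" using sorted_filling_mem qP by (auto simp: fillings_def)
      from reachable_upd[OF fil inj R qP this False] show ?thesis unfolding tU .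
    qed
  qed
  from this[of Posn] have "reachable (t Posn)" by (simp add: finite_positions)
  moreover have "t Posn = sorted_filling S" by (auto simp: t_def sorted_filling_def std_filling_def)
  ultimately show ?thesis by simp
qed

text \<open>Evaluation at the sorted fillings is dual to the wedge basis. A column permutation that
  relates two sorted fillings preserves the sets of entries, and for equal sets only the identity
  remains since the entries of a column are distinct.\<close>

lemma alt_sorted_filling:
  assumes S': "S' \<in> column_sets" and eq: "\<And>c. c \<in> columns r m \<Longrightarrow> sorted_filling S' ` {p\<in>Posn. column p = c} = S' c"
  shows "alt r m (sorted_filling S) (sorted_filling S') = (if S = S' then 1 else 0)"
proof (cases "S = S'")
  case True
  have "(if sorted_filling S' = sorted_filling S \<circ> \<sigma> then 1 else 0 :: complex poly) = (if \<sigma> = id then 1 else 0)"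
    if \<sigma>: "\<sigma> \<in> column_perms r m" for \<sigma>
  proof -
    have "\<sigma> = id" if eq: "sorted_filling S' = sorted_filling S \<circ> \<sigma>"
    proof
      fix p
      show "\<sigma> p = id p"
      proof (cases "p \<in> Posn")
        case p: True
        have "\<sigma> p \<in> Posn" using permutes_in_image[OF column_permsD(1)[OF \<sigma>]] p by simp
        moreover have "sorted_filling S (\<sigma> p) = sorted_filling S p" using fun_cong[OF eq, of p] True by simp
        ultimately show ?thesis using sorted_filling_inj p column_permsD(2)[OF \<sigma>] by (auto simp: column_inj_def)
      next
        case False
        then show ?thesis using permutes_not_in[OF column_permsD(1)[OF \<sigma>]] by simp
      qed
    qed
    then show ?thesis using True by auto
  qed
  then have "alt r m (sorted_filling S) (sorted_filling S') = (\<Sum>\<sigma>\<in>column_perms r m. of_int (sign \<sigma>) * (if \<sigma> = id then 1 else 0))"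
    unfolding alt_def by (intro sum.cong refl) simp
  also have "\<dots> = (\<Sum>\<sigma>\<in>column_perms r m. if \<sigma> = id then 1 else 0)"
    by (intro sum.cong refl) (simp add: sign_id)
  also have "\<dots> = 1" using finite_column_perms[of r m] by (simp add: column_perms_def permutes_id)
  finally show ?thesis using True by simp
next
  case False
  have "sorted_filling S' \<noteq> sorted_filling S \<circ> \<sigma>" if \<sigma>: "\<sigma> \<in> column_perms r m" for \<sigma>
  proof
    assume e: "sorted_filling S' = sorted_filling S \<circ> \<sigma>"
    have "S' c = S c" if c: "c \<in> columns r m" for c
    proof -
      have "\<sigma> ` {p\<in>Posn. column p = c} = {p\<in>Posn. column p = c}"
      proof (rule endo_inj_surj)
        show "\<sigma> ` {p\<in>Posn. column p = c} \<subseteq> {p\<in>Posn. column p = c}"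
          using permutes_in_image[OF column_permsD(1)[OF \<sigma>]] column_permsD(2)[OF \<sigma>] by auto
        show "inj_on \<sigma> {p\<in>Posn. column p = c}"
          using permutes_inj[OF column_permsD(1)[OF \<sigma>]] by (rule inj_on_subset) simp
      qed (simp add: finite_positions)
      then have "sorted_filling S' ` {p\<in>Posn. column p = c} = sorted_filling S ` {p\<in>Posn. column p = c}"
        unfolding e image_comp[symmetric] by simp
      then show ?thesis using sorted_filling_image[OF c] eq[OF c] by simp
    qed
    then have "S' = S" using S S' unfolding column_sets_def by (intro PiE_ext) auto
    then show False using False by simp
  qed
  then show ?thesis using False by (simp add: alt_def)
qed

end

theorem no_small_span_cyclic:
  assumes "finite V" "card V < (\<Prod>i=1..r. (sz choose i) ^ m i)"
    and "\<And>\<phi>. \<phi> \<in> cyclic_sub \<Longrightarrow> \<exists>a. \<exists>\<psi>\<in>cyclic_sub. \<forall>x. \<phi> x = (\<Sum>v\<in>V. [:a v:] * v x) + [:0, 1:] * \<psi> x"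
  shows False
proof -
  obtain Ss where Ss: "set Ss = column_sets" "distinct Ss"
    using finite_distinct_list[OF finite_column_sets] by blast
  define N where "N = length Ss"
  have N: "N = (\<Prod>i=1..r. (sz choose i) ^ m i)"
    unfolding N_def card_column_sets[symmetric] using Ss distinct_card by metis
  have mem: "Ss ! k \<in> column_sets" if "k < N" for k using that Ss nth_mem unfolding N_def by metis
  have "\<exists>e. k < N \<longrightarrow> (\<lambda>g. [:0, 1:] ^ e * alt r m (sorted_filling (Ss ! k)) g) \<in> cyclic_sub" for k
    using reachable_sorted_filling[OF mem] unfolding reachable_def by blast
  then obtain e where e: "\<And>k. k < N \<Longrightarrow> (\<lambda>g. [:0, 1:] ^ e k * alt r m (sorted_filling (Ss ! k)) g) \<in> cyclic_sub"
    by metis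
  \<comment> \<open>A common exponent for all basis vectors; the sum is at least each
    \<open>e k\<close>.\<close>
  define E where "E = (\<Sum>k<N. e k)"
  define y where "y k = (\<lambda>g. [:0, 1:] ^ E * alt r m (sorted_filling (Ss ! k)) g)" for k
  have "y k \<in> cyclic_sub" if k: "k < N" for k
  proof -
    have "e k \<le> E" unfolding E_def using k by (intro member_le_sum) auto
    then have "y k = (\<lambda>g. [:0, 1:] ^ (E - e k) * ([:0, 1:] ^ e k * alt r m (sorted_filling (Ss ! k)) g))"
      unfolding y_def mult.assoc[symmetric] power_add[symmetric] by simp
    then show ?thesis using scale[OF e[OF k]] by simp
  qed
  moreover have "y k (sorted_filling (Ss ! l)) = (if k = l then [:0, 1:] ^ E else 0)" if "k < N" "l < N" for k l
    using alt_sorted_filling[OF mem[OF that(1)] mem[OF that(2)] sorted_filling_image[OF mem[OF that(2)]]]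
      nth_eq_iff_index_eq[OF Ss(2)] that unfolding y_def N_def by auto
  ultimately show False
    using assms N by (intro no_small_span_mod_variable[of cyclic_sub V N y "\<lambda>l. sorted_filling (Ss ! l)" E])
      (auto intro: scale)
qed

end

section \<open>Counting partition overlaid patterns\<close>

lemma partition_fits_iff:
  "is_partition p \<and> fits a b p \<longleftrightarrow> antimono p \<and> p a = 0 \<and> p 0 \<le> b"
proof
  assume h: "is_partition p \<and> fits a b p"
  then have am: "antimono p" and ev: "eventually (\<lambda>k. p k = 0) sequentially"
    and f: "card {k. p k \<noteq> 0} \<le> a" "p 0 \<le> b"
    by (auto simp: is_partition_def fits_def)
  obtain N where N: "\<And>k. k \<ge> N \<Longrightarrow> p k = 0" using ev by (auto simp: eventually_sequentially)
  have "p a = 0"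
  proof (rule ccontr)
    assume "p a \<noteq> 0"
    then have "p k \<noteq> 0" if "k \<le> a" for k using antimonoD[OF am that] by linarith
    then have "{..a} \<subseteq> {k. p k \<noteq> 0}" by blast
    moreover have "k < N" if "p k \<noteq> 0" for k using N[of k] that by linarith
    then have "{k. p k \<noteq> 0} \<subseteq> {..<N}" by blast
    then have "finite {k. p k \<noteq> 0}" by (rule finite_subset) simp
    ultimately have "card {..a} \<le> card {k. p k \<noteq> 0}" by (intro card_mono)
    then show False using f by simp
  qed
  then show "antimono p \<and> p a = 0 \<and> p 0 \<le> b" using am f by simp
next
  assume h: "antimono p \<and> p a = 0 \<and> p 0 \<le> b"
  have z: "p k = 0" if "a \<le> k" for k using antimonoD[OF conjunct1[OF h] that] h by simp
  then have "k < a" if "p k \<noteq> 0" for k using z[of k] that by (cases "a \<le> k") auto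
  then have "{k. p k \<noteq> 0} \<subseteq> {..<a}" by blast
  then have "card {k. p k \<noteq> 0} \<le> a" using card_mono[of "{..<a}" "{k. p k \<noteq> 0}"] by simp
  moreover have "\<forall>k. p k \<le> b" using le_trans[OF antimonoD[OF conjunct1[OF h] le0]] h by blast
  ultimately show "is_partition p \<and> fits a b p"
    using h exI[of "\<lambda>N. \<forall>k\<ge>N. p k = 0" a] z unfolding is_partition_def fits_def eventually_sequentially by simp
qed

text \<open>Pascal's rule: either the largest part is smaller than the width, or it equals the width
  and is removed by shifting the sequence. \<open>case_nat\<close> puts it back.\<close>

lemma card_partitions_fits:
  "finite {p. is_partition p \<and> fits a b p} \<and> card {p. is_partition p \<and> fits a b p} = (a + b) choose a"
proof -
  define P where "P a b = {p :: nat \<Rightarrow> nat. antimono p \<and> p a = 0 \<and> p 0 \<le> b}" for a b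
  have zero: "{p :: nat \<Rightarrow> nat. antimono p \<and> p 0 = 0} = {\<lambda>_. 0}"
  proof (rule subset_antisym; rule subsetI)
    fix p :: "nat \<Rightarrow> nat" assume "p \<in> {p. antimono p \<and> p 0 = 0}"
    then have "p k = 0" for k using antimonoD[of p 0 k] by simp
    then show "p \<in> {\<lambda>_. 0}" by auto
  qed (auto simp: antimono_def)
  have P0: "P 0 b = {\<lambda>_. 0}" "P a 0 = {\<lambda>_. 0}" for a b
  proof -
    have "P 0 b = {p :: nat \<Rightarrow> nat. antimono p \<and> p 0 = 0}" by (auto simp: P_def)
    then show "P 0 b = {\<lambda>_. 0}" unfolding zero .
    have "p a = 0" if "antimono p" "p 0 = 0" for p :: "nat \<Rightarrow> nat" using antimonoD[OF that(1), of 0 a] that(2) by simp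
    then have "P a 0 = {p :: nat \<Rightarrow> nat. antimono p \<and> p 0 = 0}" by (auto simp: P_def)
    then show "P a 0 = {\<lambda>_. 0}" unfolding zero .
  qed
  have "finite (P a b) \<and> card (P a b) = (a + b) choose a" for a b
  proof (induction "a + b" arbitrary: a b rule: less_induct)
    case less
    show ?case
    proof (cases "a = 0 \<or> b = 0")
      case True
      then show ?thesis using P0 by auto
    next
      case False
      then obtain a' b' where ab: "a = Suc a'" "b = Suc b'" by (metis not0_implies_Suc)
      let ?c = "\<lambda>p. case_nat (Suc b') p"
      have split: "P (Suc a') (Suc b') = P (Suc a') b' \<union> ?c ` P a' (Suc b')"
      proof (rule subset_antisym; rule subsetI)
        fix p assume p: "p \<in> P (Suc a') (Suc b')"
        show "p \<in> P (Suc a') b' \<union> ?c ` P a' (Suc b')"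
        proof (cases "p 0 = Suc b'")
          case True
          have "p = ?c (\<lambda>k. p (Suc k))" using True by (auto simp: fun_eq_iff split: nat.split)
          moreover have "(\<lambda>k. p (Suc k)) \<in> P a' (Suc b')"
          proof -
            have am: "antimono p" and p0: "p (Suc a') = 0" "p 0 \<le> Suc b'" using p by (simp_all add: P_def)
            have "antimono (\<lambda>k. p (Suc k))"
              by (rule antimonoI) (rule antimonoD[OF am], simp)
            then show ?thesis using p0 antimonoD[OF am le0[of "Suc 0"]] by (simp add: P_def)
          qed
          ultimately show ?thesis by blast
        next
          case False
          then show ?thesis using p by (auto simp: P_def)
        qed
      next
        fix p assume "p \<in> P (Suc a') b' \<union> ?c ` P a' (Suc b')"
        then show "p \<in> P (Suc a') (Suc b')"
        proof
          assume "p \<in> ?c ` P a' (Suc b')"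
          then obtain q where q: "p = ?c q" "antimono q" "q a' = 0" "q 0 \<le> Suc b'" by (auto simp: P_def)
          have "p (Suc k) \<le> p k" for k
            using antimonoD[OF q(2), of "k - 1" k] q(4) by (cases k) (auto simp: q(1))
          then have "antimono p" by (rule antimono_iff_le_Suc[THEN iffD2, rule_format])
          then show ?thesis using q by (auto simp: P_def)
        qed (auto simp: P_def)
      qed
      have inj: "inj_on ?c (P a' (Suc b'))"
      proof (rule inj_onI)
        fix x y assume "?c x = ?c y"
        then have "?c x (Suc k) = ?c y (Suc k)" for k by (rule fun_cong)
        then show "x = y" by auto
      qed
      have "P (Suc a') b' \<inter> ?c ` P a' (Suc b') = {}" by (auto simp: P_def)
      moreover have "finite (P (Suc a') b') \<and> card (P (Suc a') b') = (Suc a' + b') choose Suc a'"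
        "finite (P a' (Suc b')) \<and> card (P a' (Suc b')) = (a' + Suc b') choose a'"
        using less[of "Suc a'" b'] less[of a' "Suc b'"] by (simp_all add: ab)
      ultimately show ?thesis unfolding ab split
        by (subst card_Un_disjoint) (auto simp: card_image[OF inj])
    qed
  qed
  then show ?thesis unfolding partition_fits_iff P_def[symmetric] by blast
qed

section \<open>Removing the top row of a pattern\<close>

definition interlacing :: "nat \<Rightarrow> (nat \<Rightarrow> int) \<Rightarrow> (nat \<Rightarrow> int) set" where
  "interlacing n lam = {\<mu> \<in> noninc_seqs n. interlace (Suc n) lam \<mu>}"

definition overlays :: "nat \<Rightarrow> (nat \<Rightarrow> int) \<Rightarrow> (nat \<Rightarrow> int) \<Rightarrow> (nat \<Rightarrow> nat \<Rightarrow> nat) set" where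
  "overlays n lam \<mu> = (\<Pi>\<^sub>E i\<in>{1..n}. {p. is_partition p \<and> fits (nat (lam i - \<mu> i)) (nat (\<mu> i - lam (Suc i))) p})"

definition extend_pop ::
  "nat \<Rightarrow> (nat \<Rightarrow> int) \<Rightarrow> (nat \<Rightarrow> nat \<Rightarrow> nat) \<Rightarrow> (nat \<Rightarrow> nat \<Rightarrow> int) \<times> (nat \<Rightarrow> nat \<Rightarrow> nat \<Rightarrow> nat) \<Rightarrow>
   (nat \<Rightarrow> nat \<Rightarrow> int) \<times> (nat \<Rightarrow> nat \<Rightarrow> nat \<Rightarrow> nat)" where
  "extend_pop n lam \<pi> P = ((fst P)(Suc n := lam), (snd P)(n := \<pi>))"

lemma extend_pop_mem:
  assumes n: "1 \<le> n" and "lam \<in> noninc_seqs (Suc n)" "\<mu> \<in> interlacing n lam" "\<pi> \<in> overlays n lam \<mu>" "P \<in> pops_bounded n \<mu>"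
  shows "extend_pop n lam \<pi> P \<in> pops_bounded (Suc n) lam"
proof -
  obtain L p where P: "P = (L, p)" by (cases P)
  have L: "L \<in> gt_patterns n" "L n = \<mu>"
    and p: "p \<in> (\<Pi>\<^sub>E j\<in>{1..<n}. \<Pi>\<^sub>E i\<in>{1..j}. {p. is_partition p \<and> fits (rect_height L j i) (rect_width L j i) p})"
    using assms(5) by (auto simp: pops_bounded_def pops_def P)
  define L' where "L' = L(Suc n := lam)"
  define p' where "p' = p(n := \<pi>)"
  have L1: "L \<in> (\<Pi>\<^sub>E j\<in>{1..n}. noninc_seqs j)" "\<And>j. j \<in> {1..<n} \<Longrightarrow> interlace (Suc j) (L (Suc j)) (L j)"
    using L(1) by (auto simp: gt_patterns_def)
  have "L' \<in> (\<Pi>\<^sub>E j\<in>{1..Suc n}. noninc_seqs j)"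
    using L1(1) assms(2) unfolding L'_def PiE_iff extensional_def by (auto simp: le_Suc_eq)
  moreover have "interlace (Suc j) (L' (Suc j)) (L' j)" if "j \<in> {1..<Suc n}" for j
    using that L1(2)[of j] assms(3) L(2) by (cases "j = n") (auto simp: L'_def interlacing_def)
  ultimately have "L' \<in> gt_patterns (Suc n)" by (auto simp: gt_patterns_def)
  moreover have "p' \<in> (\<Pi>\<^sub>E j\<in>{1..<Suc n}. \<Pi>\<^sub>E i\<in>{1..j}. {p. is_partition p \<and> fits (rect_height L' j i) (rect_width L' j i) p})"
  proof (rule PiE_I)
    fix j assume j: "j \<in> {1..<Suc n}"
    show "p' j \<in> (\<Pi>\<^sub>E i\<in>{1..j}. {p. is_partition p \<and> fits (rect_height L' j i) (rect_width L' j i) p})"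
    proof (cases "j = n")
      case True
      then show ?thesis using assms(4) L(2) by (simp add: p'_def overlays_def rect_height_def rect_width_def L'_def)
    next
      case False
      then have "j \<in> {1..<n}" using j by auto
      from PiE_mem[OF p this] show ?thesis using False j by (simp add: p'_def rect_height_def rect_width_def L'_def)
    qed
  next
    fix j assume "j \<notin> {1..<Suc n}"
    then show "p' j = undefined"
      using PiE_arb[OF p, of j] n by (cases "j = n") (auto simp: p'_def)
  qed
  ultimately show ?thesis unfolding extend_pop_def P by (simp add: pops_bounded_def pops_def L'_def p'_def)
qed

lemma pops_bounded_Suc:
  assumes n: "1 \<le> n" and lam: "lam \<in> noninc_seqs (Suc n)"
  shows "bij_betw (\<lambda>(\<mu>, \<pi>, P). extend_pop n lam \<pi> P)
    (SIGMA \<mu>:interlacing n lam. overlays n lam \<mu> \<times> pops_bounded n \<mu>) (pops_bounded (Suc n) lam)"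
  unfolding bij_betw_def
proof
  show "inj_on (\<lambda>(\<mu>, \<pi>, P). extend_pop n lam \<pi> P) (SIGMA \<mu>:interlacing n lam. overlays n lam \<mu> \<times> pops_bounded n \<mu>)"
  proof (rule inj_onI)
    fix x y
    assume x: "x \<in> (SIGMA \<mu>:interlacing n lam. overlays n lam \<mu> \<times> pops_bounded n \<mu>)"
      and y: "y \<in> (SIGMA \<mu>:interlacing n lam. overlays n lam \<mu> \<times> pops_bounded n \<mu>)"
      and e: "(\<lambda>(\<mu>, \<pi>, P). extend_pop n lam \<pi> P) x = (\<lambda>(\<mu>, \<pi>, P). extend_pop n lam \<pi> P) y"
    obtain \<mu> \<pi> L p where x': "x = (\<mu>, \<pi>, L, p)" by (metis prod_cases4)
    obtain \<mu>' \<pi>' L' p' where y': "y = (\<mu>', \<pi>', L', p')" by (metis prod_cases4)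
    have 1: "(L, p) \<in> pops_bounded n \<mu>" and 2: "(L', p') \<in> pops_bounded n \<mu>'"
      and "extend_pop n lam \<pi> (L, p) = extend_pop n lam \<pi>' (L', p')"
      using x y e x' y' by simp_all
    then have eL: "L(Suc n := lam) = L'(Suc n := lam)" and ep: "p(n := \<pi>) = p'(n := \<pi>')"
      by (auto simp: extend_pop_def)
    \<comment> \<open>Both smaller patterns have the default value at the places that
      \<open>extend_pop\<close> overwrites, so resetting these places recovers them.\<close>
    have u: "L (Suc n) = undefined" "L' (Suc n) = undefined" "p n = undefined" "p' n = undefined"
      using 1 2 by (auto simp: pops_bounded_def pops_def gt_patterns_def PiE_def extensional_def)
    have L: "L = L'" using eL u by (metis fun_upd_triv fun_upd_upd)
    have p: "p = p'" using ep u by (metis fun_upd_triv fun_upd_upd)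
    have "\<pi> = \<pi>'" using ep by (metis fun_upd_same)
    moreover have "\<mu> = \<mu>'" using 1 2 L by (auto simp: pops_bounded_def)
    ultimately show "x = y" using L p x' y' by simp
  qed
  show "(\<lambda>(\<mu>, \<pi>, P). extend_pop n lam \<pi> P) ` (SIGMA \<mu>:interlacing n lam. overlays n lam \<mu> \<times> pops_bounded n \<mu>) = pops_bounded (Suc n) lam"
  proof (rule subset_antisym; rule subsetI)
    fix Q assume "Q \<in> (\<lambda>(\<mu>, \<pi>, P). extend_pop n lam \<pi> P) ` (SIGMA \<mu>:interlacing n lam. overlays n lam \<mu> \<times> pops_bounded n \<mu>)"
    then obtain \<mu> \<pi> P where "Q = extend_pop n lam \<pi> P" "\<mu> \<in> interlacing n lam" "\<pi> \<in> overlays n lam \<mu>" "P \<in> pops_bounded n \<mu>"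
      by (elim imageE SigmaE) simp
    then show "Q \<in> pops_bounded (Suc n) lam" using extend_pop_mem[OF n lam] by simp
  next
    fix Q assume Q: "Q \<in> pops_bounded (Suc n) lam"
    obtain L p where LP: "Q = (L, p)" by (cases Q)
    have L: "L \<in> gt_patterns (Suc n)" "L (Suc n) = lam"
      and p: "p \<in> (\<Pi>\<^sub>E j\<in>{1..<Suc n}. \<Pi>\<^sub>E i\<in>{1..j}. {p. is_partition p \<and> fits (rect_height L j i) (rect_width L j i) p})"
      using Q by (auto simp: pops_bounded_def pops_def LP)
    have L1: "L \<in> (\<Pi>\<^sub>E j\<in>{1..Suc n}. noninc_seqs j)" "\<And>j. j \<in> {1..<Suc n} \<Longrightarrow> interlace (Suc j) (L (Suc j)) (L j)"
      using L(1) by (auto simp: gt_patterns_def)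
    define L0 where "L0 = L(Suc n := undefined)"
    define p0 where "p0 = p(n := undefined)"
    have L0: "L0 \<in> gt_patterns n"
    proof -
      have "L0 \<in> (\<Pi>\<^sub>E j\<in>{1..n}. noninc_seqs j)"
        using L1(1) unfolding L0_def PiE_iff extensional_def by auto
      then show ?thesis using L1(2) by (auto simp: gt_patterns_def L0_def)
    qed
    have p0: "p0 \<in> (\<Pi>\<^sub>E j\<in>{1..<n}. \<Pi>\<^sub>E i\<in>{1..j}. {p. is_partition p \<and> fits (rect_height L0 j i) (rect_width L0 j i) p})"
    proof (rule PiE_I)
      fix j assume j: "j \<in> {1..<n}"
      then have "j \<in> {1..<Suc n}" by auto
      from PiE_mem[OF p this] show "p0 j \<in> (\<Pi>\<^sub>E i\<in>{1..j}. {p. is_partition p \<and> fits (rect_height L0 j i) (rect_width L0 j i) p})"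
        using j by (simp add: p0_def rect_height_def rect_width_def L0_def)
    next
      fix j assume j: "j \<notin> {1..<n}"
      then show "p0 j = undefined"
        using PiE_arb[OF p, of j] n by (cases "j = n") (auto simp: p0_def)
    qed
    have "L n \<in> interlacing n lam"
      using L1(1) L1(2)[of n] n L(2) by (auto simp: interlacing_def PiE_iff)
    moreover have "p n \<in> overlays n lam (L n)"
    proof -
      have "n \<in> {1..<Suc n}" using n by auto
      from PiE_mem[OF p this] show ?thesis using L(2) by (simp add: overlays_def rect_height_def rect_width_def)
    qed
    moreover have "(L0, p0) \<in> pops_bounded n (L n)"
      using L0 p0 by (simp add: pops_bounded_def pops_def) (simp add: L0_def)
    moreover have "Q = extend_pop n lam (p n) (L0, p0)"
      using fun_upd_triv[of L "Suc n"] L(2) by (simp add: LP extend_pop_def L0_def p0_def)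
    ultimately show "Q \<in> (\<lambda>(\<mu>, \<pi>, P). extend_pop n lam \<pi> P) ` (SIGMA \<mu>:interlacing n lam. overlays n lam \<mu> \<times> pops_bounded n \<mu>)"
      by (intro image_eqI[of _ _ "(L n, p n, L0, p0)"]) auto
  qed
qed

lemma pops_bounded_1:
  assumes "lam \<in> noninc_seqs 1"
  shows "pops_bounded 1 lam = {((\<lambda>_. undefined)(1 := lam), \<lambda>_. undefined)}"
proof -
  have "L = (\<lambda>_. undefined)(1 := lam)" if "L \<in> (\<Pi>\<^sub>E j\<in>{1..1}. noninc_seqs j)" "L 1 = lam" for L :: "nat \<Rightarrow> nat \<Rightarrow> int"
  proof
    fix j
    show "L j = ((\<lambda>_. undefined)(1 := lam)) j"
      using that(2) PiE_arb[OF that(1), of j] by (cases "j = 1") simp_all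
  qed
  then have 1: "fst P = (\<lambda>_. undefined)(1 := lam)" if "P \<in> pops_bounded 1 lam" for P
    using that unfolding pops_bounded_def pops_def gt_patterns_def by (elim CollectE conjE SigmaE) simp
  have 2: "snd P = (\<lambda>_. undefined)" if "P \<in> pops_bounded 1 lam" for P
    using that unfolding pops_bounded_def pops_def by (elim CollectE conjE SigmaE) simp
  have "(\<lambda>_. undefined)(1 := lam) \<in> (\<Pi>\<^sub>E j\<in>{1..1}. noninc_seqs j)"
    by (rule PiE_I) (use assms in simp_all)
  then have "(\<lambda>_. undefined)(1 := lam) \<in> gt_patterns 1" unfolding gt_patterns_def by simp
  then have 3: "((\<lambda>_. undefined)(1 := lam), \<lambda>_. undefined) \<in> pops_bounded 1 lam"
    unfolding pops_bounded_def pops_def by simp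
  show ?thesis
  proof (rule subset_antisym; rule subsetI)
    fix P assume "P \<in> pops_bounded 1 lam"
    from 1[OF this] 2[OF this] show "P \<in> {((\<lambda>_. undefined)(1 := lam), \<lambda>_. undefined)}"
      by (cases P) simp
  next
    fix P :: "(nat \<Rightarrow> nat \<Rightarrow> int) \<times> (nat \<Rightarrow> nat \<Rightarrow> nat \<Rightarrow> nat)"
    assume "P \<in> {((\<lambda>_. undefined)(1 := lam), \<lambda>_. undefined)}"
    then show "P \<in> pops_bounded 1 lam" using 3 by (simp only: singleton_iff)
  qed
qed

lemma interlacingD:
  assumes "\<mu> \<in> interlacing n lam" "i \<in> {1..n}"
  shows "\<mu> i \<le> lam i" "lam (Suc i) \<le> \<mu> i"
  using assms unfolding interlacing_def interlace_def by simp_all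

text \<open>In the coordinates k_i = lam i - \<mu> i the interlacing conditions decouple: each k_i
  ranges freely from 0 to lam i - lam (i + 1), and the monotonicity of \<mu> follows.\<close>

lemma interlacing_bij:
  assumes lam: "lam \<in> noninc_seqs (Suc n)"
  shows "bij_betw (\<lambda>k. restrict (\<lambda>i. lam i - int (k i)) {1..n})
    (\<Pi>\<^sub>E i\<in>{1..n}. {..nat (lam i - lam (Suc i))}) (interlacing n lam)"
proof (rule bij_betwI[where g = "\<lambda>\<mu>. restrict (\<lambda>i. nat (lam i - \<mu> i)) {1..n}"])
  have dec: "lam (Suc i) \<le> lam i" if "i \<in> {1..n}" for i using lam that by (auto simp: noninc_seqs_def)
  show "(\<lambda>k. restrict (\<lambda>i. lam i - int (k i)) {1..n}) \<in> (\<Pi>\<^sub>E i\<in>{1..n}. {..nat (lam i - lam (Suc i))}) \<rightarrow> interlacing n lam"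
  proof
    fix k assume k: "k \<in> (\<Pi>\<^sub>E i\<in>{1..n}. {..nat (lam i - lam (Suc i))})"
    have ki: "int (k i) \<le> lam i - lam (Suc i)" if "i \<in> {1..n}" for i
      using PiE_mem[OF k that] dec[OF that] by auto
    have "lam (Suc i) - int (k (Suc i)) \<le> lam i - int (k i)" if "i \<in> {1..<n}" for i
      using ki[of i] that by auto
    moreover have "lam (Suc i) \<le> lam i - int (k i)" if "i \<in> {1..n}" for i
      using ki[OF that] by simp
    ultimately show "restrict (\<lambda>i. lam i - int (k i)) {1..n} \<in> interlacing n lam"
      by (auto simp: interlacing_def noninc_seqs_def interlace_def)
  qed
  show "(\<lambda>\<mu>. restrict (\<lambda>i. nat (lam i - \<mu> i)) {1..n}) \<in> interlacing n lam \<rightarrow> (\<Pi>\<^sub>E i\<in>{1..n}. {..nat (lam i - lam (Suc i))})"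
  proof (rule funcsetI, rule PiE_I)
    fix \<mu> i assume "\<mu> \<in> interlacing n lam" and i: "i \<in> {1..n}"
    from interlacingD[OF this] i show "restrict (\<lambda>i. nat (lam i - \<mu> i)) {1..n} i \<in> {..nat (lam i - lam (Suc i))}"
      by simp
  next
    fix \<mu> :: "nat \<Rightarrow> int" and i assume "i \<notin> {1..n}"
    then show "restrict (\<lambda>i. nat (lam i - \<mu> i)) {1..n} i = undefined" by (simp only: restrict_def if_False)
  qed
  show "restrict (\<lambda>i. nat (lam i - restrict (\<lambda>i. lam i - int (k i)) {1..n} i)) {1..n} = k"
    if "k \<in> (\<Pi>\<^sub>E i\<in>{1..n}. {..nat (lam i - lam (Suc i))})" for k
  proof
    fix i show "restrict (\<lambda>i. nat (lam i - restrict (\<lambda>i. lam i - int (k i)) {1..n} i)) {1..n} i = k i"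
      using PiE_arb[OF that, of i] by (cases "i \<in> {1..n}") simp_all
  qed
  show "restrict (\<lambda>i. lam i - int (restrict (\<lambda>i. nat (lam i - \<mu> i)) {1..n} i)) {1..n} = \<mu>"
    if \<mu>: "\<mu> \<in> interlacing n lam" for \<mu>
  proof
    have "\<mu> \<in> {1..n} \<rightarrow>\<^sub>E UNIV" using \<mu> unfolding interlacing_def noninc_seqs_def by blast
    note arb = PiE_arb[OF this]
    fix i show "restrict (\<lambda>i. lam i - int (restrict (\<lambda>i. nat (lam i - \<mu> i)) {1..n} i)) {1..n} i = \<mu> i"
      using arb[of i] interlacingD(1)[OF \<mu>, of i] by (cases "i \<in> {1..n}") simp_all
  qed
qed

lemma card_overlays:
  assumes "\<mu> \<in> interlacing n lam"
  shows "finite (overlays n lam \<mu>)"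
    "card (overlays n lam \<mu>) = (\<Prod>i=1..n. nat (lam i - lam (Suc i)) choose nat (lam i - \<mu> i))"
proof -
  show "finite (overlays n lam \<mu>)" unfolding overlays_def using card_partitions_fits by (intro finite_PiE) auto
  have "nat (lam i - \<mu> i) + nat (\<mu> i - lam (Suc i)) = nat (lam i - lam (Suc i))" if "i \<in> {1..n}" for i
    using interlacingD[OF assms that] by simp
  then show "card (overlays n lam \<mu>) = (\<Prod>i=1..n. nat (lam i - lam (Suc i)) choose nat (lam i - \<mu> i))"
    unfolding overlays_def by (simp add: card_PiE card_partitions_fits)
qed

text \<open>In the coordinates k_i the sum over the next row factors over i, and each factor is
  evaluated by the binomial theorem and Pascal's rule. This mirrors the restriction of the exterior
  power of degree i to smaller rank, a sum of those of degrees i - 1 and i, with k_i counting the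
  columns that lose a box.\<close>

theorem card_pops_bounded:
  assumes "1 \<le> n" "lam \<in> noninc_seqs n"
  shows "finite (pops_bounded n lam) \<and>
    card (pops_bounded n lam) = (\<Prod>i=1..<n. (n choose i) ^ nat (lam i - lam (Suc i)))"
  using assms
proof (induction n arbitrary: lam rule: nat_induct_at_least)
  case base
  then show ?case using pops_bounded_1[of lam] by simp
next
  case (Suc n)
  define m where "m i = nat (lam i - lam (Suc i))" for i
  have dec: "lam (Suc i) \<le> lam i" if "i \<in> {1..n}" for i using Suc.prems that by (auto simp: noninc_seqs_def)
  obtain n' where n': "n = Suc n'" using Suc.hyps by (cases n) auto
  let ?K = "\<Pi>\<^sub>E i\<in>{1..n}. {..m i}"
  have finI: "finite (interlacing n lam)"
    using bij_betw_finite[OF interlacing_bij[OF Suc.prems]] by (simp add: finite_PiE)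
  have IH: "finite (pops_bounded n \<mu>)" "card (pops_bounded n \<mu>) = (\<Prod>i=1..<n. (n choose i) ^ nat (\<mu> i - \<mu> (Suc i)))"
    if "\<mu> \<in> interlacing n lam" for \<mu>
    using Suc.IH[of \<mu>] that by (auto simp: interlacing_def)
  have fin: "finite (pops_bounded (Suc n) lam)"
    using bij_betw_finite[OF pops_bounded_Suc[OF Suc.hyps(1) Suc.prems]] finI IH(1) card_overlays(1) by auto
  have "card (pops_bounded (Suc n) lam) = (\<Sum>\<mu>\<in>interlacing n lam. card (overlays n lam \<mu>) * card (pops_bounded n \<mu>))"
    using bij_betw_same_card[OF pops_bounded_Suc[OF Suc.hyps(1) Suc.prems]] finI IH(1) card_overlays(1)
    by (simp add: card_SigmaI card_cartesian_product)
  also have "\<dots> = (\<Sum>\<mu>\<in>interlacing n lam. (\<Prod>i=1..n. m i choose nat (lam i - \<mu> i)) * (\<Prod>i=1..<n. (n choose i) ^ nat (\<mu> i - \<mu> (Suc i))))"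
    by (intro sum.cong refl) (simp add: card_overlays IH m_def)
  also have "\<dots> = (\<Sum>k\<in>?K. (\<Prod>i=1..n. m i choose k i) * (\<Prod>i=1..<n. (n choose i) ^ (m i - k i + k (Suc i))))"
  proof (rule sum.reindex_bij_betw[OF interlacing_bij[OF Suc.prems], symmetric, THEN trans], fold m_def)
    show "(\<Sum>k\<in>?K. (\<Prod>i=1..n. m i choose nat (lam i - restrict (\<lambda>i. lam i - int (k i)) {1..n} i)) *
        (\<Prod>i=1..<n. (n choose i) ^ nat (restrict (\<lambda>i. lam i - int (k i)) {1..n} i - restrict (\<lambda>i. lam i - int (k i)) {1..n} (Suc i))))
      = (\<Sum>k\<in>?K. (\<Prod>i=1..n. m i choose k i) * (\<Prod>i=1..<n. (n choose i) ^ (m i - k i + k (Suc i))))"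
    proof (rule sum.cong[OF refl])
      fix k assume k: "k \<in> ?K"
      have "nat (lam i - int (k i) - (lam (Suc i) - int (k (Suc i)))) = m i - k i + k (Suc i)" if "i \<in> {1..<n}" for i
      proof -
        have "i \<in> {1..n}" using that by auto
        from PiE_mem[OF k this] show ?thesis using dec[OF \<open>i \<in> {1..n}\<close>] by (auto simp: m_def)
      qed
      then show "(\<Prod>i=1..n. m i choose nat (lam i - restrict (\<lambda>i. lam i - int (k i)) {1..n} i)) *
        (\<Prod>i=1..<n. (n choose i) ^ nat (restrict (\<lambda>i. lam i - int (k i)) {1..n} i - restrict (\<lambda>i. lam i - int (k i)) {1..n} (Suc i)))
        = (\<Prod>i=1..n. m i choose k i) * (\<Prod>i=1..<n. (n choose i) ^ (m i - k i + k (Suc i)))"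
        by (intro arg_cong2[of _ _ _ _ "(*)"] prod.cong refl) auto
    qed
  qed
  also have "\<dots> = (\<Sum>k\<in>?K. \<Prod>i=1..n. (m i choose k i) * (n choose (i - 1)) ^ k i * (n choose i) ^ (m i - k i))"
  proof (rule sum.cong[OF refl])
    fix k
    \<comment> \<open>After splitting the exponent, the first product extends up to n because n
      choose n is 1, and the shifted second one extends down to 1 because n choose 0 is 1.\<close>
    have "(\<Prod>i=1..<n. (n choose i) ^ (m i - k i + k (Suc i))) = (\<Prod>i=1..n'. (n choose i) ^ (m i - k i)) * (\<Prod>i=1..n'. (n choose i) ^ k (Suc i))"
      by (simp add: n' power_add prod.distrib atLeastLessThanSuc_atLeastAtMost)
    also have "(\<Prod>i=1..n'. (n choose i) ^ (m i - k i)) = (\<Prod>i=1..n. (n choose i) ^ (m i - k i))"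
      by (simp add: n' prod.nat_ivl_Suc')
    also have "(\<Prod>i=1..n'. (n choose i) ^ k (Suc i)) = (\<Prod>i=1..n. (n choose (i - 1)) ^ k i)"
    proof -
      have "(\<Prod>i=1..n. (n choose (i - 1)) ^ k i) = (n choose 0) ^ k 1 * (\<Prod>i=Suc 1..Suc n'. (n choose (i - 1)) ^ k i)"
        by (simp add: n' prod.atLeast_Suc_atMost)
      also have "(\<Prod>i=Suc 1..Suc n'. (n choose (i - 1)) ^ k i) = (\<Prod>i=1..n'. (n choose i) ^ k (Suc i))"
        by (subst prod.atLeast_Suc_atMost_Suc_shift) simp
      finally show ?thesis by simp
    qed
    finally show "(\<Prod>i=1..n. m i choose k i) * (\<Prod>i=1..<n. (n choose i) ^ (m i - k i + k (Suc i)))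
      = (\<Prod>i=1..n. (m i choose k i) * (n choose (i - 1)) ^ k i * (n choose i) ^ (m i - k i))"
      by (simp only: prod.distrib ac_simps)
  qed
  also have "\<dots> = (\<Prod>i=1..n. \<Sum>k\<le>m i. (m i choose k) * (n choose (i - 1)) ^ k * (n choose i) ^ (m i - k))"
    by (rule prod_sum_PiE[symmetric]) auto
  also have "\<dots> = (\<Prod>i=1..n. (Suc n choose i) ^ m i)"
  proof (rule prod.cong[OF refl])
    fix i assume "i \<in> {1..n}"
    then have "Suc n choose i = (n choose (i - 1)) + (n choose i)" by (cases i) auto
    then show "(\<Sum>k\<le>m i. (m i choose k) * (n choose (i - 1)) ^ k * (n choose i) ^ (m i - k)) = (Suc n choose i) ^ m i"
      using binomial[of "n choose (i - 1)" "n choose i" "m i"] by simp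
  qed
  finally show ?case using fin by (simp add: m_def atLeastLessThanSuc_atLeastAtMost)
qed

section \<open>Representations of the enveloping algebra\<close>

lemma free_module_induct [consumes 1, case_names zero add]:
  assumes "Poly_Mapping.keys p \<subseteq> S" "P 0"
    "\<And>w c p. w \<in> S \<Longrightarrow> Poly_Mapping.keys p \<subseteq> S \<Longrightarrow> P p \<Longrightarrow> P (Poly_Mapping.single w c + p)"
  shows "P (p :: 'a \<Rightarrow>\<^sub>0 'b::ab_group_add)"
  using assms(1)
proof (induction "card (Poly_Mapping.keys p)" arbitrary: p)
  case 0
  then show ?case using assms(2) by simp
next
  case (Suc n)
  then obtain k where k: "k \<in> Poly_Mapping.keys p" by fastforce
  let ?q = "p - Poly_Mapping.single k (Poly_Mapping.lookup p k)"
  have q: "Poly_Mapping.keys ?q = Poly_Mapping.keys p - {k}"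
    by (auto simp: in_keys_iff lookup_minus lookup_single when_def split: if_splits)
  then have "card (Poly_Mapping.keys ?q) = n" using Suc(2) k by simp
  then have "P ?q" using Suc q by blast
  then have "P (Poly_Mapping.single k (Poly_Mapping.lookup p k) + ?q)"
    using Suc(3) k q by (intro assms(3)) auto
  then show ?case by simp
qed

abbreviation "current_words r \<equiv> carrier (free_algebra (sl_carrier r) :: (complex, complex poly mat free_monoid \<Rightarrow>\<^sub>0 complex) module)"

definition uea_class :: "nat \<Rightarrow> (complex poly mat free_monoid \<Rightarrow>\<^sub>0 complex) \<Rightarrow> (complex poly mat free_monoid \<Rightarrow>\<^sub>0 complex) set" where
  "uea_class r p = uea_ideal (sl_current r) +>\<^bsub>free_algebra (sl_carrier r)\<^esub> p"

lemma carrier_sl_current: "carrier (sl_current r) = sl_carrier r"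
  by (simp add: sl_current_def)

lemma free_algebra_ops:
  "mult (free_algebra X) = (*)" "add (free_algebra X) = (+)" "zero (free_algebra X) = 0" "one (free_algebra X) = 1"
  "smult (free_algebra X) = free_smult"
  by (simp_all add: free_algebra_def)

lemma current_words_closed:
  assumes "p \<in> current_words r" "q \<in> current_words r"
  shows "p + q \<in> current_words r" "p * q \<in> current_words r" "- p \<in> current_words r" "p - q \<in> current_words r"
    "free_smult c p \<in> current_words r" "0 \<in> current_words r" "1 \<in> current_words r"
    "A \<in> sl_carrier r \<Longrightarrow> free_gen A \<in> current_words r"
proof -
  interpret F: ring "free_algebra (sl_carrier r) :: (complex, _) module" by (rule free_algebra_ring)
  show *: "p + q \<in> current_words r" "p * q \<in> current_words r" "0 \<in> current_words r" "1 \<in> current_words r"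
    using F.add.m_closed[OF assms] F.m_closed[OF assms] F.zero_closed F.one_closed unfolding free_algebra_ops by auto
  have m: "- p \<in> current_words r" if "p \<in> current_words r" for p
    using that by (simp add: free_algebra_def in_keys_iff)
  show "- p \<in> current_words r" by (rule m[OF assms(1)])
  show "p - q \<in> current_words r"
    using F.add.m_closed[OF assms(1) m[OF assms(2)]] unfolding free_algebra_ops by simp
  show "free_smult c p \<in> current_words r" by (rule free_smult_closed[OF assms(1)])
  show "free_gen A \<in> current_words r" if "A \<in> sl_carrier r" using that by (simp add: free_algebra_def free_gen_def)
qed

lemma free_algebra_a_inv: "p \<in> current_words r \<Longrightarrow> \<ominus>\<^bsub>free_algebra (sl_carrier r)\<^esub> p = - p"
proof -
  interpret F: ring "free_algebra (sl_carrier r) :: (complex, _) module" by (rule free_algebra_ring)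
  assume p: "p \<in> current_words r"
  show "\<ominus>\<^bsub>free_algebra (sl_carrier r)\<^esub> p = - p"
    by (rule F.minus_equality) (use p current_words_closed(3)[OF p p] in \<open>simp_all add: free_algebra_ops\<close>)
qed

lemma current_uea_ideal: "ideal (uea_ideal (sl_current r)) (free_algebra (sl_carrier r))"
  using uea_ideal[OF sl_current_lie_algebra, of r] unfolding carrier_sl_current .

lemma current_uea_eq: "current_uea r = quot_algebra (free_algebra (sl_carrier r)) (uea_ideal (sl_current r))"
  unfolding uea_def carrier_sl_current ..

lemma uea_class_carrier: "u \<in> carrier (current_uea r) \<longleftrightarrow> (\<exists>p\<in>current_words r. u = uea_class r p)"
  unfolding current_uea_eq uea_class_def
  by (auto simp: quot_algebra_def quot_space_def A_RCOSETS_def RCOSETS_def a_r_coset_def)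

lemma uea_class_closed: "p \<in> current_words r \<Longrightarrow> uea_class r p \<in> carrier (current_uea r)"
  unfolding uea_class_carrier by blast

lemma uea_class_ops:
  assumes p: "p \<in> current_words r" and q: "q \<in> current_words r"
  shows uea_class_mult: "uea_class r p \<otimes>\<^bsub>current_uea r\<^esub> uea_class r q = uea_class r (p * q)"
    and uea_class_add: "uea_class r p \<oplus>\<^bsub>current_uea r\<^esub> uea_class r q = uea_class r (p + q)"
    and uea_class_smult: "c \<odot>\<^bsub>current_uea r\<^esub> uea_class r p = uea_class r (free_smult c p)"
    and uea_class_one: "\<one>\<^bsub>current_uea r\<^esub> = uea_class r 1"
    and uea_class_eq_iff: "uea_class r p = uea_class r q \<longleftrightarrow> p - q \<in> uea_ideal (sl_current r)"
proof -
  let ?F = "free_algebra (sl_carrier r) :: (complex, complex poly mat free_monoid \<Rightarrow>\<^sub>0 complex) module" and ?I = "uea_ideal (sl_current r)"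
  interpret F: vectorspace class_ring ?F by (rule free_algebra_vectorspace)
  interpret R: ring ?F by (rule free_algebra_ring)
  interpret I: ideal ?I ?F by (rule current_uea_ideal)
  show "uea_class r p \<otimes>\<^bsub>current_uea r\<^esub> uea_class r q = uea_class r (p * q)"
    using I.rcoset_mult_add[OF p q] unfolding current_uea_eq uea_class_def
    by (simp add: quot_algebra_def free_algebra_ops)
  show "uea_class r p \<oplus>\<^bsub>current_uea r\<^esub> uea_class r q = uea_class r (p + q)"
    using I.a_rcos_sum[OF p q] unfolding current_uea_eq uea_class_def
    by (simp add: quot_algebra_def quot_space_def free_algebra_ops)
  show "c \<odot>\<^bsub>current_uea r\<^esub> uea_class r p = uea_class r (free_smult c p)"
    using quot_space_smult[OF F.module_axioms ideal_submodule[OF current_uea_ideal] _ p, of c]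
    unfolding current_uea_eq uea_class_def by (simp add: quot_algebra_def free_algebra_ops)
  show "\<one>\<^bsub>current_uea r\<^esub> = uea_class r 1"
    unfolding current_uea_eq uea_class_def by (simp add: quot_algebra_def free_algebra_ops)
  have "uea_class r p = uea_class r q \<longleftrightarrow> p \<ominus>\<^bsub>?F\<^esub> q \<in> ?I"
    unfolding uea_class_def by (rule R.quotient_eq_iff_same_a_r_cos[OF current_uea_ideal p q, symmetric])
  then show "uea_class r p = uea_class r q \<longleftrightarrow> p - q \<in> ?I"
    unfolding a_minus_def free_algebra_a_inv[OF q] free_algebra_ops by simp
qed

lemma current_emb_class: "current_emb r X f = uea_class r (free_gen (tensor_poly X f))"
  unfolding current_emb_def uea_emb_def uea_class_def carrier_sl_current ..

lemma current_emb_closed: "X \<in> sl_carrier r \<Longrightarrow> current_emb r X f \<in> carrier (current_uea r)"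
  unfolding current_emb_class
  by (rule uea_class_closed) (simp add: free_algebra_def free_gen_def tensor_poly_closed)

section \<open>From representations of the current algebra to its enveloping algebra\<close>

locale current_rep = complex_space scale
  for scale :: "complex \<Rightarrow> 'v::ab_group_add \<Rightarrow> 'v" (infixr "*s" 75) +
  fixes r :: nat and \<rho> :: "complex poly mat \<Rightarrow> 'v \<Rightarrow> 'v"
  assumes lin_rho: "lin (\<rho> A)"
    and rho_add: "\<lbrakk>A \<in> sl_carrier r; B \<in> sl_carrier r\<rbrakk> \<Longrightarrow> \<rho> (A + B) x = \<rho> A x + \<rho> B x"
    and rho_smult: "A \<in> sl_carrier r \<Longrightarrow> \<rho> ([:c:] \<cdot>\<^sub>m A) x = c *s \<rho> A x"
    and rho_bracket: "\<lbrakk>A \<in> sl_carrier r; B \<in> sl_carrier r\<rbrakk> \<Longrightarrow> \<rho> (A * B - B * A) x = \<rho> A (\<rho> B x) - \<rho> B (\<rho> A x)"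
begin

definition word_act :: "complex poly mat free_monoid \<Rightarrow> 'v \<Rightarrow> 'v" where
  "word_act w = foldr \<rho> (letters w)"

definition free_act :: "(complex poly mat free_monoid \<Rightarrow>\<^sub>0 complex) \<Rightarrow> 'v \<Rightarrow> 'v" where
  "free_act p v = (\<Sum>w\<in>Poly_Mapping.keys p. Poly_Mapping.lookup p w *s word_act w v)"

lemma lin_word_act: "lin (word_act w)"
  unfolding word_act_def by (rule lin_foldr) (rule lin_rho)

lemma word_act_add: "word_act (u + w) v = word_act u (word_act w v)"
  by (simp add: word_act_def plus_free_monoid_def)

lemma free_act_superset:
  assumes "finite S" "Poly_Mapping.keys p \<subseteq> S"
  shows "free_act p v = (\<Sum>w\<in>S. Poly_Mapping.lookup p w *s word_act w v)"
  unfolding free_act_def by (rule sum.mono_neutral_left) (use assms in \<open>auto simp: in_keys_iff\<close>)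

lemma free_act_add: "free_act (p + q) v = free_act p v + free_act q v"
proof -
  let ?S = "Poly_Mapping.keys p \<union> Poly_Mapping.keys q"
  have f: "finite ?S" by simp
  show ?thesis
    unfolding free_act_superset[OF f Poly_Mapping.keys_add] free_act_superset[OF f Un_upper1] free_act_superset[OF f Un_upper2]
    by (simp only: lookup_add scale_left_distrib sum.distrib)
qed

lemma free_act_0: "free_act 0 v = 0"
  by (simp add: free_act_def)

lemma free_act_single: "free_act (Poly_Mapping.single w c) v = c *s word_act w v"
proof -
  have "free_act (Poly_Mapping.single w c) v = (\<Sum>u\<in>{w}. Poly_Mapping.lookup (Poly_Mapping.single w c) u *s word_act u v)"
    by (rule free_act_superset) auto
  then show ?thesis by simp
qed

lemma free_act_neg: "free_act (- p) v = - free_act p v"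
  using free_act_add[of p "- p" v] free_act_0[of v] by (simp add: add_eq_0_iff)

lemma lin_free_act: "lin (free_act p)"
  unfolding lin_def free_act_def linD(1,2)[OF lin_word_act]
  by (auto simp: scale_right_distrib sum.distrib scale_sum_right mult.commute)

lemma free_act_mult: "free_act (p * q) v = free_act p (free_act q v)"
proof -
  have 1: "free_act (Poly_Mapping.single w c * q) v = c *s word_act w (free_act q v)" for w c
    using subset_UNIV[of "Poly_Mapping.keys q"]
  proof (induction q rule: free_module_induct)
    case zero
    then show ?case by (simp add: free_act_0 lin_0[OF lin_word_act])
  next
    case (add u d q)
    show ?case
      by (simp only: distrib_left mult_single free_act_add add.IH free_act_single word_act_add
          linD(1,2)[OF lin_word_act] scale_right_distrib scale_scale)
  qed
  show ?thesis using subset_UNIV[of "Poly_Mapping.keys p"]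
  proof (induction p rule: free_module_induct)
    case zero
    then show ?case by (simp add: free_act_0)
  next
    case (add u d p)
    show ?case by (simp only: distrib_right free_act_add add.IH 1 free_act_single)
  qed
qed

lemma free_act_gen: "free_act (free_gen A) v = \<rho> A v"
  by (simp add: free_gen_def free_act_single word_act_def)

lemma free_act_one: "free_act 1 v = v"
proof -
  have "free_act (Poly_Mapping.single 0 1) v = v"
    unfolding free_act_single by (simp add: word_act_def zero_free_monoid_def)
  then show ?thesis by (simp only: single_one)
qed

lemma free_act_smult: "free_act (free_smult c p) v = c *s free_act p v"
  unfolding free_smult_def free_act_mult free_act_single by (simp add: word_act_def zero_free_monoid_def)

lemma free_act_diff: "free_act (p - q) v = free_act p v - free_act q v"
  using free_act_add[of p "- q" v] free_act_neg[of q v] by simp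

text \<open>The elements that act as zero form a two-sided ideal, and it contains the defining
  relations.\<close>

lemma free_act_ideal:
  assumes "p \<in> uea_ideal (sl_current r)"
  shows "free_act p v = 0"
proof -
  let ?F = "free_algebra (sl_carrier r) :: (complex, complex poly mat free_monoid \<Rightarrow>\<^sub>0 complex) module"
  interpret F: ring ?F by (rule free_algebra_ring)
  let ?N = "{p \<in> current_words r. \<forall>v. free_act p v = 0}"
  have "ideal ?N ?F"
  proof (rule idealI[OF F.ring_axioms])
    show "subgroup ?N (add_monoid ?F)"
    proof (rule F.add.subgroupI)
      show "?N \<noteq> {}" using free_act_0 F.zero_closed by (auto simp: free_algebra_ops)
    qed (auto simp: free_algebra_ops free_algebra_a_inv current_words_closed free_act_add free_act_neg)
  qed (auto simp: free_algebra_ops free_act_mult current_words_closed free_act_0 lin_0[OF lin_free_act])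
  moreover have "uea_relations (sl_current r) \<subseteq> ?N"
  proof
    fix p assume p: "p \<in> uea_relations (sl_current r)"
    then have "p \<in> current_words r" using uea_relations_subset[OF sl_current_lie_algebra] unfolding carrier_sl_current by blast
    moreover have "free_act p v = 0" for v
      using p by (auto simp: uea_relations_def carrier_sl_current free_act_diff free_act_mult free_act_smult free_act_gen)
        (simp_all add: sl_current_def rho_add rho_smult rho_bracket)
    ultimately show "p \<in> ?N" by blast
  qed
  ultimately have "uea_ideal (sl_current r) \<subseteq> ?N"
    unfolding uea_ideal_def carrier_sl_current by (rule F.genideal_minimal)
  then show ?thesis using assms by blast
qed

text \<open>An arbitrary representative of the class is used; by \<open>free_act_ideal\<close> all
  of them act alike.\<close>

definition Uact :: "(complex poly mat free_monoid \<Rightarrow>\<^sub>0 complex) set \<Rightarrow> 'v \<Rightarrow> 'v" where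
  "Uact u = free_act (SOME p. p \<in> current_words r \<and> u = uea_class r p)"

lemma Uact_class: assumes p: "p \<in> current_words r" shows "Uact (uea_class r p) v = free_act p v"
proof -
  let ?q = "SOME q. q \<in> current_words r \<and> uea_class r p = uea_class r q"
  have q: "?q \<in> current_words r \<and> uea_class r p = uea_class r ?q" by (rule someI[of _ p]) (use p in simp)
  then have "p - ?q \<in> uea_ideal (sl_current r)" using uea_class_eq_iff[OF p] by blast
  from free_act_ideal[OF this] show ?thesis unfolding Uact_def free_act_diff by simp
qed

lemma lin_Uact: "lin (Uact u)"
  unfolding Uact_def by (rule lin_free_act)

lemma Uact_ops:
  assumes u: "u \<in> carrier (current_uea r)" and w: "w \<in> carrier (current_uea r)"
  shows Uact_mult: "Uact (u \<otimes>\<^bsub>current_uea r\<^esub> w) v = Uact u (Uact w v)"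
    and Uact_add: "Uact (u \<oplus>\<^bsub>current_uea r\<^esub> w) v = Uact u v + Uact w v"
    and Uact_smult: "Uact (c \<odot>\<^bsub>current_uea r\<^esub> u) v = c *s Uact u v"
    and Uact_one: "Uact \<one>\<^bsub>current_uea r\<^esub> v = v"
    and Uact_zero: "Uact \<zero>\<^bsub>current_uea r\<^esub> v = 0"
    and Uact_a_inv: "Uact (\<ominus>\<^bsub>current_uea r\<^esub> u) v = - Uact u v"
    and Uact_minus: "Uact (u \<ominus>\<^bsub>current_uea r\<^esub> w) v = Uact u v - Uact w v"
proof -
  interpret U: ring "current_uea r" by (rule uea_ring[OF sl_current_lie_algebra])
  obtain p q where p: "p \<in> current_words r" "u = uea_class r p" and q: "q \<in> current_words r" "w = uea_class r q"
    using u w unfolding uea_class_carrier by blast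
  note pq = current_words_closed[OF p(1) q(1)]
  show "Uact (u \<otimes>\<^bsub>current_uea r\<^esub> w) v = Uact u (Uact w v)"
    by (simp only: p(2) q(2) uea_class_ops[OF p(1) q(1)] Uact_class pq p(1) q(1) free_act_mult)
  have add: "Uact (u \<oplus>\<^bsub>current_uea r\<^esub> w) v = Uact u v + Uact w v"
    if uw: "u \<in> carrier (current_uea r)" "w \<in> carrier (current_uea r)" for u w
  proof -
    obtain p q where p: "p \<in> current_words r" "u = uea_class r p" and q: "q \<in> current_words r" "w = uea_class r q"
      using uw unfolding uea_class_carrier by blast
    note pq = current_words_closed[OF p(1) q(1)]
    show ?thesis by (simp only: p(2) q(2) uea_class_ops[OF p(1) q(1)] Uact_class pq p(1) q(1) free_act_add)
  qed
  show "Uact (u \<oplus>\<^bsub>current_uea r\<^esub> w) v = Uact u v + Uact w v" by (rule add[OF u w])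
  show "Uact (c \<odot>\<^bsub>current_uea r\<^esub> u) v = c *s Uact u v"
    by (simp only: p(2) uea_class_ops[OF p(1) q(1)] Uact_class pq p(1) free_act_smult)
  show "Uact \<one>\<^bsub>current_uea r\<^esub> v = v"
    by (simp only: uea_class_ops[OF p(1) q(1)] Uact_class pq free_act_one)
  show z: "Uact \<zero>\<^bsub>current_uea r\<^esub> v = 0"
    using add[OF U.zero_closed U.zero_closed] by simp
  have inv: "Uact (\<ominus>\<^bsub>current_uea r\<^esub> u) v = - Uact u v" if "u \<in> carrier (current_uea r)" for u
    using add[OF that U.a_inv_closed[OF that]] z U.r_neg[OF that] by (simp add: add_eq_0_iff)
  show "Uact (\<ominus>\<^bsub>current_uea r\<^esub> u) v = - Uact u v" by (rule inv[OF u])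
  show "Uact (u \<ominus>\<^bsub>current_uea r\<^esub> w) v = Uact u v - Uact w v"
    unfolding a_minus_def using add[OF u U.a_inv_closed[OF w]] inv[OF w] by simp
qed

lemma Uact_emb: "X \<in> sl_carrier r \<Longrightarrow> Uact (current_emb r X f) v = \<rho> (tensor_poly X f) v"
  unfolding current_emb_class
  by (subst Uact_class) (simp_all add: free_algebra_def free_gen_def tensor_poly_closed free_act_gen[unfolded free_gen_def])

lemma Uact_pow:
  assumes u: "u \<in> carrier (current_uea r)"
  shows "Uact (u [^]\<^bsub>current_uea r\<^esub> (n::nat)) v = (Uact u ^^ n) v"
proof -
  interpret U: ring "current_uea r" by (rule uea_ring[OF sl_current_lie_algebra])
  show ?thesis
    by (induction n arbitrary: v) (simp_all add: Uact_one[OF u u] Uact_mult u funpow_swap1 U.nat_pow_closed)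
qed

lemma divided_power_closed:
  assumes "u \<in> carrier (current_uea r)"
  shows "divided_power (current_uea r) u n \<in> carrier (current_uea r)"
proof -
  interpret U: ring "current_uea r" by (rule uea_ring[OF sl_current_lie_algebra])
  interpret V: vectorspace class_ring "current_uea r" by (rule uea_vectorspace[OF sl_current_lie_algebra])
  show ?thesis unfolding divided_power_def by (rule V.smult_closed) (simp_all add: assms)
qed

lemma Uact_divided_power:
  assumes "u \<in> carrier (current_uea r)"
  shows "Uact (divided_power (current_uea r) u n) v = (1 / fact n) *s (Uact u ^^ n) v"
proof -
  interpret U: ring "current_uea r" by (rule uea_ring[OF sl_current_lie_algebra])
  show ?thesis unfolding divided_power_def
    by (simp add: Uact_smult[OF U.nat_pow_closed[OF assms] assms] Uact_pow assms)
qed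

lemma ordered_prod_closed:
  assumes "\<And>i. i \<in> set is \<Longrightarrow> f i \<in> carrier (current_uea r)"
  shows "ordered_prod (current_uea r) f is \<in> carrier (current_uea r)"
proof -
  interpret U: ring "current_uea r" by (rule uea_ring[OF sl_current_lie_algebra])
  show ?thesis using assms unfolding ordered_prod_def by (induction "is") simp_all
qed

lemma Uact_ordered_prod:
  assumes "\<And>i. i \<in> set is \<Longrightarrow> f i \<in> carrier (current_uea r)"
  shows "Uact (ordered_prod (current_uea r) f is) v = foldr (\<lambda>i. Uact (f i)) is v"
proof -
  interpret U: ring "current_uea r" by (rule uea_ring[OF sl_current_lie_algebra])
  show ?thesis using assms
  proof (induction "is" arbitrary: v)
    case Nil
    show ?case by (simp add: ordered_prod_def Uact_one[OF U.zero_closed U.zero_closed])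
  next
    case (Cons i js)
    have "ordered_prod (current_uea r) f (i # js) = f i \<otimes>\<^bsub>current_uea r\<^esub> ordered_prod (current_uea r) f js"
      by (simp add: ordered_prod_def)
    then show ?case using Cons by (simp add: Uact_mult ordered_prod_closed)
  qed
qed

end

text \<open>The traceless part of the matrix unit E_ab. Scalar matrices are central, so these
  elements have the brackets of matrix units, and any representation of sl[t] becomes one of gl[t]
  in which scalar matrices act as zero.\<close>

definition unit_sl :: "nat \<Rightarrow> nat \<Rightarrow> nat \<Rightarrow> complex mat" where
  "unit_sl r a b = mat (Suc r) (Suc r)
     (\<lambda>(i, j). of_bool (i = a - 1) * of_bool (j = b - 1) - of_bool (i = j) * of_bool (a = b) / of_nat (Suc r))"

lemma sum_of_bool_eq: "(x::nat) < n \<Longrightarrow> (\<Sum>k<n. of_bool (k = x) * F k :: complex) = F x"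
  by (simp add: of_bool_def if_distrib[of "\<lambda>y. y * _"] cong: if_cong)

lemma unit_sl_carrier: "unit_sl r a b \<in> carrier_mat (Suc r) (Suc r)"
  by (simp add: unit_sl_def)

lemma unit_sl_index: "i < Suc r \<Longrightarrow> j < Suc r \<Longrightarrow> unit_sl r a b $$ (i, j) =
  of_bool (i = a - 1) * of_bool (j = b - 1) - of_bool (i = j) * of_bool (a = b) / of_nat (Suc r)"
  by (simp add: unit_sl_def)

lemma unit_sl_mem:
  assumes "a \<in> {1..Suc r}" "b \<in> {1..Suc r}"
  shows "unit_sl r a b \<in> sl_carrier r"
proof -
  have eq: "(a - 1 = b - 1) = (a = b)" using assms by auto
  have "(\<Sum>i<Suc r. unit_sl r a b $$ (i, i)) = (\<Sum>i<Suc r. of_bool (i = a - 1) * of_bool (i = b - 1)) - (\<Sum>i<Suc r. of_bool (a = b) / of_nat (Suc r))"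
    unfolding sum_subtractf[symmetric] by (rule sum.cong[OF refl]) (simp add: unit_sl_index)
  also have "\<dots> = of_bool (a - 1 = b - 1) - of_bool (a = b)"
  proof -
    have a: "a - 1 < Suc r" using assms by auto
    show ?thesis unfolding sum_of_bool_eq[OF a] by (simp del: sum.lessThan_Suc of_nat_Suc)
  qed
  also have "\<dots> = 0" unfolding eq by simp
  finally show ?thesis by (simp add: sl_carrier_def unit_sl_carrier del: sum.lessThan_Suc)
qed

lemma unit_sl_mult_index:
  assumes "i < Suc r" "j < Suc r" "a \<in> {1..Suc r}" "b \<in> {1..Suc r}" "c \<in> {1..Suc r}" "d \<in> {1..Suc r}"
  shows "(unit_sl r a b * unit_sl r c d) $$ (i, j) =
    of_bool (i = a - 1) * of_bool (b = c) * of_bool (j = d - 1)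
    - of_bool (i = a - 1) * of_bool (j = b - 1) * of_bool (c = d) / of_nat (Suc r)
    - of_bool (a = b) / of_nat (Suc r) * of_bool (i = c - 1) * of_bool (j = d - 1)
    + of_bool (a = b) / of_nat (Suc r) * of_bool (i = j) * of_bool (c = d) / of_nat (Suc r)"
proof -
  define N where "N = (of_nat (Suc r) :: complex)"
  have eq: "(b - 1 = c - 1) = (b = c)" "(b - 1 = j) = (j = b - 1)" using assms by auto
  have alg: "(A * B - C * D / N) * (E * F - G * H / N)
    = B * (A * E * F) - B * (A * G * H / N) - C * (D / N * E * F) + C * (D / N * G * H / N)" for A B C D E F G H
    by (simp add: algebra_simps)
  have "(unit_sl r a b * unit_sl r c d) $$ (i, j) = (\<Sum>k<Suc r. unit_sl r a b $$ (i, k) * unit_sl r c d $$ (k, j))"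
    using assms(1,2) unit_sl_carrier[of r a b] unit_sl_carrier[of r c d]
    by (simp add: scalar_prod_def atLeast0LessThan del: sum.lessThan_Suc)
  also have "\<dots> = (\<Sum>k<Suc r. of_bool (k = b - 1) * (of_bool (i = a - 1) * of_bool (k = c - 1) * of_bool (j = d - 1)))
     - (\<Sum>k<Suc r. of_bool (k = b - 1) * (of_bool (i = a - 1) * of_bool (k = j) * of_bool (c = d) / N))
     - (\<Sum>k<Suc r. of_bool (k = i) * (of_bool (a = b) / N * of_bool (k = c - 1) * of_bool (j = d - 1)))
     + (\<Sum>k<Suc r. of_bool (k = i) * (of_bool (a = b) / N * of_bool (k = j) * of_bool (c = d) / N))"
    unfolding sum_subtractf[symmetric] sum.distrib[symmetric]
  proof (rule sum.cong[OF refl])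
    fix k assume "k \<in> {..<Suc r}"
    then have k: "k < Suc r" by simp
    have ik: "(i = k) = (k = i)" by auto
    show "unit_sl r a b $$ (i, k) * unit_sl r c d $$ (k, j) =
      of_bool (k = b - 1) * (of_bool (i = a - 1) * of_bool (k = c - 1) * of_bool (j = d - 1))
      - of_bool (k = b - 1) * (of_bool (i = a - 1) * of_bool (k = j) * of_bool (c = d) / N)
      - of_bool (k = i) * (of_bool (a = b) / N * of_bool (k = c - 1) * of_bool (j = d - 1))
      + of_bool (k = i) * (of_bool (a = b) / N * of_bool (k = j) * of_bool (c = d) / N)"
      unfolding unit_sl_index[OF assms(1) k] unit_sl_index[OF k assms(2)] N_def[symmetric] ik by (rule alg)
  qed
  also have "\<dots> = of_bool (i = a - 1) * of_bool (b - 1 = c - 1) * of_bool (j = d - 1)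
     - of_bool (i = a - 1) * of_bool (b - 1 = j) * of_bool (c = d) / N
     - of_bool (a = b) / N * of_bool (i = c - 1) * of_bool (j = d - 1)
     + of_bool (a = b) / N * of_bool (i = j) * of_bool (c = d) / N"
  proof -
    have b: "b - 1 < Suc r" using assms by auto
    show ?thesis unfolding sum_of_bool_eq[OF b] sum_of_bool_eq[OF assms(1)] ..
  qed
  finally show ?thesis unfolding eq N_def .
qed

lemma unit_sl_commutator:
  assumes "a \<in> {1..Suc r}" "b \<in> {1..Suc r}" "c \<in> {1..Suc r}" "d \<in> {1..Suc r}"
  shows "unit_sl r a b * unit_sl r c d - unit_sl r c d * unit_sl r a b
    = (if b = c then unit_sl r a d else 0\<^sub>m (Suc r) (Suc r)) - (if a = d then unit_sl r c b else 0\<^sub>m (Suc r) (Suc r))"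
    (is "?L = ?R")
proof (rule eq_matI)
  have dim: "dim_row (unit_sl r a b) = Suc r" "dim_col (unit_sl r a b) = Suc r" for a b by (simp_all add: unit_sl_def)
  show "dim_row ?L = dim_row ?R" "dim_col ?L = dim_col ?R" by (simp_all add: dim)
  fix i j assume "i < dim_row ?R" "j < dim_col ?R"
  then have ij: "i < Suc r" "j < Suc r" by (simp_all add: dim split: if_splits)
  have "?L $$ (i, j) = (unit_sl r a b * unit_sl r c d) $$ (i, j) - (unit_sl r c d * unit_sl r a b) $$ (i, j)"
    using ij by (simp add: dim)
  also have "\<dots> = of_bool (i = a - 1) * of_bool (j = d - 1) * of_bool (b = c) - of_bool (i = c - 1) * of_bool (j = b - 1) * of_bool (a = d)"
    unfolding unit_sl_mult_index[OF ij assms] unit_sl_mult_index[OF ij assms(3,4,1,2)]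
    using eq_commute[of d a] by (simp add: algebra_simps del: of_nat_Suc)
  also have "\<dots> = (of_bool (b = c) * unit_sl r a d $$ (i, j)) - (of_bool (a = d) * unit_sl r c b $$ (i, j))"
    unfolding unit_sl_index[OF ij] by (cases "b = c"; cases "a = d") (simp_all del: of_nat_Suc)
  also have "\<dots> = ?R $$ (i, j)"
    using ij by (cases "b = c"; cases "a = d") (simp_all add: dim)
  finally show "?L $$ (i, j) = ?R $$ (i, j)" .
qed

lemma x_minus_eq_unit_sl: "1 \<le> i \<Longrightarrow> i \<le> j \<Longrightarrow> x_minus r i j = unit_sl r (Suc j) i"
  by (rule eq_matI) (auto simp: x_minus_def unit_sl_def)

lemma x_minus_mem: "1 \<le> i \<Longrightarrow> i \<le> j \<Longrightarrow> j \<le> r \<Longrightarrow> x_minus r i j \<in> sl_carrier r"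
  by (simp add: x_minus_eq_unit_sl unit_sl_mem)

lemma unit_sl_cartan: "a \<in> {1..Suc r} \<Longrightarrow> unit_sl r a a \<in> cartan r"
  using unit_sl_mem[of a r a]
  by (auto simp: cartan_def diagonal_mat_def unit_sl_def of_bool_def)

lemma weight_unit_sl:
  assumes "a \<in> {1..Suc r}"
  shows "weight r lam (unit_sl r a a) = of_int (lam a) - of_int (\<Sum>i=1..Suc r. lam i) / of_nat (Suc r)"
proof -
  have "weight r lam (unit_sl r a a) = (\<Sum>i=1..Suc r. (if i = a then of_int (lam i) else 0) - of_int (lam i) / of_nat (Suc r))"
    unfolding weight_def
  proof (rule sum.cong[OF refl])
    fix i assume i: "i \<in> {1..Suc r}"
    then have "i - 1 < Suc r" "(i - 1 = a - 1) = (i = a)" using assms by auto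
    then show "of_int (lam i) * eps i (unit_sl r a a) = (if i = a then of_int (lam i) else 0) - of_int (lam i) / of_nat (Suc r)"
      unfolding eps_def by (subst unit_sl_index) (auto simp: algebra_simps simp del: of_nat_Suc)
  qed
  also have "\<dots> = of_int (lam a) - (\<Sum>i=1..Suc r. of_int (lam i)) / of_nat (Suc r)"
    using assms by (simp add: sum_subtractf sum_divide_distrib del: of_nat_Suc sum.cl_ivl_Suc)
  finally show ?thesis by (simp only: of_int_sum)
qed

lemma weight_simple_coroot:
  assumes "1 \<le> i" "i \<le> r"
  shows "weight r lam (simple_coroot r i) = of_int (lam i - lam (Suc i))"
proof -
  have "weight r lam (simple_coroot r i) = (\<Sum>k=1..Suc r. (if k = i then of_int (lam k) else 0) - (if k = Suc i then of_int (lam k) else 0))"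
    unfolding weight_def eps_def simple_coroot_def
  proof (rule sum.cong[OF refl])
    fix k assume k: "k \<in> {1..Suc r}"
    then have "(k - 1 = i - 1) = (k = i)" "(k - 1 = i) = (k = Suc i)" "k - 1 < Suc r" using assms by auto
    then show "of_int (lam k) * mat (Suc r) (Suc r) (\<lambda>(a, b). if a = b \<and> a = i - 1 then 1 else if a = b \<and> a = i then -1 else 0) $$ (k - 1, k - 1)
      = (if k = i then of_int (lam k) else 0 :: complex) - (if k = Suc i then of_int (lam k) else 0)"
      by simp
  qed
  then show ?thesis using assms by (simp add: sum_subtractf del: sum.cl_ivl_Suc)
qed

lemma diagonal_commutator_index:
  assumes "H \<in> cartan r" "X \<in> carrier_mat (Suc r) (Suc r)" "i < Suc r" "j < Suc r"
  shows "(H * X - X * H) $$ (i, j) = (H $$ (i, i) - H $$ (j, j)) * X $$ (i, j)"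
proof -
  have H: "H \<in> carrier_mat (Suc r) (Suc r)" "\<And>i j. i < Suc r \<Longrightarrow> j < Suc r \<Longrightarrow> i \<noteq> j \<Longrightarrow> H $$ (i, j) = 0"
    using assms(1) by (auto simp: cartan_def sl_carrier_def diagonal_mat_def)
  have "(H * X) $$ (i, j) = (\<Sum>k<Suc r. H $$ (i, k) * X $$ (k, j))"
    "(X * H) $$ (i, j) = (\<Sum>k<Suc r. X $$ (i, k) * H $$ (k, j))"
    using assms H(1) by (simp_all add: scalar_prod_def atLeast0LessThan del: sum.lessThan_Suc)
  moreover have "(\<Sum>k<Suc r. H $$ (i, k) * X $$ (k, j)) = (\<Sum>k<Suc r. if k = i then H $$ (i, i) * X $$ (i, j) else 0)"
    by (rule sum.cong[OF refl]) (use H(2)[OF assms(3)] in auto)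
  moreover have "(\<Sum>k<Suc r. X $$ (i, k) * H $$ (k, j)) = (\<Sum>k<Suc r. if k = j then X $$ (i, j) * H $$ (j, j) else 0)"
    by (rule sum.cong[OF refl]) (use H(2)[OF _ assms(4)] in auto)
  ultimately show ?thesis using assms H(1) by (simp add: algebra_simps del: sum.lessThan_Suc)
qed

lemma x_minus_root_space:
  assumes "1 \<le> i" "i \<le> r"
  shows "x_minus r i i \<in> root_space r (\<lambda>H. - simple_root i H)"
proof -
  have X: "x_minus r i i \<in> sl_carrier r" using assms by (simp add: x_minus_mem)
  then have Xc: "x_minus r i i \<in> carrier_mat (Suc r) (Suc r)" by (simp add: sl_carrier_def)
  have "H * x_minus r i i - x_minus r i i * H = - simple_root i H \<cdot>\<^sub>m x_minus r i i" if H: "H \<in> cartan r" for H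
  proof (rule eq_matI)
    have Hc: "H \<in> carrier_mat (Suc r) (Suc r)" using H by (simp add: cartan_def sl_carrier_def)
    show "dim_row (H * x_minus r i i - x_minus r i i * H) = dim_row (- simple_root i H \<cdot>\<^sub>m x_minus r i i)"
      "dim_col (H * x_minus r i i - x_minus r i i * H) = dim_col (- simple_root i H \<cdot>\<^sub>m x_minus r i i)"
      using Hc Xc by auto
    fix a b assume "a < dim_row (- simple_root i H \<cdot>\<^sub>m x_minus r i i)" "b < dim_col (- simple_root i H \<cdot>\<^sub>m x_minus r i i)"
    then have ab: "a < Suc r" "b < Suc r" using Xc by auto
    show "(H * x_minus r i i - x_minus r i i * H) $$ (a, b) = (- simple_root i H \<cdot>\<^sub>m x_minus r i i) $$ (a, b)"
      unfolding diagonal_commutator_index[OF H Xc ab] using ab by (auto simp: x_minus_def simple_root_def eps_def)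
  qed
  then show ?thesis using X by (simp add: root_space_def)
qed

lemma root_space_index:
  assumes Y: "Y \<in> root_space r (\<lambda>H. - simple_root i H)" and i: "1 \<le> i" "i \<le> r"
    and ab: "a < Suc r" "b < Suc r" "\<not> (a = i \<and> b = i - 1)"
  shows "Y $$ (a, b) = 0"
proof -
  \<comment> \<open>With this \<open>k\<close> the weights of the entries \<open>(a, b)\<close> and
    \<open>(i, i - 1)\<close> under the traceless part of the k-th diagonal unit differ: by 1 if
    \<open>a = i\<close>, and by -1 or -2 otherwise.\<close>
  define k where "k = (if a = i then i - 1 else i)"
  have k: "k < Suc r" "Suc k \<in> {1..Suc r}" using i by (auto simp: k_def)
  have Yc: "Y \<in> carrier_mat (Suc r) (Suc r)" using Y by (simp add: root_space_def sl_carrier_def)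
  let ?H = "unit_sl r (Suc k) (Suc k)"
  have H: "?H \<in> cartan r" by (rule unit_sl_cartan[OF k(2)])
  have "?H * Y - Y * ?H = - simple_root i ?H \<cdot>\<^sub>m Y" using Y H by (simp add: root_space_def)
  then have "(?H $$ (a, a) - ?H $$ (b, b)) * Y $$ (a, b) = - simple_root i ?H * Y $$ (a, b)"
    unfolding diagonal_commutator_index[OF H Yc ab(1,2), symmetric] using ab Yc by simp
  then have "((?H $$ (a, a) - ?H $$ (b, b)) + (?H $$ (i - 1, i - 1) - ?H $$ (i, i))) * Y $$ (a, b) = 0"
    by (simp add: simple_root_def eps_def algebra_simps)
  moreover have "(?H $$ (a, a) - ?H $$ (b, b)) + (?H $$ (i - 1, i - 1) - ?H $$ (i, i)) \<noteq> 0"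
    using ab i by (auto simp: unit_sl_index k_def of_bool_def simp del: of_nat_Suc)
  ultimately show ?thesis by simp
qed

lemma zero_sl: "0\<^sub>m (Suc r) (Suc r) \<in> sl_carrier r"
  by (simp add: sl_carrier_def)

context current_rep
begin

lemma rho_diff: "A \<in> sl_carrier r \<Longrightarrow> B \<in> sl_carrier r \<Longrightarrow> \<rho> (A - B) v = \<rho> A v - \<rho> B v"
proof -
  assume A: "A \<in> sl_carrier r" and B: "B \<in> sl_carrier r"
  have d: "A \<in> carrier_mat (Suc r) (Suc r)" "B \<in> carrier_mat (Suc r) (Suc r)" using A B by (auto simp: sl_carrier_def)
  interpret L: lie_algebra class_ring "sl_current r" by (rule sl_current_lie_algebra)
  have "[:-1:] \<cdot>\<^sub>m B \<in> sl_carrier r" using L.smult_closed[of "-1" B] B by (simp add: sl_current_def)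
  moreover have "A - B = A + [:-1:] \<cdot>\<^sub>m B" by (rule eq_matI) (use d in auto)
  ultimately show ?thesis by (simp add: rho_add[OF A] rho_smult[OF B])
qed

lemma rho_tensor_diff:
  assumes "X \<in> sl_carrier r" "Y \<in> sl_carrier r"
  shows "\<rho> (tensor_poly (X - Y) f) v = \<rho> (tensor_poly X f) v - \<rho> (tensor_poly Y f) v"
proof -
  have d: "X \<in> carrier_mat (Suc r) (Suc r)" "Y \<in> carrier_mat (Suc r) (Suc r)" using assms by (auto simp: sl_carrier_def)
  have "tensor_poly (X - Y) f = tensor_poly X f - tensor_poly Y f"
    by (rule eq_matI) (use d in \<open>auto simp: tensor_poly_def smult_diff_left\<close>)
  then show ?thesis by (simp add: rho_diff tensor_poly_closed assms)
qed

lemma rho_zero: "\<rho> (0\<^sub>m (Suc r) (Suc r)) v = 0"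
proof -
  have z: "0\<^sub>m (Suc r) (Suc r) - 0\<^sub>m (Suc r) (Suc r) = (0\<^sub>m (Suc r) (Suc r) :: complex poly mat)" by (rule eq_matI) auto
  show ?thesis using rho_diff[OF zero_sl zero_sl, of v] unfolding z by simp
qed

lemma rho_tensor_zero: "\<rho> (tensor_poly (0\<^sub>m (Suc r) (Suc r)) f) v = 0"
proof -
  have z: "0\<^sub>m (Suc r) (Suc r) - 0\<^sub>m (Suc r) (Suc r) = (0\<^sub>m (Suc r) (Suc r) :: complex mat)" by (rule eq_matI) auto
  show ?thesis using rho_tensor_diff[OF zero_sl zero_sl, of f v] unfolding z by simp
qed

definition e :: "nat \<Rightarrow> nat \<Rightarrow> nat \<Rightarrow> 'v \<Rightarrow> 'v" where
  "e a b s = \<rho> (tensor_poly (unit_sl r a b) (monom 1 s))"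

sublocale gl_current_rep scale "Suc r" e
proof
  show "lin (e a b s)" for a b s unfolding e_def by (rule lin_rho)
  fix a b c d s u x assume m: "a \<in> {1..Suc r}" "b \<in> {1..Suc r}" "c \<in> {1..Suc r}" "d \<in> {1..Suc r}"
  let ?Z = "0\<^sub>m (Suc r) (Suc r) :: complex mat"
  let ?X = "unit_sl r a b" and ?Y = "unit_sl r c d"
  have X: "?X \<in> sl_carrier r" "?Y \<in> sl_carrier r" using m by (simp_all only: unit_sl_mem)
  have "tensor_poly ?X (monom 1 s) * tensor_poly ?Y (monom 1 u) - tensor_poly ?Y (monom 1 u) * tensor_poly ?X (monom 1 s)
    = tensor_poly (?X * ?Y - ?Y * ?X) (monom 1 (s + u))"
    using tensor_poly_bracket[OF X, of "monom 1 s" "monom 1 u"] by (simp add: sl_current_def mult_monom)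
  then have "e a b s (e c d u x) - e c d u (e a b s x) = \<rho> (tensor_poly (?X * ?Y - ?Y * ?X) (monom 1 (s + u))) x"
    unfolding e_def using rho_bracket[OF tensor_poly_closed[OF X(1)] tensor_poly_closed[OF X(2)]] by metis
  also have "\<dots> = \<rho> (tensor_poly (if b = c then unit_sl r a d else ?Z) (monom 1 (s + u))) x
     - \<rho> (tensor_poly (if a = d then unit_sl r c b else ?Z) (monom 1 (s + u))) x"
    unfolding unit_sl_commutator[OF m] using m by (intro rho_tensor_diff) (simp_all add: unit_sl_mem zero_sl del: One_nat_def)
  also have "\<dots> = (if b = c then e a d (s + u) x else 0) - (if a = d then e c b (s + u) x else 0)"
    unfolding e_def if_distrib[of "\<lambda>M. \<rho> (tensor_poly M (monom 1 (s + u))) x"] rho_tensor_zero ..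
  finally show "e a b s (e c d u x) = e c d u (e a b s x) + (if b = c then e a d (s + u) x else 0) - (if a = d then e c b (s + u) x else 0)"
    by (simp add: algebra_simps)
qed

lemma rho_unit_sum:
  assumes "finite I" "I \<subseteq> {1..Suc r} \<times> {1..Suc r} \<times> UNIV"
  shows "mat (Suc r) (Suc r) (\<lambda>(i, j). \<Sum>(a, b, s)\<in>I. [:k a b s:] * tensor_poly (unit_sl r a b) (monom 1 s) $$ (i, j)) \<in> sl_carrier r
    \<and> \<rho> (mat (Suc r) (Suc r) (\<lambda>(i, j). \<Sum>(a, b, s)\<in>I. [:k a b s:] * tensor_poly (unit_sl r a b) (monom 1 s) $$ (i, j))) v
      = (\<Sum>(a, b, s)\<in>I. k a b s *s e a b s v)"
    (is "?M I \<in> _ \<and> _")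
  using assms
proof (induction I)
  case empty
  have z: "?M {} = 0\<^sub>m (Suc r) (Suc r)" by (rule eq_matI) auto
  show ?case unfolding z by (simp add: zero_sl rho_zero)
next
  case (insert t I)
  obtain a b s where t: "t = (a, b, s)" by (cases t)
  interpret L: lie_algebra class_ring "sl_current r" by (rule sl_current_lie_algebra)
  let ?T = "tensor_poly (unit_sl r a b) (monom 1 s)"
  have ab: "a \<in> {1..Suc r}" "b \<in> {1..Suc r}" using insert.prems t by auto
  have T: "?T \<in> sl_carrier r" by (rule tensor_poly_closed[OF unit_sl_mem[OF ab]])
  have Tc: "?T \<in> carrier_mat (Suc r) (Suc r)" using T by (simp add: sl_carrier_def)
  have kT: "[:k a b s:] \<cdot>\<^sub>m ?T \<in> sl_carrier r" using L.smult_closed[of "k a b s" ?T] T by (simp add: sl_current_def)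
  have I: "?M I \<in> sl_carrier r" "\<rho> (?M I) v = (\<Sum>(a, b, s)\<in>I. k a b s *s e a b s v)" using insert by auto
  have eq: "?M (insert t I) = [:k a b s:] \<cdot>\<^sub>m ?T + ?M I"
    by (rule eq_matI) (use insert.hyps Tc in \<open>auto simp: t\<close>)
  have m1: "[:k a b s:] \<cdot>\<^sub>m ?T + ?M I \<in> sl_carrier r"
    using L.M.add.m_closed[of "[:k a b s:] \<cdot>\<^sub>m ?T" "?M I"] kT I(1) by (simp add: sl_current_def)
  have m2: "\<rho> ([:k a b s:] \<cdot>\<^sub>m ?T + ?M I) v = k a b s *s e a b s v + \<rho> (?M I) v"
    unfolding rho_add[OF kT I(1)] rho_smult[OF T] e_def ..
  have m3: "(\<Sum>(a, b, s)\<in>insert t I. k a b s *s e a b s v) = k a b s *s e a b s v + (\<Sum>(a, b, s)\<in>I. k a b s *s e a b s v)"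
    using insert.hyps by (simp add: t)
  show ?case unfolding eq m3 m2 I(2) using m1 by blast
qed

text \<open>Combining the traceless matrix units with the coefficients of the entries of
  \<open>A\<close> gives \<open>A\<close> minus its trace divided by r + 1 times the identity, which
  is \<open>A\<close> itself. Hence stability under the operators \<open>e\<close> is stability
  under all of sl[t].\<close>

lemma rho_stable:
  assumes S: "stable (Suc r) S" and A: "A \<in> sl_carrier r" and v: "v \<in> S"
  shows "\<rho> A v \<in> S"
proof -
  obtain D where D: "\<And>a b. a < Suc r \<Longrightarrow> b < Suc r \<Longrightarrow> degree (A $$ (a, b)) \<le> D"
  proof -
    let ?D = "Max ((\<lambda>ab. degree (A $$ ab)) ` ({..<Suc r} \<times> {..<Suc r}))"
    have "degree (A $$ (a, b)) \<le> ?D" if "a < Suc r" "b < Suc r" for a b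
      by (rule Max_ge) (use that in auto)
    then show ?thesis using that by blast
  qed
  have Ac: "A \<in> carrier_mat (Suc r) (Suc r)" and tr: "(\<Sum>i<Suc r. A $$ (i, i)) = 0" using A by (auto simp: sl_carrier_def)
  let ?I = "{1..Suc r} \<times> {1..Suc r} \<times> {..D}"
  define k where "k a b s = coeff (A $$ (a - 1, b - 1)) s" for a b s
  have polyA: "(\<Sum>s\<le>D. [:coeff (A $$ (a, b)) s:] * monom 1 s) = A $$ (a, b)" if "a < Suc r" "b < Suc r" for a b
    using poly_as_sum_of_monoms'[OF D[OF that]] by (simp add: smult_monom)
  have "A = mat (Suc r) (Suc r) (\<lambda>(i, j). \<Sum>(a, b, s)\<in>?I. [:k a b s:] * tensor_poly (unit_sl r a b) (monom 1 s) $$ (i, j))" (is "A = ?M")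
  proof (rule eq_matI)
    show "dim_row A = dim_row ?M" "dim_col A = dim_col ?M" using Ac by auto
    fix i j assume "i < dim_row ?M" "j < dim_col ?M"
    then have ij: "i < Suc r" "j < Suc r" by auto
    let ?u = "\<lambda>a b. [:unit_sl r (Suc a) (Suc b) $$ (i, j):]"
    have "?M $$ (i, j) = (\<Sum>(a, b, s)\<in>?I. [:k a b s:] * tensor_poly (unit_sl r a b) (monom 1 s) $$ (i, j))"
      using ij by simp
    also have "\<dots> = (\<Sum>a=1..Suc r. \<Sum>b=1..Suc r. \<Sum>s\<le>D. [:k a b s:] * ([:unit_sl r a b $$ (i, j):] * monom 1 s))"
    proof -
      have tp: "tensor_poly (unit_sl r a b) f $$ (i, j) = [:unit_sl r a b $$ (i, j):] * f" for a b f
        using ij unit_sl_carrier[of r a b] by (simp add: tensor_poly_def)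
      show ?thesis unfolding tp sum.cartesian_product[symmetric] ..
    qed
    also have "\<dots> = (\<Sum>a<Suc r. \<Sum>b<Suc r. \<Sum>s\<le>D. [:coeff (A $$ (a, b)) s:] * (?u a b * monom 1 s))"
      unfolding image_Suc_lessThan[symmetric] k_def by (simp add: sum.reindex del: sum.lessThan_Suc)
    also have "\<dots> = (\<Sum>a<Suc r. \<Sum>b<Suc r. ?u a b * A $$ (a, b))"
    proof (intro sum.cong[OF refl])
      fix a b assume ab: "a \<in> {..<Suc r}" "b \<in> {..<Suc r}"
      have "(\<Sum>s\<le>D. [:coeff (A $$ (a, b)) s:] * (?u a b * monom 1 s)) = ?u a b * (\<Sum>s\<le>D. [:coeff (A $$ (a, b)) s:] * monom 1 s)"
        unfolding sum_distrib_left by (rule sum.cong[OF refl]) (simp only: mult_ac)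
      then show "(\<Sum>s\<le>D. [:coeff (A $$ (a, b)) s:] * (?u a b * monom 1 s)) = ?u a b * A $$ (a, b)"
        using ab polyA by simp
    qed
    also have "\<dots> = (\<Sum>a<Suc r. \<Sum>b<Suc r. (if a = i then if b = j then A $$ (a, b) else 0 else 0)
        - (if b = a then [:of_bool (i = j) / of_nat (Suc r):] * A $$ (a, a) else 0))"
      by (intro sum.cong[OF refl]) (use ij in \<open>auto simp: unit_sl_index of_bool_def one_pCons[symmetric] smult_diff_left algebra_simps simp del: of_nat_Suc\<close>)
    also have "\<dots> = (\<Sum>a<Suc r. (if a = i then A $$ (i, j) else 0)) - [:of_bool (i = j) / of_nat (Suc r):] * (\<Sum>a<Suc r. A $$ (a, a))"
      unfolding sum_distrib_left sum_subtractf[symmetric] using ij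
      by (intro sum.cong[OF refl]) (simp add: sum_subtractf del: sum.lessThan_Suc of_nat_Suc)
    also have "\<dots> = A $$ (i, j)" unfolding tr using ij by (simp del: sum.lessThan_Suc)
    finally show "A $$ (i, j) = ?M $$ (i, j)" by (rule sym)
  qed
  then have "\<rho> A v = (\<Sum>(a, b, s)\<in>?I. k a b s *s e a b s v)" using rho_unit_sum[of ?I k v] by auto
  also have "\<dots> \<in> S"
  proof -
    have "k a b s *s e a b s v \<in> S" if "(a, b, s) \<in> ?I" for a b s
      using that S v by (intro subspace_scale[OF stable_subspace[OF S]]) (auto simp: stable_def)
    then show ?thesis using stable_subspace[OF S] by (intro subspace_sum) auto
  qed
  finally show ?thesis .
qed

lemma Uact_stable:
  assumes S: "stable (Suc r) S" and p: "p \<in> current_words r" and v: "v \<in> S"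
  shows "free_act p v \<in> S"
proof -
  have "foldr \<rho> ws v \<in> S" if "set ws \<subseteq> sl_carrier r" for ws
    using that by (induction ws) (auto simp: v intro: rho_stable[OF S])
  then have "word_act w v \<in> S" if "w \<in> Poly_Mapping.keys p" for w
    using that p by (simp add: word_act_def free_algebra_def)
  then show ?thesis unfolding free_act_def
    using stable_subspace[OF S] by (intro subspace_sum subspace_scale) auto
qed

text \<open>Taking traceless parts of the diagonal units subtracts the mean of the tuple
  \<open>lam\<close> from every weight; this is the constant in place of \<open>c\<close>.\<close>

lemma highest_weyl_relations:
  assumes z: "\<And>u. u \<in> weyl_relations r lam \<Longrightarrow> Uact u z = 0" and dec: "\<And>i. i \<in> {1..r} \<Longrightarrow> lam (Suc i) \<le> lam i"
  shows "highest (Suc r) lam (- of_int (\<Sum>i=1..Suc r. lam i) / of_nat (Suc r)) {0} z"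
  unfolding highest_def singleton_iff
proof (intro conjI allI impI)
  have e: "e a b s z = Uact (current_emb r (unit_sl r a b) (monom 1 s)) z" if "a \<in> {1..Suc r}" "b \<in> {1..Suc r}" for a b s
    unfolding e_def by (rule Uact_emb[OF unit_sl_mem[OF that], symmetric])
  fix a b s assume ab: "1 \<le> a" "a < b" "b \<le> Suc r"
  then have m: "a \<in> {1..Suc r}" "b \<in> {1..Suc r}" by auto
  have "unit_sl r a b \<in> n_plus r"
    unfolding n_plus_def using unit_sl_mem[OF m] ab by (auto simp: unit_sl_index of_bool_def simp del: of_nat_Suc)
  then have "current_emb r (unit_sl r a b) (monom 1 s) \<in> weyl_relations r lam" unfolding weyl_relations_def by blast
  then show "e a b s z = 0" unfolding e[OF m] by (rule z)
next
  fix a s :: nat assume "1 \<le> a" "a \<le> Suc r" "0 < s"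
  then have m: "a \<in> {1..Suc r}" and s: "monom 1 s = monom 1 1 * (monom 1 (s - 1) :: complex poly)" by (auto simp: mult_monom)
  have "current_emb r (unit_sl r a a) (monom 1 s) \<in> weyl_relations r lam"
    unfolding s weyl_relations_def using unit_sl_cartan[OF m] by blast
  then show "e a a s z = 0" unfolding e_def Uact_emb[OF unit_sl_mem[OF m m], symmetric] by (rule z)
next
  fix a :: nat assume "1 \<le> a" "a \<le> Suc r"
  then have m: "a \<in> {1..Suc r}" by auto
  let ?X = "unit_sl r a a"
  interpret U: ring "current_uea r" by (rule uea_ring[OF sl_current_lie_algebra])
  interpret V: vectorspace class_ring "current_uea r" by (rule uea_vectorspace[OF sl_current_lie_algebra])
  have X: "current_emb r ?X 1 \<in> carrier (current_uea r)" by (rule current_emb_closed[OF unit_sl_mem[OF m m]])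
  have c: "weight r lam ?X \<odot>\<^bsub>current_uea r\<^esub> \<one>\<^bsub>current_uea r\<^esub> \<in> carrier (current_uea r)"
    by (rule V.smult_closed) simp_all
  have "current_emb r ?X 1 \<ominus>\<^bsub>current_uea r\<^esub> (weight r lam ?X \<odot>\<^bsub>current_uea r\<^esub> \<one>\<^bsub>current_uea r\<^esub>) \<in> weyl_relations r lam"
    unfolding weyl_relations_def using unit_sl_cartan[OF m] by blast
  from z[OF this] have "\<rho> (tensor_poly ?X 1) z - weight r lam ?X *s z = 0"
    unfolding Uact_minus[OF X c] Uact_emb[OF unit_sl_mem[OF m m]] Uact_smult[OF U.one_closed U.one_closed] Uact_one[OF X X] .
  moreover have "monom 1 0 = (1 :: complex poly)" by simp
  ultimately show "e a a 0 z - (of_int (lam a) + - of_int (\<Sum>i=1..Suc r. lam i) / of_nat (Suc r)) *s z = 0"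
    unfolding e_def weight_unit_sl[OF m] by (simp del: sum.cl_ivl_Suc of_nat_Suc)
next
  fix i assume i: "1 \<le> i" "i < Suc r"
  let ?m = "nat (lam i - lam (Suc i))"
  let ?Y = "x_minus r i i"
  have Y: "?Y \<in> sl_carrier r" using i by (intro x_minus_mem) auto
  have "weight r lam (simple_coroot r i) = of_nat ?m"
    using i dec[of i] by (subst weight_simple_coroot) auto
  moreover have "?Y \<in> root_space r (\<lambda>H. - simple_root i H)" using i by (intro x_minus_root_space) auto
  moreover have "i \<in> {1..r}" using i by simp
  ultimately have "current_emb r ?Y 1 [^]\<^bsub>current_uea r\<^esub> (?m + 1) \<in> weyl_relations r lam"
    unfolding weyl_relations_def by blast
  from z[OF this] have "(Uact (current_emb r ?Y 1) ^^ (?m + 1)) z = 0" unfolding Uact_pow[OF current_emb_closed[OF Y]] .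
  moreover have "Uact (current_emb r ?Y 1) = e (Suc i) i 0"
    unfolding Uact_emb[OF Y, abs_def] e_def using i by (simp add: x_minus_eq_unit_sl)
  ultimately show "\<exists>N. (e (Suc i) i 0 ^^ N) z = 0" by metis
qed

end

section \<open>The quotient by a left ideal as a representation\<close>

lemma free_smult_vector_space: "vector_space (free_smult :: complex \<Rightarrow> ('a free_monoid \<Rightarrow>\<^sub>0 complex) \<Rightarrow> _)"
  by standard (simp_all add: free_smult_def distrib_left distrib_right single_add mult_single mult.assoc[symmetric])

lemma free_smult_mult_right: "p * free_smult c q = free_smult c (p * (q :: 'a free_monoid \<Rightarrow>\<^sub>0 complex))"
proof -
  have "p * Poly_Mapping.single 0 c = Poly_Mapping.single 0 c * p"
    using subset_UNIV[of "Poly_Mapping.keys p"]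
    by (induction p rule: free_module_induct) (simp_all add: distrib_left distrib_right mult_single mult.commute)
  then show ?thesis by (simp add: free_smult_def mult.assoc[symmetric])
qed

lemma (in vector_space) exists_projection:
  assumes "subspace K"
  shows "\<exists>\<pi>. (\<forall>x y. \<pi> (x + y) = \<pi> x + \<pi> y) \<and> (\<forall>c x. \<pi> (scale c x) = scale c (\<pi> x)) \<and>
    (\<forall>x\<in>K. \<pi> x = 0) \<and> (\<forall>x. x - \<pi> x \<in> K)"
proof -
  interpret vector_space_pair scale scale ..
  obtain B where B: "independent B" "B \<subseteq> K" "K \<subseteq> span B" using maximal_independent_subset[of K] by metis
  have KB: "K = span B" using B span_minimal[OF B(2) assms] by blast
  define B' where "B' = extend_basis B"
  have B': "B \<subseteq> B'" "independent B'" "span B' = UNIV"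
    unfolding B'_def using extend_basis_superset[OF B(1)] independent_extend_basis[OF B(1)] span_extend_basis[OF B(1)] by auto
  define \<pi> where "\<pi> = construct B' (\<lambda>b. if b \<in> B then 0 else b)"
  have lin: "Vector_Spaces.linear scale scale \<pi>" unfolding \<pi>_def by (rule linear_construct[OF B'(2)])
  have \<pi>B: "\<pi> b = (if b \<in> B then 0 else b)" if "b \<in> B'" for b unfolding \<pi>_def by (rule construct_basis[OF B'(2) that])
  have 0: "\<pi> x = 0" if "x \<in> K" for x
  proof (rule linear_eq_0_on_span[OF lin])
    show "x \<in> span B" using that unfolding KB .
    show "\<pi> b = 0" if "b \<in> B" for b using \<pi>B[of b] B'(1) that by auto
  qed
  have "x - \<pi> x \<in> K" for x
  proof -
    have "x \<in> span B'" using B'(3) by simp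
    then show ?thesis
    proof (induction rule: span_induct_alt)
      case base
      show ?case using linear_0[OF lin] subspace_0[OF assms] by simp
    next
      case (step c b y)
      have "b - \<pi> b \<in> K" using \<pi>B[OF step(1)] B(2) subspace_0[OF assms] by auto
      then have "scale c (b - \<pi> b) + (y - \<pi> y) \<in> K" using step(2) by (intro subspace_add[OF assms] subspace_scale[OF assms])
      then show ?case by (simp add: linear_add[OF lin] linear_scale[OF lin] scale_right_diff_distrib algebra_simps)
    qed
  qed
  with 0 linear_add[OF lin] linear_scale[OF lin] show ?thesis by (intro exI[of _ \<pi>]) simp
qed

text \<open>The quotient by \<open>J\<close> is realised on a complement inside the free algebra:
  \<open>\<pi>\<close> is a projection along \<open>K\<close>, and a letter acts by left
  multiplication followed by \<open>\<pi>\<close>. The subspace \<open>K\<close> consists of the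
  preimage of \<open>J\<close> and of \<open>N\<close>, which removes the words with letters outside
  the Lie algebra.\<close>

lemma universal_current_rep:
  fixes r :: nat and J
  assumes J: "left_ideal J (current_uea r)"
  obtains \<rho> and \<pi> :: "(complex poly mat free_monoid \<Rightarrow>\<^sub>0 complex) \<Rightarrow> (complex poly mat free_monoid \<Rightarrow>\<^sub>0 complex)"
  where "current_rep free_smult r \<rho>"
    "\<And>p. p \<in> current_words r \<Longrightarrow> current_rep.free_act free_smult \<rho> p (\<pi> 1) = \<pi> p"
    "\<And>p. p \<in> current_words r \<Longrightarrow> \<pi> p = 0 \<longleftrightarrow> uea_class r p \<in> J"
proof -
  define F where "F = current_words r"
  define N where "N = {p :: complex poly mat free_monoid \<Rightarrow>\<^sub>0 complex. \<forall>w\<in>Poly_Mapping.keys p. \<not> set (letters w) \<subseteq> sl_carrier r}"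
  define J' where "J' = {p \<in> F. uea_class r p \<in> J}"
  define K where "K = {p + q | p q. p \<in> J' \<and> q \<in> N}"
  let ?I = "uea_ideal (sl_current r)"
  interpret VS: complex_space "free_smult :: complex \<Rightarrow> (complex poly mat free_monoid \<Rightarrow>\<^sub>0 complex) \<Rightarrow> _"
    unfolding complex_space_def by (rule free_smult_vector_space)
  interpret U: ring "current_uea r" by (rule uea_ring[OF sl_current_lie_algebra])
  interpret I: ideal ?I "free_algebra (sl_carrier r)" by (rule current_uea_ideal)
  note F = current_words_closed[where r = r, folded F_def]
  have one_F: "1 \<in> F" and zero_F: "0 \<in> F" by (simp_all add: F_def free_algebra_def zero_free_monoid_def)
  have subJ: "subgroup J (add_monoid (current_uea r))" and multJ: "\<And>a x. a \<in> carrier (current_uea r) \<Longrightarrow> x \<in> J \<Longrightarrow> a \<otimes>\<^bsub>current_uea r\<^esub> x \<in> J"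
    using J by (auto simp: left_ideal_def additive_subgroup_def)
  have addJ: "x \<oplus>\<^bsub>current_uea r\<^esub> y \<in> J" if "x \<in> J" "y \<in> J" for x y
    using subgroup.m_closed[OF subJ that] by simp
  have zeroJ: "\<zero>\<^bsub>current_uea r\<^esub> \<in> J" using subgroup.one_closed[OF subJ] by simp
  have zero_class: "uea_class r 0 = \<zero>\<^bsub>current_uea r\<^esub>"
  proof -
    have "uea_class r 0 \<oplus>\<^bsub>current_uea r\<^esub> uea_class r 0 = uea_class r 0"
      using uea_class_add[of 0 r 0] zero_F unfolding F_def by simp
    moreover have "uea_class r 0 \<in> carrier (current_uea r)" using uea_class_closed zero_F unfolding F_def by blast
    ultimately show ?thesis using U.add.r_cancel_one'[of "uea_class r 0" "uea_class r 0"] by simp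
  qed
  have J'_add: "p + q \<in> J'" if "p \<in> J'" "q \<in> J'" for p q
  proof -
    have pq: "p \<in> F" "q \<in> F" "uea_class r p \<in> J" "uea_class r q \<in> J" using that by (simp_all add: J'_def)
    have "uea_class r (p + q) \<in> J" using addJ[OF pq(3,4)] unfolding uea_class_add[OF pq(1,2)[unfolded F_def]] .
    then show ?thesis using F(1)[OF pq(1,2)] by (simp add: J'_def)
  qed
  have J'_mult: "p * q \<in> J'" if "p \<in> F" "q \<in> J'" for p q
  proof -
    have pq: "p \<in> F" "q \<in> F" "uea_class r q \<in> J" using that by (simp_all add: J'_def)
    have "uea_class r (p * q) \<in> J"
      using multJ[OF uea_class_closed[OF pq(1)[unfolded F_def]] pq(3)] unfolding uea_class_mult[OF pq(1,2)[unfolded F_def]] .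
    then show ?thesis using F(2)[OF pq(1,2)] by (simp add: J'_def)
  qed
  have J'_0: "0 \<in> J'" using zeroJ zero_F by (simp add: J'_def zero_class)
  have J'_smult: "free_smult c q \<in> J'" if "q \<in> J'" for c q
    using J'_mult[OF F(5)[OF one_F one_F] that, of c] unfolding free_smult_mult[symmetric] by simp
  have I_J': "p \<in> J'" if "p \<in> ?I" for p
  proof -
    have "p \<in> F" using that I.a_subset unfolding F_def by blast
    moreover have "uea_class r p = uea_class r 0"
      using uea_class_eq_iff[OF \<open>p \<in> F\<close>[unfolded F_def] zero_F[unfolded F_def]] that by simp
    ultimately show ?thesis using zeroJ by (simp add: J'_def zero_class)
  qed
  have N_add: "p + q \<in> N" if "p \<in> N" "q \<in> N" for p q
    using that Poly_Mapping.keys_add[of p q] unfolding N_def by blast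
  have N_mult: "p * q \<in> N" if "q \<in> N" for p q
  proof -
    have "\<not> set (letters w) \<subseteq> sl_carrier r" if w: "w \<in> Poly_Mapping.keys (p * q)" for w
    proof -
      obtain u v where "v \<in> Poly_Mapping.keys q" "w = u + v" using keys_mult[of p q] w by blast
      then show ?thesis using \<open>q \<in> N\<close> by (auto simp: N_def plus_free_monoid_def)
    qed
    then show ?thesis by (simp add: N_def)
  qed
  have N_0: "0 \<in> N" by (simp add: N_def)
  have K_subspace: "VS.subspace K"
    unfolding VS.subspace_def
  proof (intro conjI ballI allI)
    show "0 \<in> K" unfolding K_def using J'_0 N_0 by force
    fix x y assume "x \<in> K" "y \<in> K"
    then obtain p q p' q' where "x = p + q" "y = p' + q'" "p \<in> J'" "p' \<in> J'" "q \<in> N" "q' \<in> N" unfolding K_def by blast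
    then have "x + y = (p + p') + (q + q')" "p + p' \<in> J'" "q + q' \<in> N" using J'_add N_add by (simp_all add: algebra_simps)
    then show "x + y \<in> K" unfolding K_def by blast
  next
    fix c x assume "x \<in> K"
    then obtain p q where "x = p + q" "p \<in> J'" "q \<in> N" unfolding K_def by blast
    then have "free_smult c x = free_smult c p + free_smult c q" "free_smult c p \<in> J'" "free_smult c q \<in> N"
      using J'_smult N_mult by (simp_all add: free_smult_def distrib_left)
    then show "free_smult c x \<in> K" unfolding K_def by blast
  qed
  have K_mult: "p * x \<in> K" if p: "p \<in> F" and x: "x \<in> K" for p x
  proof -
    obtain j q where "x = j + q" "j \<in> J'" "q \<in> N" using x unfolding K_def by blast
    then have "p * x = p * j + p * q" "p * j \<in> J'" "p * q \<in> N" using J'_mult[OF p] N_mult by (simp_all add: distrib_left)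
    then show ?thesis unfolding K_def by blast
  qed
  have decomp: "\<exists>p\<in>F. \<exists>q\<in>N. x = p + q" for x
    using subset_UNIV[of "Poly_Mapping.keys x"]
  proof (induction x rule: free_module_induct)
    case zero
    show ?case using zero_F N_0 by force
  next
    case (add w c x)
    then obtain p q where pq: "p \<in> F" "q \<in> N" "x = p + q" by blast
    show ?case
    proof (cases "set (letters w) \<subseteq> sl_carrier r")
      case True
      then have "Poly_Mapping.single w c \<in> F" by (simp add: F_def free_algebra_def)
      then have "Poly_Mapping.single w c + p \<in> F" "Poly_Mapping.single w c + x = (Poly_Mapping.single w c + p) + q"
        using F(1)[OF _ pq(1)] pq(3) by (simp_all add: add.assoc)
      then show ?thesis using pq(2) by blast
    next
      case False
      then have "Poly_Mapping.single w c \<in> N" by (simp add: N_def)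
      then have "Poly_Mapping.single w c + q \<in> N" "Poly_Mapping.single w c + x = p + (Poly_Mapping.single w c + q)"
        using N_add pq by (simp_all add: algebra_simps)
      then show ?thesis using pq(1) by blast
    qed
  qed
  \<comment> \<open>The laws of a representation are demanded on the whole vector space, so the
    relations must be sent into \<open>K\<close> also when multiplied by words with foreign
    letters.\<close>
  have I_mult: "i * x \<in> K" if i: "i \<in> ?I" for i x
  proof -
    obtain p q where pq: "p \<in> F" "q \<in> N" "x = p + q" using decomp by blast
    have "i * p \<in> ?I" using I.I_r_closed[OF i, of p] pq(1) by (simp add: F_def free_algebra_ops)
    then have "i * p \<in> J'" by (rule I_J')
    then show ?thesis unfolding K_def using N_mult[OF pq(2)] pq(3) by (auto simp: distrib_left)
  qed
  have FK: "x \<in> J'" if x: "x \<in> F" "x \<in> K" for x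
  proof -
    obtain p q where pq: "x = p + q" "p \<in> J'" "q \<in> N" using x(2) unfolding K_def by blast
    then have "q = x - p" by simp
    then have "q \<in> F" using F(4)[OF x(1), of p] pq(2) by (simp add: J'_def)
    then have "Poly_Mapping.keys q = {}" using pq(3) by (auto simp: F_def free_algebra_def N_def)
    then show ?thesis using pq by simp
  qed
  obtain \<pi> where proj: "(\<forall>x y. \<pi> (x + y) = \<pi> x + \<pi> y) \<and> (\<forall>c x. \<pi> (free_smult c x) = free_smult c (\<pi> x)) \<and>
      (\<forall>x\<in>K. \<pi> x = 0) \<and> (\<forall>x. x - \<pi> x \<in> K)"
    by (rule exE[OF VS.exists_projection[OF K_subspace]])
  then have \<pi>: "\<pi> (x + y) = \<pi> x + \<pi> y" "\<pi> (free_smult c x) = free_smult c (\<pi> x)"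
    "x \<in> K \<Longrightarrow> \<pi> x = 0" "x - \<pi> x \<in> K" for x y c by simp_all
  have \<pi>_diff: "\<pi> (x - y) = \<pi> x - \<pi> y" for x y using \<pi>(1)[of "x - y" y] by simp
  have \<pi>_eq: "\<pi> x = \<pi> y" if "x - y \<in> K" for x y using \<pi>(3)[OF that] \<pi>_diff by simp
  define \<rho> where "\<rho> A v = \<pi> (free_gen A * v)" for A :: "complex poly mat" and v
  have gen: "free_gen A \<in> F" if "A \<in> sl_carrier r" for A using that by (simp add: F_def free_algebra_def free_gen_def)
  have \<rho>\<pi>: "\<rho> A (\<pi> x) = \<pi> (free_gen A * x)" if A: "A \<in> sl_carrier r" for A x
  proof -
    have "\<pi> x - x \<in> K" using VS.subspace_neg[OF K_subspace \<pi>(4)[of x]] by simp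
    from K_mult[OF gen[OF A] this] show ?thesis unfolding \<rho>_def by (intro \<pi>_eq) (simp add: right_diff_distrib)
  qed
  have rel: "i \<in> ?I" if "i \<in> uea_relations (sl_current r)" for i
    using that uea_relations_subset[OF sl_current_lie_algebra, of r] unfolding uea_ideal_def carrier_sl_current
    by (meson ring.genideal_self[OF free_algebra_ring] subsetD)
  interpret L: lie_algebra class_ring "sl_current r" by (rule sl_current_lie_algebra)
  have rep: "current_rep free_smult r \<rho>"
  proof (intro current_rep.intro current_rep_axioms.intro VS.complex_space_axioms)
    show "VS.lin (\<rho> A)" for A
      unfolding VS.lin_def \<rho>_def by (simp add: distrib_left \<pi> free_smult_mult_right)
    fix A B :: "complex poly mat" and x assume A: "A \<in> sl_carrier r" and B: "B \<in> sl_carrier r"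
    have "free_gen (A + B) - free_gen A - free_gen B \<in> uea_relations (sl_current r)"
      unfolding uea_relations_def
      by (rule UnI1, rule UnI1, rule CollectI, rule exI[of _ A], rule exI[of _ B]) (simp add: A B sl_current_def)
    from I_mult[OF rel[OF this], of x] show "\<rho> (A + B) x = \<rho> A x + \<rho> B x"
      unfolding \<rho>_def \<pi>(1)[symmetric] by (intro \<pi>_eq) (simp add: algebra_simps)
    have "free_gen A * free_gen B - free_gen B * free_gen A - free_gen (A * B - B * A) \<in> uea_relations (sl_current r)"
      unfolding uea_relations_def
      by (rule UnI2, rule CollectI, rule exI[of _ A], rule exI[of _ B]) (simp add: A B sl_current_def)
    from VS.subspace_neg[OF K_subspace I_mult[OF rel[OF this], of x]] show "\<rho> (A * B - B * A) x = \<rho> A (\<rho> B x) - \<rho> B (\<rho> A x)"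
      unfolding \<rho>_def[of B x] \<rho>_def[of A x] \<rho>\<pi>[OF A] \<rho>\<pi>[OF B] \<pi>_diff[symmetric] unfolding \<rho>_def
      by (intro \<pi>_eq) (simp add: algebra_simps)
  next
    fix A :: "complex poly mat" and c x assume A: "A \<in> sl_carrier r"
    have "free_gen ([:c:] \<cdot>\<^sub>m A) - free_smult c (free_gen A) \<in> uea_relations (sl_current r)"
      unfolding uea_relations_def
      by (rule UnI1, rule UnI2, rule CollectI, rule exI[of _ c], rule exI[of _ A]) (simp add: A sl_current_def)
    from I_mult[OF rel[OF this], of x] show "\<rho> ([:c:] \<cdot>\<^sub>m A) x = free_smult c (\<rho> A x)"
      unfolding \<rho>_def \<pi>(2)[symmetric] by (intro \<pi>_eq) (simp add: algebra_simps free_smult_mult)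
  qed
  interpret R: current_rep free_smult r \<rho> by (rule rep)
  have word: "foldr \<rho> ws (\<pi> 1) = \<pi> (Poly_Mapping.single (Word ws) 1)" if "set ws \<subseteq> sl_carrier r" for ws
    using that
  proof (induction ws)
    case Nil
    show ?case by (simp add: zero_free_monoid_def[symmetric])
  next
    case (Cons A ws)
    have "free_gen A * Poly_Mapping.single (Word ws) 1 = Poly_Mapping.single (Word (A # ws)) (1::complex)"
      by (simp add: free_gen_def mult_single plus_free_monoid_def)
    then show ?case using Cons by (simp add: \<rho>\<pi>)
  qed
  have act: "R.free_act p (\<pi> 1) = \<pi> p" if "p \<in> F" for p
  proof -
    have "Poly_Mapping.keys p \<subseteq> {w. set (letters w) \<subseteq> sl_carrier r}" using that by (auto simp: F_def free_algebra_def)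
    then show ?thesis
    proof (induction p rule: free_module_induct)
      case zero
      show ?case using \<pi>(3)[OF VS.subspace_0[OF K_subspace]] by (simp add: R.free_act_0)
    next
      case (add w c p)
      have "free_smult c (Poly_Mapping.single w 1) = Poly_Mapping.single w c"
        by (simp add: free_smult_def mult_single)
      then have "free_smult c (\<pi> (Poly_Mapping.single w 1)) = \<pi> (Poly_Mapping.single w c)" by (metis \<pi>(2))
      moreover have "R.word_act w (\<pi> 1) = \<pi> (Poly_Mapping.single w 1)"
        using add(1) word[of "letters w"] by (simp add: R.word_act_def)
      ultimately show ?case by (simp only: R.free_act_add R.free_act_single add.IH \<pi>(1))
    qed
  qed
  have ker: "\<pi> p = 0 \<longleftrightarrow> uea_class r p \<in> J" if p: "p \<in> F" for p
  proof
    assume "\<pi> p = 0"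
    then have "p \<in> K" using \<pi>(4)[of p] by simp
    from FK[OF p this] show "uea_class r p \<in> J" by (simp add: J'_def)
  next
    assume "uea_class r p \<in> J"
    then have "p \<in> J'" using p by (simp add: J'_def)
    then have "p \<in> K" unfolding K_def using N_0 by force
    then show "\<pi> p = 0" by (rule \<pi>(3))
  qed
  show ?thesis by (rule that[OF rep act[unfolded F_def] ker[unfolded F_def]])
qed

section \<open>From boxed monomials to partition overlays\<close>

lemma partition_of_list:
  assumes b: "\<And>s. s \<in> set xs \<Longrightarrow> s \<le> b"
  shows "\<exists>p. is_partition p \<and> fits (length xs) b p \<and> (\<forall>k\<le>b. part_mult (length xs) b p k = count_list xs k)"
proof -
  define ys where "ys = rev (sort xs)"
  define p where "p k = (if k < length xs then ys ! k else 0)" for k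
  have ys: "length ys = length xs" "set ys = set xs" "sorted (rev ys)" "mset ys = mset xs" by (simp_all add: ys_def)
  have "p (Suc k) \<le> p k" for k
    using sorted_rev_nth_mono[OF ys(3), of k "Suc k"] ys(1) by (simp add: p_def)
  then have am: "antimono p" unfolding antimono_iff_le_Suc by blast
  have "p 0 \<le> b"
  proof (cases xs)
    case (Cons x xs')
    then have "ys ! 0 \<in> set xs" using ys nth_mem[of 0 ys] by simp
    then show ?thesis using b Cons by (simp add: p_def)
  qed (simp add: p_def)
  then have fits: "is_partition p \<and> fits (length xs) b p" using am partition_fits_iff[of p "length xs" b] by (simp add: p_def)
  have c: "card {s. p s = l} = count_list xs l" if "1 \<le> l" for l
  proof -
    have "{s. p s = l} = {i. i < length ys \<and> l = ys ! i}" using that ys(1) by (auto simp: p_def split: if_splits)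
    then have "card {s. p s = l} = count_list ys l"
      unfolding count_list_eq_length_filter length_filter_conv_card by simp
    also have "\<dots> = count_list xs l" unfolding count_mset[symmetric] ys(4) ..
    finally show ?thesis .
  qed
  have "length xs = (\<Sum>l=0..b. count_list xs l)"
    by (rule sum_count_set[symmetric]) (use b in auto)
  also have "\<dots> = count_list xs 0 + (\<Sum>l=1..b. count_list xs l)" by (simp add: sum.atLeast_Suc_atMost)
  also have "(\<Sum>l=1..b. count_list xs l) = (\<Sum>l=1..b. card {s. p s = l})" by (rule sum.cong[OF refl]) (simp add: c)
  finally have "count_list xs 0 = length xs - (\<Sum>l=1..b. card {s. p s = l})" by simp
  then have "part_mult (length xs) b p k = count_list xs k" for k
    using c[of k] by (cases "k = 0") (simp_all add: part_mult_def)
  then show ?thesis using fits by blast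
qed

lemma count_concat_map:
  assumes "distinct ks" "\<And>k. k \<in> set ks \<Longrightarrow> k \<noteq> kx \<Longrightarrow> count (mset (F k)) x = 0"
  shows "count (mset (concat (map F ks))) x = (if kx \<in> set ks then count (mset (F kx)) x else 0)"
  using assms by (induction ks) auto

lemma count_grid:
  "count (mset (concat (map (\<lambda>i. concat (map (\<lambda>k. replicate (c i k) (i, k)) [0..<Suc (b i)])) [1..<Suc n]))) x
    = (if fst x \<in> {1..n} \<and> snd x \<le> b (fst x) then c (fst x) (snd x) else 0)"
proof -
  obtain ix kx where x: "x = (ix, kx)" by (cases x)
  have rep: "count (mset (concat (map (\<lambda>k. replicate (c i k) (i, k)) [0..<Suc (b i)]))) x = (if i = ix \<and> kx \<le> b i then c i kx else 0)" for i
    by (subst count_concat_map[where kx = kx]) (auto simp: x)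
  have "count (mset (concat (map (\<lambda>k. replicate (c i k) (i, k)) [0..<Suc (b i)]))) x = 0" if "i \<in> set [1..<Suc n]" "i \<noteq> ix" for i
    unfolding rep using that by simp
  from count_concat_map[OF distinct_upt this] show ?thesis
    unfolding rep by (auto simp: x simp del: mset_concat upt_Suc)
qed

lemma count_list_snd_filter: "count_list (map snd (filter (\<lambda>q. fst q = i) ps)) k = count (mset ps) (i, k)"
  by (induction ps) auto

context current_rep
begin

lemma x_minus_partition_closed:
  assumes "1 \<le> i" "i \<le> j" "j \<le> r"
  shows "x_minus_partition r i j a b p \<in> carrier (current_uea r)"
  unfolding x_minus_partition_def
  by (intro ordered_prod_closed divided_power_closed current_emb_closed x_minus_mem assms)

lemma pop_row_closed: "j \<le> r \<Longrightarrow> pop_row r P j \<in> carrier (current_uea r)"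
  unfolding pop_row_def by (rule ordered_prod_closed, rule x_minus_partition_closed) auto

lemma pop_monomial_closed: "pop_monomial r P \<in> carrier (current_uea r)"
  unfolding pop_monomial_def by (rule ordered_prod_closed, rule pop_row_closed) auto

lemma foldr_umono:
  assumes "\<And>k. k \<in> set ks \<Longrightarrow> \<exists>c. c \<noteq> 0 \<and> (\<forall>v. f k v = c *s umono n (l k) v)"
  shows "\<exists>c. c \<noteq> 0 \<and> (\<forall>v. foldr f ks v = c *s umono n (concat (map l ks)) v)"
  using assms
proof (induction ks)
  case Nil
  show ?case by (rule exI[of _ 1]) simp
next
  case (Cons k ks)
  then obtain c where c: "c \<noteq> 0" "\<And>v. foldr f ks v = c *s umono n (concat (map l ks)) v" by auto
  obtain d where d: "d \<noteq> 0" "\<And>v. f k v = d *s umono n (l k) v" using Cons.prems by auto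
  show ?case
    by (rule exI[of _ "d * c"]) (simp add: c d linD(2)[OF lin_mono])
qed

lemma umono_replicate: "umono n (replicate m (i, k)) v = (e n i k ^^ m) v"
  by (induction m) simp_all

lemma Uact_divided_x_minus:
  assumes "1 \<le> i" "i \<le> j" "j \<le> r"
  shows "Uact (divided_power (current_uea r) (current_emb r (x_minus r i j) (monom 1 k)) m) v
    = (1 / fact m) *s umono (Suc j) (replicate m (i, k)) v"
proof -
  have X: "x_minus r i j \<in> sl_carrier r" by (rule x_minus_mem[OF assms])
  have "Uact (current_emb r (x_minus r i j) (monom 1 k)) = e (Suc j) i k"
  proof
    fix v show "Uact (current_emb r (x_minus r i j) (monom 1 k)) v = e (Suc j) i k v"
      using Uact_emb[OF X, of "monom 1 k" v] unfolding e_def x_minus_eq_unit_sl[OF assms(1,2)] .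
  qed
  then show ?thesis unfolding Uact_divided_power[OF current_emb_closed[OF X]] umono_replicate by simp
qed

lemma Uact_pop_row:
  assumes j: "j \<le> r"
  shows "\<exists>c. c \<noteq> 0 \<and> (\<forall>v. Uact (pop_row r P j) v = c *s umono (Suc j)
    (concat (map (\<lambda>i. concat (map (\<lambda>k. replicate (part_mult (rect_height (fst P) j i) (rect_width (fst P) j i) (snd P j i) k) (i, k))
      [0..<Suc (rect_width (fst P) j i)])) [1..<Suc j])) v)"
proof -
  let ?a = "rect_height (fst P) j" and ?b = "rect_width (fst P) j" and ?p = "snd P j"
  have part: "\<exists>c. c \<noteq> 0 \<and> (\<forall>v. Uact (x_minus_partition r i j (?a i) (?b i) (?p i)) v
      = c *s umono (Suc j) (concat (map (\<lambda>k. replicate (part_mult (?a i) (?b i) (?p i) k) (i, k)) [0..<Suc (?b i)])) v)"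
    if i: "i \<in> set [1..<Suc j]" for i
  proof -
    have ij: "1 \<le> i" "i \<le> j" using i by auto
    have "Uact (x_minus_partition r i j (?a i) (?b i) (?p i)) v = foldr (\<lambda>k. Uact (divided_power (current_uea r)
        (current_emb r (x_minus r i j) (monom 1 k)) (part_mult (?a i) (?b i) (?p i) k))) [0..<Suc (?b i)] v" for v
      unfolding x_minus_partition_def
      by (rule Uact_ordered_prod) (intro divided_power_closed current_emb_closed x_minus_mem[OF ij j])
    moreover have "\<exists>c. c \<noteq> 0 \<and> (\<forall>v. foldr (\<lambda>k. Uact (divided_power (current_uea r)
        (current_emb r (x_minus r i j) (monom 1 k)) (part_mult (?a i) (?b i) (?p i) k))) [0..<Suc (?b i)] v
      = c *s umono (Suc j) (concat (map (\<lambda>k. replicate (part_mult (?a i) (?b i) (?p i) k) (i, k)) [0..<Suc (?b i)])) v)"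
    proof (rule foldr_umono)
      fix k
      show "\<exists>c. c \<noteq> 0 \<and> (\<forall>v. Uact (divided_power (current_uea r) (current_emb r (x_minus r i j) (monom 1 k)) (part_mult (?a i) (?b i) (?p i) k)) v
          = c *s umono (Suc j) (replicate (part_mult (?a i) (?b i) (?p i) k) (i, k)) v)"
        by (intro exI[of _ "1 / fact (part_mult (?a i) (?b i) (?p i) k) :: complex"] conjI allI) (simp_all only: Uact_divided_x_minus[OF ij j], simp)
    qed
    ultimately show ?thesis by simp
  qed
  have "Uact (pop_row r P j) v = foldr (\<lambda>i. Uact (x_minus_partition r i j (?a i) (?b i) (?p i))) [1..<Suc j] v" for v
    unfolding pop_row_def by (rule Uact_ordered_prod, rule x_minus_partition_closed) (use j in auto)
  moreover have "\<exists>c. c \<noteq> 0 \<and> (\<forall>v. foldr (\<lambda>i. Uact (x_minus_partition r i j (?a i) (?b i) (?p i))) [1..<Suc j] v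
    = c *s umono (Suc j) (concat (map (\<lambda>i. concat (map (\<lambda>k. replicate (part_mult (?a i) (?b i) (?p i) k) (i, k)) [0..<Suc (?b i)])) [1..<Suc j])) v)"
    by (rule foldr_umono) (rule part)
  ultimately show ?thesis by (simp only:)
qed

text \<open>A boxed list yields the next row through its index counts and one partition for each
  index by sorting its exponents. The row operator of the resulting POP acts as a nonzero multiple
  of the same monomial, the multiple coming from the factorials in the divided powers; hence a span
  on the right side.\<close>

lemma pop_vectors_subset:
  assumes "k \<le> r" "\<forall>i\<in>{1..k}. lam (Suc i) \<le> lam i"
  shows "pop_vectors k lam z \<subseteq>
    span ((\<lambda>P. Uact (ordered_prod (current_uea r) (pop_row r P) [1..<Suc k]) z) ` pops_bounded (Suc k) (restrict lam {1..Suc k}))"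
  using assms
proof (induction k arbitrary: lam z)
  case 0
  have "restrict lam {1..1} \<in> noninc_seqs 1" by (auto simp: noninc_seqs_def)
  from pops_bounded_1[OF this] obtain P where P: "P \<in> pops_bounded 1 (restrict lam {1..1})" by blast
  have "Uact (ordered_prod (current_uea r) (pop_row r P) [1..<Suc 0]) z = z"
    by (subst Uact_ordered_prod) simp_all
  moreover have "Uact (ordered_prod (current_uea r) (pop_row r P) [1..<Suc 0]) z
     \<in> span ((\<lambda>P. Uact (ordered_prod (current_uea r) (pop_row r P) [1..<Suc 0]) z) ` pops_bounded (Suc 0) (restrict lam {1..Suc 0}))"
    by (rule span_base, rule imageI) (use P in \<open>simp only: One_nat_def\<close>)
  ultimately show ?case by (simp only: pop_vectors.simps insert_subset empty_subsetI simp_thms)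
next
  case (Suc k)
  let ?n = "Suc k"
  let ?lam = "restrict lam {1..Suc ?n}"
  let ?S = "span ((\<lambda>P. Uact (ordered_prod (current_uea r) (pop_row r P) [1..<Suc ?n]) z) ` pops_bounded (Suc ?n) ?lam)"
  have k: "k \<le> r" "?n \<le> r" using Suc.prems(1) by auto
  have lam: "?lam \<in> noninc_seqs (Suc ?n)" using Suc.prems(2) by (simp add: noninc_seqs_def)
  show ?case
  proof
    fix y assume "y \<in> pop_vectors (Suc k) lam z"
    then obtain ps where ind: "indices_le ?n ps" and boxed: "\<And>i. i \<in> {1..?n} \<Longrightarrow> boxed (\<lambda>i. nat (lam i - lam (Suc i))) i ps"
      and y: "y \<in> pop_vectors k (\<lambda>i. lam i - int (index_count i ps)) (umono (Suc ?n) ps z)" by auto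
    define \<mu> where "\<mu> i = lam i - int (index_count i ps)" for i
    let ?\<mu> = "restrict \<mu> {1..?n}"
    define b where "b i = nat (lam i - lam (Suc i)) - index_count i ps" for i
    have cnt: "int (index_count i ps) \<le> lam i - lam (Suc i)" if "i \<in> {1..?n}" for i
      using boxed_index_count[OF boxed[OF that]] bspec[OF Suc.prems(2) that] by simp
    have \<mu>le: "lam (Suc i) \<le> \<mu> i" "\<mu> i \<le> lam i" if "i \<in> {1..?n}" for i using cnt[OF that] by (simp_all add: \<mu>_def)
    have \<mu>dec: "\<forall>i\<in>{1..k}. \<mu> (Suc i) \<le> \<mu> i"
    proof
      fix i assume i: "i \<in> {1..k}"
      then have "\<mu> (Suc i) \<le> lam (Suc i)" "lam (Suc i) \<le> \<mu> i" using \<mu>le[of i] \<mu>le[of "Suc i"] by auto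
      then show "\<mu> (Suc i) \<le> \<mu> i" by simp
    qed
    have inter: "?\<mu> \<in> interlacing ?n ?lam"
      using \<mu>dec \<mu>le by (simp add: interlacing_def noninc_seqs_def interlace_def)
    have exP: "\<exists>p. is_partition p \<and> fits (index_count i ps) (b i) p \<and> (\<forall>l\<le>b i. part_mult (index_count i ps) (b i) p l = count (mset ps) (i, l))"
      if i: "i \<in> {1..?n}" for i
    proof -
      have "s \<le> b i" if "s \<in> set (map snd (filter (\<lambda>q. fst q = i) ps))" for s
      proof -
        have "(i, s) \<in> set ps" using that by auto
        from boxed[OF i, unfolded boxed_def, rule_format, OF this]
        have "s + index_count i ps \<le> nat (lam i - lam (Suc i))" .
        then show ?thesis by (simp add: b_def)
      qed
      then have "\<exists>p. is_partition p \<and> fits (length (map snd (filter (\<lambda>q. fst q = i) ps))) (b i) p \<and>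
        (\<forall>l\<le>b i. part_mult (length (map snd (filter (\<lambda>q. fst q = i) ps))) (b i) p l = count_list (map snd (filter (\<lambda>q. fst q = i) ps)) l)"
        by (rule partition_of_list)
      then show ?thesis unfolding count_list_snd_filter length_map index_count_def[symmetric] .
    qed
    have "\<forall>i\<in>{1..?n}. \<exists>p. is_partition p \<and> fits (index_count i ps) (b i) p \<and> (\<forall>l\<le>b i. part_mult (index_count i ps) (b i) p l = count (mset ps) (i, l))"
      by (rule ballI) (rule exP)
    from bchoice[OF this] obtain \<pi>0 where "\<forall>i\<in>{1..?n}. is_partition (\<pi>0 i) \<and> fits (index_count i ps) (b i) (\<pi>0 i)
        \<and> (\<forall>l\<le>b i. part_mult (index_count i ps) (b i) (\<pi>0 i) l = count (mset ps) (i, l))" by (rule exE)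
    note \<pi>0 = bspec[OF this]
    define \<pi> where "\<pi> = restrict \<pi>0 {1..?n}"
    have hw: "nat (?lam i - ?\<mu> i) = index_count i ps" "nat (?\<mu> i - ?lam (Suc i)) = b i" if "i \<in> {1..?n}" for i
      using that cnt[OF that] by (simp_all add: \<mu>_def b_def nat_diff_distrib)
    have over: "\<pi> \<in> overlays ?n ?lam ?\<mu>"
      unfolding overlays_def \<pi>_def
    proof (rule PiE_I)
      fix i assume i: "i \<in> {1..?n}"
      show "restrict \<pi>0 {1..?n} i \<in> {p. is_partition p \<and> fits (nat (?lam i - ?\<mu> i)) (nat (?\<mu> i - ?lam (Suc i))) p}"
        unfolding hw[OF i] using \<pi>0[OF i] i by simp
    next
      fix i assume "i \<notin> {1..?n}"
      then show "restrict \<pi>0 {1..?n} i = undefined" by (simp only: restrict_def if_False)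
    qed
    have "pop_vectors k \<mu> (umono (Suc ?n) ps z) \<subseteq>
      span ((\<lambda>P. Uact (ordered_prod (current_uea r) (pop_row r P) [1..<Suc k]) (umono (Suc ?n) ps z)) ` pops_bounded ?n ?\<mu>)"
      by (rule Suc.IH[OF k(1) \<mu>dec])
    also have "\<dots> \<subseteq> ?S"
    proof (rule span_minimal[OF _ subspace_span], rule subsetI)
      fix x assume "x \<in> (\<lambda>P. Uact (ordered_prod (current_uea r) (pop_row r P) [1..<Suc k]) (umono (Suc ?n) ps z)) ` pops_bounded ?n ?\<mu>"
      then obtain P where P: "P \<in> pops_bounded ?n ?\<mu>"
        and x: "x = Uact (ordered_prod (current_uea r) (pop_row r P) [1..<Suc k]) (umono (Suc ?n) ps z)" by blast
      define Q where "Q = extend_pop ?n ?lam \<pi> P"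
      have Q: "Q \<in> pops_bounded (Suc ?n) ?lam"
        unfolding Q_def by (rule extend_pop_mem[OF _ lam inter over P]) simp
      have Pn: "fst P ?n = ?\<mu>" using P by (simp add: pops_bounded_def)
      have rows: "pop_row r Q j = pop_row r P j" if "j \<in> set [1..<Suc k]" for j
      proof -
        have "j \<noteq> ?n" "j \<noteq> Suc ?n" "Suc j \<noteq> Suc ?n" using that by auto
        then have "fst Q j = fst P j" "fst Q (Suc j) = fst P (Suc j)" "snd Q j = snd P j"
          unfolding Q_def extend_pop_def fst_conv snd_conv by (simp_all only: fun_upd_apply if_False)
        then show ?thesis unfolding pop_row_def rect_height_def rect_width_def by (simp only:)
      qed
      have h: "rect_height (fst Q) ?n i = index_count i ps" "rect_width (fst Q) ?n i = b i" if "i \<in> {1..?n}" for i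
        using hw[OF that] Pn by (simp_all add: rect_height_def rect_width_def Q_def extend_pop_def)
      have q: "snd Q ?n i = \<pi>0 i" if "i \<in> {1..?n}" for i using that by (simp add: Q_def extend_pop_def \<pi>_def)
      define qs where "qs = concat (map (\<lambda>i. concat (map (\<lambda>l. replicate (part_mult (rect_height (fst Q) ?n i) (rect_width (fst Q) ?n i) (snd Q ?n i) l) (i, l))
        [0..<Suc (rect_width (fst Q) ?n i)])) [1..<Suc ?n])"
      obtain c where c: "c \<noteq> 0" "\<And>v. Uact (pop_row r Q ?n) v = c *s umono (Suc ?n) qs v"
        using Uact_pop_row[OF k(2), of Q] unfolding qs_def by blast
      have perm: "mset qs = mset ps"
      proof (rule multiset_eqI)
        fix w :: "nat \<times> nat"
        obtain i l where w: "w = (i, l)" by (cases w)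
        show "count (mset qs) w = count (mset ps) w"
        proof (cases "i \<in> {1..?n} \<and> l \<le> b i")
          case True
          then have i: "i \<in> {1..?n}" and l: "l \<le> b i" by simp_all
          show ?thesis unfolding qs_def count_grid w fst_conv snd_conv h[OF i] q[OF i] using \<pi>0[OF i] i l by simp
        next
          case False
          have "(i, l) \<notin> set ps"
          proof
            assume il: "(i, l) \<in> set ps"
            then have i: "i \<in> {1..?n}" using ind by (auto simp: indices_le_def)
            from boxed[OF i, unfolded boxed_def, rule_format, OF il]
            have "l + index_count i ps \<le> nat (lam i - lam (Suc i))" .
            then show False using False i by (simp add: b_def)
          qed
          then have "count (mset ps) w = 0" by (simp add: w)
          moreover have "count (mset qs) w = 0"
          proof (cases "i \<in> {1..?n}")
            case True
            then show ?thesis unfolding qs_def count_grid w fst_conv snd_conv h[OF True] using False by simp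
          next
            case False
            then show ?thesis unfolding qs_def count_grid w fst_conv snd_conv by (simp only: simp_thms if_False)
          qed
          ultimately show ?thesis by (simp only:)
        qed
      qed
      have "indices_le ?n qs" using ind stats_perm(4)[OF perm] by simp
      then have mono: "umono (Suc ?n) qs v = umono (Suc ?n) ps v" for v
        using mono_perm[OF _ _ perm] k(2) by simp
      have row_closed: "pop_row r Q j \<in> carrier (current_uea r)" if "j \<in> set [1..<Suc ?n]" for j
        using that k(2) by (intro pop_row_closed) auto
      have "Uact (ordered_prod (current_uea r) (pop_row r Q) [1..<Suc ?n]) z = foldr (\<lambda>j. Uact (pop_row r Q j)) ([1..<Suc k] @ [?n]) z"
        using Uact_ordered_prod[OF row_closed, of "[1..<Suc ?n]" "\<lambda>j. j"] by simp
      also have "\<dots> = foldr (\<lambda>j. Uact (pop_row r Q j)) [1..<Suc k] (c *s umono (Suc ?n) ps z)"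
        by (simp only: foldr_append foldr.simps o_apply id_apply c(2) mono)
      also have "foldr (\<lambda>j. Uact (pop_row r Q j)) [1..<Suc k] = foldr (\<lambda>j. Uact (pop_row r P j)) [1..<Suc k]"
        by (intro ext foldr_cong refl) (simp only: rows)
      also have "foldr (\<lambda>j. Uact (pop_row r P j)) [1..<Suc k] (c *s umono (Suc ?n) ps z) = c *s foldr (\<lambda>j. Uact (pop_row r P j)) [1..<Suc k] (umono (Suc ?n) ps z)"
        by (rule linD(2)[OF lin_foldr]) (rule lin_Uact)
      also have "foldr (\<lambda>j. Uact (pop_row r P j)) [1..<Suc k] (umono (Suc ?n) ps z) = x"
        unfolding x by (rule Uact_ordered_prod[symmetric], rule pop_row_closed) (use k(1) in auto)
      finally have "c *s x \<in> ?S" using Q by (metis (no_types, lifting) span_base imageI)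
      then show "x \<in> ?S" using subspace_scale_cancel[OF subspace_span] c(1) by blast
    qed
    finally show "y \<in> ?S" using y unfolding \<mu>_def by blast
  qed
qed

end

section \<open>The basis\<close>

lemma (in current_rep) pop_vector_eq: "pop_vector r lam P = weyl_ideal r lam +>\<^bsub>current_uea r\<^esub> pop_monomial r P"
proof -
  interpret U: ring "current_uea r" by (rule uea_ring[OF sl_current_lie_algebra])
  show ?thesis unfolding pop_vector_def weyl_gen_def weyl_act_coset[OF pop_monomial_closed U.one_closed]
    by (simp add: pop_monomial_closed)
qed

lemma weyl_coset:
  assumes u: "u \<in> carrier (current_uea r)" and w: "w \<in> carrier (current_uea r)"
  shows weyl_coset_add: "(weyl_ideal r lam +>\<^bsub>current_uea r\<^esub> u) \<oplus>\<^bsub>local_weyl r lam\<^esub> (weyl_ideal r lam +>\<^bsub>current_uea r\<^esub> w)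
      = weyl_ideal r lam +>\<^bsub>current_uea r\<^esub> (u \<oplus>\<^bsub>current_uea r\<^esub> w)"
    and weyl_coset_smult: "c \<odot>\<^bsub>local_weyl r lam\<^esub> (weyl_ideal r lam +>\<^bsub>current_uea r\<^esub> u)
      = weyl_ideal r lam +>\<^bsub>current_uea r\<^esub> (c \<odot>\<^bsub>current_uea r\<^esub> u)"
    and weyl_coset_zero: "u \<in> weyl_ideal r lam \<Longrightarrow> weyl_ideal r lam +>\<^bsub>current_uea r\<^esub> u = \<zero>\<^bsub>local_weyl r lam\<^esub>"
    and weyl_coset_eqD: "weyl_ideal r lam +>\<^bsub>current_uea r\<^esub> u = weyl_ideal r lam +>\<^bsub>current_uea r\<^esub> w
      \<Longrightarrow> \<exists>h\<in>weyl_ideal r lam. u = h \<oplus>\<^bsub>current_uea r\<^esub> w"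
    and weyl_coset_carrier: "weyl_ideal r lam +>\<^bsub>current_uea r\<^esub> u \<in> carrier (local_weyl r lam)"
proof -
  interpret U: ring "current_uea r" by (rule uea_ring[OF sl_current_lie_algebra])
  interpret V: vectorspace class_ring "current_uea r" by (rule uea_vectorspace[OF sl_current_lie_algebra])
  interpret A: abelian_subgroup "weyl_ideal r lam" "current_uea r"
    by (rule abelian_subgroupI3) (use weyl_left_ideal[of r lam] in \<open>auto simp: left_ideal_def intro: U.abelian_group_axioms\<close>)
  show "(weyl_ideal r lam +>\<^bsub>current_uea r\<^esub> u) \<oplus>\<^bsub>local_weyl r lam\<^esub> (weyl_ideal r lam +>\<^bsub>current_uea r\<^esub> w)
      = weyl_ideal r lam +>\<^bsub>current_uea r\<^esub> (u \<oplus>\<^bsub>current_uea r\<^esub> w)"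
    using A.a_rcos_sum[OF u w] by (simp add: local_weyl_def quot_space_def)
  show "c \<odot>\<^bsub>local_weyl r lam\<^esub> (weyl_ideal r lam +>\<^bsub>current_uea r\<^esub> u)
      = weyl_ideal r lam +>\<^bsub>current_uea r\<^esub> (c \<odot>\<^bsub>current_uea r\<^esub> u)"
    unfolding local_weyl_def
    by (rule quot_space_smult[OF V.module_axioms uea_left_ideal_submodule[OF sl_current_lie_algebra weyl_left_ideal] _ u]) simp
  show "weyl_ideal r lam +>\<^bsub>current_uea r\<^esub> u = \<zero>\<^bsub>local_weyl r lam\<^esub>" if "u \<in> weyl_ideal r lam"
    using A.a_rcos_const[OF that] by (simp add: local_weyl_def quot_space_def)
  show "\<exists>h\<in>weyl_ideal r lam. u = h \<oplus>\<^bsub>current_uea r\<^esub> w"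
    if "weyl_ideal r lam +>\<^bsub>current_uea r\<^esub> u = weyl_ideal r lam +>\<^bsub>current_uea r\<^esub> w"
    using A.a_rcos_self[OF u] unfolding that by (auto simp: a_r_coset_def r_coset_def)
  show "weyl_ideal r lam +>\<^bsub>current_uea r\<^esub> u \<in> carrier (local_weyl r lam)"
    using u by (auto simp: local_weyl_def quot_space_def A_RCOSETS_def RCOSETS_def a_r_coset_def)
qed

lemma local_weyl_carrierE:
  assumes "X \<in> carrier (local_weyl r lam)"
  obtains u where "u \<in> carrier (current_uea r)" "X = weyl_ideal r lam +>\<^bsub>current_uea r\<^esub> u"
  using assms by (auto simp: local_weyl_def quot_space_def A_RCOSETS_def RCOSETS_def a_r_coset_def)

lemma weyl_relations_ideal: "weyl_relations r lam \<subseteq> weyl_ideal r lam"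
  unfolding weyl_ideal_def gen_left_ideal_def by blast

lemma noninc_seqsD: "lam \<in> noninc_seqs (Suc r) \<Longrightarrow> i \<in> {1..r} \<Longrightarrow> lam (Suc i) \<le> lam i"
  by (simp add: noninc_seqs_def)

theorem pop_vectors_span_local_weyl:
  assumes lam: "lam \<in> noninc_seqs (Suc r)"
  shows "LinearCombinations.module.span class_ring (local_weyl r lam) (pop_vector r lam ` pops_bounded (Suc r) lam) = carrier (local_weyl r lam)"
    and "pop_vector r lam ` pops_bounded (Suc r) lam \<subseteq> carrier (local_weyl r lam)"
proof -
  let ?J = "weyl_ideal r lam" and ?U = "current_uea r" and ?W = "local_weyl r lam"
  define F where "F = current_words r"
  define S where "S = pop_vector r lam ` pops_bounded (Suc r) lam"
  obtain \<rho> and \<pi> :: "(complex poly mat free_monoid \<Rightarrow>\<^sub>0 complex) \<Rightarrow> (complex poly mat free_monoid \<Rightarrow>\<^sub>0 complex)"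
    where rep: "current_rep free_smult r \<rho>"
    and act: "\<And>p. p \<in> current_words r \<Longrightarrow> current_rep.free_act free_smult \<rho> p (\<pi> 1) = \<pi> p"
    and ker: "\<And>p. p \<in> current_words r \<Longrightarrow> \<pi> p = 0 \<longleftrightarrow> uea_class r p \<in> ?J"
    using universal_current_rep[OF weyl_left_ideal[of r lam]] by metis
  interpret R: current_rep free_smult r \<rho> by (rule rep)
  interpret W: vectorspace class_ring ?W by (rule local_weyl_vectorspace)
  define z where "z = \<pi> 1"
  have ker: "R.free_act p z = 0 \<longleftrightarrow> uea_class r p \<in> ?J" if "p \<in> F" for p
    using ker act that unfolding F_def z_def by simp
  have closed: "uea_class r p \<in> carrier ?U" if "p \<in> F" for p using uea_class_closed that unfolding F_def by blast
  note Fc = current_words_closed[where r = r, folded F_def]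
  have Uz: "R.Uact u z = 0" if u: "u \<in> weyl_relations r lam" for u
  proof -
    have "u \<in> carrier ?U" "u \<in> ?J" using u weyl_relations_subset weyl_relations_ideal by blast+
    then obtain p where p: "p \<in> current_words r" "u = uea_class r p" unfolding uea_class_carrier by blast
    show ?thesis using ker[of p] p \<open>u \<in> ?J\<close> unfolding p(2) R.Uact_class[OF p(1)] F_def by simp
  qed
  have high: "R.highest (Suc r) lam (- of_int (\<Sum>i=1..Suc r. lam i) / of_nat (Suc r)) {0} z"
    by (rule R.highest_weyl_relations) (fact Uz, rule noninc_seqsD[OF lam])
  have stab: "R.stable (Suc r) {0}" unfolding R.stable_def by (simp add: R.subspace_single_0 R.e_lin(3))
  have dec: "\<forall>i\<in>{1..r}. lam (Suc i) \<le> lam i" using noninc_seqsD[OF lam] by blast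
  have res: "restrict lam {1..Suc r} = lam"
    using lam by (intro extensional_restrict) (simp add: noninc_seqs_def PiE_def)
  define G where "G = (\<lambda>P. R.Uact (pop_monomial r P) z) ` pops_bounded (Suc r) lam"
  have "R.pop_vectors r lam z \<subseteq> R.span G"
    using R.pop_vectors_subset[OF order_refl dec, of z] unfolding res G_def pop_monomial_def .
  then have "R.pop_vectors r lam z \<union> {0} \<subseteq> R.span G" using R.span_zero by blast
  then have "R.span (R.pop_vectors r lam z \<union> {0}) \<subseteq> R.span G" by (rule R.span_minimal) (rule R.subspace_span)
  then have genG: "R.gen (Suc r) (insert z {0}) \<subseteq> R.span G"
    using R.gen_subset_span_pop_vectors[OF order_refl stab high dec] by blast
  have Ssub: "S \<subseteq> carrier ?W"
    unfolding S_def using weyl_coset_carrier[OF R.pop_monomial_closed R.pop_monomial_closed] by (auto simp: R.pop_vector_eq)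
  interpret SS: LinearCombinations.submodule class_ring "W.span S" ?W by (rule W.span_is_submodule[OF Ssub])
  \<comment> \<open>\<open>T\<close> carries the spanning result over to cosets: it consists of the
    vectors q z for which the coset of q lies in the span of the POP vectors. It is a subspace
    containing \<open>G\<close>. Two elements with the same effect on \<open>z\<close> differ by an
    element of the ideal, so any q may be used in the end.\<close>
  define T where "T = {x. \<exists>q\<in>F. x = R.free_act q z \<and> ?J +>\<^bsub>?U\<^esub> uea_class r q \<in> W.span S}"
  have F0: "0 \<in> F" by (simp add: F_def free_algebra_def)
  have "R.subspace T"
    unfolding R.subspace_def
  proof (intro conjI ballI allI)
    have "uea_class r 0 \<in> ?J" using ker[OF F0] by (simp add: R.free_act_0)
    then have "?J +>\<^bsub>?U\<^esub> uea_class r 0 \<in> W.span S" using weyl_coset_zero[OF closed[OF F0] closed[OF F0]] by simp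
    then show "0 \<in> T" unfolding T_def using F0 R.free_act_0[of z] by force
    fix x y assume "x \<in> T" "y \<in> T"
    then obtain p q where pq: "p \<in> F" "q \<in> F" "x = R.free_act p z" "y = R.free_act q z"
      "?J +>\<^bsub>?U\<^esub> uea_class r p \<in> W.span S" "?J +>\<^bsub>?U\<^esub> uea_class r q \<in> W.span S" unfolding T_def by blast
    have "?J +>\<^bsub>?U\<^esub> uea_class r (p + q) \<in> W.span S"
      using SS.m_closed[OF pq(5,6)] unfolding weyl_coset_add[OF closed[OF pq(1)] closed[OF pq(2)]]
        uea_class_add[OF pq(1,2)[unfolded F_def]] .
    moreover have "x + y = R.free_act (p + q) z" by (simp add: pq R.free_act_add)
    ultimately show "x + y \<in> T" unfolding T_def using Fc(1)[OF pq(1,2)] by blast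
  next
    fix c x assume "x \<in> T"
    then obtain p where p: "p \<in> F" "x = R.free_act p z" "?J +>\<^bsub>?U\<^esub> uea_class r p \<in> W.span S" unfolding T_def by blast
    have "c \<odot>\<^bsub>?W\<^esub> (?J +>\<^bsub>?U\<^esub> uea_class r p) \<in> W.span S" by (rule SS.smult_closed) (use p in simp_all)
    then have "?J +>\<^bsub>?U\<^esub> uea_class r (free_smult c p) \<in> W.span S"
      unfolding weyl_coset_smult[OF closed[OF p(1)] closed[OF p(1)]] uea_class_smult[OF p(1)[unfolded F_def] p(1)[unfolded F_def]] .
    moreover have "free_smult c x = R.free_act (free_smult c p) z" by (simp add: p R.free_act_smult)
    ultimately show "free_smult c x \<in> T" unfolding T_def using Fc(5)[OF p(1) p(1)] by blast
  qed
  moreover have "G \<subseteq> T"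
  proof
    fix x assume "x \<in> G"
    then obtain P where P: "P \<in> pops_bounded (Suc r) lam" "x = R.Uact (pop_monomial r P) z" unfolding G_def by blast
    obtain q where q: "q \<in> current_words r" "pop_monomial r P = uea_class r q"
      using R.pop_monomial_closed[of P] unfolding uea_class_carrier by blast
    have "pop_vector r lam P \<in> W.span S" using W.in_own_span[OF Ssub] P(1) unfolding S_def by blast
    then show "x \<in> T" unfolding T_def P(2) R.pop_vector_eq q(2) R.Uact_class[OF q(1)] using q(1) unfolding F_def by blast
  qed
  ultimately have GT: "R.span G \<subseteq> T" by (intro R.span_minimal)
  have "carrier ?W \<subseteq> W.span S"
  proof
    fix X assume "X \<in> carrier ?W"
    then obtain u where "u \<in> carrier ?U" "X = ?J +>\<^bsub>?U\<^esub> u" by (rule local_weyl_carrierE)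
    then obtain p where p: "p \<in> F" "X = ?J +>\<^bsub>?U\<^esub> uea_class r p" unfolding uea_class_carrier F_def by blast
    have "z \<in> R.gen (Suc r) (insert z {0})" using R.gen_superset[of "insert z {0}" "Suc r"] by blast
    from R.Uact_stable[OF R.stable_gen p(1)[unfolded F_def] this] have "R.free_act p z \<in> T" using genG GT by blast
    then obtain q where q: "q \<in> F" "R.free_act p z = R.free_act q z" "?J +>\<^bsub>?U\<^esub> uea_class r q \<in> W.span S" unfolding T_def by blast
    have d: "p - q \<in> F" by (rule Fc(4)[OF p(1) q(1)])
    have "uea_class r (p - q) \<in> ?J" using ker[OF d] q(2) by (simp add: R.free_act_diff)
    then have 0: "?J +>\<^bsub>?U\<^esub> uea_class r (p - q) = \<zero>\<^bsub>?W\<^esub>" by (rule weyl_coset_zero[OF closed[OF d] closed[OF d]])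
    have "X = (?J +>\<^bsub>?U\<^esub> uea_class r (p - q)) \<oplus>\<^bsub>?W\<^esub> (?J +>\<^bsub>?U\<^esub> uea_class r q)"
      unfolding weyl_coset_add[OF closed[OF d] closed[OF q(1)]] uea_class_add[OF d[unfolded F_def] q(1)[unfolded F_def]] p(2) by simp
    then have "X = ?J +>\<^bsub>?U\<^esub> uea_class r q" unfolding 0 using weyl_coset_carrier[OF closed[OF q(1)] closed[OF q(1)]] by simp
    then show "X \<in> W.span S" using q(3) by simp
  qed
  then show "W.span (pop_vector r lam ` pops_bounded (Suc r) lam) = carrier ?W"
    using W.span_is_subset2[OF Ssub] unfolding S_def by blast
  show "pop_vector r lam ` pops_bounded (Suc r) lam \<subseteq> carrier ?W" using Ssub unfolding S_def .
qed

section \<open>The lower bound for spanning sets\<close>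

lemma sum_by_parts:
  fixes l :: "nat \<Rightarrow> int" and h :: "nat \<Rightarrow> complex"
  shows "(\<Sum>i=1..n. of_int (l i - l (Suc i)) * (\<Sum>q<i. h q))
    = (\<Sum>i=1..n. of_int (l i) * h (i - 1)) - of_int (l (Suc n)) * (\<Sum>q<n. h q)"
  by (induction n) (simp_all add: algebra_simps sum.lessThan_Suc)

text \<open>Scalars are restricted to the constants in C[s], which makes the tensor power a complex
  representation of the current algebra.\<close>

definition poly_const_scale :: "complex \<Rightarrow> ('b \<Rightarrow> complex poly) \<Rightarrow> 'b \<Rightarrow> complex poly" where
  "poly_const_scale c \<phi> = (\<lambda>g. [:c:] * \<phi> g)"

lemma poly_const_scale_vector_space: "vector_space poly_const_scale"
  by standard (simp_all add: poly_const_scale_def fun_eq_iff smult_add_left smult_add_right mult.commute)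

lemma tensor_current_rep: "current_rep poly_const_scale r (tensor_act r m)"
proof -
  interpret complex_space poly_const_scale unfolding complex_space_def by (rule poly_const_scale_vector_space)
  show ?thesis
  proof (intro current_rep.intro current_rep_axioms.intro complex_space_axioms)
    show "lin (tensor_act r m A)" for A
      unfolding lin_def poly_const_scale_def by (intro conjI allI tensor_act_add tensor_act_scale)
    fix A B :: "complex poly mat" and \<phi>
    assume "A \<in> sl_carrier r" "B \<in> sl_carrier r"
    then have AB: "A \<in> carrier_mat (Suc r) (Suc r)" "B \<in> carrier_mat (Suc r) (Suc r)" by (simp_all add: sl_carrier_def)
    show "tensor_act r m (A + B) \<phi> = tensor_act r m A \<phi> + tensor_act r m B \<phi>" by (rule tensor_act_mat_add[OF AB])
    show "tensor_act r m (A * B - B * A) \<phi> = tensor_act r m A (tensor_act r m B \<phi>) - tensor_act r m B (tensor_act r m A \<phi>)"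
      by (rule tensor_act_bracket[OF AB])
  next
    fix A :: "complex poly mat" and c \<phi>
    assume "A \<in> sl_carrier r"
    then have "A \<in> carrier_mat (Suc r) (Suc r)" by (simp add: sl_carrier_def)
    then show "tensor_act r m ([:c:] \<cdot>\<^sub>m A) \<phi> = poly_const_scale c (tensor_act r m A \<phi>)"
      unfolding poly_const_scale_def by (rule tensor_act_mat_scale)
  qed
qed

context
  fixes r :: nat and m :: "nat \<Rightarrow> nat"
begin

interpretation M: current_rep poly_const_scale r "tensor_act r m" by (rule tensor_current_rep)

private abbreviation "gen0 \<equiv> tensor_gen r m"
private abbreviation "cyc \<equiv> cyclic_sub r m"

text \<open>The variable times elements of the cyclic submodule itself. An element of the cyclic
  submodule that is divisible by the variable only in the tensor power need not belong to
  it.\<close>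

definition mod_variable :: "((nat \<times> nat \<times> nat \<Rightarrow> nat) \<Rightarrow> complex poly) set" where
  "mod_variable = (\<lambda>\<psi> g. [:0, 1:] * \<psi> g) ` cyc"

lemma cyclic_scale: "\<phi> \<in> cyc \<Longrightarrow> poly_const_scale c \<phi> \<in> cyc"
  unfolding poly_const_scale_def by (rule cyclic_sub.scale)

lemma mod_variable_add: assumes "\<phi> \<in> mod_variable" "\<psi> \<in> mod_variable" shows "\<phi> + \<psi> \<in> mod_variable"
proof -
  obtain \<phi>' \<psi>' where "\<phi>' \<in> cyc" "\<psi>' \<in> cyc" "\<phi> = (\<lambda>g. [:0, 1:] * \<phi>' g)" "\<psi> = (\<lambda>g. [:0, 1:] * \<psi>' g)"
    using assms unfolding mod_variable_def by blast
  then show ?thesis unfolding mod_variable_def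
    by (intro image_eqI[of _ _ "\<phi>' + \<psi>'"] cyclic_sub.add) (simp_all add: fun_eq_iff distrib_left)
qed

lemma mod_variable_scale: assumes "\<phi> \<in> mod_variable" shows "poly_const_scale c \<phi> \<in> mod_variable"
proof -
  obtain \<phi>' where "\<phi>' \<in> cyc" "\<phi> = (\<lambda>g. [:0, 1:] * \<phi>' g)" using assms unfolding mod_variable_def by blast
  then show ?thesis unfolding mod_variable_def
    by (intro image_eqI[of _ _ "poly_const_scale c \<phi>'"] cyclic_scale) (simp_all only: poly_const_scale_def mult.left_commute)
qed

lemma mod_variable_gen: "(\<lambda>g. [:0, 1:] * k * gen0 g) \<in> mod_variable"
  unfolding mod_variable_def
  by (rule image_eqI[of _ _ "\<lambda>g. k * gen0 g"]) (simp_all only: mult.assoc cyclic_sub.scale[OF cyclic_sub.gen])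

lemma mod_variable_0: "0 \<in> mod_variable"
proof -
  have "(\<lambda>g. [:0, 1:] * 0 * gen0 g) = 0" by (rule ext) simp
  then show ?thesis using mod_variable_gen[of 0] by simp
qed

lemma word_act_poly_scale: "M.word_act w (\<lambda>g. c * \<phi> g) = (\<lambda>g. c * M.word_act w \<phi> g)"
proof -
  have "foldr (tensor_act r m) ws (\<lambda>g. c * \<phi> g) = (\<lambda>g. c * foldr (tensor_act r m) ws \<phi> g)" for ws
    by (induction ws) (simp_all add: tensor_act_scale)
  then show ?thesis unfolding M.word_act_def .
qed

lemma free_act_cyclic:
  assumes "p \<in> current_words r" "\<phi> \<in> cyc"
  shows "M.free_act p \<phi> \<in> cyc \<and> M.free_act p (\<lambda>g. [:0, 1:] * \<phi> g) = (\<lambda>g. [:0, 1:] * M.free_act p \<phi> g)"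
proof -
  have "Poly_Mapping.keys p \<subseteq> {w. set (letters w) \<subseteq> sl_carrier r}" using assms(1) by (auto simp: free_algebra_def)
  then show ?thesis
  proof (induction p rule: free_module_induct)
    case zero
    have "poly_const_scale 0 \<phi> \<in> cyc" by (rule cyclic_scale[OF assms(2)])
    then have z: "0 \<in> cyc" by (simp only: M.scale_zero_left)
    show ?case unfolding M.free_act_0 by (rule conjI, rule z, rule ext) simp
  next
    case (add w c p)
    have "foldr (tensor_act r m) ws \<phi> \<in> cyc" if "set ws \<subseteq> sl_carrier r" for ws
      using that by (induction ws) (simp_all add: assms(2) cyclic_sub.act)
    then have w: "M.word_act w \<phi> \<in> cyc" using add(1) by (simp add: M.word_act_def)
    have e: "M.free_act (Poly_Mapping.single w c + p) x = poly_const_scale c (M.word_act w x) + M.free_act p x" for x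
      by (simp only: M.free_act_add M.free_act_single)
    show ?case unfolding e word_act_poly_scale conjunct2[OF add.IH]
      by (intro conjI cyclic_sub.add cyclic_scale w conjunct1[OF add.IH])
        (simp add: fun_eq_iff poly_const_scale_def distrib_left mult.left_commute)
  qed
qed

lemma Uact_cyclic:
  assumes "u \<in> carrier (current_uea r)" "\<phi> \<in> cyc"
  shows "M.Uact u \<phi> \<in> cyc" "M.Uact u (\<lambda>g. [:0, 1:] * \<phi> g) = (\<lambda>g. [:0, 1:] * M.Uact u \<phi> g)"
proof -
  obtain p where p: "p \<in> current_words r" "u = uea_class r p" using assms(1) unfolding uea_class_carrier by blast
  show "M.Uact u \<phi> \<in> cyc" "M.Uact u (\<lambda>g. [:0, 1:] * \<phi> g) = (\<lambda>g. [:0, 1:] * M.Uact u \<phi> g)"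
    using free_act_cyclic[OF p(1) assms(2)] unfolding p(2) M.Uact_class[OF p(1)] by blast+
qed

text \<open>Modulo the variable, the cyclic submodule is generated by \<open>gen0\<close> over the
  enveloping algebra alone: the constant term of a polynomial scalar is moved into the enveloping
  algebra and the rest is divisible by the variable.\<close>

lemma cyclic_decomposition:
  assumes "\<phi> \<in> cyc"
  shows "\<exists>u\<in>carrier (current_uea r). \<exists>\<psi>\<in>mod_variable. \<phi> = M.Uact u gen0 + \<psi>"
  using assms
proof (induction rule: cyclic_sub.induct)
  interpret U: ring "current_uea r" by (rule uea_ring[OF sl_current_lie_algebra])
  interpret V: vectorspace class_ring "current_uea r" by (rule uea_vectorspace[OF sl_current_lie_algebra])
  case gen
  show ?case
    by (rule bexI[OF _ U.one_closed], rule bexI[OF _ mod_variable_0]) (simp add: M.Uact_one[OF U.one_closed U.one_closed])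
  case (add \<phi> \<psi>)
  then obtain u u' x x' where *: "u \<in> carrier (current_uea r)" "u' \<in> carrier (current_uea r)" "x \<in> mod_variable" "x' \<in> mod_variable"
    "\<phi> = M.Uact u gen0 + x" "\<psi> = M.Uact u' gen0 + x'" by blast
  show ?case
    by (rule bexI[OF _ U.a_closed[OF *(1,2)]], rule bexI[OF _ mod_variable_add[OF *(3,4)]])
      (simp add: M.Uact_add[OF *(1,2)] *(5,6) algebra_simps)
  case (scale \<phi> c)
  then obtain u x where *: "u \<in> carrier (current_uea r)" "x \<in> mod_variable" "\<phi> = M.Uact u gen0 + x" by blast
  obtain c0 c' where c: "c = pCons c0 c'" by (cases c)
  have cu: "c0 \<odot>\<^bsub>current_uea r\<^esub> u \<in> carrier (current_uea r)" by (rule V.smult_closed) (simp_all add: *(1))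
  have "(\<lambda>g. [:0, 1:] * (c' * \<phi> g)) \<in> mod_variable"
    unfolding mod_variable_def by (rule imageI) (rule cyclic_sub.scale[OF scale(1)])
  from mod_variable_add[OF mod_variable_scale[OF *(2), of c0] this]
  have "poly_const_scale c0 x + (\<lambda>g. [:0, 1:] * (c' * \<phi> g)) \<in> mod_variable" .
  moreover have "(\<lambda>g. c * \<phi> g) = M.Uact (c0 \<odot>\<^bsub>current_uea r\<^esub> u) gen0 + (poly_const_scale c0 x + (\<lambda>g. [:0, 1:] * (c' * \<phi> g)))"
  proof -
    have "(\<lambda>g. c * \<phi> g) = poly_const_scale c0 \<phi> + (\<lambda>g. [:0, 1:] * (c' * \<phi> g))"
      by (rule ext) (simp add: poly_const_scale_def c)
    then show ?thesis
      unfolding M.Uact_smult[OF *(1) *(1)] by (simp only: *(3) M.scale_right_distrib add.assoc)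
  qed
  ultimately show ?case using cu by blast
  case (act \<phi> A)
  then obtain u x where *: "u \<in> carrier (current_uea r)" "x \<in> mod_variable" "\<phi> = M.Uact u gen0 + x" by blast
  obtain \<psi> where \<psi>: "\<psi> \<in> cyc" "x = (\<lambda>g. [:0, 1:] * \<psi> g)" using *(2) unfolding mod_variable_def by blast
  have g: "free_gen A \<in> current_words r" using act(2) by (simp add: free_algebra_def free_gen_def)
  have cl: "uea_class r (free_gen A) \<in> carrier (current_uea r)" by (rule uea_class_closed[OF g])
  have A: "M.Uact (uea_class r (free_gen A)) y = tensor_act r m A y" for y
    unfolding M.Uact_class[OF g] M.free_act_gen ..
  have "tensor_act r m A x \<in> mod_variable"
    unfolding \<psi>(2) tensor_act_scale mod_variable_def by (rule imageI) (rule cyclic_sub.act[OF \<psi>(1) act(2)])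
  moreover have "tensor_act r m A \<phi> = M.Uact (uea_class r (free_gen A) \<otimes>\<^bsub>current_uea r\<^esub> u) gen0 + tensor_act r m A x"
    unfolding M.Uact_mult[OF cl *(1)] A *(3) tensor_act_add ..
  ultimately show ?case using U.m_closed[OF cl *(1)] by blast
qed

text \<open>Three of the four families annihilate \<open>gen0\<close> exactly. The Cartan currents
  divisible by t act on it by an eigenvalue divisible by the variable, since t is evaluated at
  constant multiples of it.\<close>

lemma weyl_relations_mod_variable:
  assumes m: "\<And>i. i \<in> {1..r} \<Longrightarrow> int (m i) = lam i - lam (Suc i)" and lam0: "lam (Suc r) = 0"
    and u: "u \<in> weyl_relations r lam"
  shows "M.Uact u gen0 \<in> mod_variable"
proof -
  interpret U: ring "current_uea r" by (rule uea_ring[OF sl_current_lie_algebra])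
  interpret V: vectorspace class_ring "current_uea r" by (rule uea_vectorspace[OF sl_current_lie_algebra])
  have entry: "tensor_poly X f $$ (a, b) = [:X $$ (a, b):] * f" if "X \<in> sl_carrier r" "a < Suc r" "b < Suc r" for X f a b
  proof -
    have "X \<in> carrier_mat (Suc r) (Suc r)" using that(1) by (simp add: sl_carrier_def)
    then show ?thesis using that(2,3) by (simp add: tensor_poly_def)
  qed
  have std: "std_filling r m q < Suc r" if "q \<in> positions r m" for q
    using std_filling_mem[of r m] that by (auto simp: fillings_def)
  have diag: "tensor_act r m (tensor_poly H f) gen0 = (\<lambda>g. (\<Sum>q\<in>positions r m. eval_at q ([:H $$ (std_filling r m q, std_filling r m q):] * f)) * gen0 g)"
    if H: "H \<in> cartan r" for H f
  proof -
    have Hs1: "H \<in> sl_carrier r" "diagonal_mat H" using H by (simp_all add: cartan_def)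
    then have Hd: "H \<in> carrier_mat (Suc r) (Suc r)" by (simp add: sl_carrier_def)
    have Hs2: "H $$ (a, b) = 0" if "a < Suc r" "b < Suc r" "a \<noteq> b" for a b
      using Hs1(2) Hd that unfolding diagonal_mat_def by simp
    have "tensor_act r m (tensor_poly H f) gen0 = (\<lambda>g. (\<Sum>q\<in>positions r m. eval_at q (tensor_poly H f $$ (std_filling r m q, std_filling r m q))) * gen0 g)"
      by (rule tensor_act_diag) (simp add: entry[OF Hs1(1)] Hs2)
    also have "(\<Sum>q\<in>positions r m. eval_at q (tensor_poly H f $$ (std_filling r m q, std_filling r m q)))
      = (\<Sum>q\<in>positions r m. eval_at q ([:H $$ (std_filling r m q, std_filling r m q):] * f))"
      by (rule sum.cong[OF refl]) (simp only: entry[OF Hs1(1) std std])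
    finally show ?thesis .
  qed
  consider X f where "u = current_emb r X f" "X \<in> n_plus r"
    | H f where "u = current_emb r H (monom 1 1 * f)" "H \<in> cartan r"
    | H where "u = current_emb r H 1 \<ominus>\<^bsub>current_uea r\<^esub> (weight r lam H \<odot>\<^bsub>current_uea r\<^esub> \<one>\<^bsub>current_uea r\<^esub>)" "H \<in> cartan r"
    | i Y k where "u = current_emb r Y 1 [^]\<^bsub>current_uea r\<^esub> (k + 1 :: nat)" "i \<in> {1..r}"
        "Y \<in> root_space r (\<lambda>H. - simple_root i H)" "weight r lam (simple_coroot r i) = of_nat k"
    using u unfolding weyl_relations_def by blast
  then show ?thesis
  proof cases
    case 1
    then have X: "X \<in> sl_carrier r" "\<And>a b. a < Suc r \<Longrightarrow> b \<le> a \<Longrightarrow> X $$ (a, b) = 0" by (simp_all add: n_plus_def)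
    have "tensor_act r m (tensor_poly X f) gen0 = 0"
      by (rule tensor_act_upper) (simp add: entry[OF X(1)] X(2))
    then show ?thesis unfolding 1(1) M.Uact_emb[OF X(1)] by (simp only: mod_variable_0)
  next
    case 2
    then have H: "H \<in> sl_carrier r" by (simp add: cartan_def)
    have "\<exists>k. eval_at q ([:a:] * (monom 1 1 * f)) = [:0, 1:] * k" for q a
    proof -
      obtain c where c: "eval_at q (monom 1 1) = [:0, c:]"
        unfolding eval_at_def by (auto simp: monom_altdef pcompose_pCons)
      have "eval_at q ([:a:] * (monom 1 1 * f)) = [:0, c:] * (eval_at q [:a:] * eval_at q f)"
        unfolding c[symmetric] eval_at_def pcompose_mult by (simp only: mult.left_commute)
      also have "[:0, c:] = [:0, 1:] * [:c:]" by simp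
      finally show ?thesis by (metis mult.assoc)
    qed
    then have "\<forall>q. \<exists>k. eval_at q ([:H $$ (std_filling r m q, std_filling r m q):] * (monom 1 1 * f)) = [:0, 1:] * k" by blast
    from choice[OF this] obtain k where k: "\<And>q. eval_at q ([:H $$ (std_filling r m q, std_filling r m q):] * (monom 1 1 * f)) = [:0, 1:] * k q" by blast
    show ?thesis unfolding 2(1) M.Uact_emb[OF H] diag[OF 2(2)] k sum_distrib_left[symmetric] by (rule mod_variable_gen)
  next
    case 3
    then have H: "H \<in> sl_carrier r" by (simp add: cartan_def)
    let ?h = "\<lambda>q. H $$ (q, q)"
    have c: "weight r lam H \<odot>\<^bsub>current_uea r\<^esub> \<one>\<^bsub>current_uea r\<^esub> \<in> carrier (current_uea r)"
      by (rule V.smult_closed) simp_all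
    have const: "(\<Sum>q\<in>A. [:F q:]) = [:\<Sum>q\<in>A. F q :: complex:]" for A :: "(nat \<times> nat \<times> nat) set" and F
      by (induction A rule: infinite_finite_induct) simp_all
    have "(\<Sum>q\<in>positions r m. eval_at q ([:?h (std_filling r m q):] * 1)) = (\<Sum>q\<in>positions r m. [:?h (snd (snd q)):])"
      by (rule sum.cong[OF refl]) (simp add: eval_at_def std_filling_def)
    also have "\<dots> = [:\<Sum>i=1..r. of_nat (m i) * (\<Sum>q<i. ?h q):]" unfolding const sum_positions[of ?h] ..
    also have "(\<Sum>i=1..r. of_nat (m i) * (\<Sum>q<i. ?h q)) = (\<Sum>i=1..r. of_int (lam i - lam (Suc i)) * (\<Sum>q<i. ?h q))"
      by (rule sum.cong[OF refl]) (simp only: m[symmetric] of_int_of_nat_eq)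
    \<comment> \<open>Abel summation; the boundary term vanishes because
      \<open>lam (Suc r) = 0\<close>. It expresses that the differences \<open>m i\<close> are the
      coefficients of the weight in the fundamental weights.\<close>
    also have "\<dots> = weight r lam H"
      unfolding sum_by_parts weight_def eps_def by (simp add: lam0)
    finally have "tensor_act r m (tensor_poly H 1) gen0 = poly_const_scale (weight r lam H) gen0"
      unfolding diag[OF 3(2)] poly_const_scale_def by (simp only:)
    then have "M.Uact u gen0 = 0"
      unfolding 3(1) M.Uact_minus[OF current_emb_closed[OF H] c] M.Uact_emb[OF H] M.Uact_smult[OF U.one_closed U.one_closed]
        M.Uact_one[OF U.one_closed U.one_closed] by (simp only: diff_self)
    then show ?thesis by (simp only: mod_variable_0)
  next
    case 4
    then have Y: "Y \<in> sl_carrier r" by (simp add: root_space_def)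
    have i: "1 \<le> i" "i \<le> r" using 4(2) by auto
    have "of_int (lam i - lam (Suc i)) = (of_nat k :: complex)" using 4(4) unfolding weight_simple_coroot[OF i] .
    then have "int k = int (m i)" unfolding m[OF 4(2)] by (metis of_int_eq_iff of_int_of_nat_eq)
    then have k: "k + 1 = Suc (m i)" by simp
    have eY: "tensor_poly Y 1 $$ (a, b) = (if a = i \<and> b = i - 1 then [:Y $$ (i, i - 1):] else 0)" if "a < Suc r" "b < Suc r" for a b
    proof (cases "a = i \<and> b = i - 1")
      case True
      then show ?thesis unfolding entry[OF Y that] by simp
    next
      case False
      from root_space_index[OF 4(3) i that False] show ?thesis unfolding entry[OF Y that] if_not_P[OF False] by simp
    qed
    have "M.Uact (current_emb r Y 1) = tensor_act r m (tensor_poly Y 1)" by (rule ext) (rule M.Uact_emb[OF Y])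
    then have "M.Uact u gen0 = (tensor_act r m (tensor_poly Y 1) ^^ Suc (m i)) gen0"
      unfolding 4(1) M.Uact_pow[OF current_emb_closed[OF Y]] k by (simp only:)
    also have "\<dots> = 0" by (rule tensor_act_lower[OF i eY])
    finally show ?thesis by (simp only: mod_variable_0)
  qed
qed

lemma weyl_ideal_mod_variable:
  assumes "\<And>i. i \<in> {1..r} \<Longrightarrow> int (m i) = lam i - lam (Suc i)" "lam (Suc r) = 0" "u \<in> weyl_ideal r lam"
  shows "M.Uact u gen0 \<in> mod_variable"
proof -
  interpret U: ring "current_uea r" by (rule uea_ring[OF sl_current_lie_algebra])
  let ?N = "{u \<in> carrier (current_uea r). M.Uact u gen0 \<in> mod_variable}"
  have neg: "- \<phi> \<in> mod_variable" if "\<phi> \<in> mod_variable" for \<phi>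
    using mod_variable_scale[OF that, of "-1"] by simp
  have "left_ideal ?N (current_uea r)"
    unfolding left_ideal_def additive_subgroup_def
  proof (intro conjI ballI)
    show "subgroup ?N (add_monoid (current_uea r))"
    proof (rule U.add.subgroupI)
      have "\<zero>\<^bsub>current_uea r\<^esub> \<in> ?N" using M.Uact_zero[OF U.zero_closed U.zero_closed] mod_variable_0 by simp
      then show "?N \<noteq> {}" by blast
      show "\<ominus>\<^bsub>current_uea r\<^esub> a \<in> ?N" if "a \<in> ?N" for a
        using that neg M.Uact_a_inv[of a a] by simp
      show "a \<oplus>\<^bsub>current_uea r\<^esub> b \<in> ?N" if "a \<in> ?N" "b \<in> ?N" for a b
        using that mod_variable_add M.Uact_add[of a b] by simp
    qed blast
    fix a x assume a: "a \<in> carrier (current_uea r)" and "x \<in> ?N"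
    then obtain \<psi> where x: "x \<in> carrier (current_uea r)" "\<psi> \<in> cyc" "M.Uact x gen0 = (\<lambda>g. [:0, 1:] * \<psi> g)"
      unfolding mod_variable_def by blast
    have "M.Uact (a \<otimes>\<^bsub>current_uea r\<^esub> x) gen0 \<in> mod_variable"
      unfolding M.Uact_mult[OF a x(1)] x(3) Uact_cyclic(2)[OF a x(2)] mod_variable_def
      by (rule imageI) (rule Uact_cyclic(1)[OF a x(2)])
    then show "a \<otimes>\<^bsub>current_uea r\<^esub> x \<in> ?N" using a x(1) by simp
  qed
  moreover have "weyl_relations r lam \<subseteq> ?N"
    using weyl_relations_subset weyl_relations_mod_variable[OF assms(1,2)] by blast
  ultimately have "weyl_ideal r lam \<subseteq> ?N" unfolding weyl_ideal_def gen_left_ideal_def by blast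
  then show ?thesis using assms(3) by blast
qed

text \<open>By \<open>weyl_ideal_mod_variable\<close> the local Weyl module maps onto the cyclic
  submodule modulo the variable. Lifting a generating set and applying the lifts to
  \<open>gen0\<close> gives vectors that span this quotient over the constants, and the rank forbids
  too few of them.\<close>

theorem card_gen_set_local_weyl:
  assumes m: "\<And>i. i \<in> {1..r} \<Longrightarrow> int (m i) = lam i - lam (Suc i)" and lam0: "lam (Suc r) = 0"
    and A: "finite A" "A \<subseteq> carrier (local_weyl r lam)" "LinearCombinations.module.span class_ring (local_weyl r lam) A = carrier (local_weyl r lam)"
  shows "(\<Prod>i=1..r. (Suc r choose i) ^ m i) \<le> card A"
proof (rule ccontr)
  let ?J = "weyl_ideal r lam" and ?U = "current_uea r" and ?W = "local_weyl r lam"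
  interpret U: ring ?U by (rule uea_ring[OF sl_current_lie_algebra])
  interpret V: vectorspace class_ring ?U by (rule uea_vectorspace[OF sl_current_lie_algebra])
  interpret W: vectorspace class_ring ?W by (rule local_weyl_vectorspace)
  assume small: "\<not> (\<Prod>i=1..r. (Suc r choose i) ^ m i) \<le> card A"
  have "\<forall>B\<in>A. \<exists>u. u \<in> carrier ?U \<and> B = ?J +>\<^bsub>?U\<^esub> u"
  proof
    fix B assume "B \<in> A"
    then have "B \<in> carrier ?W" using A(2) by blast
    then show "\<exists>u. u \<in> carrier ?U \<and> B = ?J +>\<^bsub>?U\<^esub> u" by (rule local_weyl_carrierE) blast
  qed
  from bchoice[OF this] obtain w where w: "\<forall>B\<in>A. w B \<in> carrier ?U \<and> B = ?J +>\<^bsub>?U\<^esub> w B" by (rule exE)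
  define S where "S = (\<lambda>B. M.Uact (w B) gen0) ` A"
  have S: "finite S" "card S < (\<Prod>i=1..r. (Suc r choose i) ^ m i)"
    using A(1) small card_image_le[OF A(1), of "\<lambda>B. M.Uact (w B) gen0"] by (simp_all add: S_def)
  \<comment> \<open>The cosets that have some representative sending \<open>gen0\<close> into the
    span of \<open>S\<close> plus multiples of the variable. Being a submodule that contains
    \<open>A\<close>, it is the whole local Weyl module.\<close>
  define N where "N = {X \<in> carrier ?W. \<exists>u\<in>carrier ?U. X = ?J +>\<^bsub>?U\<^esub> u \<and> (\<exists>v\<in>M.span S. \<exists>\<psi>\<in>mod_variable. M.Uact u gen0 = v + \<psi>)}"
  have N: "LinearCombinations.submodule class_ring N ?W"
  proof (rule LinearCombinations.submodule.intro)
    show "Module.module class_ring ?W" by (rule W.module_axioms)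
    show "N \<subseteq> carrier ?W" by (auto simp: N_def)
    fix X Y assume "X \<in> N" "Y \<in> N"
    then obtain u u' v v' \<psi> \<psi>' where *: "u \<in> carrier ?U" "u' \<in> carrier ?U" "X = ?J +>\<^bsub>?U\<^esub> u" "Y = ?J +>\<^bsub>?U\<^esub> u'"
      "v \<in> M.span S" "v' \<in> M.span S" "\<psi> \<in> mod_variable" "\<psi>' \<in> mod_variable" "M.Uact u gen0 = v + \<psi>" "M.Uact u' gen0 = v' + \<psi>'"
      unfolding N_def by blast
    have uu: "u \<oplus>\<^bsub>?U\<^esub> u' \<in> carrier ?U" using * by simp
    have "M.Uact (u \<oplus>\<^bsub>?U\<^esub> u') gen0 = (v + v') + (\<psi> + \<psi>')" unfolding M.Uact_add[OF *(1,2)] *(9,10) by (simp only: ac_simps)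
    moreover have "X \<oplus>\<^bsub>?W\<^esub> Y = ?J +>\<^bsub>?U\<^esub> (u \<oplus>\<^bsub>?U\<^esub> u')" unfolding *(3,4) by (rule weyl_coset_add[OF *(1,2)])
    ultimately show "X \<oplus>\<^bsub>?W\<^esub> Y \<in> N"
      unfolding N_def using weyl_coset_carrier[OF uu uu, of lam] uu M.span_add[OF *(5,6)] mod_variable_add[OF *(7,8)] by auto
  next
    have "M.Uact \<zero>\<^bsub>?U\<^esub> gen0 = 0 + 0" using M.Uact_zero[OF U.zero_closed U.zero_closed] by simp
    moreover have "\<zero>\<^bsub>?U\<^esub> \<in> ?J" using subgroup.one_closed[of ?J "add_monoid ?U"] weyl_left_ideal[of r lam] by (simp add: left_ideal_def additive_subgroup_def)
    then have "\<zero>\<^bsub>?W\<^esub> = ?J +>\<^bsub>?U\<^esub> \<zero>\<^bsub>?U\<^esub>" using weyl_coset_zero[OF U.zero_closed U.zero_closed] by simp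
    ultimately show "\<zero>\<^bsub>?W\<^esub> \<in> N" unfolding N_def using M.span_zero[of S] mod_variable_0 U.zero_closed W.M.zero_closed by blast
  next
    fix c X assume "X \<in> N"
    then obtain u v \<psi> where *: "u \<in> carrier ?U" "X = ?J +>\<^bsub>?U\<^esub> u" "v \<in> M.span S" "\<psi> \<in> mod_variable" "M.Uact u gen0 = v + \<psi>"
      unfolding N_def by blast
    have cu: "c \<odot>\<^bsub>?U\<^esub> u \<in> carrier ?U" by (rule V.smult_closed) (simp_all add: *)
    have "M.Uact (c \<odot>\<^bsub>?U\<^esub> u) gen0 = poly_const_scale c v + poly_const_scale c \<psi>" unfolding M.Uact_smult[OF *(1,1)] *(5) by (rule M.scale_right_distrib)
    moreover have "c \<odot>\<^bsub>?W\<^esub> X = ?J +>\<^bsub>?U\<^esub> (c \<odot>\<^bsub>?U\<^esub> u)" unfolding *(2) by (rule weyl_coset_smult[OF *(1,1)])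
    ultimately show "c \<odot>\<^bsub>?W\<^esub> X \<in> N"
      unfolding N_def using weyl_coset_carrier[OF cu cu, of lam] cu M.span_scale[OF *(3), of c] mod_variable_scale[OF *(4), of c] by auto
  qed
  have "A \<subseteq> N"
  proof
    fix B assume B: "B \<in> A"
    have "M.Uact (w B) gen0 = M.Uact (w B) gen0 + 0" by simp
    moreover have "M.Uact (w B) gen0 \<in> M.span S" unfolding S_def by (rule M.span_base) (rule imageI[OF B])
    ultimately show "B \<in> N" unfolding N_def using bspec[OF w B] A(2) B mod_variable_0 by blast
  qed
  from W.span_is_subset[OF this N] have WN: "carrier ?W \<subseteq> N" unfolding A(3) .
  show False
  proof (rule no_small_span_cyclic[OF S])
    fix \<phi> assume "\<phi> \<in> cyc"
    then obtain u \<psi> where u: "u \<in> carrier ?U" "\<psi> \<in> mod_variable" "\<phi> = M.Uact u gen0 + \<psi>" using cyclic_decomposition by blast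
    have "?J +>\<^bsub>?U\<^esub> u \<in> N" using WN weyl_coset_carrier[OF u(1,1)] by blast
    then obtain u' v \<psi>' where u': "u' \<in> carrier ?U" "?J +>\<^bsub>?U\<^esub> u = ?J +>\<^bsub>?U\<^esub> u'" "v \<in> M.span S" "\<psi>' \<in> mod_variable" "M.Uact u' gen0 = v + \<psi>'"
      unfolding N_def by blast
    obtain h where h: "h \<in> ?J" "u = h \<oplus>\<^bsub>?U\<^esub> u'" using weyl_coset_eqD[OF u(1) u'(1,2)] by blast
    have hc: "h \<in> carrier ?U" using h(1) subgroup.subset[of ?J "add_monoid ?U"] weyl_left_ideal[of r lam] by (auto simp: left_ideal_def additive_subgroup_def)
    have "\<phi> = v + ((M.Uact h gen0 + \<psi>') + \<psi>)" unfolding u(3) h(2) M.Uact_add[OF hc u'(1)] u'(5) by (simp only: ac_simps)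
    moreover have "(M.Uact h gen0 + \<psi>') + \<psi> \<in> mod_variable"
      by (intro mod_variable_add weyl_ideal_mod_variable[OF m lam0 h(1)] u u')
    then obtain \<chi> where \<chi>: "\<chi> \<in> cyc" "(M.Uact h gen0 + \<psi>') + \<psi> = (\<lambda>g. [:0, 1:] * \<chi> g)" unfolding mod_variable_def by blast
    obtain a where a: "v = (\<Sum>x\<in>S. poly_const_scale (a x) x)" using u'(3) unfolding M.span_finite[OF S(1)] by blast
    have "v x = (\<Sum>y\<in>S. [:a y:] * y x)" for x
      unfolding a using S(1) by (induction S rule: finite_induct) (simp_all add: poly_const_scale_def)
    ultimately have "\<forall>x. \<phi> x = (\<Sum>y\<in>S. [:a y:] * y x) + [:0, 1:] * \<chi> x" by (simp only: \<chi>(2) plus_fun_apply simp_thms)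
    then show "\<exists>a. \<exists>\<psi>\<in>cyc. \<forall>x. \<phi> x = (\<Sum>v\<in>S. [:a v:] * v x) + [:0, 1:] * \<psi> x" using \<chi>(1) by blast
  qed
qed

end

theorem theorem4p3:
  fixes r :: nat and lam :: "nat \<Rightarrow> int"
  assumes "r \<ge> 1"
    and "lam \<in> noninc_seqs (Suc r)"
    and "lam (Suc r) = 0"
  shows "inj_on (pop_vector r lam) (pops_bounded (Suc r) lam) \<and>
         vectorspace.basis class_ring (local_weyl r lam)
           (pop_vector r lam ` pops_bounded (Suc r) lam)"
proof -
  let ?P = "pops_bounded (Suc r) lam" and ?S = "pop_vector r lam ` pops_bounded (Suc r) lam"
  interpret W: vectorspace class_ring "local_weyl r lam" by (rule local_weyl_vectorspace)
  \<comment> \<open>The same number counts the POPs and bounds every finite spanning set from below.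
    A collision between two POP vectors would leave a spanning set that is too small, and a spanning
    set of minimal size is a basis.\<close>
  define n where "n = (\<Prod>i=1..r. (Suc r choose i) ^ nat (lam i - lam (Suc i)))"
  have P: "finite ?P" "card ?P = n"
    using card_pops_bounded[OF _ assms(2)] by (simp_all add: n_def atLeastLessThanSuc_atLeastAtMost)
  note span = pop_vectors_span_local_weyl[OF assms(2)]
  have m: "int (nat (lam i - lam (Suc i))) = lam i - lam (Suc i)" if "i \<in> {1..r}" for i
    using noninc_seqsD[OF assms(2) that] by simp
  have lower: "n \<le> card A" if "finite A" "A \<subseteq> carrier (local_weyl r lam)" "W.span A = carrier (local_weyl r lam)" for A
    unfolding n_def by (rule card_gen_set_local_weyl[OF m assms(3) that])
  have finS: "finite ?S" using P(1) by simp
  have cS: "card ?S = card ?P"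
    using lower[OF finS span(2,1)] card_image_le[OF P(1), of "pop_vector r lam"] P(2) by simp
  have "n \<le> W.dim"
  proof -
    have ex: "\<exists>A. finite A \<and> card A = card ?S \<and> A \<subseteq> carrier (local_weyl r lam) \<and> W.span A = carrier (local_weyl r lam)"
      using finS span by blast
    have "\<exists>A. finite A \<and> card A = W.dim \<and> A \<subseteq> carrier (local_weyl r lam) \<and> W.span A = carrier (local_weyl r lam)"
      unfolding W.dim_def by (rule LeastI[of "\<lambda>k. \<exists>A. finite A \<and> card A = k \<and> A \<subseteq> carrier (local_weyl r lam) \<and> W.span A = carrier (local_weyl r lam)", OF ex])
    then obtain A where A: "finite A" "card A = W.dim" "A \<subseteq> carrier (local_weyl r lam)" "W.span A = carrier (local_weyl r lam)"
      by (elim exE conjE)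
    show ?thesis using lower[OF A(1,3,4)] A(2) by simp
  qed
  then have "W.basis ?S" using W.dim_gen_is_basis[OF finS span(2,1)] cS P(2) by simp
  with eq_card_imp_inj_on[OF P(1) cS] show ?thesis by (rule conjI)
qed

end
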